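(* Let $G$ be a locally compact group, let $A$, $B$ be C*-algebras with actions of $G$, with $G$ acting trivially on $B$, and let $(A,E_B,D)$ be a $(\mu_g)_{g\in G}$-conformally $G$-equivariant unbounded Kasparov module. Then $$\big(A\rtimes_uG,\ E_B,\ D;\ C_0(G),\ (1,\mu_g)_{g\in G}\big)$$ is a conformally generated cycle, with the integrated representation of the universal crossed product $A\rtimes_uG$ on $E$.
   Context: All C*-algebras are complex and trivially graded; $\otimes$ is the minimal tensor product. $\operatorname{End}^*(E)$ is the C*-algebra of adjointable operators of a right Hilbert $B$-module $E$. An $A$-$B$-correspondence is a right Hilbert $B$-module $E$ with a $*$-homomorphism $A\to\operatorname{End}^*(E)$; elements of $A$ are identified with their images. $\overline{\operatorname{span}}$ is the norm-closed linear span. For $D$ self-adjoint regular, $\operatorname{Lip}^*_0(D)$ is the $*$-algebra of $a\in\operatorname{End}^*(E)$ with $a\operatorname{dom}D\subseteq\operatorname{dom}D$ and $[D,a]$ extending to an adjointable operator. An unbounded Kasparov module $(A,E_B,D)$ is an $A$-$B$-correspondence $E$ with a self-adjoint regular operator $D$ such that $(1+D^2)^{-1}a$ is compact for all $a\in A$ and $A\subseteq\overline{\operatorname{Lip}^*_0(D)}$; even if $E$ is $\mathbb Z/2$-graded, $A$ acts evenly and $D$ is odd; odd if $E$ is ungraded. With $\alpha^A$ and $\beta$ the actions of $G$ on $A$ and $B$ (here $\beta$ trivial), a $G$-equivariant $A$-$B$-correspondence is an $A$-$B$-correspondence $E$ with a continuous map $U:G\times E\to E$, $\mathbb C$-linear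 in $E$, with $U_{gh}=U_gU_h$, $U_g(xb)=U_g(x)\beta_g(b)$, $\beta_g((x,y)_B)=(U_gx,U_gy)_B$, $U_g(ax)=\alpha^A_g(a)U_g(x)$; $U_g^*=U_g^{-1}$. When $\beta$ is trivial, the covariant pair (representation $\pi$ of $A$, $U$) integrates to a representation of $A\rtimes_uG$ on $E$, given on $f\in C_c(G,A)$ by $\int_G\pi(f(g))U_g\,dg$. An unbounded Kasparov module $(A,E_B,D)$ is $(\mu_g)_{g\in G}$-conformally $G$-equivariant if $E$ is a $G$-equivariant $A$-$B$-correspondence and $(\mu_g)_{g\in G}\subseteq\operatorname{End}^*(E)$ is a $*$-strongly continuous family of invertible operators (even if $E$ is graded) such that $A\subseteq\overline{\operatorname{span}}(A\mathscr Q)\cap\overline{\operatorname{span}}(\mathscr QA)$, where $\mathscr Q$ is the set of $a\in\operatorname{Lip}^*_0(D)$ such that for all $g\in G$ one has $\{a\mu_g,a\mu_g^{-1*}\}\operatorname{dom}D\subseteq\operatorname{dom}D\cap U_g\operatorname{dom}D$, and the maps $g\mapsto(U_gDU_g^*a-a\mu_gD\mu_g^* )\mu_g^{-1*}$, $g\mapsto U_gDU_g^*a-a\mu_gD\mu_g^*$, $g\mapsto[D,a\mu_g]$, $g\mapsto[D,a\mu_g^{-1*}]$ are $*$-strongly continuous from $G$ into bounded operators (not necessarily globally bounded over $G$). Matched operators: for a C*-algebra $C$, a regular operator $T$ on the Hilbert $B\otimes C$-module $E\otimes C$ is $C$-matched if the set of $c\in C$ with $(E\otimes C)(1\otimes c)\subseteq\operatorname{dom}T$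 is dense in $C$; these form a $*$-algebra $\operatorname{Mtc}^*(E\otimes C,C)$ (sums and products followed by closure). For $C=C_0(X)$, $X$ locally compact Hausdorff, the $C_0(X)$-matched operators on $C_0(X,E)$ are exactly the (not necessarily bounded) $*$-strongly continuous functions $X\to\operatorname{End}^*(E)$. $K_C$ is the Pedersen ideal (minimal dense two-sided ideal). A state $\psi$ on $C$ is compactly supported, $\psi\in\mathcal S_c(C)$, if $\psi(c)=\|c\|$ for some nonzero $c\in C$; then there is a positive $a\in K_C$ with $\psi(a)=1=\|a\|$ and $\psi(ac)=\psi(c)=\psi(ca)$ for all $c\in C$, and $(1\otimes\psi)(T):=(1\otimes\psi)(T(1\otimes a))\in\operatorname{End}^*(E)$ for $C$-matched $T$. $C^*(X)$ is the C*-algebra generated by $X$. A conformally generated $A$-$B$-cycle $(A,E_B,D;C,\mu)$ consists of an $A$-$B$-correspondence $E$, a regular operator $D$ on $E$, a C*-algebra $C$, and a pair $\mu=(\mu_L,\mu_R)$ of (even) $C$-matched operators on $E\otimes C$ whose inverses are also $C$-matched, such that: (1) $D$ is self-adjoint; (2) $(1+D^2)^{-1}a$ is compact for all $a\in A$; (3) with $\mathscr L$ the set of $a\in\operatorname{Mtc}^*(E\otimes C,C)$ such that $[D\otimes1,a]$, $[\mu_L(D\otimes1)\mu_L^*,a]$, $[D\otimes1,\mu_L^*a]$, $[D\otimes1,\mu_L^{-1}a]$, $[D\otimes1,a\mu_L]$, $[D\otimes1,a\mu_L^{-1*}]$ are $C$-matched, $\mathscr R$ the set defined in the same way with $\mu_R$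 in place of $\mu_L$, and $\mathscr T=\{a\in\operatorname{Mtc}^*(E\otimes C,C):\mu_L(D\otimes1)\mu_L^*a-a\mu_R(D\otimes1)\mu_R^*\in\operatorname{Mtc}^*(E\otimes C,C)\}$, one has $A\subseteq C^*((1\otimes\psi)(\mathscr{LTR})\mid\psi\in\mathcal S_c(C))$. In the claim, $(1,\mu_g)_{g\in G}$ means $\mu_L=1$ and $\mu_R$ is the function $g\mapsto\mu_g$.
   Formalization: The inverses μ_g^{-1} are also assumed *-strongly continuous in g (otherwise the cycle's requirement that the inverse of μ be matched can fail), and if E is graded the operators U_g are assumed even, so that the crossed product acts evenly. *)

theory Defs
  imports "HOL-Analysis.Analysis"
begin

section \<open>Complex Banach spaces and C*-algebras\<close>

class scaleC = scaleR +
  fixes scaleC :: "complex \<Rightarrow> 'a \<Rightarrow> 'a" (infixr "*\<^sub>C" 75)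

class cbanach = scaleC + banach +
  assumes scaleC_add_right: "c *\<^sub>C (x + y) = c *\<^sub>C x + c *\<^sub>C y"
    and scaleC_add_left: "(c + d) *\<^sub>C x = c *\<^sub>C x + d *\<^sub>C x"
    and scaleC_scaleC: "c *\<^sub>C d *\<^sub>C x = (c * d) *\<^sub>C x"
    and scaleR_scaleC: "r *\<^sub>R x = complex_of_real r *\<^sub>C x"
    and norm_scaleC: "norm (c *\<^sub>C x) = cmod c * norm x"

text \<open>No unit is assumed.\<close>

class cstar_algebra = cbanach + real_normed_algebra +
  fixes star :: "'a \<Rightarrow> 'a"
  assumes mult_scaleC_left: "(c *\<^sub>C x) * y = c *\<^sub>C (x * y)"
    and mult_scaleC_right: "x * (c *\<^sub>C y) = c *\<^sub>C (x * y)"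
    and star_star: "star (star x) = x"
    and star_add: "star (x + y) = star x + star y"
    and star_scaleC: "star (c *\<^sub>C x) = cnj c *\<^sub>C star x"
    and star_mult: "star (x * y) = star y * star x"
    and cstar_identity: "norm (star x * x) = (norm x)\<^sup>2"

instantiation complex :: cstar_algebra
begin
definition "scaleC_complex (c::complex) (x::complex) = c * x"
definition "star_complex = cnj"
instance
  by standard
    (auto simp: scaleC_complex_def star_complex_def algebra_simps norm_mult scaleR_conv_of_real
      power2_eq_square)
end

lemma bounded_linear_scaleC: "bounded_linear ((*\<^sub>C) c :: 'a::cbanach \<Rightarrow> 'a)"
proof (rule bounded_linear_intro[where K = "cmod c"])
  show "c *\<^sub>C r *\<^sub>R x = r *\<^sub>R c *\<^sub>C x" for r and x :: 'a
    by (simp add: scaleR_scaleC scaleC_scaleC mult.commute)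
qed (simp_all add: scaleC_add_right norm_scaleC mult.commute)

instantiation blinfun :: (real_normed_vector, cbanach) cbanach
begin
lift_definition scaleC_blinfun :: "complex \<Rightarrow> ('a \<Rightarrow>\<^sub>L 'b) \<Rightarrow> 'a \<Rightarrow>\<^sub>L 'b"
  is "\<lambda>c f x. c *\<^sub>C f x"
  by (rule bounded_linear_compose[OF bounded_linear_scaleC])
instance
proof
  fix c d :: complex and r :: real and x y :: "'a \<Rightarrow>\<^sub>L 'b"
  show "c *\<^sub>C (x + y) = c *\<^sub>C x + c *\<^sub>C y" by transfer (simp add: scaleC_add_right)
  show "(c + d) *\<^sub>C x = c *\<^sub>C x + d *\<^sub>C x" by transfer (simp add: scaleC_add_left)
  show cd: "c *\<^sub>C d *\<^sub>C x = (c * d) *\<^sub>C x" for c d and x :: "'a \<Rightarrow>\<^sub>L 'b"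
    by transfer (simp add: scaleC_scaleC)
  show one: "r *\<^sub>R x = complex_of_real r *\<^sub>C x" for r and x :: "'a \<Rightarrow>\<^sub>L 'b"
    by transfer (simp add: scaleR_scaleC)
  have le: "norm (c *\<^sub>C x) \<le> cmod c * norm x" for c and x :: "'a \<Rightarrow>\<^sub>L 'b"
  proof (rule norm_blinfun_bound)
    fix z
    have "norm (blinfun_apply (c *\<^sub>C x) z) = cmod c * norm (blinfun_apply x z)"
      by transfer (simp add: norm_scaleC)
    also have "\<dots> \<le> cmod c * (norm x * norm z)"
      by (intro mult_left_mono norm_blinfun) simp
    finally show "norm (blinfun_apply (c *\<^sub>C x) z) \<le> cmod c * norm x * norm z" by simp
  qed simp
  show "norm (c *\<^sub>C x) = cmod c * norm x"
  proof (cases "c = 0")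
    case True
    then show ?thesis using le[of 0 x] by simp
  next
    case False
    have "norm x = norm (inverse c *\<^sub>C c *\<^sub>C x)"
      using False one[of 1 x] by (simp add: cd)
    also have "\<dots> \<le> cmod (inverse c) * norm (c *\<^sub>C x)" by (rule le)
    finally have "cmod c * norm x \<le> norm (c *\<^sub>C x)"
      using False by (simp add: norm_inverse norm_divide field_simps)
    then show ?thesis using le[of c x] by simp
  qed
qed
end

definition clinear :: "('a::cbanach \<Rightarrow> 'b::cbanach) \<Rightarrow> bool" where
  "clinear f \<longleftrightarrow> (\<forall>x y. f (x + y) = f x + f y) \<and> (\<forall>c x. f (c *\<^sub>C x) = c *\<^sub>C f x)"

definition positive :: "'a::cstar_algebra \<Rightarrow> bool" where
  "positive a \<longleftrightarrow> (\<exists>b. a = star b * b)"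

definition state :: "('c::cstar_algebra \<Rightarrow> complex) \<Rightarrow> bool" where
  "state \<psi> \<longleftrightarrow> clinear \<psi> \<and> bounded_linear \<psi> \<and> onorm \<psi> = 1 \<and>
     (\<forall>c. \<psi> (star c * c) \<in> \<real> \<and> 0 \<le> Re (\<psi> (star c * c)))"

definition compactly_supported_state :: "('c::cstar_algebra \<Rightarrow> complex) \<Rightarrow> bool" where
  "compactly_supported_state \<psi> \<longleftrightarrow>
     state \<psi> \<and> (\<exists>c. c \<noteq> 0 \<and> \<psi> c = complex_of_real (norm c))"

definition two_sided_ideal :: "'c::cstar_algebra set \<Rightarrow> bool" where
  "two_sided_ideal I \<longleftrightarrow> 0 \<in> I \<and> (\<forall>x\<in>I. \<forall>y\<in>I. x + y \<in> I) \<and> (\<forall>c. \<forall>x\<in>I. c *\<^sub>C x \<in> I) \<and>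
     (\<forall>x\<in>I. \<forall>y. x * y \<in> I \<and> y * x \<in> I)"

definition pedersen_ideal :: "'c::cstar_algebra set" where
  "pedersen_ideal = \<Inter>{I. two_sided_ideal I \<and> closure I = UNIV}"


section \<open>Functions vanishing at infinity\<close>

definition c0_set :: "('g::topological_space \<Rightarrow> 'v::real_normed_vector) set" where
  "c0_set = {f. continuous_on UNIV f \<and>
     (\<forall>\<epsilon>>0. \<exists>K. compact K \<and> (\<forall>x. x \<notin> K \<longrightarrow> norm (f x) < \<epsilon>))}"

lemma c0_setI:
  assumes "continuous_on UNIV f"
    and "\<And>\<epsilon>. \<epsilon> > 0 \<Longrightarrow> \<exists>K. compact K \<and> (\<forall>x. x \<notin> K \<longrightarrow> norm (f x) < \<epsilon>)"
  shows "f \<in> c0_set"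
  using assms by (simp add: c0_set_def)

lemma c0_setD:
  assumes "f \<in> c0_set" "\<epsilon> > 0"
  shows "\<exists>K. compact K \<and> (\<forall>x. x \<notin> K \<longrightarrow> norm (f x) < \<epsilon>)"
  using assms by (auto simp: c0_set_def)

lemma c0_set_bounded:
  assumes "f \<in> c0_set"
  shows "\<exists>B. \<forall>x. norm (f x) \<le> B"
proof -
  obtain K where K: "compact K" "\<And>x. x \<notin> K \<Longrightarrow> norm (f x) < 1"
    using c0_setD[OF assms, of 1] by auto
  have "continuous_on K f"
    using assms by (auto simp: c0_set_def intro: continuous_on_subset)
  then have "bounded (f ` K)"
    using K(1) by (intro compact_imp_bounded compact_continuous_image)
  then obtain B where B: "\<And>x. x \<in> K \<Longrightarrow> norm (f x) \<le> B"
    by (auto simp: bounded_iff)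
  have "norm (f x) \<le> max B 1" for x
    using K(2)[of x] B[of x] by (cases "x \<in> K") auto
  then show ?thesis by blast
qed

lemma c0_set_dominated:
  assumes "continuous_on UNIV h" "f \<in> c0_set" "\<And>x. norm (h x) \<le> C * norm (f x)"
  shows "h \<in> c0_set"
proof (rule c0_setI)
  fix \<epsilon> :: real assume "\<epsilon> > 0"
  define C' where "C' = max C 1"
  have C': "C' > 0" "C \<le> C'" by (auto simp: C'_def)
  then have "\<epsilon> / C' > 0" using \<open>\<epsilon> > 0\<close> by simp
  then obtain K where K: "compact K" "\<And>x. x \<notin> K \<Longrightarrow> norm (f x) < \<epsilon> / C'"
    using c0_setD[OF assms(2) \<open>\<epsilon> / C' > 0\<close>] by blast
  have "norm (h x) < \<epsilon>" if "x \<notin> K" for x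
  proof -
    have "norm (h x) \<le> C' * norm (f x)"
      using assms(3)[of x] C' by (meson mult_right_mono norm_ge_zero order_trans)
    also have "\<dots> < \<epsilon>" using K(2)[OF that] C' by (simp add: field_simps)
    finally show ?thesis .
  qed
  then show "\<exists>K. compact K \<and> (\<forall>x. x \<notin> K \<longrightarrow> norm (h x) < \<epsilon>)" using K(1) by blast
qed (rule assms(1))

lemma c0_set_add:
  assumes "f \<in> c0_set" "h \<in> c0_set"
  shows "(\<lambda>x. f x + h x) \<in> c0_set"
proof (rule c0_setI)
  show "continuous_on UNIV (\<lambda>x. f x + h x)"
    using assms by (auto simp: c0_set_def intro: continuous_intros)
  fix \<epsilon> :: real assume "\<epsilon> > 0"
  then have e: "\<epsilon> / 2 > 0" by simp
  obtain K where K: "compact K" "\<And>x. x \<notin> K \<Longrightarrow> norm (f x) < \<epsilon> / 2"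
    using c0_setD[OF assms(1) e] by blast
  obtain L where L: "compact L" "\<And>x. x \<notin> L \<Longrightarrow> norm (h x) < \<epsilon> / 2"
    using c0_setD[OF assms(2) e] by blast
  have "norm (f x + h x) < \<epsilon>" if "x \<notin> K \<union> L" for x
    using K(2)[of x] L(2)[of x] that norm_triangle_ineq[of "f x" "h x"] by auto
  then show "\<exists>K. compact K \<and> (\<forall>x. x \<notin> K \<longrightarrow> norm (f x + h x) < \<epsilon>)"
    using compact_Un[OF K(1) L(1)] by blast
qed

lemma c0_set_zero: "(\<lambda>x. 0) \<in> c0_set"
  by (rule c0_setI) (auto intro!: exI[of _ "{}"])

lemma c0_set_bounded_linear:
  assumes "bounded_linear T" "f \<in> c0_set"
  shows "(\<lambda>x. T (f x)) \<in> c0_set"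
proof -
  obtain C where C: "\<And>x. norm (T x) \<le> C * norm x"
    using bounded_linear.bounded[OF assms(1)] by (auto simp: mult.commute)
  show ?thesis
  proof (rule c0_set_dominated[OF _ assms(2) C])
    show "continuous_on UNIV (\<lambda>x. T (f x))"
      using assms by (auto simp: c0_set_def intro: bounded_linear.continuous_on)
  qed
qed

lemma c0_set_mult:
  fixes f h :: "'g::topological_space \<Rightarrow> 'v::real_normed_algebra"
  assumes "f \<in> c0_set" "h \<in> c0_set"
  shows "(\<lambda>x. f x * h x) \<in> c0_set"
proof -
  obtain B where B: "\<And>x. norm (f x) \<le> B" using c0_set_bounded[OF assms(1)] by blast
  show ?thesis
  proof (rule c0_set_dominated[OF _ assms(2)])
    show "continuous_on UNIV (\<lambda>x. f x * h x)"
      using assms by (auto simp: c0_set_def intro: continuous_intros)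
    show "norm (f x * h x) \<le> B * norm (h x)" for x
      by (rule order_trans[OF norm_mult_ineq mult_right_mono[OF B]]) simp
  qed
qed

typedef (overloaded) ('g, 'v) c0 = "c0_set :: ('g::topological_space \<Rightarrow> 'v::real_normed_vector) set"
  morphisms apply_c0 Abs_c0
  using c0_set_zero by blast

declare [[coercion "apply_c0 :: ('g::topological_space, 'v::real_normed_vector) c0 \<Rightarrow> 'g \<Rightarrow> 'v"]]

setup_lifting type_definition_c0

lemma c0_eqI: "(\<And>x. apply_c0 f x = apply_c0 h x) \<Longrightarrow> f = h"
  by transfer auto

instantiation c0 :: (topological_space, real_normed_vector) real_vector
begin
lift_definition zero_c0 :: "('a, 'b) c0" is "\<lambda>_. 0" by (rule c0_set_zero)
lift_definition plus_c0 :: "('a, 'b) c0 \<Rightarrow> ('a, 'b) c0 \<Rightarrow> ('a, 'b) c0" is "\<lambda>f h x. f x + h x"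
  by (rule c0_set_add)
lift_definition scaleR_c0 :: "real \<Rightarrow> ('a, 'b) c0 \<Rightarrow> ('a, 'b) c0" is "\<lambda>r f x. r *\<^sub>R f x"
  by (rule c0_set_bounded_linear[OF bounded_linear_scaleR_right])
lift_definition uminus_c0 :: "('a, 'b) c0 \<Rightarrow> ('a, 'b) c0" is "\<lambda>f x. - f x"
  by (rule c0_set_bounded_linear[OF bounded_linear_minus[OF bounded_linear_ident]])
definition minus_c0 :: "('a, 'b) c0 \<Rightarrow> ('a, 'b) c0 \<Rightarrow> ('a, 'b) c0"
  where "minus_c0 f h = f + (- h)"
instance
proof
  fix f h k :: "('a, 'b) c0" and r s :: real
  show "f - h = f + - h" by (rule minus_c0_def)
qed (transfer; simp add: algebra_simps)+
end

instantiation c0 :: (topological_space, real_normed_vector) real_normed_vector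
begin
definition norm_c0 :: "('a, 'b) c0 \<Rightarrow> real" where "norm_c0 f = (SUP x. norm (f x))"
definition dist_c0 :: "('a, 'b) c0 \<Rightarrow> ('a, 'b) c0 \<Rightarrow> real" where "dist_c0 f h = norm (f - h)"
definition sgn_c0 :: "('a, 'b) c0 \<Rightarrow> ('a, 'b) c0" where "sgn_c0 f = f /\<^sub>R norm f"
definition uniformity_c0 :: "(('a, 'b) c0 \<times> ('a, 'b) c0) filter"
  where "uniformity_c0 = (INF e\<in>{0 <..}. principal {(x, y). dist x y < e})"
definition open_c0 :: "('a, 'b) c0 set \<Rightarrow> bool"
  where "open_c0 S = (\<forall>x\<in>S. \<forall>\<^sub>F (x', y) in uniformity. x' = x \<longrightarrow> y \<in> S)"

lemma norm_c0_ge: "norm (apply_c0 f x) \<le> norm f"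
proof -
  obtain B where "\<And>x. norm (f x) \<le> B" using c0_set_bounded[OF apply_c0[of f]] by blast
  then show ?thesis unfolding norm_c0_def by (intro cSUP_upper bdd_aboveI2) auto
qed

lemma norm_c0_le: "(\<And>x. norm (apply_c0 f x) \<le> B) \<Longrightarrow> norm f \<le> B"
  unfolding norm_c0_def by (rule cSUP_least) auto

instance
proof
  fix f h :: "('a, 'b) c0" and r :: real
  show "dist f h = norm (f - h)" by (rule dist_c0_def)
  show "sgn f = f /\<^sub>R norm f" by (rule sgn_c0_def)
  show "(uniformity :: (('a, 'b) c0 \<times> _) filter) = (INF e\<in>{0 <..}. principal {(x, y). dist x y < e})"
    by (rule uniformity_c0_def)
  show "open U = (\<forall>x\<in>U. \<forall>\<^sub>F (x', y) in uniformity. x' = x \<longrightarrow> y \<in> U)" for U :: "('a, 'b) c0 set"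
    by (rule open_c0_def)
  show "norm f = 0 \<longleftrightarrow> f = 0"
  proof
    assume "norm f = 0"
    then have "apply_c0 f x = 0" for x using norm_c0_ge[of f x] by simp
    then show "f = 0" by (intro c0_eqI) (simp add: zero_c0.rep_eq)
  next
    assume "f = 0"
    then show "norm f = 0" by (simp add: norm_c0_def zero_c0.rep_eq)
  qed
  show "norm (f + h) \<le> norm f + norm h"
  proof (rule norm_c0_le)
    show "norm (apply_c0 (f + h) x) \<le> norm f + norm h" for x
      unfolding plus_c0.rep_eq
      using norm_triangle_ineq[of "f x" "h x"] norm_c0_ge[of f x] norm_c0_ge[of h x] by simp
  qed
  have le: "norm (r *\<^sub>R f) \<le> \<bar>r\<bar> * norm f" for r and f :: "('a, 'b) c0"
    by (rule norm_c0_le) (simp add: scaleR_c0.rep_eq mult_left_mono norm_c0_ge)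
  show "norm (r *\<^sub>R f) = \<bar>r\<bar> * norm f"
  proof (cases "r = 0")
    case True
    then show ?thesis by (simp add: norm_c0_def zero_c0.rep_eq)
  next
    case False
    then show ?thesis
      using le[of r f] le[of "inverse r" "r *\<^sub>R f"] by (simp add: field_simps)
  qed
qed
end

instance c0 :: (topological_space, banach) banach
proof
  fix X :: "nat \<Rightarrow> ('a, 'b) c0"
  assume X: "Cauchy X"
  have minus: "apply_c0 (f - h) x = f x - h x" for f h :: "('a, 'b) c0" and x
    unfolding minus_c0_def plus_c0.rep_eq uminus_c0.rep_eq by simp
  have "uniformly_Cauchy_on UNIV (\<lambda>n x. apply_c0 (X n) x)"
  proof (rule uniformly_Cauchy_onI)
    fix e :: real assume "e > 0"
    then obtain M where M: "\<forall>m\<ge>M. \<forall>n\<ge>M. dist (X m) (X n) < e" using metric_CauchyD[OF X, of e] by auto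
    have "dist (apply_c0 (X m) x) (apply_c0 (X n) x) < e" if "m \<ge> M" "n \<ge> M" for m n x
      using norm_c0_ge[of "X m - X n" x] M that by (force simp: dist_norm minus)
    then show "\<exists>M. \<forall>x\<in>UNIV. \<forall>m\<ge>M. \<forall>n\<ge>M. dist (apply_c0 (X m) x) (apply_c0 (X n) x) < e"
      by blast
  qed
  then obtain l where l: "uniform_limit UNIV (\<lambda>n x. apply_c0 (X n) x) l sequentially"
    using Cauchy_uniformly_convergent uniformly_convergent_on_def by metis
  have close: "\<forall>\<^sub>F n in sequentially. \<forall>x. dist (apply_c0 (X n) x) (l x) < e" if "e > 0" for e
    using uniform_limitD[OF l that] by simp
  have l_in: "l \<in> c0_set"
  proof (rule c0_setI)
    show "continuous_on UNIV l"
    proof (rule uniform_limit_theorem[OF _ l])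
      show "\<forall>\<^sub>F n in sequentially. continuous_on UNIV (apply_c0 (X n))"
        using apply_c0[of "X n" for n] by (intro always_eventually) (simp add: c0_set_def)
    qed simp
    fix e :: real assume "e > 0"
    then have "e / 2 > 0" by simp
    from eventually_happens'[OF _ close[OF this]]
    obtain n where n: "\<And>x. dist (apply_c0 (X n) x) (l x) < e / 2" by auto
    obtain K where K: "compact K" "\<And>x. x \<notin> K \<Longrightarrow> norm (apply_c0 (X n) x) < e / 2"
      using c0_setD[OF apply_c0[of "X n"] \<open>e / 2 > 0\<close>] by blast
    have "norm (l x) < e" if "x \<notin> K" for x
      using n[of x] K(2)[OF that] norm_triangle_sub[of "l x" "X n x"]
      by (simp add: dist_norm norm_minus_commute)
    then show "\<exists>K. compact K \<and> (\<forall>x. x \<notin> K \<longrightarrow> norm (l x) < e)" using K(1) by blast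
  qed
  have "X \<longlonglongrightarrow> Abs_c0 l"
  proof (rule metric_LIMSEQ_I)
    fix e :: real assume "e > 0"
    then have "e / 2 > 0" by simp
    from close[OF this] obtain N where
      N: "\<And>n x. n \<ge> N \<Longrightarrow> dist (apply_c0 (X n) x) (l x) < e / 2"
      unfolding eventually_sequentially by blast
    have "dist (X n) (Abs_c0 l) \<le> e / 2" if "n \<ge> N" for n
      unfolding dist_norm
      by (rule norm_c0_le) (use N[OF that] in \<open>simp add: minus Abs_c0_inverse[OF l_in] dist_norm less_imp_le\<close>)
    then show "\<exists>N. \<forall>n\<ge>N. dist (X n) (Abs_c0 l) < e" using \<open>e > 0\<close> by force
  qed
  then show "convergent X" by (rule convergentI)
qed

instantiation c0 :: (topological_space, cbanach) cbanach
begin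
lift_definition scaleC_c0 :: "complex \<Rightarrow> ('a, 'b) c0 \<Rightarrow> ('a, 'b) c0" is "\<lambda>c f x. c *\<^sub>C f x"
  by (rule c0_set_bounded_linear[OF bounded_linear_scaleC])
instance
proof
  fix c d :: complex and r :: real and x y :: "('a, 'b) c0"
  show "c *\<^sub>C (x + y) = c *\<^sub>C x + c *\<^sub>C y" by transfer (simp add: scaleC_add_right)
  show "(c + d) *\<^sub>C x = c *\<^sub>C x + d *\<^sub>C x" by transfer (simp add: scaleC_add_left)
  show cd: "c *\<^sub>C d *\<^sub>C x = (c * d) *\<^sub>C x" for c d and x :: "('a, 'b) c0"
    by transfer (simp add: scaleC_scaleC)
  show one: "r *\<^sub>R x = complex_of_real r *\<^sub>C x" for r and x :: "('a, 'b) c0"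
    by transfer (simp add: scaleR_scaleC)
  have le: "norm (c *\<^sub>C x) \<le> cmod c * norm x" for c and x :: "('a, 'b) c0"
    by (rule norm_c0_le) (simp add: scaleC_c0.rep_eq norm_scaleC mult_left_mono norm_c0_ge)
  show "norm (c *\<^sub>C x) = cmod c * norm x"
  proof (cases "c = 0")
    case True
    then show ?thesis using le[of 0 x] by simp
  next
    case False
    have "norm x = norm (inverse c *\<^sub>C c *\<^sub>C x)"
      using False one[of 1 x] by (simp add: cd)
    also have "\<dots> \<le> cmod (inverse c) * norm (c *\<^sub>C x)" by (rule le)
    finally have "cmod c * norm x \<le> norm (c *\<^sub>C x)"
      using False by (simp add: norm_inverse norm_divide field_simps)
    then show ?thesis using le[of c x] by simp
  qed
qed
end

lemma norm_star: "norm (star x) = norm (x::'a::cstar_algebra)"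
proof -
  have le: "norm y \<le> norm (star y)" for y :: 'a
  proof (cases "y = 0")
    case False
    have "norm y * norm y \<le> norm (star y) * norm y"
      using norm_mult_ineq[of "star y" y] by (simp add: cstar_identity power2_eq_square)
    then show ?thesis using False by simp
  qed simp
  show ?thesis using le[of x] le[of "star x"] by (simp add: star_star)
qed

lemma bounded_linear_star: "bounded_linear (star :: 'a::cstar_algebra \<Rightarrow> 'a)"
  by (rule bounded_linear_intro[where K = 1])
    (simp_all add: star_add norm_star scaleR_scaleC star_scaleC)

instantiation c0 :: (topological_space, cstar_algebra) cstar_algebra
begin
lift_definition times_c0 :: "('a, 'b) c0 \<Rightarrow> ('a, 'b) c0 \<Rightarrow> ('a, 'b) c0" is "\<lambda>f h x. f x * h x"
  by (rule c0_set_mult)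
lift_definition star_c0 :: "('a, 'b) c0 \<Rightarrow> ('a, 'b) c0" is "\<lambda>f x. star (f x)"
  by (rule c0_set_bounded_linear[OF bounded_linear_star])
instance
proof
  fix f h k :: "('a, 'b) c0" and c :: complex and r :: real
  show "f * h * k = f * (h * k)" by transfer (simp add: mult.assoc)
  show "(f + h) * k = f * k + h * k" by transfer (simp add: algebra_simps)
  show "f * (h + k) = f * h + f * k" by transfer (simp add: algebra_simps)
  show "r *\<^sub>R f * h = r *\<^sub>R (f * h)" by transfer simp
  show "f * r *\<^sub>R h = r *\<^sub>R (f * h)" by transfer simp
  show nm: "norm (f * h) \<le> norm f * norm h"
  proof (rule norm_c0_le)
    fix x
    have "norm (apply_c0 (f * h) x) \<le> norm (f x) * norm (h x)"
      by (simp add: times_c0.rep_eq norm_mult_ineq)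
    also have "\<dots> \<le> norm f * norm h" by (intro mult_mono norm_c0_ge) auto
    finally show "norm (apply_c0 (f * h) x) \<le> norm f * norm h" .
  qed
  show "(c *\<^sub>C f) * h = c *\<^sub>C (f * h)" by transfer (simp add: mult_scaleC_left)
  show "f * (c *\<^sub>C h) = c *\<^sub>C (f * h)" by transfer (simp add: mult_scaleC_right)
  show "star (star f) = f" by transfer (simp add: star_star)
  show "star (f + h) = star f + star h" by transfer (simp add: star_add)
  show "star (c *\<^sub>C f) = cnj c *\<^sub>C star f" by transfer (simp add: star_scaleC)
  show "star (f * h) = star h * star f" by transfer (simp add: star_mult)
  show "norm (star f * f) = (norm f)\<^sup>2"
  proof (rule antisym)
    show "norm (star f * f) \<le> (norm f)\<^sup>2"
    proof (rule norm_c0_le)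
      show "norm (apply_c0 (star f * f) x) \<le> (norm f)\<^sup>2" for x
        by (simp add: times_c0.rep_eq star_c0.rep_eq cstar_identity power_mono norm_c0_ge)
    qed
    have "norm f \<le> sqrt (norm (star f * f))"
    proof (rule norm_c0_le)
      fix x
      have "(norm (f x))\<^sup>2 \<le> norm (star f * f)"
        using norm_c0_ge[of "star f * f" x]
        by (simp add: times_c0.rep_eq star_c0.rep_eq cstar_identity)
      then show "norm (f x) \<le> sqrt (norm (star f * f))" by (rule real_le_rsqrt)
    qed
    then show "(norm f)\<^sup>2 \<le> norm (star f * f)"
      using power_mono[of "norm f" "sqrt (norm (star f * f))" 2] by simp
  qed
qed
end


section \<open>Hilbert modules and their operators\<close>

text \<open>The carrier of a right Hilbert module over \<open>'b\<close> is the type \<open>'e\<close>.\<close>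

record ('e, 'b) hmodule =
  rmul :: "'e \<Rightarrow> 'b \<Rightarrow> 'e"
  inn :: "'e \<Rightarrow> 'e \<Rightarrow> 'b"

definition hilbert_module :: "('e::cbanach, 'b::cstar_algebra) hmodule \<Rightarrow> bool" where
  "hilbert_module E \<longleftrightarrow>
     (\<forall>x. clinear (rmul E x)) \<and> (\<forall>b. clinear (\<lambda>x. rmul E x b)) \<and>
     (\<forall>x a b. rmul E (rmul E x a) b = rmul E x (a * b)) \<and>
     (\<forall>x. clinear (inn E x)) \<and>
     (\<forall>x y b. inn E x (rmul E y b) = inn E x y * b) \<and>
     (\<forall>x y. star (inn E x y) = inn E y x) \<and>
     (\<forall>x. positive (inn E x x)) \<and>
     (\<forall>x. norm x = sqrt (norm (inn E x x)))"

definition adjointable :: "('e::cbanach, 'b::cstar_algebra) hmodule \<Rightarrow> ('e \<Rightarrow>\<^sub>L 'e) \<Rightarrow> bool" where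
  "adjointable E T \<longleftrightarrow> (\<exists>S::'e \<Rightarrow>\<^sub>L 'e. \<forall>x y. inn E (T x) y = inn E x (S y))"

definition adj :: "('e::cbanach, 'b::cstar_algebra) hmodule \<Rightarrow> ('e \<Rightarrow>\<^sub>L 'e) \<Rightarrow> 'e \<Rightarrow>\<^sub>L 'e" where
  "adj E T = (THE S::'e \<Rightarrow>\<^sub>L 'e. \<forall>x y. inn E (T x) y = inn E x (S y))"

definition inverse_of :: "('e::cbanach \<Rightarrow>\<^sub>L 'e) \<Rightarrow> ('e \<Rightarrow>\<^sub>L 'e) \<Rightarrow> bool" where
  "inverse_of T S \<longleftrightarrow> S o\<^sub>L T = id_blinfun \<and> T o\<^sub>L S = id_blinfun"

definition op_inv :: "('e::cbanach \<Rightarrow>\<^sub>L 'e) \<Rightarrow> 'e \<Rightarrow>\<^sub>L 'e" where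
  "op_inv T = (THE S. inverse_of T S)"

text \<open>The set of rank-one operators is closed under complex scalars, so its real linear span is
  its complex linear span. This applies to all spans below.\<close>

definition compact_ops :: "('e::cbanach, 'b::cstar_algebra) hmodule \<Rightarrow> ('e \<Rightarrow>\<^sub>L 'e) set" where
  "compact_ops E = closure (span {T. \<exists>x y. \<forall>z. blinfun_apply T z = rmul E x (inn E y z)})"

definition cstar_generated ::
  "('e::cbanach, 'b::cstar_algebra) hmodule \<Rightarrow> ('e \<Rightarrow>\<^sub>L 'e) set \<Rightarrow> ('e \<Rightarrow>\<^sub>L 'e) set" where
  "cstar_generated E X = \<Inter>{S. X \<subseteq> S \<and> closed S \<and> 0 \<in> S \<and>
     (\<forall>a\<in>S. \<forall>b\<in>S. a + b \<in> S \<and> a o\<^sub>L b \<in> S) \<and> (\<forall>a\<in>S. adj E a \<in> S \<and> (\<forall>c. c *\<^sub>C a \<in> S))}"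

definition star_rep ::
  "('e::cbanach, 'b::cstar_algebra) hmodule \<Rightarrow> ('a::cstar_algebra \<Rightarrow> 'e \<Rightarrow>\<^sub>L 'e) \<Rightarrow> bool" where
  "star_rep E \<pi> \<longleftrightarrow> clinear \<pi> \<and> (\<forall>a b. \<pi> (a * b) = \<pi> a o\<^sub>L \<pi> b) \<and>
     (\<forall>a x y. inn E (\<pi> a x) y = inn E x (\<pi> (star a) y))"

text \<open>Unbounded operators are identified with their graphs. The composite ``first \<open>S\<close>, then \<open>T\<close>''
  on its natural domain is the relational composite \<open>S O T\<close>, the domain is \<open>Domain T\<close>, and the
  inverse is the converse relation.\<close>

type_synonym 'e uop = "('e \<times> 'e) set"

definition graph :: "('e \<Rightarrow> 'e) \<Rightarrow> 'e uop" where
  "graph f = {(x, f x) |x. True}"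

definition linear_op :: "('e::cbanach, 'b::cstar_algebra) hmodule \<Rightarrow> 'e uop \<Rightarrow> bool" where
  "linear_op E T \<longleftrightarrow> single_valued T \<and> subspace T \<and>
     (\<forall>(x, y)\<in>T. (\<forall>c. (c *\<^sub>C x, c *\<^sub>C y) \<in> T) \<and> (\<forall>b. (rmul E x b, rmul E y b) \<in> T))"

definition op_adj :: "('e::cbanach, 'b::cstar_algebra) hmodule \<Rightarrow> 'e uop \<Rightarrow> 'e uop" where
  "op_adj E T = {(x, y). \<forall>(u, v)\<in>T. inn E v x = inn E u y}"

definition regular_op :: "('e::cbanach, 'b::cstar_algebra) hmodule \<Rightarrow> 'e uop \<Rightarrow> bool" where
  "regular_op E T \<longleftrightarrow> linear_op E T \<and> closed T \<and>
     closure (Domain T) = UNIV \<and> closure (Domain (op_adj E T)) = UNIV \<and>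
     closure {x + z |x z. (x, z) \<in> T O op_adj E T} = UNIV"

definition self_adjoint_op :: "('e::cbanach, 'b::cstar_algebra) hmodule \<Rightarrow> 'e uop \<Rightarrow> bool" where
  "self_adjoint_op E D \<longleftrightarrow> op_adj E D = D"

text \<open>The operator \<open>(1 + D\<^sup>2)\<^sup>-\<^sup>1\<close>.\<close>

definition resolvent_sq :: "'e::cbanach uop \<Rightarrow> 'e \<Rightarrow>\<^sub>L 'e" where
  "resolvent_sq D = (THE R. \<forall>y. \<exists>z. (blinfun_apply R y, z) \<in> D O D \<and> blinfun_apply R y + z = y)"

text \<open>The operator \<open>T a - a S\<close> on its natural domain; it is the commutator \<open>[T, a]\<close> when \<open>S = T\<close>.\<close>

definition twisted_comm :: "'e::cbanach uop \<Rightarrow> 'e uop \<Rightarrow> 'e uop \<Rightarrow> 'e uop" where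
  "twisted_comm T a S = {(x, y - z) |x y z. (x, y) \<in> a O T \<and> (x, z) \<in> S O a}"

definition Lip0 :: "('e::cbanach, 'b::cstar_algebra) hmodule \<Rightarrow> 'e uop \<Rightarrow> ('e \<Rightarrow>\<^sub>L 'e) set" where
  "Lip0 E D = {a. adjointable E a \<and> blinfun_apply a ` Domain D \<subseteq> Domain D \<and>
     (\<exists>Z. adjointable E Z \<and> twisted_comm D (graph a) D \<subseteq> graph Z)}"

text \<open>Gradings. \<open>None\<close> stands for an ungraded module (the odd case), \<open>Some \<Gamma>\<close> for the
  \<open>\<int>/2\<close>-grading with self-adjoint grading unitary \<open>\<Gamma>\<close> (the even case).\<close>

definition is_grading ::
  "('e::cbanach, 'b::cstar_algebra) hmodule \<Rightarrow> ('e \<Rightarrow>\<^sub>L 'e) option \<Rightarrow> bool" where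
  "is_grading E \<gamma> \<longleftrightarrow> (\<forall>\<Gamma>. \<gamma> = Some \<Gamma> \<longrightarrow>
     \<Gamma> o\<^sub>L \<Gamma> = id_blinfun \<and> (\<forall>x y. inn E (\<Gamma> x) y = inn E x (\<Gamma> y)))"

definition even_map :: "('e::cbanach \<Rightarrow>\<^sub>L 'e) option \<Rightarrow> ('e \<Rightarrow> 'e) \<Rightarrow> bool" where
  "even_map \<gamma> f \<longleftrightarrow> (\<forall>\<Gamma>. \<gamma> = Some \<Gamma> \<longrightarrow> (\<forall>x. f (\<Gamma> x) = \<Gamma> (f x)))"

definition odd_op :: "('e::cbanach \<Rightarrow>\<^sub>L 'e) option \<Rightarrow> 'e uop \<Rightarrow> bool" where
  "odd_op \<gamma> D \<longleftrightarrow> (\<forall>\<Gamma>. \<gamma> = Some \<Gamma> \<longrightarrow> (\<forall>(x, y)\<in>D. (\<Gamma> x, - \<Gamma> y) \<in> D))"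

definition correspondence ::
  "('e::cbanach, 'b::cstar_algebra) hmodule \<Rightarrow> ('e \<Rightarrow>\<^sub>L 'e) option \<Rightarrow>
     ('a::cstar_algebra \<Rightarrow> 'e \<Rightarrow>\<^sub>L 'e) \<Rightarrow> bool" where
  "correspondence E \<gamma> \<pi> \<longleftrightarrow> hilbert_module E \<and> is_grading E \<gamma> \<and> star_rep E \<pi> \<and>
     (\<forall>a. even_map \<gamma> (\<pi> a))"

definition kasparov_module ::
  "('e::cbanach, 'b::cstar_algebra) hmodule \<Rightarrow> ('e \<Rightarrow>\<^sub>L 'e) option \<Rightarrow>
     ('a::cstar_algebra \<Rightarrow> 'e \<Rightarrow>\<^sub>L 'e) \<Rightarrow> 'e uop \<Rightarrow> bool" where
  "kasparov_module E \<gamma> \<pi> D \<longleftrightarrow> correspondence E \<gamma> \<pi> \<and>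
     regular_op E D \<and> self_adjoint_op E D \<and> odd_op \<gamma> D \<and>
     (\<forall>a. resolvent_sq D o\<^sub>L \<pi> a \<in> compact_ops E) \<and> range \<pi> \<subseteq> closure (Lip0 E D)"


section \<open>Conformal equivariance\<close>

text \<open>The library's topological groups are written additively; \<open>group_add\<close> is not assumed to be
  commutative, so \<open>g + h\<close>, \<open>- g\<close>, \<open>0\<close> stand for the product, inverse and unit of \<open>G\<close>.\<close>

definition cstar_action ::
  "('g::topological_group_add \<Rightarrow> 'a::cstar_algebra \<Rightarrow> 'a) \<Rightarrow> bool" where
  "cstar_action \<alpha> \<longleftrightarrow>
     (\<forall>g. clinear (\<alpha> g) \<and> bij (\<alpha> g) \<and> (\<forall>a b. \<alpha> g (a * b) = \<alpha> g a * \<alpha> g b) \<and>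
          (\<forall>a. \<alpha> g (star a) = star (\<alpha> g a))) \<and>
     (\<forall>g h a. \<alpha> (g + h) a = \<alpha> g (\<alpha> h a)) \<and>
     (\<forall>a. continuous_on UNIV (\<lambda>g. \<alpha> g a))"

definition equivariant_correspondence ::
  "('g::topological_group_add \<Rightarrow> 'a::cstar_algebra \<Rightarrow> 'a) \<Rightarrow> ('g \<Rightarrow> 'b::cstar_algebra \<Rightarrow> 'b) \<Rightarrow>
     ('e::cbanach, 'b) hmodule \<Rightarrow> ('e \<Rightarrow>\<^sub>L 'e) option \<Rightarrow> ('a \<Rightarrow> 'e \<Rightarrow>\<^sub>L 'e) \<Rightarrow>
     ('g \<Rightarrow> 'e \<Rightarrow> 'e) \<Rightarrow> bool" where
  "equivariant_correspondence \<alpha> \<beta> E \<gamma> \<pi> U \<longleftrightarrow> correspondence E \<gamma> \<pi> \<and>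
     continuous_on UNIV (\<lambda>(g, x). U g x) \<and>
     (\<forall>g. clinear (U g) \<and> even_map \<gamma> (U g)) \<and>
     (\<forall>g h x. U (g + h) x = U g (U h x)) \<and>
     (\<forall>g x b. U g (rmul E x b) = rmul E (U g x) (\<beta> g b)) \<and>
     (\<forall>g x y. \<beta> g (inn E x y) = inn E (U g x) (U g y)) \<and>
     (\<forall>g a x. U g (\<pi> a x) = \<pi> (\<alpha> g a) (U g x))"

definition star_strongly_continuous ::
  "('e::cbanach, 'b::cstar_algebra) hmodule \<Rightarrow> ('g::topological_space \<Rightarrow> 'e \<Rightarrow>\<^sub>L 'e) \<Rightarrow> bool" where
  "star_strongly_continuous E Z \<longleftrightarrow> (\<forall>g. adjointable E (Z g)) \<and>
     (\<forall>x. continuous_on UNIV (\<lambda>g. blinfun_apply (Z g) x) \<and>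
          continuous_on UNIV (\<lambda>g. blinfun_apply (adj E (Z g)) x))"

text \<open>The operators \<open>F g\<close> on their domains extend to a *-strongly continuous family.\<close>

definition extends_star_strongly ::
  "('e::cbanach, 'b::cstar_algebra) hmodule \<Rightarrow> ('g::topological_space \<Rightarrow> 'e uop) \<Rightarrow> bool" where
  "extends_star_strongly E F \<longleftrightarrow> (\<exists>Z. star_strongly_continuous E Z \<and> (\<forall>g. F g \<subseteq> graph (Z g)))"

text \<open>The set \<open>\<Q>\<close>. Since \<open>U\<^sub>g\<^sup>* = U\<^sub>g\<^sup>-\<^sup>1\<close>, the graph of \<open>U\<^sub>g D U\<^sub>g\<^sup>*\<close> is the image of
  the graph of \<open>D\<close> under \<open>U\<^sub>g \<times> U\<^sub>g\<close>.\<close>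

definition conformal_set ::
  "('e::cbanach, 'b::cstar_algebra) hmodule \<Rightarrow> 'e uop \<Rightarrow> ('g::topological_group_add \<Rightarrow> 'e \<Rightarrow> 'e) \<Rightarrow>
     ('g \<Rightarrow> 'e \<Rightarrow>\<^sub>L 'e) \<Rightarrow> ('e \<Rightarrow>\<^sub>L 'e) set" where
  "conformal_set E D U \<mu> =
    (let \<nu> = (\<lambda>g. adj E (op_inv (\<mu> g)));
         UDU = (\<lambda>g. map_prod (U g) (U g) ` D);
         \<mu>D\<mu> = (\<lambda>g. graph (adj E (\<mu> g)) O D O graph (\<mu> g))
     in {a \<in> Lip0 E D.
          (\<forall>g. \<forall>b\<in>{a o\<^sub>L \<mu> g, a o\<^sub>L \<nu> g}.
             blinfun_apply b ` Domain D \<subseteq> Domain D \<inter> U g ` Domain D) \<and>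
          extends_star_strongly E (\<lambda>g. graph (\<nu> g) O twisted_comm (UDU g) (graph a) (\<mu>D\<mu> g)) \<and>
          extends_star_strongly E (\<lambda>g. twisted_comm (UDU g) (graph a) (\<mu>D\<mu> g)) \<and>
          extends_star_strongly E (\<lambda>g. twisted_comm D (graph (a o\<^sub>L \<mu> g)) D) \<and>
          extends_star_strongly E (\<lambda>g. twisted_comm D (graph (a o\<^sub>L \<nu> g)) D)})"

text \<open>A *-strongly continuous family of invertible operators is understood to be invertible in the
  algebra of *-strongly continuous functions; continuity of the inverses is not automatic.\<close>

definition conformally_equivariant ::
  "('g::topological_group_add \<Rightarrow> 'a::cstar_algebra \<Rightarrow> 'a) \<Rightarrow> ('g \<Rightarrow> 'b::cstar_algebra \<Rightarrow> 'b) \<Rightarrow>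
     ('e::cbanach, 'b) hmodule \<Rightarrow> ('e \<Rightarrow>\<^sub>L 'e) option \<Rightarrow> ('a \<Rightarrow> 'e \<Rightarrow>\<^sub>L 'e) \<Rightarrow> 'e uop \<Rightarrow>
     ('g \<Rightarrow> 'e \<Rightarrow> 'e) \<Rightarrow> ('g \<Rightarrow> 'e \<Rightarrow>\<^sub>L 'e) \<Rightarrow> bool" where
  "conformally_equivariant \<alpha> \<beta> E \<gamma> \<pi> D U \<mu> \<longleftrightarrow>
     kasparov_module E \<gamma> \<pi> D \<and> equivariant_correspondence \<alpha> \<beta> E \<gamma> \<pi> U \<and>
     star_strongly_continuous E \<mu> \<and> star_strongly_continuous E (\<lambda>g. op_inv (\<mu> g)) \<and>
     (\<forall>g. even_map \<gamma> (\<mu> g) \<and> (\<exists>S. adjointable E S \<and> inverse_of (\<mu> g) S)) \<and>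
     range \<pi> \<subseteq> closure (span {\<pi> a o\<^sub>L q |a q. q \<in> conformal_set E D U \<mu>}) \<inter>
                closure (span {q o\<^sub>L \<pi> a |a q. q \<in> conformal_set E D U \<mu>})"


section \<open>Tensor products\<close>

text \<open>Elements of the algebraic tensor product are represented by lists of elementary tensors.\<close>

definition tsum :: "('b \<Rightarrow> 'c \<Rightarrow> 't::comm_monoid_add) \<Rightarrow> ('b \<times> 'c) list \<Rightarrow> 't" where
  "tsum \<tau> xs = sum_list (map (\<lambda>(b, c). \<tau> b c) xs)"

definition tmult ::
  "('b::cstar_algebra \<times> 'c::cstar_algebra) list \<Rightarrow> ('b \<times> 'c) list \<Rightarrow> ('b \<times> 'c) list" where
  "tmult xs ys = [(b * b', c * c'). (b, c) \<leftarrow> xs, (b', c') \<leftarrow> ys]"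

definition tsquare :: "('b::cstar_algebra \<times> 'c::cstar_algebra) list \<Rightarrow> ('b \<times> 'c) list" where
  "tsquare xs = tmult (map (map_prod star star) xs) xs"

text \<open>\<open>\<tau>\<close> exhibits \<open>'t\<close> as the minimal tensor product of \<open>'b\<close> and \<open>'c\<close>. The last clause says that
  the norm is the spatial one: \<open>\<parallel>t\<parallel>\<close> is the supremum of \<open>\<parallel>(\<pi>\<^sub>\<phi> \<otimes> \<pi>\<^sub>\<psi>)(t)\<parallel>\<close> over the
  GNS representations of states \<open>\<phi>\<close>, \<open>\<psi>\<close>, and the classes of algebraic tensors \<open>s\<close> are dense in the
  GNS space, so \<open>\<parallel>(\<pi>\<^sub>\<phi> \<otimes> \<pi>\<^sub>\<psi>)(t)\<parallel> \<le> K\<close> iff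
  \<open>(\<phi> \<otimes> \<psi>)((t s)\<^sup>* (t s)) \<le> K\<^sup>2 (\<phi> \<otimes> \<psi>)(s\<^sup>* s)\<close> for all \<open>s\<close>.\<close>

definition min_tensor ::
  "('b::cstar_algebra \<Rightarrow> 'c::cstar_algebra \<Rightarrow> 't::cstar_algebra) \<Rightarrow> bool" where
  "min_tensor \<tau> \<longleftrightarrow>
     (\<forall>b. clinear (\<tau> b)) \<and> (\<forall>c. clinear (\<lambda>b. \<tau> b c)) \<and>
     (\<forall>b c b' c'. \<tau> b c * \<tau> b' c' = \<tau> (b * b') (c * c')) \<and>
     (\<forall>b c. star (\<tau> b c) = \<tau> (star b) (star c)) \<and>
     closure (span {\<tau> b c |b c. True}) = UNIV \<and>
     (\<forall>xs. \<forall>K\<ge>0. norm (tsum \<tau> xs) \<le> K \<longleftrightarrow>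
        (\<forall>\<phi> \<psi> ys. state \<phi> \<longrightarrow> state \<psi> \<longrightarrow>
           Re (tsum (\<lambda>b c. \<phi> b * \<psi> c) (tsquare (tmult xs ys)))
             \<le> K\<^sup>2 * Re (tsum (\<lambda>b c. \<phi> b * \<psi> c) (tsquare ys))))"

text \<open>\<open>\<theta>\<close> exhibits \<open>F\<close> as the external tensor product \<open>E \<otimes> C\<close>, a Hilbert module over the
  tensor product given by \<open>\<tau>\<close>. Both products are determined up to unique isomorphism.\<close>

definition ext_tensor ::
  "('b::cstar_algebra \<Rightarrow> 'c::cstar_algebra \<Rightarrow> 't::cstar_algebra) \<Rightarrow> ('e::cbanach, 'b) hmodule \<Rightarrow>
     ('e \<Rightarrow> 'c \<Rightarrow> 'f::cbanach) \<Rightarrow> ('f, 't) hmodule \<Rightarrow> bool" where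
  "ext_tensor \<tau> E \<theta> F \<longleftrightarrow> hilbert_module F \<and>
     (\<forall>x. clinear (\<theta> x)) \<and> (\<forall>c. clinear (\<lambda>x. \<theta> x c)) \<and>
     (\<forall>x c b d. rmul F (\<theta> x c) (\<tau> b d) = \<theta> (rmul E x b) (c * d)) \<and>
     (\<forall>x c y d. inn F (\<theta> x c) (\<theta> y d) = \<tau> (inn E x y) (star c * d)) \<and>
     closure (span {\<theta> x c |x c. True}) = UNIV"

text \<open>Right multiplication by \<open>1 \<otimes> c\<close>.\<close>

definition rmult :: "('e::cbanach \<Rightarrow> 'c::cstar_algebra \<Rightarrow> 'f::cbanach) \<Rightarrow> 'c \<Rightarrow> 'f \<Rightarrow>\<^sub>L 'f" where
  "rmult \<theta> c = (THE R. \<forall>x d. blinfun_apply R (\<theta> x d) = \<theta> x (d * c))"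

text \<open>The operator \<open>D \<otimes> 1\<close>.\<close>

definition amplify :: "('e::cbanach \<Rightarrow> 'c::cstar_algebra \<Rightarrow> 'f::cbanach) \<Rightarrow> 'e uop \<Rightarrow> 'f uop" where
  "amplify \<theta> D = closure (span {(\<theta> x c, \<theta> y c) |x y c. (x, y) \<in> D})"

text \<open>The slice map \<open>1 \<otimes> \<psi>\<close> from \<open>B \<otimes> C\<close> to \<open>B\<close>.\<close>

definition slice_map ::
  "('b::cstar_algebra \<Rightarrow> 'c::cstar_algebra \<Rightarrow> 't::cstar_algebra) \<Rightarrow> ('c \<Rightarrow> complex) \<Rightarrow> 't \<Rightarrow>\<^sub>L 'b" where
  "slice_map \<tau> \<psi> = (THE P. \<forall>b c. blinfun_apply P (\<tau> b c) = \<psi> c *\<^sub>C b)"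


section \<open>Matched operators and conformally generated cycles\<close>

definition matched ::
  "('e::cbanach \<Rightarrow> 'c::cstar_algebra \<Rightarrow> 'f::cbanach) \<Rightarrow> ('f, 't::cstar_algebra) hmodule \<Rightarrow>
     'f uop \<Rightarrow> bool" where
  "matched \<theta> F T \<longleftrightarrow> regular_op F T \<and>
     closure {c. range (blinfun_apply (rmult \<theta> c)) \<subseteq> Domain T} = UNIV"

definition mprod :: "'f::cbanach uop \<Rightarrow> 'f uop \<Rightarrow> 'f uop" where
  "mprod S T = closure (T O S)"

text \<open>The statement that \<open>T a - a S\<close> is matched, for matched \<open>a\<close>: the closure of this operator is
  matched, and the operator is defined on enough of the domain of \<open>S\<close>. For \<open>C = \<complex>\<close> and \<open>S = T\<close> this
  says that \<open>a\<close> maps the domain of \<open>T\<close> into itself and \<open>[T, a]\<close> extends to an adjointable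
  operator, as in the definition of \<open>Lip0\<close>.\<close>

definition comm_matched ::
  "('e::cbanach \<Rightarrow> 'c::cstar_algebra \<Rightarrow> 'f::cbanach) \<Rightarrow> ('f, 't::cstar_algebra) hmodule \<Rightarrow>
     'f uop \<Rightarrow> 'f uop \<Rightarrow> 'f uop \<Rightarrow> bool" where
  "comm_matched \<theta> F T a S \<longleftrightarrow> matched \<theta> F (closure (twisted_comm T a S)) \<and>
     closure {c. blinfun_apply (rmult \<theta> c) ` Domain S \<subseteq> Domain (twisted_comm T a S)} = UNIV"

text \<open>The sets \<open>\<L>\<close> (for \<open>\<mu> = \<mu>\<^sub>L\<close>) and \<open>\<R>\<close> (for \<open>\<mu> = \<mu>\<^sub>R\<close>).\<close>

definition side_set ::
  "('e::cbanach \<Rightarrow> 'c::cstar_algebra \<Rightarrow> 'f::cbanach) \<Rightarrow> ('f, 't::cstar_algebra) hmodule \<Rightarrow>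
     'e uop \<Rightarrow> 'f uop \<Rightarrow> 'f uop set" where
  "side_set \<theta> F D \<mu> =
    (let D1 = amplify \<theta> D;
         \<mu>D\<mu> = op_adj F \<mu> O D1 O \<mu>
     in {a. matched \<theta> F a \<and>
          comm_matched \<theta> F D1 a D1 \<and>
          comm_matched \<theta> F \<mu>D\<mu> a \<mu>D\<mu> \<and>
          comm_matched \<theta> F D1 (mprod (op_adj F \<mu>) a) D1 \<and>
          comm_matched \<theta> F D1 (mprod (\<mu>\<inverse>) a) D1 \<and>
          comm_matched \<theta> F D1 (mprod a \<mu>) D1 \<and>
          comm_matched \<theta> F D1 (mprod a (op_adj F (\<mu>\<inverse>))) D1})"

definition middle_set ::
  "('e::cbanach \<Rightarrow> 'c::cstar_algebra \<Rightarrow> 'f::cbanach) \<Rightarrow> ('f, 't::cstar_algebra) hmodule \<Rightarrow>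
     'e uop \<Rightarrow> 'f uop \<Rightarrow> 'f uop \<Rightarrow> 'f uop set" where
  "middle_set \<theta> F D \<mu>L \<mu>R =
    (let D1 = amplify \<theta> D
     in {a. matched \<theta> F a \<and>
          comm_matched \<theta> F (op_adj F \<mu>L O D1 O \<mu>L) a (op_adj F \<mu>R O D1 O \<mu>R)})"

text \<open>\<open>R = (1 \<otimes> \<psi>)(T)\<close>. As \<open>\<psi>(a c) = \<psi>(c) = \<psi>(c a)\<close>, the matrix coefficient
  \<open>(x, (1 \<otimes> \<psi>)(T (1 \<otimes> a)) y)\<close> is the slice of \<open>(x \<otimes> a, T (y \<otimes> a))\<close>.\<close>

definition is_slice ::
  "('b::cstar_algebra \<Rightarrow> 'c::cstar_algebra \<Rightarrow> 't::cstar_algebra) \<Rightarrow> ('e::cbanach, 'b) hmodule \<Rightarrow>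
     ('e \<Rightarrow> 'c \<Rightarrow> 'f::cbanach) \<Rightarrow> ('f, 't) hmodule \<Rightarrow>
     ('c \<Rightarrow> complex) \<Rightarrow> 'f uop \<Rightarrow> ('e \<Rightarrow>\<^sub>L 'e) \<Rightarrow> bool" where
  "is_slice \<tau> E \<theta> F \<psi> T R \<longleftrightarrow> adjointable E R \<and>
     (\<exists>a\<in>pedersen_ideal. positive a \<and> \<psi> a = 1 \<and> norm a = 1 \<and>
        (\<forall>c. \<psi> (a * c) = \<psi> c \<and> \<psi> (c * a) = \<psi> c) \<and>
        (\<forall>x y. \<exists>z. (\<theta> y a, z) \<in> T \<and> inn E x (R y) = slice_map \<tau> \<psi> (inn F (\<theta> x a) z)))"

text \<open>Evenness with respect to \<open>\<Gamma> \<otimes> 1\<close>.\<close>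

definition even_uop ::
  "('e::cbanach \<Rightarrow> 'c::cstar_algebra \<Rightarrow> 'f::cbanach) \<Rightarrow> ('e \<Rightarrow>\<^sub>L 'e) option \<Rightarrow> 'f uop \<Rightarrow> bool" where
  "even_uop \<theta> \<gamma> T \<longleftrightarrow> (\<forall>\<Gamma>. \<gamma> = Some \<Gamma> \<longrightarrow>
     (\<exists>\<Gamma>1 :: 'f \<Rightarrow>\<^sub>L 'f. (\<forall>x c. \<Gamma>1 (\<theta> x c) = \<theta> (\<Gamma> x) c) \<and> (\<forall>(u, v)\<in>T. (\<Gamma>1 u, \<Gamma>1 v) \<in> T)))"

text \<open>The cycle \<open>(A, E\<^sub>B, D; C, (\<mu>L, \<mu>R))\<close>, where \<open>A\<close> acts by \<open>\<rho>\<close> and \<open>\<tau>\<close>, \<open>\<theta>\<close>, \<open>F\<close> realise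
  \<open>B \<otimes> C\<close> and \<open>E \<otimes> C\<close>.\<close>

definition conformally_generated_cycle ::
  "('b::cstar_algebra \<Rightarrow> 'c::cstar_algebra \<Rightarrow> 't::cstar_algebra) \<Rightarrow>
     ('e::cbanach \<Rightarrow> 'c \<Rightarrow> 'f::cbanach) \<Rightarrow> ('f, 't) hmodule \<Rightarrow>
     ('e, 'b) hmodule \<Rightarrow> ('e \<Rightarrow>\<^sub>L 'e) option \<Rightarrow> ('a::cstar_algebra \<Rightarrow> 'e \<Rightarrow>\<^sub>L 'e) \<Rightarrow> 'e uop \<Rightarrow>
     'f uop \<Rightarrow> 'f uop \<Rightarrow> bool" where
  "conformally_generated_cycle \<tau> \<theta> F E \<gamma> \<rho> D \<mu>L \<mu>R \<longleftrightarrow>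
     correspondence E \<gamma> \<rho> \<and> min_tensor \<tau> \<and> ext_tensor \<tau> E \<theta> F \<and>
     regular_op E D \<and> odd_op \<gamma> D \<and>
     (\<forall>\<mu>\<in>{\<mu>L, \<mu>R}. matched \<theta> F \<mu> \<and> matched \<theta> F (\<mu>\<inverse>) \<and> even_uop \<theta> \<gamma> \<mu>) \<and>
     self_adjoint_op E D \<and>
     (\<forall>a. resolvent_sq D o\<^sub>L \<rho> a \<in> compact_ops E) \<and>
     range \<rho> \<subseteq> cstar_generated E
       {R. \<exists>l\<in>side_set \<theta> F D \<mu>L. \<exists>t\<in>middle_set \<theta> F D \<mu>L \<mu>R. \<exists>r\<in>side_set \<theta> F D \<mu>R. \<exists>\<psi>.
          compactly_supported_state \<psi> \<and> is_slice \<tau> E \<theta> F \<psi> (mprod l (mprod t r)) R}"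

text \<open>For \<open>C = C\<^sub>0(X)\<close> the tensor products \<open>B \<otimes> C\<close> and \<open>E \<otimes> C\<close> are \<open>C\<^sub>0(X, B)\<close> and
  \<open>C\<^sub>0(X, E)\<close>, with \<open>x \<otimes> f\<close> the function \<open>g \<mapsto> f(g) x\<close>.\<close>

lift_definition c0_tensor ::
  "'v::cbanach \<Rightarrow> ('g::topological_space, complex) c0 \<Rightarrow> ('g, 'v) c0" is "\<lambda>x f g. f g *\<^sub>C x"
proof -
  fix x :: 'v and f :: "'g \<Rightarrow> complex"
  assume "f \<in> c0_set"
  moreover have "bounded_linear (\<lambda>c. c *\<^sub>C x)"
    by (rule bounded_linear_intro[where K = "norm x"])
      (simp_all add: scaleC_add_left norm_scaleC scaleR_scaleC scaleC_scaleC scaleC_complex_def)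
  ultimately show "(\<lambda>g. f g *\<^sub>C x) \<in> c0_set" by (rule c0_set_bounded_linear[rotated])
qed

definition c0_module ::
  "('e::cbanach, 'b::cstar_algebra) hmodule \<Rightarrow>
     (('g::topological_space, 'e) c0, ('g, 'b) c0) hmodule" where
  "c0_module E = \<lparr>rmul = (\<lambda>f b. Abs_c0 (\<lambda>g. rmul E (apply_c0 f g) (apply_c0 b g))),
                  inn = (\<lambda>f h. Abs_c0 (\<lambda>g. inn E (apply_c0 f g) (apply_c0 h g)))\<rparr>"

text \<open>The (unbounded) multiplication operator on \<open>C\<^sub>0(X, E)\<close> by a family of operators on \<open>E\<close>.\<close>

definition c0_multiplication ::
  "('g::topological_space \<Rightarrow> 'e::cbanach \<Rightarrow>\<^sub>L 'e) \<Rightarrow> ('g, 'e) c0 uop" where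
  "c0_multiplication Z = {(f, h). \<forall>g. apply_c0 h g = blinfun_apply (Z g) (apply_c0 f g)}"


section \<open>Crossed products\<close>

definition left_haar_measure :: "'g::topological_group_add measure \<Rightarrow> bool" where
  "left_haar_measure M \<longleftrightarrow> sets M = sets borel \<and> emeasure M UNIV \<noteq> 0 \<and>
     (\<forall>g. \<forall>S\<in>sets borel. emeasure M ((\<lambda>s. g + s) ` S) = emeasure M S) \<and>
     (\<forall>K. compact K \<longrightarrow> emeasure M K < \<infinity>) \<and>
     (\<forall>S\<in>sets borel. emeasure M S = (INF V\<in>{V. open V \<and> S \<subseteq> V}. emeasure M V)) \<and>
     (\<forall>V. open V \<longrightarrow> emeasure M V = (SUP K\<in>{K. compact K \<and> K \<subseteq> V}. emeasure M K))"

definition modular_function :: "'g::topological_group_add measure \<Rightarrow> ('g \<Rightarrow> real) \<Rightarrow> bool" where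
  "modular_function M \<Delta> \<longleftrightarrow> (\<forall>g. \<Delta> g > 0 \<and>
     (\<forall>S\<in>sets borel. emeasure M ((\<lambda>s. s + g) ` S) = ennreal (\<Delta> g) * emeasure M S))"

definition Cc :: "('g::topological_space \<Rightarrow> 'v::real_normed_vector) set" where
  "Cc = {f. continuous_on UNIV f \<and> (\<exists>K. compact K \<and> (\<forall>x. x \<notin> K \<longrightarrow> f x = 0))}"

text \<open>The Bochner integral of a continuous function. \<open>has_bochner_integral\<close> is restricted to
  second countable Banach spaces; this is its definition without the measurability clause.\<close>

definition has_integral_of ::
  "'g measure \<Rightarrow> ('g \<Rightarrow> 'v::real_normed_vector) \<Rightarrow> 'v \<Rightarrow> bool" where
  "has_integral_of M f v \<longleftrightarrow> (\<exists>s. (\<forall>i::nat. Bochner_Integration.simple_bochner_integrable M (s i)) \<and>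
     (\<lambda>i. \<integral>\<^sup>+ x. ennreal (norm (f x - s i x)) \<partial>M) \<longlonglongrightarrow> 0 \<and>
     (\<lambda>i. Bochner_Integration.simple_bochner_integral M (s i)) \<longlonglongrightarrow> v)"

definition convolution ::
  "'g::topological_group_add measure \<Rightarrow> ('g \<Rightarrow> 'a::cstar_algebra \<Rightarrow> 'a) \<Rightarrow>
     ('g \<Rightarrow> 'a) \<Rightarrow> ('g \<Rightarrow> 'a) \<Rightarrow> 'g \<Rightarrow> 'a" where
  "convolution M \<alpha> f h s = (THE v. has_integral_of M (\<lambda>r. f r * \<alpha> r (h (- r + s))) v)"

definition involution ::
  "('g::topological_group_add \<Rightarrow> real) \<Rightarrow> ('g \<Rightarrow> 'a::cstar_algebra \<Rightarrow> 'a) \<Rightarrow>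
     ('g \<Rightarrow> 'a) \<Rightarrow> 'g \<Rightarrow> 'a" where
  "involution \<Delta> \<alpha> f s = \<Delta> (- s) *\<^sub>R \<alpha> s (star (f (- s)))"

text \<open>C*-seminorms on the convolution *-algebra \<open>C\<^sub>c(G, A)\<close> that are bounded by the \<open>L\<^sup>1\<close>-norm.\<close>

definition cstar_seminorm ::
  "'g::topological_group_add measure \<Rightarrow> ('g \<Rightarrow> real) \<Rightarrow> ('g \<Rightarrow> 'a::cstar_algebra \<Rightarrow> 'a) \<Rightarrow>
     (('g \<Rightarrow> 'a) \<Rightarrow> real) \<Rightarrow> bool" where
  "cstar_seminorm M \<Delta> \<alpha> p \<longleftrightarrow>
     (\<forall>f\<in>Cc. 0 \<le> p f \<and> p f \<le> (\<integral>g. norm (f g) \<partial>M) \<and>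
        (\<forall>c. p (\<lambda>g. c *\<^sub>C f g) = cmod c * p f) \<and>
        p (convolution M \<alpha> (involution \<Delta> \<alpha> f) f) = (p f)\<^sup>2 \<and>
        (\<forall>h\<in>Cc. p (\<lambda>g. f g + h g) \<le> p f + p h \<and> p (convolution M \<alpha> f h) \<le> p f * p h))"

text \<open>\<open>\<iota>\<close>, restricted to \<open>C\<^sub>c(G, A)\<close>, exhibits \<open>'p\<close> as the universal crossed product, the
  enveloping C*-algebra of \<open>L\<^sup>1(G, A)\<close>; this determines \<open>'p\<close> up to unique isomorphism.\<close>

definition universal_crossed_product ::
  "'g::topological_group_add measure \<Rightarrow> ('g \<Rightarrow> real) \<Rightarrow> ('g \<Rightarrow> 'a::cstar_algebra \<Rightarrow> 'a) \<Rightarrow>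
     (('g \<Rightarrow> 'a) \<Rightarrow> 'p::cstar_algebra) \<Rightarrow> bool" where
  "universal_crossed_product M \<Delta> \<alpha> \<iota> \<longleftrightarrow>
     (\<forall>f\<in>Cc. \<forall>h\<in>Cc. \<iota> (\<lambda>g. f g + h g) = \<iota> f + \<iota> h \<and> \<iota> (convolution M \<alpha> f h) = \<iota> f * \<iota> h) \<and>
     (\<forall>f\<in>Cc. (\<forall>c. \<iota> (\<lambda>g. c *\<^sub>C f g) = c *\<^sub>C \<iota> f) \<and> \<iota> (involution \<Delta> \<alpha> f) = star (\<iota> f)) \<and>
     closure (\<iota> ` Cc) = UNIV \<and>
     (\<forall>f\<in>Cc. norm (\<iota> f) \<le> (\<integral>g. norm (f g) \<partial>M)) \<and>
     (\<forall>p. cstar_seminorm M \<Delta> \<alpha> p \<longrightarrow> (\<forall>f\<in>Cc. p f \<le> norm (\<iota> f)))"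

text \<open>\<open>\<rho>\<close> is the integrated form of the covariant pair \<open>(\<pi>, U)\<close>.\<close>

definition integrated_rep ::
  "'g::topological_group_add measure \<Rightarrow> (('g \<Rightarrow> 'a::cstar_algebra) \<Rightarrow> 'p::cstar_algebra) \<Rightarrow>
     ('e::cbanach, 'b::cstar_algebra) hmodule \<Rightarrow> ('a \<Rightarrow> 'e \<Rightarrow>\<^sub>L 'e) \<Rightarrow> ('g \<Rightarrow> 'e \<Rightarrow> 'e) \<Rightarrow>
     ('p \<Rightarrow> 'e \<Rightarrow>\<^sub>L 'e) \<Rightarrow> bool" where
  "integrated_rep M \<iota> E \<pi> U \<rho> \<longleftrightarrow> star_rep E \<rho> \<and>
     (\<forall>f\<in>Cc. \<forall>x. has_integral_of M (\<lambda>g. blinfun_apply (\<pi> (f g)) (U g x))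
        (blinfun_apply (\<rho> (\<iota> f)) x))"

end

theory Submission
  imports Defs
begin

text \<open>
  The Hilbert module \<open>E \<otimes> C\<^sub>0(G)\<close> is \<open>C\<^sub>0(G, E)\<close>. On it \<open>D \<otimes> 1\<close> acts pointwise, and every
  *-strongly continuous family \<open>Z\<^sub>g\<close> gives a matched multiplication operator. The commutator conditions
  in the definition of a cycle then become pointwise: \<open>Y\<^sub>g\<close> has to carry \<open>dom S\<^sub>g\<close> into \<open>dom T\<^sub>g\<close> with
  \<open>T\<^sub>g Y\<^sub>g - Y\<^sub>g S\<^sub>g\<close> extending to a *-strongly continuous family (\<open>intertwines\<close>, \<open>comm_matchedI\<close>). This
  relation is stable under composition, and under adjoints when all \<open>S\<^sub>g\<close>, \<open>T\<^sub>g\<close> are self-adjoint.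

  Since \<open>D U\<^sub>g\<^sup>* = U\<^sub>g\<^sup>* (U\<^sub>g D U\<^sub>g\<^sup>*)\<close>, an element \<open>q\<close> of the conformal set \<open>\<Q>\<close> gives the family
  \<open>g \<mapsto> U\<^sub>g\<^sup>* q\<close>, which intertwines \<open>\<mu>\<^sub>g D \<mu>\<^sub>g\<^sup>*\<close> with \<open>D\<close> and so lies in the middle set \<open>\<T>\<close>. The constant
  families \<open>l\<close> in \<open>Lip0\<close> lie in \<open>\<L>\<close>, and the constant families \<open>(q\<^sup>* q)\<^sup>n\<close>, \<open>n \<ge> 1\<close>, lie in \<open>\<R>\<close>: a power of
  \<open>q\<^sup>* q\<close> has a factor \<open>q\<^sup>*\<close> on the left and \<open>q\<close> on the right, as the conditions on \<open>\<mu>\<^sub>g\<^sup>* r\<close>,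
  \<open>\<mu>\<^sub>g\<^sup>-\<^sup>1 r\<close>, \<open>r \<mu>\<^sub>g\<close> and \<open>r \<mu>\<^sub>g\<^sup>-\<^sup>1\<^sup>*\<close> require. Integration against a probability density \<open>\<phi>\<close> in \<open>C\<^sub>c(G)\<close> is a
  compactly supported state, so the generated C*-algebra \<open>S\<close> contains
  \<open>\<integral> \<phi>(g) l U\<^sub>g\<^sup>* q (q\<^sup>* q)\<^sup>n dg\<close>. More elements of \<open>S\<close> are then found in steps. By density \<open>l\<close> may be
  replaced by \<open>\<pi>(a)\<close>. The factor \<open>(q\<^sup>* q)\<^sup>n\<close> may be dropped, because \<open>q (1 - s q\<^sup>* q)\<^sup>N\<close> tends to \<open>0\<close> for
  small \<open>s > 0\<close>, so that \<open>q\<close> is a limit of combinations of the \<open>q (q\<^sup>* q)\<^sup>n\<close> (\<open>in_closure_square_powers\<close>).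
  Approximating functions in \<open>C\<^sub>c(G, A)\<close> by finite sums \<open>\<Sum> \<phi>\<^sub>i a\<^sub>i\<close> lets \<open>a\<close> depend on \<open>g\<close>; with
  \<open>\<pi>(\<alpha>\<^sub>g\<^sup>-\<^sup>1(b)) U\<^sub>g\<^sup>* = U\<^sub>g\<^sup>* \<pi>(b)\<close> this gives \<open>\<integral> \<phi>(g) U\<^sub>g\<^sup>* \<pi>(b) q dg\<close>, and \<open>A \<subseteq> [A \<Q>]\<close> removes \<open>q\<close>. Adjoints and a
  second approximation produce \<open>\<integral> \<pi>(f(g)) U\<^sub>g dg\<close> for all \<open>f\<close> in \<open>C\<^sub>c(G, A)\<close> (\<open>range_\<rho>\<close>).

  The integrated representation exists because \<open>f \<mapsto> \<parallel>\<integral> \<pi>(f(g)) U\<^sub>g dg\<parallel>\<close> is a C*-seminorm dominated by the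
  \<open>L\<^sup>1\<close>-norm. It has locally compact resolvent: the integrand \<open>(1 + D\<^sup>2)\<^sup>-\<^sup>1 \<pi>(f(g)) U\<^sub>g\<close> takes compact
  values and is norm continuous, since \<open>g \<mapsto> K U\<^sub>g\<close> is norm continuous for compact \<open>K\<close>.

  Underneath lies C*-algebra theory: that every \<open>y\<^sup>* y\<close> is the square of a
  self-adjoint element, norming states, the Cauchy--Schwarz inequality for Hilbert modules,
  contractivity of *-representations, and continuity of the positive square root, which makes
  \<open>C\<^sub>0(G, E)\<close> a Hilbert module and identifies \<open>C\<^sub>0(G, B)\<close> as the minimal tensor product.
\<close>

section \<open>Hilbert modules: elementary algebra\<close>

lemma scaleC_one [simp]: "1 *\<^sub>C x = (x::'a::cbanach)"
  using scaleR_scaleC[of 1 x] by simp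

lemma scaleC_zero_right [simp]: "c *\<^sub>C 0 = (0::'a::cbanach)"
  using linear_0[OF bounded_linear.linear[OF bounded_linear_scaleC]] .

lemma scaleC_zero_left [simp]: "0 *\<^sub>C x = (0::'a::cbanach)"
  using scaleR_scaleC[of 0 x] by simp

lemma scaleC_minus_right: "c *\<^sub>C (- x) = - (c *\<^sub>C (x::'a::cbanach))"
  using linear_neg[OF bounded_linear.linear[OF bounded_linear_scaleC]] .

lemma scaleC_diff_right: "c *\<^sub>C (x - y) = c *\<^sub>C x - c *\<^sub>C (y::'a::cbanach)"
  using linear_diff[OF bounded_linear.linear[OF bounded_linear_scaleC]] .

lemma scaleC_minus_left: "(- c) *\<^sub>C x = - (c *\<^sub>C (x::'a::cbanach))"
  using scaleC_add_left[of c "-c" x] by (simp add: add_eq_0_iff)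

lemma star_zero [simp]: "star (0::'a::cstar_algebra) = 0"
  using linear_0[OF bounded_linear.linear[OF bounded_linear_star]] .

lemma star_diff: "star (x - y) = star x - star (y::'a::cstar_algebra)"
  using linear_diff[OF bounded_linear.linear[OF bounded_linear_star]] .

lemma star_scaleR: "star (r *\<^sub>R x) = r *\<^sub>R star (x::'a::cstar_algebra)"
  using linear_scale[OF bounded_linear.linear[OF bounded_linear_star]] .

lemma clinearD:
  assumes "clinear f"
  shows clinear_add: "f (x + y) = f x + f y"
    and clinear_scaleC: "f (c *\<^sub>C x) = c *\<^sub>C f x"
    and clinear_scaleR: "f (r *\<^sub>R x) = r *\<^sub>R f x"
    and clinear_zero: "f 0 = 0"
    and clinear_minus: "f (- x) = - f x"
    and clinear_diff: "f (x - y) = f x - f y"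
proof -
  show a: "f (x + y) = f x + f y" and s: "f (c *\<^sub>C x) = c *\<^sub>C f x" for x y c
    using assms by (auto simp: clinear_def)
  show "f (r *\<^sub>R x) = r *\<^sub>R f x" for r x
    by (simp add: scaleR_scaleC s)
  show "f 0 = 0" using s[of 0 0] by simp
  show m: "f (- x) = - f x" for x
    using s[of "-1" x] by (simp add: scaleC_minus_left)
  show "f (x - y) = f x - f y"
    using a[of x "-y"] by (simp add: m)
qed

lemma clinear_linear: "clinear f \<Longrightarrow> linear f"
  by (rule linearI) (simp_all add: clinear_add clinear_scaleR)

lemma clinear_sum: "clinear f \<Longrightarrow> f (sum g A) = (\<Sum>a\<in>A. f (g a))"
  by (rule linear_sum[OF clinear_linear])

lemma norm_sq_star: "norm (star x * x) = norm x * norm (x::'a::cstar_algebra)"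
  by (simp add: cstar_identity power2_eq_square)

lemma star_mult_self_eq_0: "star x * x = 0 \<longleftrightarrow> (x::'a::cstar_algebra) = 0"
  by (metis cstar_identity mult_zero_right norm_eq_zero power_eq_0_iff)

locale hmod =
  fixes E :: "('e::cbanach, 'b::cstar_algebra) hmodule"
  assumes hilbert: "hilbert_module E"
begin

lemma rmul_clinear: "clinear (rmul E x)" "clinear (\<lambda>x. rmul E x b)"
  using hilbert by (auto simp: hilbert_module_def)

lemma inn_clinear: "clinear (inn E x)"
  using hilbert by (auto simp: hilbert_module_def)

lemma star_inn: "star (inn E x y) = inn E y x"
  using hilbert by (auto simp: hilbert_module_def)

lemma rmul_rmul: "rmul E (rmul E x a) b = rmul E x (a * b)"
  using hilbert by (auto simp: hilbert_module_def)

lemma inn_rmul_right: "inn E x (rmul E y b) = inn E x y * b"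
  using hilbert by (auto simp: hilbert_module_def)

lemma inn_rmul_left: "inn E (rmul E x b) y = star b * inn E x y"
  using inn_rmul_right[of y x b] by (metis star_inn star_mult)

lemma positive_inn: "positive (inn E x x)"
  using hilbert by (auto simp: hilbert_module_def)

lemma norm_inn_self: "norm (inn E x x) = norm x * norm x"
proof -
  have "norm x = sqrt (norm (inn E x x))"
    using hilbert unfolding hilbert_module_def by blast
  then show ?thesis by (metis abs_norm_cancel real_sqrt_mult_self)
qed

lemma inn_add_right: "inn E x (y + z) = inn E x y + inn E x z"
  by (rule clinear_add[OF inn_clinear])

lemma inn_scaleC_right: "inn E x (c *\<^sub>C z) = c *\<^sub>C inn E x z"
  by (rule clinear_scaleC[OF inn_clinear])

lemma inn_add_left: "inn E (x + y) z = inn E x z + inn E y z"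
  by (metis inn_add_right star_add star_inn)

lemma inn_scaleC_left: "inn E (c *\<^sub>C x) z = cnj c *\<^sub>C inn E x z"
  by (metis inn_scaleC_right star_inn star_scaleC)

lemma inn_scaleR_left: "inn E (r *\<^sub>R x) z = r *\<^sub>R inn E x z"
  by (simp add: inn_scaleC_left scaleR_scaleC)

lemma inn_scaleR_right: "inn E x (r *\<^sub>R z) = r *\<^sub>R inn E x z"
  by (simp add: inn_scaleC_right scaleR_scaleC)

lemma inn_zero [simp]: "inn E x 0 = 0" "inn E 0 x = 0"
  using inn_scaleR_right[of x 0 0] inn_scaleR_left[of 0 0 x] by simp_all

lemma inn_minus_right: "inn E x (- y) = - inn E x y"
  using inn_scaleR_right[of x "-1" y] by simp

lemma inn_minus_left: "inn E (- x) y = - inn E x y"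
  using inn_scaleR_left[of "-1" x y] by simp

lemma inn_diff_right: "inn E x (y - z) = inn E x y - inn E x z"
  using inn_add_right[of x y "-z"] by (simp add: inn_minus_right)

lemma inn_diff_left: "inn E (x - y) z = inn E x z - inn E y z"
  using inn_add_left[of x "-y" z] by (simp add: inn_minus_left)

lemma inn_self_eq_0: "inn E x x = 0 \<Longrightarrow> x = 0"
  using norm_inn_self[of x] by simp

lemma inn_ext: "(\<And>x. inn E x y = inn E x z) \<Longrightarrow> y = z"
  using inn_self_eq_0[of "y - z"] inn_diff_right[of "y - z" y z] by simp

lemma norm_rmul: "norm (rmul E x b) \<le> norm x * norm b"
proof (rule power2_le_imp_le)
  have "(norm (rmul E x b))\<^sup>2 = norm (star b * inn E x x * b)"
    by (simp add: norm_inn_self[symmetric] power2_eq_square inn_rmul_left inn_rmul_right mult.assoc)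
  also have "\<dots> \<le> norm (star b) * norm (inn E x x) * norm b"
    by (meson mult_right_mono norm_ge_zero norm_mult_ineq order_trans)
  also have "\<dots> = (norm x * norm b)\<^sup>2"
    by (simp add: norm_star norm_inn_self power2_eq_square algebra_simps)
  finally show "(norm (rmul E x b))\<^sup>2 \<le> (norm x * norm b)\<^sup>2" .
qed simp

lemma adj_eqI:
  assumes "\<And>x y. inn E (blinfun_apply T x) y = inn E x (blinfun_apply S y)"
  shows "adj E T = S"
  unfolding adj_def
proof (rule the_equality)
  fix S' assume S': "\<forall>x y. inn E (blinfun_apply T x) y = inn E x (blinfun_apply S' y)"
  show "S' = S"
    by (rule blinfun_eqI, rule inn_ext) (simp add: assms S'[rule_format, symmetric])
qed (simp add: assms)

lemma adjointableI:
  "(\<And>x y. inn E (blinfun_apply T x) y = inn E x (blinfun_apply S y)) \<Longrightarrow> adjointable E T"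
  by (auto simp: adjointable_def)

lemma adj_right:
  assumes "adjointable E T"
  shows "inn E (blinfun_apply T x) y = inn E x (blinfun_apply (adj E T) y)"
  using assms adj_eqI[of T] unfolding adjointable_def by metis

lemma adj_left:
  assumes "adjointable E T"
  shows "inn E x (blinfun_apply T y) = inn E (blinfun_apply (adj E T) x) y"
  using adj_right[OF assms, of y x] by (metis star_inn)

lemma adjointable_adj: "adjointable E T \<Longrightarrow> adjointable E (adj E T)"
  by (rule adjointableI[of _ T]) (simp add: adj_left)

lemma adj_adj: "adjointable E T \<Longrightarrow> adj E (adj E T) = T"
  by (rule adj_eqI) (simp add: adj_left)

lemma adjointable_compose: "adjointable E S \<Longrightarrow> adjointable E T \<Longrightarrow> adjointable E (S o\<^sub>L T)"
  by (rule adjointableI[of _ "adj E T o\<^sub>L adj E S"]) (simp add: adj_right)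

lemma adj_compose: "adjointable E S \<Longrightarrow> adjointable E T \<Longrightarrow> adj E (S o\<^sub>L T) = adj E T o\<^sub>L adj E S"
  by (rule adj_eqI) (simp add: adj_right)

lemma adjointable_id [simp]: "adjointable E id_blinfun"
  by (rule adjointableI[of _ id_blinfun]) simp

lemma adj_id [simp]: "adj E id_blinfun = id_blinfun"
  by (rule adj_eqI) simp

lemma adjointable_zero [simp]: "adjointable E 0"
  by (rule adjointableI[of _ 0]) simp

lemma adjointable_add: "adjointable E S \<Longrightarrow> adjointable E T \<Longrightarrow> adjointable E (S + T)"
  by (rule adjointableI[of _ "adj E S + adj E T"])
    (simp add: blinfun.add_left inn_add_left inn_add_right adj_right)

lemma adj_add: "adjointable E S \<Longrightarrow> adjointable E T \<Longrightarrow> adj E (S + T) = adj E S + adj E T"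
  by (rule adj_eqI) (simp add: blinfun.add_left inn_add_left inn_add_right adj_right)

lemma adjointable_scaleC: "adjointable E S \<Longrightarrow> adjointable E (c *\<^sub>C S)"
  by (rule adjointableI[of _ "cnj c *\<^sub>C adj E S"])
    (simp add: scaleC_blinfun.rep_eq inn_scaleC_left inn_scaleC_right adj_right)

lemma adj_scaleC: "adjointable E S \<Longrightarrow> adj E (c *\<^sub>C S) = cnj c *\<^sub>C adj E S"
  by (rule adj_eqI) (simp add: scaleC_blinfun.rep_eq inn_scaleC_left inn_scaleC_right adj_right)

lemma adjointable_scaleR: "adjointable E S \<Longrightarrow> adjointable E (r *\<^sub>R S)"
  by (simp add: scaleR_scaleC adjointable_scaleC)

lemma adj_scaleR: "adjointable E S \<Longrightarrow> adj E (r *\<^sub>R S) = r *\<^sub>R adj E S"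
  by (simp add: scaleR_scaleC adj_scaleC)

lemma adjointable_minus: "adjointable E S \<Longrightarrow> adjointable E (- S)"
  using adjointable_scaleR[of S "-1"] by simp

lemma adj_minus: "adjointable E S \<Longrightarrow> adj E (- S) = - adj E S"
  using adj_scaleR[of S "-1"] by simp

lemma adjointable_diff: "adjointable E S \<Longrightarrow> adjointable E T \<Longrightarrow> adjointable E (S - T)"
  using adjointable_add[of S "- T"] by (simp add: adjointable_minus)

lemma adj_diff: "adjointable E S \<Longrightarrow> adjointable E T \<Longrightarrow> adj E (S - T) = adj E S - adj E T"
  using adj_add[of S "- T"] by (simp add: adjointable_minus adj_minus)

lemma adjointable_clinear: "adjointable E T \<Longrightarrow> clinear (blinfun_apply T)"
  unfolding clinear_def
  by (auto simp: blinfun.add_right intro!: inn_ext simp: adj_left inn_scaleC_right)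

lemma adjointable_rmul:
  "adjointable E T \<Longrightarrow> blinfun_apply T (rmul E x b) = rmul E (blinfun_apply T x) b"
  by (rule inn_ext) (simp add: adj_left inn_rmul_right)

end

text \<open>Cauchy--Schwarz is a separate assumption for the moment: for the module \<open>B\<close> over itself it
  is just submultiplicativity of the norm, and that case gives the multiplier algebra, from which
  positivity in \<open>B\<close>, and with it the general case, is derived.\<close>

locale hmod_cs = hmod +
  assumes cauchy_schwarz: "norm (inn E x y) \<le> norm x * norm y"
begin

lemma norm_adj_le: "adjointable E T \<Longrightarrow> norm (adj E T) \<le> norm T"
proof (rule norm_blinfun_bound)
  fix y assume T: "adjointable E T"
  let ?z = "blinfun_apply (adj E T) y"
  have "norm ?z * norm ?z = norm (inn E (blinfun_apply T ?z) y)"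
    by (simp add: norm_inn_self[symmetric] adj_right[OF T])
  also have "\<dots> \<le> norm (blinfun_apply T ?z) * norm y" by (rule cauchy_schwarz)
  also have "\<dots> \<le> norm T * norm ?z * norm y"
    by (intro mult_right_mono norm_blinfun) simp
  finally show "norm ?z \<le> norm T * norm y"
    by (cases "?z = 0") (simp_all add: mult.commute mult.left_commute)
qed simp

lemma norm_adj: "adjointable E T \<Longrightarrow> norm (adj E T) = norm T"
  using norm_adj_le[of T] norm_adj_le[of "adj E T"] by (simp add: adj_adj adjointable_adj)

lemma norm_adj_compose: "adjointable E T \<Longrightarrow> norm (adj E T o\<^sub>L T) = (norm T)\<^sup>2"
proof (rule antisym)
  assume T: "adjointable E T"
  show "norm (adj E T o\<^sub>L T) \<le> (norm T)\<^sup>2"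
    using norm_blinfun_compose[of "adj E T" T] norm_adj[OF T] by (simp add: power2_eq_square)
  have "norm T \<le> sqrt (norm (adj E T o\<^sub>L T))"
  proof (rule norm_blinfun_bound)
    fix x
    have "(norm (blinfun_apply T x))\<^sup>2 = norm (inn E x (blinfun_apply (adj E T o\<^sub>L T) x))"
      by (simp add: power2_eq_square norm_inn_self[symmetric] adj_right[OF T])
    also have "\<dots> \<le> norm x * (norm (adj E T o\<^sub>L T) * norm x)"
      by (rule order_trans[OF cauchy_schwarz mult_left_mono[OF norm_blinfun]]) simp
    finally have "norm (blinfun_apply T x) \<le> sqrt (norm (adj E T o\<^sub>L T) * (norm x)\<^sup>2)"
      by (intro real_le_rsqrt) (simp add: power2_eq_square algebra_simps)
    then show "norm (blinfun_apply T x) \<le> sqrt (norm (adj E T o\<^sub>L T)) * norm x"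
      by (simp add: real_sqrt_mult)
  qed simp
  then show "(norm T)\<^sup>2 \<le> norm (adj E T o\<^sub>L T)"
    using power_mono[of "norm T" "sqrt (norm (adj E T o\<^sub>L T))" 2] by simp
qed

lemma bounded_linear_inn_right: "bounded_linear (inn E x)"
  by (rule bounded_linear_intro[where K = "norm x"])
    (simp_all add: inn_add_right inn_scaleR_right cauchy_schwarz mult.commute[of _ "norm x"])

lemma bounded_bilinear_inn: "bounded_bilinear (inn E)"
  by (standard; (simp add: inn_add_right inn_add_left inn_scaleR_right inn_scaleR_left)?)
    (rule exI[of _ 1], simp add: cauchy_schwarz)

lemma closed_adjointable: "closed {T. adjointable E T}"
  unfolding closed_sequential_limits
proof (intro allI impI, elim conjE)
  fix X T assume X: "\<forall>n. X n \<in> {T. adjointable E T}" and lim: "X \<longlonglongrightarrow> T"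
  have "Cauchy (\<lambda>n. adj E (X n))"
  proof (rule metric_CauchyI)
    fix e :: real assume "e > 0"
    then obtain M where "\<forall>m\<ge>M. \<forall>n\<ge>M. dist (X m) (X n) < e"
      using metric_CauchyD[OF LIMSEQ_imp_Cauchy[OF lim]] by blast
    moreover have "dist (adj E (X m)) (adj E (X n)) = dist (X m) (X n)" for m n
      using X norm_adj[of "X m - X n"] by (simp add: dist_norm adj_diff adjointable_diff)
    ultimately show "\<exists>M. \<forall>m\<ge>M. \<forall>n\<ge>M. dist (adj E (X m)) (adj E (X n)) < e" by auto
  qed
  then obtain S where S: "(\<lambda>n. adj E (X n)) \<longlonglongrightarrow> S"
    using Cauchy_convergent convergent_def by blast
  have "inn E (blinfun_apply T x) y = inn E x (blinfun_apply S y)" for x y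
  proof (rule LIMSEQ_unique)
    show "(\<lambda>n. inn E (blinfun_apply (X n) x) y) \<longlonglongrightarrow> inn E (blinfun_apply T x) y"
      by (intro bounded_bilinear.tendsto[OF bounded_bilinear_inn] tendsto_const
          blinfun.tendsto lim)
    have "(\<lambda>n. inn E x (blinfun_apply (adj E (X n)) y)) \<longlonglongrightarrow> inn E x (blinfun_apply S y)"
      by (intro bounded_bilinear.tendsto[OF bounded_bilinear_inn] tendsto_const
          blinfun.tendsto S)
    then show "(\<lambda>n. inn E (blinfun_apply (X n) x) y) \<longlonglongrightarrow> inn E x (blinfun_apply S y)"
      using X by (simp add: adj_right)
  qed
  then show "T \<in> {T. adjointable E T}" by (auto intro: adjointableI)
qed

end

section \<open>The multiplier algebra\<close>

text \<open>Positivity is studied in unital algebras. The algebra \<open>B\<close> is embedded isometrically in the unital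
  C*-algebra of adjointable operators on \<open>B\<close>, viewed as a Hilbert module over itself.\<close>

definition self_module :: "('b::cstar_algebra, 'b) hmodule" where
  "self_module = \<lparr>rmul = (*), inn = (\<lambda>x y. star x * y)\<rparr>"

interpretation self: hmod_cs "self_module :: ('b::cstar_algebra, 'b) hmodule"
proof
  show "hilbert_module (self_module :: ('b, 'b) hmodule)"
    unfolding hilbert_module_def self_module_def clinear_def positive_def
    by (auto simp: algebra_simps mult_scaleC_left mult_scaleC_right star_mult star_star
        norm_sq_star)
  show "norm (inn self_module x y) \<le> norm x * norm (y :: 'b)" for x y
    using norm_mult_ineq[of "star x" y] by (simp add: self_module_def norm_star)
qed

lemma inn_self_module [simp]: "inn self_module x y = star x * y"
  by (simp add: self_module_def)

typedef (overloaded) 'b multiplier = "{T :: 'b::cstar_algebra \<Rightarrow>\<^sub>L 'b. adjointable self_module T}"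
  morphisms multiplier_op Abs_multiplier
  by (rule exI[of _ 0]) simp

setup_lifting type_definition_multiplier

class cstar_unital = cstar_algebra + monoid_mult

instantiation multiplier :: (cstar_algebra) real_vector
begin
lift_definition zero_multiplier :: "'a multiplier" is 0 by simp
lift_definition plus_multiplier :: "'a multiplier \<Rightarrow> 'a multiplier \<Rightarrow> 'a multiplier" is "(+)" by (rule self.adjointable_add)
lift_definition minus_multiplier :: "'a multiplier \<Rightarrow> 'a multiplier \<Rightarrow> 'a multiplier" is "(-)" by (rule self.adjointable_diff)
lift_definition uminus_multiplier :: "'a multiplier \<Rightarrow> 'a multiplier" is uminus by (rule self.adjointable_minus)
lift_definition scaleR_multiplier :: "real \<Rightarrow> 'a multiplier \<Rightarrow> 'a multiplier" is scaleR by (rule self.adjointable_scaleR)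
instance
  by standard (transfer; simp add: algebra_simps)+
end

instantiation multiplier :: (cstar_algebra) real_normed_vector
begin
lift_definition norm_multiplier :: "'a multiplier \<Rightarrow> real" is norm .
lift_definition dist_multiplier :: "'a multiplier \<Rightarrow> 'a multiplier \<Rightarrow> real" is dist .
definition sgn_multiplier :: "'a multiplier \<Rightarrow> 'a multiplier" where "sgn_multiplier f = f /\<^sub>R norm f"
definition uniformity_multiplier :: "('a multiplier \<times> 'a multiplier) filter"
  where "uniformity_multiplier = (INF e\<in>{0 <..}. principal {(x, y). dist x y < e})"
definition open_multiplier :: "'a multiplier set \<Rightarrow> bool"
  where "open_multiplier S = (\<forall>x\<in>S. \<forall>\<^sub>F (x', y) in uniformity. x' = x \<longrightarrow> y \<in> S)"
instance
  apply standard
  unfolding sgn_multiplier_def uniformity_multiplier_def open_multiplier_def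
  apply (simp_all only: refl)
     apply (transfer; simp add: dist_norm norm_triangle_ineq)+
  done
end

instantiation multiplier :: (cstar_algebra) cstar_unital
begin
lift_definition one_multiplier :: "'a multiplier" is id_blinfun by simp
lift_definition times_multiplier :: "'a multiplier \<Rightarrow> 'a multiplier \<Rightarrow> 'a multiplier" is "(o\<^sub>L)" by (rule self.adjointable_compose)
lift_definition star_multiplier :: "'a multiplier \<Rightarrow> 'a multiplier" is "adj self_module" by (rule self.adjointable_adj)
lift_definition scaleC_multiplier :: "complex \<Rightarrow> 'a multiplier \<Rightarrow> 'a multiplier" is "scaleC" by (rule self.adjointable_scaleC)
instance
proof
  fix a b d :: "'a multiplier" and c :: complex and e :: complex and r :: real
  show "a * b * d = a * (b * d)" by transfer (simp add: blinfun_eqI)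
  show "(a + b) * d = a * d + b * d" by transfer (simp add: blinfun_eqI blinfun.add_left)
  show "a * (b + d) = a * b + a * d"
    by transfer (simp add: blinfun_eqI blinfun.add_left blinfun.add_right)
  show "r *\<^sub>R a * b = r *\<^sub>R (a * b)" by transfer (simp add: blinfun_eqI blinfun.scaleR_left)
  show "a * r *\<^sub>R b = r *\<^sub>R (a * b)"
    by transfer (simp add: blinfun_eqI blinfun.scaleR_left blinfun.scaleR_right)
  show "norm (a * b) \<le> norm a * norm b" by transfer (rule norm_blinfun_compose)
  show "(c *\<^sub>C a) * b = c *\<^sub>C (a * b)" by transfer (simp add: blinfun_eqI scaleC_blinfun.rep_eq)
  show "a * (c *\<^sub>C b) = c *\<^sub>C (a * b)"
    by transfer (simp add: blinfun_eqI scaleC_blinfun.rep_eq clinear_scaleC[OF self.adjointable_clinear])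
  show "star (star a) = a" by transfer (simp add: self.adj_adj)
  show "star (a + b) = star a + star b" by transfer (simp add: self.adj_add)
  show "star (c *\<^sub>C a) = cnj c *\<^sub>C star a" by transfer (simp add: self.adj_scaleC)
  show "star (a * b) = star b * star a" by transfer (simp add: self.adj_compose)
  show "norm (star a * a) = (norm a)\<^sup>2" by transfer (simp add: self.norm_adj_compose)
  show "1 * a = a" by transfer (simp add: blinfun_eqI)
  show "a * 1 = a" by transfer (simp add: blinfun_eqI)
  show "c *\<^sub>C (a + b) = c *\<^sub>C a + c *\<^sub>C b" by transfer (rule scaleC_add_right)
  show "(c + e) *\<^sub>C a = c *\<^sub>C a + e *\<^sub>C a" by transfer (rule scaleC_add_left)
  show "c *\<^sub>C e *\<^sub>C a = (c * e) *\<^sub>C a" by transfer (rule scaleC_scaleC)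
  show "r *\<^sub>R a = complex_of_real r *\<^sub>C a" by transfer (rule scaleR_scaleC)
  show "norm (c *\<^sub>C a) = cmod c * norm a" by transfer (rule norm_scaleC)
  fix X :: "nat \<Rightarrow> 'a multiplier"
  assume X: "Cauchy X"
  have "Cauchy (\<lambda>n. multiplier_op (X n))"
    using X unfolding Cauchy_def dist_multiplier.rep_eq .
  then obtain T where T: "(\<lambda>n. multiplier_op (X n)) \<longlonglongrightarrow> T"
    using Cauchy_convergent convergent_def by blast
  have "adjointable self_module T"
    using closed_sequentially[OF self.closed_adjointable _ T] multiplier_op by auto
  then have "X \<longlonglongrightarrow> Abs_multiplier T"
    using T unfolding tendsto_iff dist_multiplier.rep_eq by (simp add: Abs_multiplier_inverse)
  then show "convergent X" by (rule convergentI)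
qed
end

lift_definition emb :: "'b::cstar_algebra \<Rightarrow> 'b multiplier" is "\<lambda>b. Blinfun ((*) b)"
  by (rule self.adjointableI[of _ "Blinfun ((*) (star b))" for b])
    (simp add: bounded_linear_Blinfun_apply bounded_linear_mult_right star_mult mult.assoc)

lemma multiplier_op_emb: "blinfun_apply (multiplier_op (emb b)) x = b * x"
  by (simp add: emb.rep_eq bounded_linear_Blinfun_apply bounded_linear_mult_right)

lemma multiplier_eqI: "(\<And>x. blinfun_apply (multiplier_op S) x = blinfun_apply (multiplier_op T) x) \<Longrightarrow> S = T"
  by transfer (rule blinfun_eqI)

lemma emb_add: "emb (a + b) = emb a + emb b"
  by (rule multiplier_eqI) (simp add: multiplier_op_emb plus_multiplier.rep_eq blinfun.add_left algebra_simps)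

lemma emb_mult: "emb (a * b) = emb a * emb b"
  by (rule multiplier_eqI) (simp add: multiplier_op_emb times_multiplier.rep_eq mult.assoc)

lemma emb_scaleC: "emb (c *\<^sub>C a) = c *\<^sub>C emb a"
  by (rule multiplier_eqI) (simp add: multiplier_op_emb scaleC_multiplier.rep_eq scaleC_blinfun.rep_eq mult_scaleC_left)

lemma clinear_emb: "clinear emb"
  by (simp add: clinear_def emb_add emb_scaleC)

lemma emb_star: "emb (star b) = star (emb b)"
proof (rule multiplier_eqI)
  fix x
  have "adj self_module (multiplier_op (emb b)) = multiplier_op (emb (star b))"
    by (rule self.adj_eqI) (simp add: multiplier_op_emb star_mult mult.assoc)
  then show "blinfun_apply (multiplier_op (emb (star b))) x = blinfun_apply (multiplier_op (star (emb b))) x"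
    by (simp add: star_multiplier.rep_eq)
qed

lemma norm_emb: "norm (emb b) = norm b"
proof (rule antisym)
  show "norm (emb b) \<le> norm b"
    unfolding norm_multiplier.rep_eq
    by (rule norm_blinfun_bound) (simp_all add: multiplier_op_emb norm_mult_ineq)
  have "norm b * norm b = norm (blinfun_apply (multiplier_op (emb b)) (star b))"
    using norm_sq_star[of "star b"] by (simp add: multiplier_op_emb star_star norm_star)
  also have "\<dots> \<le> norm (emb b) * norm b"
    using norm_blinfun[of "multiplier_op (emb b)" "star b"] by (simp add: norm_multiplier.rep_eq norm_star)
  finally show "norm b \<le> norm (emb b)" by (cases "b = 0") simp_all
qed

section \<open>Square roots by iteration\<close>

text \<open>The solution \<open>c = 1 - sqrt (1 - h)\<close> of \<open>2 c - c\<^sup>2 = h\<close>, as the limit of an iteration that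
  makes sense without a unit. The scalar iteration at \<open>h = 1\<close> dominates it, because the increments
  are polynomials with nonnegative coefficients; this covers the boundary case of norm one.\<close>

primrec sqrt_iter :: "nat \<Rightarrow> 'a::cstar_algebra \<Rightarrow> 'a" where
  "sqrt_iter 0 h = 0"
| "sqrt_iter (Suc n) h = (1/2) *\<^sub>R (h + sqrt_iter n h * sqrt_iter n h)"

primrec scalar_iter :: "nat \<Rightarrow> real" where
  "scalar_iter 0 = 0"
| "scalar_iter (Suc n) = (1 + scalar_iter n * scalar_iter n) / 2"

lemma scalar_iter_bounds: "0 \<le> scalar_iter n \<and> scalar_iter n \<le> 1"
proof (induction n)
  case (Suc n)
  then have "scalar_iter n * scalar_iter n \<le> 1 * 1" by (intro mult_mono) auto
  then show ?case using Suc by auto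
qed simp

lemma scalar_iter_step: "scalar_iter n \<le> scalar_iter (Suc n)"
  using zero_le_square[of "scalar_iter n - 1"] by (simp add: algebra_simps)

lemma scalar_iter_lim: "scalar_iter \<longlonglongrightarrow> 1"
proof -
  have "incseq scalar_iter" by (rule incseq_SucI) (rule scalar_iter_step)
  then obtain L where L: "scalar_iter \<longlonglongrightarrow> L"
    using incseq_convergent[of scalar_iter 1] scalar_iter_bounds by blast
  have "(\<lambda>n. scalar_iter (Suc n)) \<longlonglongrightarrow> (1 + L * L) / 2"
    unfolding scalar_iter.simps by (intro tendsto_intros L) simp
  then have "(1 + L * L) / 2 = L"
    using LIMSEQ_unique LIMSEQ_Suc[OF L] by blast
  then have "(L - 1) * (L - 1) = 0" by (simp add: algebra_simps)
  then show ?thesis using L by simp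
qed

lemma sqrt_iter_dominated:
  assumes "norm h \<le> 1"
  shows "norm (sqrt_iter n h) \<le> scalar_iter n \<and>
    norm (sqrt_iter (Suc n) h - sqrt_iter n h) \<le> scalar_iter (Suc n) - scalar_iter n"
proof (induction n)
  case 0
  then show ?case using assms by simp
next
  case (Suc n)
  let ?c = "\<lambda>n. sqrt_iter n h" and ?s = scalar_iter
  have b: "norm (?c (Suc n)) \<le> ?s (Suc n)"
  proof -
    have "norm (?c n * ?c n) \<le> ?s n * ?s n"
      by (rule order_trans[OF norm_mult_ineq]) (use Suc scalar_iter_bounds[of n] in \<open>blast intro: mult_mono norm_ge_zero\<close>)
    then have "norm (h + ?c n * ?c n) \<le> 1 + ?s n * ?s n"
      using norm_triangle_ineq[of h "?c n * ?c n"] assms by linarith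
    then show ?thesis by simp
  qed
  have "?c (Suc (Suc n)) - ?c (Suc n) =
      (1/2) *\<^sub>R (?c (Suc n) * ?c (Suc n) - ?c n * ?c n)"
    unfolding sqrt_iter.simps(2)[of "Suc n"] sqrt_iter.simps(2)[of n h]
    by (simp add: algebra_simps)
  also have "?c (Suc n) * ?c (Suc n) - ?c n * ?c n =
      ?c (Suc n) * (?c (Suc n) - ?c n) + (?c (Suc n) - ?c n) * ?c n"
    by (simp add: algebra_simps del: sqrt_iter.simps)
  finally have eq: "?c (Suc (Suc n)) - ?c (Suc n) =
    (1/2) *\<^sub>R (?c (Suc n) * (?c (Suc n) - ?c n) + (?c (Suc n) - ?c n) * ?c n)" .
  have "norm (?c (Suc n) * (?c (Suc n) - ?c n) + (?c (Suc n) - ?c n) * ?c n)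
    \<le> ?s (Suc n) * (?s (Suc n) - ?s n) + (?s (Suc n) - ?s n) * ?s n"
  proof (rule order_trans[OF norm_triangle_ineq], rule add_mono)
    show "norm (?c (Suc n) * (?c (Suc n) - ?c n)) \<le> ?s (Suc n) * (?s (Suc n) - ?s n)"
      by (rule order_trans[OF norm_mult_ineq], rule mult_mono)
        (use Suc b scalar_iter_bounds in \<open>simp_all del: sqrt_iter.simps scalar_iter.simps\<close>)
    show "norm ((?c (Suc n) - ?c n) * ?c n) \<le> (?s (Suc n) - ?s n) * ?s n"
      by (rule order_trans[OF norm_mult_ineq], rule mult_mono)
        (use Suc scalar_iter_step[of n] scalar_iter_bounds[of n] in \<open>simp_all del: sqrt_iter.simps scalar_iter.simps\<close>)
  qed
  then have "norm (?c (Suc (Suc n)) - ?c (Suc n)) \<le>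
     (?s (Suc n) * (?s (Suc n) - ?s n) + (?s (Suc n) - ?s n) * ?s n) / 2"
    unfolding eq by (simp del: sqrt_iter.simps scalar_iter.simps)
  also have "\<dots> = ?s (Suc (Suc n)) - ?s (Suc n)"
    unfolding scalar_iter.simps(2)[of "Suc n"] scalar_iter.simps(2)[of n]
    by (simp add: field_simps)
  finally show ?case using b by blast
qed

lemma sqrt_iter_diff:
  assumes "norm h \<le> 1" "m \<le> n"
  shows "norm (sqrt_iter n h - sqrt_iter m h) \<le> scalar_iter n - scalar_iter m"
  using assms(2)
proof (induction n rule: dec_induct)
  case (step n)
  have "sqrt_iter (Suc n) h - sqrt_iter m h =
      (sqrt_iter (Suc n) h - sqrt_iter n h) + (sqrt_iter n h - sqrt_iter m h)" by simp
  then show ?case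
    using step.IH sqrt_iter_dominated[OF assms(1), of n]
      norm_triangle_ineq[of "sqrt_iter (Suc n) h - sqrt_iter n h" "sqrt_iter n h - sqrt_iter m h"]
    by (simp del: sqrt_iter.simps scalar_iter.simps)
qed simp

definition one_minus_sqrt :: "'a::cstar_algebra \<Rightarrow> 'a" where
  "one_minus_sqrt h = lim (\<lambda>n. sqrt_iter n h)"

lemma sqrt_iter_tendsto:
  assumes "norm h \<le> 1"
  shows "(\<lambda>n. sqrt_iter n h) \<longlonglongrightarrow> one_minus_sqrt h"
proof -
  have "Cauchy (\<lambda>n. sqrt_iter n h)"
  proof (rule metric_CauchyI)
    fix e :: real assume "e > 0"
    then obtain M where M: "\<forall>m\<ge>M. \<forall>n\<ge>M. dist (scalar_iter m) (scalar_iter n) < e"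
      using metric_CauchyD[OF LIMSEQ_imp_Cauchy[OF scalar_iter_lim]] by blast
    have "dist (sqrt_iter m h) (sqrt_iter n h) < e" if "m \<ge> M" "n \<ge> M" for m n
    proof (cases "m \<le> n")
      case True
      then show ?thesis
        using sqrt_iter_diff[OF assms True] M[rule_format, OF that]
        by (simp add: dist_norm norm_minus_commute abs_if split: if_splits)
    next
      case False
      then show ?thesis
        using sqrt_iter_diff[OF assms, of n m] M[rule_format, OF that]
        by (simp add: dist_norm abs_if split: if_splits)
    qed
    then show "\<exists>M. \<forall>m\<ge>M. \<forall>n\<ge>M. dist (sqrt_iter m h) (sqrt_iter n h) < e" by blast
  qed
  then show ?thesis
    unfolding one_minus_sqrt_def by (simp add: Cauchy_convergent convergent_LIMSEQ_iff[symmetric])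
qed

lemma one_minus_sqrt_close:
  assumes "norm h \<le> 1"
  shows "norm (one_minus_sqrt h - sqrt_iter n h) \<le> 1 - scalar_iter n"
proof (rule Lim_bounded[of "\<lambda>k. norm (sqrt_iter k h - sqrt_iter n h)"])
  show "(\<lambda>k. norm (sqrt_iter k h - sqrt_iter n h)) \<longlonglongrightarrow> norm (one_minus_sqrt h - sqrt_iter n h)"
    by (intro tendsto_intros sqrt_iter_tendsto assms)
  show "\<forall>k\<ge>n. norm (sqrt_iter k h - sqrt_iter n h) \<le> 1 - scalar_iter n"
  proof (intro allI impI)
    fix k assume "k \<ge> n"
    then show "norm (sqrt_iter k h - sqrt_iter n h) \<le> 1 - scalar_iter n"
      using sqrt_iter_diff[OF assms, of n k] scalar_iter_bounds[of k] by linarith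
  qed
qed

lemma norm_one_minus_sqrt: "norm h \<le> 1 \<Longrightarrow> norm (one_minus_sqrt h) \<le> 1"
  using one_minus_sqrt_close[of h 0] by simp

lemma one_minus_sqrt_eq:
  assumes "norm h \<le> 1"
  shows "2 *\<^sub>R one_minus_sqrt h - one_minus_sqrt h * one_minus_sqrt h = h"
proof -
  let ?c = "one_minus_sqrt h"
  have "(\<lambda>n. sqrt_iter (Suc n) h) \<longlonglongrightarrow> (1/2) *\<^sub>R (h + ?c * ?c)"
    unfolding sqrt_iter.simps by (intro tendsto_intros sqrt_iter_tendsto assms)
  then have "(1/2) *\<^sub>R (h + ?c * ?c) = ?c"
    using LIMSEQ_unique LIMSEQ_Suc[OF sqrt_iter_tendsto[OF assms]] by blast
  then have "2 *\<^sub>R ((1/2) *\<^sub>R (h + ?c * ?c)) = 2 *\<^sub>R ?c" by simp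
  then show ?thesis by (simp add: algebra_simps)
qed

lemma one_minus_sqrt_in:
  assumes "norm h \<le> 1" "closed S" "h \<in> S" "0 \<in> S"
    "\<And>x y. x \<in> S \<Longrightarrow> y \<in> S \<Longrightarrow> x + y \<in> S \<and> x * y \<in> S" "\<And>x r. x \<in> S \<Longrightarrow> r *\<^sub>R x \<in> S"
  shows "one_minus_sqrt h \<in> S"
proof (rule closed_sequentially[OF assms(2) _ sqrt_iter_tendsto[OF assms(1)]])
  show "sqrt_iter n h \<in> S" for n
    by (induction n) (auto intro: assms simp: assms(5,6) assms)
qed

lemma one_minus_sqrt_commute:
  assumes "norm h \<le> 1" "x * h = h * x"
  shows "x * one_minus_sqrt h = one_minus_sqrt h * x"
proof -
  have "one_minus_sqrt h \<in> {y. x * y = y * x}"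
  proof (rule one_minus_sqrt_in[OF assms(1)])
    show "closed {y. x * y = y * x}" by (intro closed_Collect_eq continuous_intros)
    show "y + z \<in> {y. x * y = y * x} \<and> y * z \<in> {y. x * y = y * x}"
      if "y \<in> {y. x * y = y * x}" "z \<in> {y. x * y = y * x}" for y z
      using that by (simp add: algebra_simps) (metis mult.assoc)
  qed (use assms in auto)
  then show ?thesis by simp
qed

lemma star_one_minus_sqrt:
  assumes "norm h \<le> 1" "star h = h"
  shows "star (one_minus_sqrt h) = one_minus_sqrt h"
proof (rule LIMSEQ_unique)
  have it: "star (sqrt_iter n h) = sqrt_iter n h" for n
    by (induction n) (simp_all add: assms star_add star_mult star_scaleR)
  show "(\<lambda>n. sqrt_iter n h) \<longlonglongrightarrow> one_minus_sqrt h" by (rule sqrt_iter_tendsto[OF assms(1)])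
  show "(\<lambda>n. sqrt_iter n h) \<longlonglongrightarrow> star (one_minus_sqrt h)"
    using bounded_linear.tendsto[OF bounded_linear_star sqrt_iter_tendsto[OF assms(1)]]
    by (simp add: it)
qed

text \<open>The convergence of the iteration is uniform on the unit ball.\<close>

lemma continuous_on_one_minus_sqrt: "continuous_on (cball 0 1) (one_minus_sqrt :: 'a::cstar_algebra \<Rightarrow> 'a)"
proof (rule uniform_limit_theorem)
  show "\<forall>\<^sub>F n in sequentially. continuous_on (cball 0 1) (\<lambda>h::'a. sqrt_iter n h)"
  proof (intro always_eventually allI)
    show "continuous_on (cball 0 1) (\<lambda>h::'a. sqrt_iter n h)" for n
      by (induction n) (auto intro!: continuous_intros)
  qed
  show "uniform_limit (cball 0 1) (\<lambda>n h::'a. sqrt_iter n h) one_minus_sqrt sequentially"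
  proof (rule uniform_limitI)
    fix e :: real assume "e > 0"
    then have "\<forall>\<^sub>F n in sequentially. dist (scalar_iter n) 1 < e"
      by (rule tendstoD[OF scalar_iter_lim])
    then show "\<forall>\<^sub>F n in sequentially. \<forall>h\<in>cball 0 1. dist (sqrt_iter n h) (one_minus_sqrt (h::'a)) < e"
    proof eventually_elim
      case (elim n)
      then show ?case
        using one_minus_sqrt_close[of _ n]
        by (force simp: dist_norm norm_minus_commute)
    qed
  qed
qed simp

section \<open>Positive elements\<close>

text \<open>The squares of self-adjoint elements of a unital C*-algebra are those self-adjoint \<open>h\<close> with
  \<open>\<parallel>t - h\<parallel> \<le> t\<close> for some \<open>t\<close>; from this they form a cone that meets its negative only in \<open>0\<close>, and an
  algebraic computation with negative parts shows that the cone contains every \<open>y\<^sup>* y\<close>.\<close>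

lemma star_one [simp]: "star (1::'a::cstar_unital) = 1"
  by (metis mult_1 mult_1_right star_mult star_star)

lemma norm_one_le: "norm (1::'a::cstar_unital) \<le> 1"
proof -
  have "norm (1::'a) * norm (1::'a) = norm (1::'a)" using norm_sq_star[of "1::'a"] by simp
  then show ?thesis by (cases "norm (1::'a) = 0") simp_all
qed

lemma norm_unitary_le: "star u * u = 1 \<Longrightarrow> norm (u::'a::cstar_unital) \<le> 1"
  using norm_sq_star[of u] norm_one_le[where 'a='a] abs_square_le_1[of "norm u"]
  by (simp add: power2_eq_square)

text \<open>A self-adjoint contraction \<open>w\<close> is the real part of the unitary
  \<open>u = w + i sqrt (1 - w\<^sup>2)\<close>, and \<open>1 - 2 w\<^sup>2 = - (u\<^sup>2 + (u\<^sup>*)\<^sup>2) / 2\<close>.\<close>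

lemma norm_one_minus_2_square:
  assumes "star w = (w::'a::cstar_unital)" "norm w \<le> 1"
  shows "norm (1 - 2 *\<^sub>R (w * w)) \<le> 1"
proof -
  define c where "c = one_minus_sqrt (w * w)"
  have n: "norm (w * w) \<le> 1"
    using norm_mult_ineq[of w w] mult_mono[OF assms(2) assms(2)] by simp
  have cs: "star c = c" unfolding c_def by (rule star_one_minus_sqrt[OF n]) (simp add: star_mult assms)
  have cc: "2 *\<^sub>R c - c * c = w * w" unfolding c_def by (rule one_minus_sqrt_eq[OF n])
  have cw: "w * c = c * w" unfolding c_def by (rule one_minus_sqrt_commute[OF n]) (simp add: mult.assoc)
  define s where "s = 1 - c"
  have ss: "star s = s" by (simp add: s_def star_diff cs)
  have s2: "s * s = 1 - w * w"
    by (simp add: s_def cc[symmetric] algebra_simps scaleR_2)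
  have sw: "s * w = w * s" by (simp add: s_def algebra_simps cw)
  define u where "u = w + \<i> *\<^sub>C s"
  have us: "star u = w - \<i> *\<^sub>C s"
    by (simp add: u_def star_add star_scaleC assms ss scaleC_minus_left)
  have ii: "\<i> *\<^sub>C \<i> *\<^sub>C x = - x" for x :: 'a by (simp add: scaleC_scaleC scaleC_minus_left)
  have "star u * u = 1"
    unfolding us by (simp add: u_def algebra_simps mult_scaleC_left mult_scaleC_right ii s2 sw
        scaleC_diff_right scaleC_add_right)
  then have nu: "norm u \<le> 1" by (rule norm_unitary_le)
  have sum: "u * u + star u * star u = 2 *\<^sub>R (w * w) - 2 *\<^sub>R (s * s)"
    unfolding us by (simp add: u_def algebra_simps mult_scaleC_left mult_scaleC_right ii sw scaleR_2
        scaleC_diff_right scaleC_add_right)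
  have "u * u + star u * star u = - 2 *\<^sub>R (1 - 2 *\<^sub>R (w * w))"
    unfolding sum s2 by (simp add: algebra_simps scaleR_2)
  then have "2 * norm (1 - 2 *\<^sub>R (w * w)) = norm (u * u + star u * star u)" by simp
  also have "\<dots> \<le> norm u * norm u + norm u * norm u"
    using norm_triangle_ineq[of "u * u" "star u * star u"] norm_mult_ineq[of u u]
      norm_mult_ineq[of "star u" "star u"] by (simp add: norm_star)
  also have "\<dots> \<le> 2" using mult_mono[OF nu nu] by simp
  finally show ?thesis by simp
qed

definition sa_square :: "'a::cstar_algebra \<Rightarrow> bool" where
  "sa_square h \<longleftrightarrow> (\<exists>w. star w = w \<and> h = w * w)"

lemma sa_square_star: "sa_square h \<Longrightarrow> star h = h"
  by (auto simp: sa_square_def star_mult)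

lemma sa_square_scale: "sa_square h \<Longrightarrow> r \<ge> 0 \<Longrightarrow> sa_square (r *\<^sub>R h)"
  unfolding sa_square_def
proof (elim exE conjE)
  fix w assume "star w = w" "h = w * w" "r \<ge> 0"
  then show "\<exists>w. star w = w \<and> r *\<^sub>R h = w * w"
    by (intro exI[of _ "sqrt r *\<^sub>R w"]) (simp add: star_scaleR)
qed

lemma sa_square_norm:
  assumes "sa_square (h::'a::cstar_unital)"
  shows "norm (norm h *\<^sub>R 1 - 2 *\<^sub>R h) \<le> norm h"
proof (cases "h = 0")
  case False
  obtain w where w: "star w = w" "h = w * w" using assms by (auto simp: sa_square_def)
  have nh: "norm h = norm w * norm w" using norm_sq_star[of w] w by simp
  have w0: "norm w > 0" using False w by auto
  define v where "v = w /\<^sub>R norm w"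
  have "norm (1 - 2 *\<^sub>R (v * v)) \<le> 1"
    by (rule norm_one_minus_2_square) (use w0 in \<open>simp_all add: v_def star_scaleR w\<close>)
  moreover have "norm h *\<^sub>R 1 - 2 *\<^sub>R h = norm h *\<^sub>R (1 - 2 *\<^sub>R (v * v))"
  proof -
    have "norm h * (inverse (norm w) * inverse (norm w)) = 1"
      unfolding nh using w0 by (simp add: field_simps)
    then have "norm h *\<^sub>R (v * v) = h" by (simp add: v_def w(2)[symmetric])
    then have "2 *\<^sub>R h = norm h *\<^sub>R 2 *\<^sub>R (v * v)" by (metis scaleR_left_commute)
    then show ?thesis by (simp add: scaleR_diff_right)
  qed
  ultimately show ?thesis using mult_left_mono[of "norm (1 - 2 *\<^sub>R (v * v))" 1 "norm h"] by simp
qed simp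

lemma sa_square_shift:
  assumes "sa_square (h::'a::cstar_unital)"
  shows "norm ((norm h / 2) *\<^sub>R 1 - h) \<le> norm h / 2"
proof -
  have "(norm h / 2) *\<^sub>R 1 - h = (1/2) *\<^sub>R (norm h *\<^sub>R 1 - 2 *\<^sub>R h)"
    by (simp add: algebra_simps)
  then show ?thesis using sa_square_norm[OF assms] by simp
qed

text \<open>\<open>\<parallel>t - h\<parallel> \<le> t\<close> makes \<open>1 - h / t\<close> a contraction, so \<open>1 - c\<close> with \<open>2 c - c\<^sup>2 = 1 - h / t\<close> is a root of
  \<open>h / t\<close>. The root satisfies the same kind of estimate, hence has a root itself; and it commutes with
  everything that commutes with \<open>h\<close>, being a limit of polynomials in \<open>h\<close>.\<close>

lemma positive_root:
  fixes h :: "'a::cstar_unital"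
  assumes "star h = h" "norm (t *\<^sub>R 1 - h) \<le> t"
  obtains w where "star w = w" "w * w = h" "sa_square w" "\<And>x. x * h = h * x \<Longrightarrow> x * w = w * x"
proof -
  have 1: "\<exists>w. star w = w \<and> w * w = h \<and> (\<forall>x. x * h = h * x \<longrightarrow> x * w = w * x) \<and>
      (\<exists>t. norm (t *\<^sub>R 1 - w) \<le> t)"
    if "star h = h" "norm (t *\<^sub>R 1 - h) \<le> t" for h :: 'a and t
  proof (cases "t = 0")
    case True
    then show ?thesis using that by (intro exI[of _ 0]) (auto intro!: exI[of _ 0])
  next
    case False
    then have t: "t > 0" using that(2) norm_ge_zero[of "t *\<^sub>R 1 - h"] by linarith
    define k where "k = 1 - h /\<^sub>R t"
    have "t *\<^sub>R k = t *\<^sub>R 1 - h" using t by (simp add: k_def scaleR_diff_right)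
    then have "t * norm k \<le> t * 1" using that(2) t by (metis norm_scaleR abs_of_pos mult_1_right)
    then have k: "norm k \<le> 1" using t by simp
    define c where "c = one_minus_sqrt k"
    have cs: "star c = c" unfolding c_def by (rule star_one_minus_sqrt[OF k]) (simp add: k_def star_diff star_scaleR that)
    have cc: "2 *\<^sub>R c - c * c = k" unfolding c_def by (rule one_minus_sqrt_eq[OF k])
    have cn: "norm c \<le> 1" unfolding c_def by (rule norm_one_minus_sqrt[OF k])
    have "(1 - c) * (1 - c) = 1 - k" by (simp add: cc[symmetric] algebra_simps scaleR_2)
    also have "\<dots> = h /\<^sub>R t" by (simp add: k_def)
    finally have sq: "(1 - c) * (1 - c) = h /\<^sub>R t" .
    show ?thesis
    proof (intro exI[of _ "sqrt t *\<^sub>R (1 - c)"] conjI allI impI)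
      show "star (sqrt t *\<^sub>R (1 - c)) = sqrt t *\<^sub>R (1 - c)" by (simp add: star_scaleR star_diff cs)
      show "sqrt t *\<^sub>R (1 - c) * sqrt t *\<^sub>R (1 - c) = h"
      proof -
        have "sqrt t *\<^sub>R (1 - c) * sqrt t *\<^sub>R (1 - c) = (sqrt t * sqrt t) *\<^sub>R ((1 - c) * (1 - c))"
          by (simp only: mult_scaleR_left mult_scaleR_right scaleR_scaleR)
        then show ?thesis using t by (simp add: sq)
      qed
      show "x * sqrt t *\<^sub>R (1 - c) = sqrt t *\<^sub>R (1 - c) * x" if "x * h = h * x" for x
      proof -
        have "x * c = c * x" unfolding c_def
          by (rule one_minus_sqrt_commute[OF k]) (simp add: k_def algebra_simps that)
        then show ?thesis by (simp add: algebra_simps)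
      qed
      show "\<exists>t'. norm (t' *\<^sub>R 1 - sqrt t *\<^sub>R (1 - c)) \<le> t'"
        using cn t by (intro exI[of _ "sqrt t"]) (simp add: algebra_simps mult_left_le)
    qed
  qed
  obtain w s where w: "star w = w" "w * w = h" "\<And>x. x * h = h * x \<Longrightarrow> x * w = w * x"
      "norm (s *\<^sub>R 1 - w) \<le> s"
    using 1[OF assms] by blast
  have "sa_square w" using 1[OF w(1,4)] unfolding sa_square_def by metis
  then show thesis using that w by blast
qed

lemma sa_squareI:
  fixes h :: "'a::cstar_unital"
  shows "star h = h \<Longrightarrow> norm (t *\<^sub>R 1 - h) \<le> t \<Longrightarrow> sa_square h"
  unfolding sa_square_def by (metis positive_root)

lemma sa_square_add:
  assumes "sa_square (h::'a::cstar_unital)" "sa_square k"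
  shows "sa_square (h + k)"
proof (rule sa_squareI)
  show "star (h + k) = h + k" using assms by (simp add: star_add sa_square_star)
  have "(norm h / 2 + norm k / 2) *\<^sub>R 1 - (h + k) =
      ((norm h / 2) *\<^sub>R 1 - h) + ((norm k / 2) *\<^sub>R 1 - k)"
    by (simp add: algebra_simps)
  then show "norm ((norm h / 2 + norm k / 2) *\<^sub>R 1 - (h + k)) \<le> norm h / 2 + norm k / 2"
    apply (simp only:)
    using norm_triangle_ineq[of "(norm h / 2) *\<^sub>R 1 - h" "(norm k / 2) *\<^sub>R 1 - k"]
      sa_square_shift[OF assms(1)] sa_square_shift[OF assms(2)] by linarith
qed

text \<open>Subtract the estimates of \<open>\<parallel>h\<parallel> - 2 h\<close> and \<open>\<parallel>h\<parallel> + 2 h\<close>: the norm of \<open>4 h\<close> is at most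
  \<open>2 \<parallel>h\<parallel>\<close>.\<close>

lemma sa_square_antisym:
  assumes "sa_square (h::'a::cstar_unital)" "sa_square (- h)"
  shows "h = 0"
proof -
  have "4 *\<^sub>R h = (norm h *\<^sub>R 1 - 2 *\<^sub>R (- h)) - (norm h *\<^sub>R 1 - 2 *\<^sub>R h)"
    using scaleR_add_left[of 2 2 h] by (simp add: algebra_simps)
  then have "4 * norm h = norm ((norm h *\<^sub>R 1 - 2 *\<^sub>R (- h)) - (norm h *\<^sub>R 1 - 2 *\<^sub>R h))"
    by (metis abs_numeral norm_scaleR)
  also have "\<dots> \<le> norm h + norm h"
    using sa_square_norm[OF assms(1)] sa_square_norm[OF assms(2)]
      norm_triangle_ineq4[of "norm h *\<^sub>R 1 - 2 *\<^sub>R (- h)" "norm h *\<^sub>R 1 - 2 *\<^sub>R h"]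
    by simp
  finally show ?thesis by simp
qed

text \<open>Write \<open>v = a + i b\<close> with self-adjoint \<open>a\<close>, \<open>b\<close>; the sum is \<open>2 (a\<^sup>2 + b\<^sup>2)\<close>.\<close>

lemma sa_square_sum_star:
  fixes v :: "'a::cstar_unital"
  shows "sa_square (star v * v + v * star v)"
proof -
  define a where "a = (1/2) *\<^sub>R (v + star v)"
  define b where "b = (- \<i> / 2) *\<^sub>C (v - star v)"
  have a: "star a = a" by (simp add: a_def star_scaleR star_add star_star add.commute)
  have b: "star b = b"
    by (simp add: b_def star_scaleC star_diff star_star scaleC_diff_right scaleC_minus_left)
  have bb: "b * b = - ((1/4) *\<^sub>R ((v - star v) * (v - star v)))"
    by (simp add: b_def mult_scaleC_left mult_scaleC_right scaleC_scaleC scaleR_scaleC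
        scaleC_minus_left scaleC_minus_right)
  have "sa_square (2 *\<^sub>R (a * a) + 2 *\<^sub>R (b * b))"
    by (intro sa_square_add sa_square_scale) (use a b in \<open>auto simp: sa_square_def\<close>)
  also have "2 *\<^sub>R (a * a) + 2 *\<^sub>R (b * b) = star v * v + v * star v"
  proof -
    have "(v + star v) * (v + star v) - (v - star v) * (v - star v) =
        2 *\<^sub>R (star v * v + v * star v)"
      by (simp add: algebra_simps scaleR_2)
    then have "(1/2) *\<^sub>R ((v + star v) * (v + star v) - (v - star v) * (v - star v)) =
        star v * v + v * star v" by simp
    then show ?thesis unfolding bb a_def by (simp add: scaleR_diff_right)
  qed
  finally show ?thesis .
qed

text \<open>If \<open>z\<^sup>* z = - w\<^sup>2\<close>, then for \<open>v = w z\<^sup>*\<close> both \<open>v\<^sup>* v\<close> and \<open>v v\<^sup>*\<close> are negatives of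
  squares, while their sum is positive.\<close>

lemma negative_star_square:
  fixes z :: "'a::cstar_unital"
  assumes "sa_square (- (star z * z))"
  shows "z = 0"
proof -
  obtain w where w: "star w = w" "- (star z * z) = w * w" using assms by (auto simp: sa_square_def)
  have zz: "star z * z = - (w * w)" using w(2) by (metis minus_minus)
  define v where "v = w * star z"
  define m where "m = z * star z"
  define k where "k = w * w"
  have "star v * v = z * (w * w) * star z" by (simp add: v_def star_mult star_star w(1) mult.assoc)
  also have "\<dots> = - (z * (star z * z) * star z)" by (simp add: zz)
  finally have 1: "star v * v = - (m * m)" by (simp add: m_def mult.assoc)
  have "v * star v = w * (star z * z) * w" by (simp add: v_def star_mult star_star w(1) mult.assoc)
  then have 2: "v * star v = - (k * k)" by (simp add: zz k_def mult.assoc)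
  have ms: "star m = m" and ks: "star k = k" by (simp_all add: m_def k_def star_mult star_star w(1))
  have "sa_square (star v * v + v * star v)" by (rule sa_square_sum_star)
  then have neg: "sa_square (- (m * m + k * k))" by (simp add: 1 2)
  have mm: "sa_square (m * m)" and kk: "sa_square (k * k)" using ms ks by (auto simp: sa_square_def)
  have "m * m + k * k = 0" by (rule sa_square_antisym[OF sa_square_add[OF mm kk] neg])
  then have "- (k * k) = m * m" by (metis add_eq_0_iff2)
  then have "k * k = 0" using sa_square_antisym[OF kk] mm by simp
  then have "k = 0" using norm_sq_star[of k] ks by simp
  then have "star z * z = 0" using zz by (simp add: k_def)
  then show ?thesis by (simp add: star_mult_self_eq_0)
qed

text \<open>Let \<open>h = y\<^sup>* y\<close> and \<open>n = (\<bar>h\<bar> - h) / 2\<close> its negative part. Then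
  \<open>(y n)\<^sup>* (y n) = - n\<^sup>3\<close>, so \<open>y n = 0\<close>, hence \<open>n = 0\<close>.\<close>

theorem sa_square_star_mult:
  fixes y :: "'a::cstar_unital"
  shows "sa_square (star y * y)"
proof -
  define h where "h = star y * y"
  have hs: "star h = h" by (simp add: h_def star_mult star_star)
  have "sa_square (h * h)" using hs by (auto simp: sa_square_def)
  from sa_square_shift[OF this] obtain r where r: "star r = r" "r * r = h * h" "sa_square r"
      "\<And>x. x * (h * h) = h * h * x \<Longrightarrow> x * r = r * x"
    using positive_root[OF sa_square_star[OF \<open>sa_square (h * h)\<close>]] by metis
  have hr: "h * r = r * h" by (rule r(4)) (simp add: mult.assoc)
  obtain w where w: "star w = w" "w * w = r" "\<And>x. x * r = r * x \<Longrightarrow> x * w = w * x"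
    using positive_root[OF r(1) sa_square_shift[OF r(3)]] by metis
  define n where "n = (1/2) *\<^sub>R (r - h)"
  have ns: "star n = n" by (simp add: n_def star_scaleR star_diff r hs)
  have nr: "n * r = r * n" by (simp add: n_def algebra_simps hr)
  have nw: "n * w = w * n" by (rule w(3)[OF nr])
  have "(r + h) * n = 0" by (simp add: n_def algebra_simps r(2) hr)
  then have "h * n = - (r * n)" by (simp add: algebra_simps add_eq_0_iff2)
  then have nhn: "n * h * n = - (n * r * n)" by (simp add: mult.assoc)
  have wn: "star (w * n) = w * n" by (simp add: star_mult w ns nw)
  have nrn: "n * r * n = (w * n) * (w * n)"
  proof -
    have "(w * n) * (w * n) = (n * w) * (w * n)" by (simp only: nw)
    also have "\<dots> = n * (w * w) * n" by (simp only: mult.assoc)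
    finally show ?thesis by (simp add: w(2))
  qed
  have "star (y * n) * (y * n) = n * h * n" by (simp add: h_def star_mult ns mult.assoc)
  then have "sa_square (- (star (y * n) * (y * n)))"
    using wn by (auto simp: nhn nrn sa_square_def)
  then have "y * n = 0" by (rule negative_star_square)
  then have "h * n = 0" by (simp add: h_def mult.assoc)
  then have "r * n = 0" using \<open>h * n = - (r * n)\<close> by simp
  moreover have "n * n = (1/2) *\<^sub>R (r * n - h * n)"
    by (subst (1) n_def) (simp add: left_diff_distrib)
  ultimately have "n * n = 0" using \<open>h * n = 0\<close> by simp
  then have "n = 0" using norm_sq_star[of n] ns by simp
  then have "r = h" by (simp add: n_def)
  then show ?thesis using r(3) by (simp add: h_def)
qed

section \<open>The Hahn--Banach theorem and states\<close>

text \<open>Zorn's lemma for linear subspaces of \<open>'a \<times> \<real>\<close> lying below the norm. Such a subspace is the graph of a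
  functional dominated by the norm, and the union of a chain of them is another one.\<close>

lemma Hahn_Banach_norming:
  fixes x0 :: "'a::real_normed_vector"
  shows "\<exists>r::'a \<Rightarrow> real. linear r \<and> (\<forall>x. r x \<le> norm x) \<and> r x0 = norm x0"
proof -
  define \<G> where "\<G> = {g :: ('a \<times> real) set. subspace g \<and> (\<forall>(x, a)\<in>g. a \<le> norm x) \<and> (x0, norm x0) \<in> g}"
  have "\<exists>M\<in>\<G>. \<forall>X\<in>\<G>. M \<subseteq> X \<longrightarrow> X = M"
  proof (rule subset_Zorn_nonempty)
    have "range (\<lambda>t. (t *\<^sub>R x0, t * norm x0)) \<in> \<G>"
    proof -
      have "subspace (range (\<lambda>t. (t *\<^sub>R x0, t * norm x0)))"
        unfolding subspace_def
        by (auto simp: image_iff zero_prod_def scaleR_add_left distrib_right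
            intro: exI[of _ 0] exI[of _ "_ + _"] exI[of _ "_ * _"])
      moreover have "t * norm x0 \<le> norm (t *\<^sub>R x0)" for t
        by (simp add: mult_right_mono)
      moreover have "(x0, norm x0) \<in> range (\<lambda>t. (t *\<^sub>R x0, t * norm x0))"
        by (rule image_eqI[of _ _ 1]) auto
      ultimately show ?thesis unfolding \<G>_def by auto
    qed
    then show "\<G> \<noteq> {}" by blast
    show "\<Union>\<C> \<in> \<G>" if ne: "\<C> \<noteq> {}" and ch: "subset.chain \<G> \<C>" for \<C>
    proof -
      have mem: "g \<in> \<G>" if "g \<in> \<C>" for g using ch that by (auto simp: subset.chain_def)
      have cmp: "\<exists>k\<in>\<C>. g \<subseteq> k \<and> h \<subseteq> k" if "g \<in> \<C>" "h \<in> \<C>" for g h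
        using subset_chain_def[of \<G> \<C>] ch that by (metis order_refl)
      have "subspace (\<Union>\<C>)"
        unfolding subspace_def
      proof (intro conjI ballI allI)
        show "0 \<in> \<Union>\<C>" using ne mem by (auto simp: \<G>_def subspace_0)
        fix u assume "u \<in> \<Union>\<C>"
        then obtain g where g: "g \<in> \<C>" "u \<in> g" by blast
        show "r *\<^sub>R u \<in> \<Union>\<C>" for r using g mem[OF g(1)] by (auto simp: \<G>_def intro: subspace_scale)
        fix v assume "v \<in> \<Union>\<C>"
        then obtain h where h: "h \<in> \<C>" "v \<in> h" by blast
        obtain k where "k \<in> \<C>" "g \<subseteq> k" "h \<subseteq> k" using cmp g(1) h(1) by blast
        then show "u + v \<in> \<Union>\<C>" using g h mem[of k] by (auto simp: \<G>_def intro!: subspace_add)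
      qed
      then show ?thesis using ne mem by (fastforce simp: \<G>_def)
    qed
  qed
  then obtain g where gG: "g \<in> \<G>" and max: "\<And>X. X \<in> \<G> \<Longrightarrow> g \<subseteq> X \<Longrightarrow> X = g" by blast
  have sub: "subspace g" and le: "\<And>x a. (x, a) \<in> g \<Longrightarrow> a \<le> norm x" and x0: "(x0, norm x0) \<in> g"
    using gG by (auto simp: \<G>_def)
  have add: "(x + y, a + b) \<in> g" if "(x, a) \<in> g" "(y, b) \<in> g" for x y a b
    using subspace_add[OF sub that] by simp
  have scale: "(t *\<^sub>R x, t * a) \<in> g" if "(x, a) \<in> g" for x t a
    using subspace_scale[OF sub that, of t] by simp
  have uniq: "a = b" if "(x, a) \<in> g" "(x, b) \<in> g" for x a b
    using le[OF add[OF that(1) scale[OF that(2), of "-1"]]] le[OF add[OF that(2) scale[OF that(1), of "-1"]]]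
    by simp
  have total: "\<exists>a. (z, a) \<in> g" for z
  proof -
    let ?S = "{a - norm (x - z) |x a. (x, a) \<in> g}"
    define c where "c = Sup ?S"
    have up: "s \<le> norm (y + z) - b" if s: "s \<in> ?S" and y: "(y, b) \<in> g" for s y b
    proof -
      obtain x a where x: "(x, a) \<in> g" "s = a - norm (x - z)" using s by blast
      have "a + b \<le> norm (x + y)" by (rule le[OF add[OF x(1) y]])
      also have "\<dots> \<le> norm (x - z) + norm (y + z)"
        using norm_triangle_ineq[of "x - z" "y + z"] by simp
      finally show ?thesis by (simp add: x(2))
    qed
    have ne: "?S \<noteq> {}" using x0 by blast
    have bdd: "bdd_above ?S" using up[OF _ x0] by (rule bdd_aboveI)
    have c1: "c \<le> norm (y + z) - b" if "(y, b) \<in> g" for y b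
      unfolding c_def by (rule cSup_least[OF ne]) (rule up[OF _ that])
    have c2: "a - norm (x - z) \<le> c" if "(x, a) \<in> g" for x a
      unfolding c_def by (rule cSup_upper[OF _ bdd]) (use that in blast)
    have key: "a + t * c \<le> norm (x + t *\<^sub>R z)" if xa: "(x, a) \<in> g" for x a t
    proof (cases t "0::real" rule: linorder_cases)
      case equal
      then show ?thesis using le[OF xa] by simp
    next
      case greater
      have "c \<le> norm (inverse t *\<^sub>R x + z) - inverse t * a" by (rule c1[OF scale[OF xa]])
      then have "t * c \<le> t * norm (inverse t *\<^sub>R x + z) - t * (inverse t * a)"
        using greater by (metis mult_left_mono less_imp_le right_diff_distrib)
      also have "t * norm (inverse t *\<^sub>R x + z) = norm (t *\<^sub>R (inverse t *\<^sub>R x + z))" using greater by simp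
      also have "t *\<^sub>R (inverse t *\<^sub>R x + z) = x + t *\<^sub>R z" using greater by (simp add: scaleR_add_right)
      also have "t * (inverse t * a) = a" using greater by simp
      finally show ?thesis by simp
    next
      case less
      define s where "s = - t"
      have s: "s > 0" using less by (simp add: s_def)
      have "inverse s * a - norm (inverse s *\<^sub>R x - z) \<le> c" by (rule c2[OF scale[OF xa]])
      then have "s * (inverse s * a) - s * norm (inverse s *\<^sub>R x - z) \<le> s * c"
        using s by (metis mult_left_mono less_imp_le right_diff_distrib)
      moreover have "s * norm (inverse s *\<^sub>R x - z) = norm (s *\<^sub>R (inverse s *\<^sub>R x - z))" using s by simp
      moreover have "s *\<^sub>R (inverse s *\<^sub>R x - z) = x + t *\<^sub>R z" using s by (simp add: scaleR_diff_right s_def)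
      moreover have "s * (inverse s * a) = a" using s by simp
      ultimately have "a - norm (x + t *\<^sub>R z) \<le> s * c" by simp
      then show ?thesis by (simp add: s_def)
    qed
    define g' where "g' = {(x + t *\<^sub>R z, a + t * c) |x a t. (x, a) \<in> g}"
    have sub': "subspace g'"
      unfolding subspace_def
    proof (intro conjI ballI allI)
      have "(0, 0) \<in> g" using subspace_0[OF sub] by (simp add: zero_prod_def)
      then show "0 \<in> g'" unfolding g'_def zero_prod_def by (auto intro!: exI[of _ 0])
      fix u assume "u \<in> g'"
      then obtain x a t where u: "u = (x + t *\<^sub>R z, a + t * c)" "(x, a) \<in> g" by (auto simp: g'_def)
      show "r *\<^sub>R u \<in> g'" for r
        unfolding g'_def u(1)
        by (rule CollectI, rule exI[of _ "r *\<^sub>R x"], rule exI[of _ "r * a"], rule exI[of _ "r * t"])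
          (use scale[OF u(2), of r] in \<open>simp add: algebra_simps\<close>)
      fix v assume "v \<in> g'"
      then obtain y b s where v: "v = (y + s *\<^sub>R z, b + s * c)" "(y, b) \<in> g" by (auto simp: g'_def)
      show "u + v \<in> g'"
        unfolding g'_def u(1) v(1)
        by (rule CollectI, rule exI[of _ "x + y"], rule exI[of _ "a + b"], rule exI[of _ "t + s"])
          (simp add: add[OF u(2) v(2)] algebra_simps)
    qed
    have sup: "g \<subseteq> g'"
    proof clarify
      fix x a assume "(x, a) \<in> g"
      then show "(x, a) \<in> g'" unfolding g'_def
        by (intro CollectI exI[of _ x] exI[of _ a] exI[of _ 0]) simp
    qed
    have "g' \<in> \<G>"
    proof -
      have "\<forall>(x, a)\<in>g'. a \<le> norm x" using key by (auto simp: g'_def)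
      then show ?thesis using sub' sup x0 unfolding \<G>_def by blast
    qed
    then have "g' = g" using max sup by blast
    moreover have "(z, c) \<in> g'"
      unfolding g'_def using subspace_0[OF sub]
      by (intro CollectI exI[of _ 0] exI[of _ 0] exI[of _ 1]) (simp add: zero_prod_def)
    ultimately show ?thesis by blast
  qed
  define r where "r z = (THE a. (z, a) \<in> g)" for z
  have r: "(z, a) \<in> g \<longleftrightarrow> r z = a" for z a
    unfolding r_def using total[of z] uniq by (metis the_equality)
  have "linear r"
    by (rule linearI) (use add scale r in auto)
  moreover have "\<forall>x. r x \<le> norm x" using le r by blast
  moreover have "r x0 = norm x0" using x0 r by blast
  ultimately show ?thesis by blast
qed

lemma dominated_linear_abs:
  assumes "linear r" "\<And>x. r x \<le> norm x"
  shows "\<bar>r x\<bar> \<le> norm (x::'a::real_normed_vector)"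
  using assms(2)[of x] assms(2)[of "-x"] by (simp add: linear_neg[OF assms(1)])

lemma dominated_bounded_linear:
  assumes "linear r" "\<And>x. r x \<le> norm x"
  shows "bounded_linear (r :: 'a::real_normed_vector \<Rightarrow> real)"
  using linear_add[OF assms(1)] linear_scale[OF assms(1)] dominated_linear_abs[OF assms]
  by (intro bounded_linear_intro[where K = 1]) simp_all

lemma eq_by_functionals:
  fixes x y :: "'a::real_normed_vector"
  assumes "\<And>r::'a \<Rightarrow> real. bounded_linear r \<Longrightarrow> r x = r y"
  shows "x = y"
proof -
  obtain r :: "'a \<Rightarrow> real" where r: "linear r" "\<And>x. r x \<le> norm x" "r (x - y) = norm (x - y)"
    using Hahn_Banach_norming[of "x - y"] by blast
  have "r x = r y" by (rule assms[OF dominated_bounded_linear[OF r(1,2)]])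
  then show ?thesis using r(3) linear_diff[OF r(1), of x y] by simp
qed

text \<open>For \<open>\<parallel>p\<parallel> = 1\<close>, \<open>3 p = (1 + p) - (1 - 2 p)\<close> forces \<open>\<parallel>1 + p\<parallel> = 2\<close>, so a functional norming
  \<open>1 + p\<close> norms both \<open>1\<close> and \<open>p\<close>.\<close>

lemma norming_functional_unital:
  fixes p :: "'a::cstar_unital"
  assumes "sa_square p" "p \<noteq> 0"
  obtains r :: "'a \<Rightarrow> real" where "linear r" "\<And>x. r x \<le> norm x" "r 1 = 1" "r p = norm p"
proof -
  obtain r :: "'a \<Rightarrow> real" where r: "linear r" "\<And>x. r x \<le> norm x"
      "r (norm p *\<^sub>R 1 + p) = norm (norm p *\<^sub>R 1 + p)"
    using Hahn_Banach_norming by metis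
  have "3 *\<^sub>R p = (norm p *\<^sub>R 1 + p) - (norm p *\<^sub>R 1 - 2 *\<^sub>R p)"
    using scaleR_add_left[of 1 2 p] by (simp add: algebra_simps)
  then have "3 * norm p = norm ((norm p *\<^sub>R 1 + p) - (norm p *\<^sub>R 1 - 2 *\<^sub>R p))"
    by (metis abs_numeral norm_scaleR)
  also have "\<dots> \<le> norm (norm p *\<^sub>R 1 + p) + norm p"
    using norm_triangle_ineq4[of "norm p *\<^sub>R 1 + p" "norm p *\<^sub>R 1 - 2 *\<^sub>R p"] sa_square_norm[OF assms(1)]
    by linarith
  finally have "2 * norm p \<le> norm p * r 1 + r p"
    using r(3) by (simp add: linear_add[OF r(1)] linear_scale[OF r(1)])
  moreover have "norm p * r 1 \<le> norm p"
    using r(2)[of 1] norm_one_le[where 'a='a] by (simp add: mult_left_le)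
  moreover have "r p \<le> norm p" by (rule r(2))
  ultimately have "norm p * r 1 = norm p" "r p = norm p" by linarith+
  then show thesis using that[OF r(1,2)] assms(2) by simp
qed

lemma unital_functional_positive:
  fixes h :: "'a::cstar_unital"
  assumes "linear r" "\<And>x. r x \<le> norm x" "r 1 = (1::real)" "sa_square h"
  shows "0 \<le> r h"
  using assms(2)[of "(norm h / 2) *\<^sub>R 1 - h"] sa_square_shift[OF assms(4)]
  by (simp add: linear_diff[OF assms(1)] linear_scale[OF assms(1)] assms(3))

text \<open>The hermitian complex functional with a given restriction to the self-adjoint part.\<close>

definition hermitian_extension :: "('b::cstar_algebra \<Rightarrow> real) \<Rightarrow> 'b \<Rightarrow> complex" where
  "hermitian_extension r x =
    Complex (r ((1/2) *\<^sub>R (x + star x))) (r ((- \<i> / 2) *\<^sub>C (x - star x)))"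

lemma hermitian_extension_sa:
  assumes "linear r" "star h = h"
  shows "hermitian_extension r h = complex_of_real (r h)"
  using assms(2) linear_0[OF assms(1)]
  by (simp add: hermitian_extension_def complex_eq_iff scaleR_2[symmetric] del: scaleR_half_double)

lemma clinear_hermitian_extension:
  assumes r: "linear r"
  shows "clinear (hermitian_extension r)"
  unfolding clinear_def
proof (intro conjI allI)
  note rs = linear_add[OF r] linear_scale[OF r] linear_diff[OF r] linear_neg[OF r]
  show add: "hermitian_extension r (x + y) = hermitian_extension r x + hermitian_extension r y" for x y
    unfolding hermitian_extension_def
    by (simp add: complex_eq_iff star_add rs[symmetric])
      (simp add: algebra_simps scaleC_add_right scaleC_diff_right star_add)
  have sc: "hermitian_extension r (t *\<^sub>R x) = complex_of_real t * hermitian_extension r x" for t x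
  proof -
    have "(1/2) *\<^sub>R (t *\<^sub>R x + star (t *\<^sub>R x)) = t *\<^sub>R ((1/2) *\<^sub>R (x + star x))"
      by (simp add: star_scaleR scaleR_add_right)
    moreover have "(- \<i> / 2) *\<^sub>C (t *\<^sub>R x - star (t *\<^sub>R x)) = t *\<^sub>R ((- \<i> / 2) *\<^sub>C (x - star x))"
      by (simp only: star_scaleR scaleR_diff_right[symmetric])
        (simp add: scaleR_scaleC scaleC_scaleC mult.commute)
    ultimately show ?thesis
      unfolding hermitian_extension_def by (simp add: rs complex_eq_iff)
  qed
  have im: "hermitian_extension r (\<i> *\<^sub>C x) = \<i> * hermitian_extension r x" for x
  proof -
    have "(1/2) *\<^sub>R (\<i> *\<^sub>C x + star (\<i> *\<^sub>C x)) = - ((- \<i> / 2) *\<^sub>C (x - star x))"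
      by (simp add: star_scaleC scaleR_scaleC scaleC_scaleC scaleC_diff_right scaleC_add_right scaleC_minus_left)
    moreover have "(- \<i> / 2) *\<^sub>C (\<i> *\<^sub>C x - star (\<i> *\<^sub>C x)) = (1/2) *\<^sub>R (x + star x)"
      by (simp add: star_scaleC scaleR_scaleC scaleC_scaleC scaleC_diff_right scaleC_add_right scaleC_minus_left)
    ultimately show ?thesis
      unfolding hermitian_extension_def by (simp only: rs complex_eq_iff) simp
  qed
  show "hermitian_extension r (c *\<^sub>C x) = c *\<^sub>C hermitian_extension r x" for c x
  proof -
    have "c *\<^sub>C x = Re c *\<^sub>R x + Im c *\<^sub>R (\<i> *\<^sub>C x)"
      by (simp add: scaleR_scaleC scaleC_scaleC scaleC_add_left[symmetric])
        (metis complex_eq mult.commute)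
    then have "hermitian_extension r (c *\<^sub>C x) =
        (complex_of_real (Re c) + \<i> * complex_of_real (Im c)) * hermitian_extension r x"
      by (simp add: add sc im algebra_simps)
    then show ?thesis by (simp add: scaleC_complex_def complex_eq[symmetric])
  qed
qed

lemma norm_hermitian_extension:
  assumes r: "linear r" "\<And>x. r x \<le> norm x"
  shows "cmod (hermitian_extension r x) \<le> norm x"
proof (cases "hermitian_extension r x = 0")
  case False
  define z where "z = hermitian_extension r x"
  define w where "w = cnj z / cmod z"
  have w: "cmod w = 1" using False by (simp add: w_def z_def norm_divide)
  have "hermitian_extension r (w *\<^sub>C x) = w * z"
    using clinear_scaleC[OF clinear_hermitian_extension[OF r(1)]] by (simp add: z_def scaleC_complex_def)
  also have "w * z = complex_of_real (cmod z)"
    using False complex_norm_square[of z]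
    by (simp add: w_def z_def mult.commute[of "cnj _"] power2_eq_square nonzero_divide_eq_eq)
  finally have "cmod z = Re (hermitian_extension r (w *\<^sub>C x))" by simp
  also have "\<dots> = r ((1/2) *\<^sub>R (w *\<^sub>C x + star (w *\<^sub>C x)))" by (simp add: hermitian_extension_def)
  also have "\<dots> \<le> norm ((1/2) *\<^sub>R (w *\<^sub>C x + star (w *\<^sub>C x)))" by (rule r(2))
  also have "\<dots> \<le> norm x"
    using norm_triangle_ineq[of "w *\<^sub>C x" "star (w *\<^sub>C x)"] by (simp add: norm_star norm_scaleC w)
  finally show ?thesis by (simp add: z_def)
qed simp

text \<open>A functional on the multiplier algebra that norms \<open>1\<close> and \<open>b\<^sup>* b\<close> at once is positive. Its
  restriction to \<open>B\<close>, extended to a complex functional, still has norm one because it norms \<open>b\<^sup>* b\<close>.\<close>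

theorem norming_state:
  fixes b :: "'b::cstar_algebra"
  assumes "b \<noteq> 0"
  shows "\<exists>\<phi>. state \<phi> \<and> \<phi> (star b * b) = complex_of_real ((norm b)\<^sup>2)"
proof -
  have sq: "sa_square (emb (star a * a))" for a :: 'b
    by (simp add: emb_mult emb_star sa_square_star_mult)
  have np: "norm (emb (star b * b)) = (norm b)\<^sup>2" by (simp add: norm_emb cstar_identity)
  then have "emb (star b * b) \<noteq> 0" using assms by auto
  then obtain s :: "'b multiplier \<Rightarrow> real" where
    s: "linear s" "\<And>x. s x \<le> norm x" "s 1 = 1" "s (emb (star b * b)) = norm (emb (star b * b))"
    using norming_functional_unital[OF sq] by metis
  define r where "r = (\<lambda>x. s (emb x))"
  have r: "linear r"
    by (rule linearI) (simp_all add: r_def emb_add linear_add[OF s(1)] linear_scale[OF s(1)]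
        clinear_scaleR[OF clinear_emb])
  have rn: "r x \<le> norm x" for x using s(2)[of "emb x"] by (simp add: r_def norm_emb)
  have pos: "0 \<le> r (star a * a)" for a
    unfolding r_def by (rule unital_functional_positive[OF s(1-3) sq])
  let ?\<phi> = "hermitian_extension r"
  have cl: "clinear ?\<phi>" by (rule clinear_hermitian_extension[OF r])
  have bl: "bounded_linear ?\<phi>"
    by (rule bounded_linear_intro[where K = 1])
      (simp_all add: clinear_add[OF cl] clinear_scaleR[OF cl] norm_hermitian_extension[OF r rn])
  have v: "?\<phi> (star a * a) = complex_of_real (r (star a * a))" for a
    by (rule hermitian_extension_sa[OF r]) (simp add: star_mult star_star)
  have vb: "?\<phi> (star b * b) = complex_of_real ((norm b)\<^sup>2)"
    using s(4) unfolding v np by (simp add: r_def)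
  have "onorm ?\<phi> \<le> 1" using norm_hermitian_extension[OF r rn] by (intro onorm_bound) simp_all
  moreover have "cmod (?\<phi> (star b * b)) \<le> onorm ?\<phi> * norm (star b * b)" by (rule onorm[OF bl])
  then have "(norm b)\<^sup>2 \<le> onorm ?\<phi> * (norm b)\<^sup>2" by (simp add: vb cstar_identity norm_power)
  then have "1 \<le> onorm ?\<phi>" using assms by simp
  ultimately have "state ?\<phi>" using cl bl pos by (simp add: state_def v)
  then show ?thesis using vb by blast
qed

lemma stateD:
  assumes "state \<phi>"
  shows state_clinear: "clinear \<phi>" and state_norm: "cmod (\<phi> x) \<le> norm x"
    and state_real: "positive p \<Longrightarrow> \<phi> p \<in> \<real>" and state_nonneg: "positive p \<Longrightarrow> 0 \<le> Re (\<phi> p)"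
  using assms onorm[of \<phi> x] by (auto simp: state_def positive_def)

lemma state_bounded_linear: "state \<phi> \<Longrightarrow> bounded_linear \<phi>"
  by (simp add: state_def)

section \<open>Consequences for Hilbert modules\<close>

text \<open>Stated for forms on the module itself, so that it applies to \<open>\<phi> \<langle>x, y\<rangle>\<close> for every state \<open>\<phi>\<close>.\<close>

lemma semi_inner_cauchy_schwarz:
  fixes f :: "'e::cbanach \<Rightarrow> 'e \<Rightarrow> complex"
  assumes add_left: "\<And>x y z. f (x + y) z = f x z + f y z"
    and add_right: "\<And>x y z. f x (y + z) = f x y + f x z"
    and scale_left: "\<And>c x y. f (c *\<^sub>C x) y = cnj c * f x y"
    and scale_right: "\<And>c x y. f x (c *\<^sub>C y) = c * f x y"
    and real: "\<And>x. f x x \<in> \<real>" and nonneg: "\<And>x. 0 \<le> Re (f x x)"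
  shows "(cmod (f x y))\<^sup>2 \<le> Re (f x x) * Re (f y y)"
proof -
  have ex: "f (x + c *\<^sub>C y) (x + c *\<^sub>C y) = f x x + c * f x y + cnj c * f y x + cnj c * c * f y y" for c
    by (simp add: add_left add_right scale_left scale_right algebra_simps)
  have im0: "Im (f z z) = 0" for z using real[of z] by (simp add: complex_is_Real_iff)
  have herm: "f y x = cnj (f x y)"
    using im0[of "x + 1 *\<^sub>C y"] im0[of "x + \<i> *\<^sub>C y"] im0[of x] im0[of y]
    unfolding ex by (simp add: complex_eq_iff)
  define a where "a = Re (f x x)" define b where "b = Re (f y y)" define z where "z = f x y"
  have ab: "0 \<le> a" "0 \<le> b" using nonneg by (auto simp: a_def b_def)
  have q: "0 \<le> a - 2 * t * (cmod z)\<^sup>2 + t\<^sup>2 * (cmod z)\<^sup>2 * b" for t :: real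
  proof -
    define c where "c = - complex_of_real t * cnj z"
    have "Re (f x x + c * f x y + cnj c * f y x + cnj c * c * f y y)
        = a - 2 * t * (cmod z)\<^sup>2 + t\<^sup>2 * (cmod z)\<^sup>2 * b"
      unfolding herm cmod_power2 using im0[of y]
      by (simp add: c_def a_def b_def z_def[symmetric] power2_eq_square algebra_simps)
    then show ?thesis using nonneg[of "x + c *\<^sub>C y"] unfolding ex by simp
  qed
  show ?thesis
  proof (cases "b = 0")
    case True
    have "z = 0"
    proof (rule ccontr)
      assume "z \<noteq> 0"
      then have "(a + 1) / (cmod z)\<^sup>2 * (cmod z)\<^sup>2 = a + 1" by simp
      then have "2 * ((a + 1) / (cmod z)\<^sup>2) * (cmod z)\<^sup>2 = 2 * (a + 1)" by (metis mult.assoc)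
      then show False using q[of "(a + 1) / (cmod z)\<^sup>2"] ab(1) True by simp
    qed
    then show ?thesis using ab True by (simp add: z_def[symmetric] a_def[symmetric] b_def[symmetric])
  next
    case False
    then have "0 < b" using ab by simp
    then show ?thesis
      using q[of "1 / b"] unfolding a_def[symmetric] b_def[symmetric] z_def[symmetric]
      by (simp add: power2_eq_square field_simps)
  qed
qed

context hmod
begin

lemma state_inn_cauchy_schwarz:
  assumes "state \<phi>"
  shows "(cmod (\<phi> (inn E x y)))\<^sup>2 \<le> Re (\<phi> (inn E x x)) * Re (\<phi> (inn E y y))"
  using state_clinear[OF assms] state_real[OF assms positive_inn] state_nonneg[OF assms positive_inn]
  by (intro semi_inner_cauchy_schwarz[where f = "\<lambda>x y. \<phi> (inn E x y)"])
    (simp_all add: inn_add_left inn_add_right inn_scaleC_left inn_scaleC_right clinear_add clinear_scaleC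
      scaleC_complex_def)

lemma state_inn_le: "state \<phi> \<Longrightarrow> Re (\<phi> (inn E x x)) \<le> (norm x)\<^sup>2"
  using state_norm[of \<phi> "inn E x x"] complex_Re_le_cmod[of "\<phi> (inn E x x)"]
  by (simp add: norm_inn_self power2_eq_square)

lemma norming_state_inn:
  assumes "x \<noteq> 0"
  shows "\<exists>\<phi>. state \<phi> \<and> \<phi> (inn E x x) = complex_of_real ((norm x)\<^sup>2)"
proof -
  obtain b where b: "inn E x x = star b * b" using positive_inn[of x] by (auto simp: positive_def)
  have "(norm b)\<^sup>2 = (norm x)\<^sup>2"
    using norm_inn_self[of x] by (simp add: b cstar_identity power2_eq_square)
  moreover from this have "b \<noteq> 0" using assms by auto
  ultimately show ?thesis using norming_state[of b] b by simp
qed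

lemma norm_le_by_states:
  assumes "\<And>\<phi>. state \<phi> \<Longrightarrow> Re (\<phi> (inn E x x)) \<le> C" "0 \<le> C"
  shows "(norm x)\<^sup>2 \<le> C"
proof (cases "x = 0")
  case False
  then obtain \<phi> where "state \<phi>" "\<phi> (inn E x x) = complex_of_real ((norm x)\<^sup>2)"
    using norming_state_inn by blast
  then show ?thesis using assms(1)[of \<phi>] by simp
qed (simp add: assms(2))

lemma norm_le_by_sum:
  assumes "inn E u u + inn E v v = inn E w w"
  shows "norm u \<le> norm w"
proof (rule power2_le_imp_le[OF norm_le_by_states])
  fix \<phi> :: "'b \<Rightarrow> complex" assume s: "state \<phi>"
  have "Re (\<phi> (inn E u u)) + Re (\<phi> (inn E v v)) = Re (\<phi> (inn E w w))"
    unfolding assms[symmetric] clinear_add[OF state_clinear[OF s]] by simp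
  then show "Re (\<phi> (inn E u u)) \<le> (norm w)\<^sup>2"
    using state_nonneg[OF s positive_inn[of v]] state_inn_le[OF s, of w] by linarith
qed auto

text \<open>Take a state norming \<open>b\<^sup>* b\<close> for \<open>b = \<langle>x, y\<rangle>\<close>, and apply the scalar inequality to \<open>y\<close> and
  \<open>x b\<close>.\<close>

sublocale hmod_cs E
proof
  fix x y
  define b where "b = inn E x y"
  show "norm (inn E x y) \<le> norm x * norm y"
  proof (cases "b = 0")
    case False
    then obtain \<phi> where \<phi>: "state \<phi>" "\<phi> (star b * b) = complex_of_real ((norm b)\<^sup>2)"
      using norming_state by blast
    have "star b * b = inn E y (rmul E x b)" by (simp add: b_def star_inn inn_rmul_right)
    then have "((norm b)\<^sup>2)\<^sup>2 \<le> Re (\<phi> (inn E y y)) * Re (\<phi> (inn E (rmul E x b) (rmul E x b)))"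
      using state_inn_cauchy_schwarz[OF \<phi>(1), of y "rmul E x b"] \<phi>(2) by (simp add: norm_power)
    also have "\<dots> \<le> (norm y)\<^sup>2 * (norm x * norm b)\<^sup>2"
    proof (intro mult_mono)
      have "(norm (rmul E x b))\<^sup>2 \<le> (norm x * norm b)\<^sup>2" by (intro power_mono norm_rmul) simp
      then show "Re (\<phi> (inn E (rmul E x b) (rmul E x b))) \<le> (norm x * norm b)\<^sup>2"
        using state_inn_le[OF \<phi>(1)] order_trans by blast
    qed (auto intro: state_inn_le state_nonneg positive_inn \<phi>)
    finally have "(norm b)\<^sup>2 * (norm b)\<^sup>2 \<le> (norm x * norm y)\<^sup>2 * (norm b)\<^sup>2"
      by (simp add: power2_eq_square algebra_simps)
    then have "(norm b)\<^sup>2 \<le> (norm x * norm y)\<^sup>2"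
      using False by (metis mult_right_le_imp_le zero_less_norm_iff zero_less_power)
    then show ?thesis unfolding b_def by (rule power2_le_imp_le) simp
  qed (simp add: b_def)
qed

end

text \<open>For \<open>\<parallel>a\<parallel> \<le> 1\<close> write \<open>a\<^sup>* a = 2 c - c\<^sup>2\<close> with \<open>c\<close> self-adjoint; then
  \<open>\<langle>a x, a x\<rangle> + \<langle>x - c x, x - c x\<rangle> = \<langle>x, x\<rangle>\<close>.\<close>

lemma contraction_root:
  fixes a :: "'a::cstar_algebra"
  assumes "norm a \<le> 1"
  obtains c where "star c = c" "2 *\<^sub>R c - c * c = star a * a"
proof -
  have n: "norm (star a * a) \<le> 1" using assms by (simp add: norm_sq_star mult_le_one)
  show thesis
    by (rule that[of "one_minus_sqrt (star a * a)"])
      (simp_all add: star_one_minus_sqrt[OF n] one_minus_sqrt_eq[OF n] star_mult star_star)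
qed

lemma (in hmod) star_rep_contractive:
  assumes "star_rep E \<pi>"
  shows "norm (\<pi> a) \<le> norm a"
proof -
  have cl: "clinear \<pi>" and m: "\<And>a b. \<pi> (a * b) = \<pi> a o\<^sub>L \<pi> b"
    and adj: "\<And>a x y. inn E (blinfun_apply (\<pi> a) x) y = inn E x (blinfun_apply (\<pi> (star a)) y)"
    using assms by (auto simp: star_rep_def)
  have 1: "norm (\<pi> a) \<le> 1" if na: "norm a \<le> 1" for a
  proof (rule norm_blinfun_bound)
    fix x
    obtain c where c: "star c = c" "2 *\<^sub>R c - c * c = star a * a" using contraction_root[OF na] .
    let ?P = "\<lambda>a. blinfun_apply (\<pi> a)"
    have "inn E (?P a x) (?P a x) = inn E x (?P (star a * a) x)" by (simp add: adj m)
    also have "\<dots> = 2 *\<^sub>R inn E x (?P c x) - inn E (?P c x) (?P c x)"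
      by (simp add: c(2)[symmetric] clinear_diff[OF cl] clinear_scaleR[OF cl] m blinfun.diff_left
          blinfun.scaleR_left inn_diff_right inn_scaleR_right adj c(1))
    finally have "inn E (?P a x) (?P a x) + inn E (x - ?P c x) (x - ?P c x) = inn E x x"
      by (simp add: inn_diff_left inn_diff_right adj[of c x x] c(1) scaleR_2)
    then show "norm (?P a x) \<le> 1 * norm x" by (simp add: norm_le_by_sum)
  qed simp
  show ?thesis
  proof (cases "a = 0")
    case True
    then show ?thesis using clinear_zero[OF cl] by simp
  next
    case False
    have "norm (\<pi> (a /\<^sub>R norm a)) \<le> 1" by (rule 1) (use False in simp)
    then show ?thesis using False by (simp add: clinear_scaleR[OF cl] field_simps)
  qed
qed

text \<open>The inequality \<open>T\<^sup>* T \<le> \<parallel>T\<parallel>\<^sup>2\<close> tested in a state, by iterating the Cauchy--Schwarz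
  inequality: \<open>a\<^sub>n = \<phi> \<langle>z, (T\<^sup>* T)\<^sup>N z\<rangle>\<close> with \<open>N = 2\<^sup>n\<close> satisfies \<open>a\<^sub>n\<^sup>2 \<le> a a\<^sub>n\<^sub>+\<^sub>1\<close> for
  \<open>a = \<phi> \<langle>z, z\<rangle>\<close>, so \<open>a\<^sub>0 > \<parallel>T\<parallel>\<^sup>2 a\<close> would make \<open>a\<^sub>n\<close> outgrow \<open>\<parallel>T\<parallel>\<^sup>2\<^sup>N \<parallel>z\<parallel>\<^sup>2\<close>.\<close>

lemma (in hmod) state_adjointable_le:
  assumes T: "adjointable E T" and \<phi>: "state \<phi>"
  shows "Re (\<phi> (inn E (blinfun_apply T z) (blinfun_apply T z))) \<le> (norm T)\<^sup>2 * Re (\<phi> (inn E z z))"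
proof (rule ccontr)
  define b where "b = (norm T)\<^sup>2"
  define A where "A = Re (\<phi> (inn E z z))"
  define B where "B = rec_nat (adj E T o\<^sub>L T) (\<lambda>_ X. X o\<^sub>L X)"
  have B0: "B 0 = adj E T o\<^sub>L T" and BS: "B (Suc n) = B n o\<^sub>L B n" for n by (simp_all add: B_def)
  define a where "a n = Re (\<phi> (inn E z (blinfun_apply (B n) z)))" for n
  assume "\<not> ?thesis"
  moreover have a0: "a 0 = Re (\<phi> (inn E (blinfun_apply T z) (blinfun_apply T z)))"
    by (simp add: a_def B0 adj_right[OF T])
  ultimately have gt: "b * A < a 0" by (simp add: A_def b_def)
  have A0: "0 \<le> A" using state_nonneg[OF \<phi> positive_inn] by (simp add: A_def)
  have b0: "0 \<le> b" by (simp add: b_def)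
  have B: "adjointable E (B n) \<and> adj E (B n) = B n \<and> norm (B n) \<le> b ^ 2 ^ n" for n
  proof (induction n)
    case 0
    then show ?case using T by (simp add: B0 adjointable_compose adjointable_adj adj_compose adj_adj norm_adj_compose b_def)
  next
    case (Suc n)
    have "norm (B (Suc n)) \<le> norm (B n) * norm (B n)" by (simp add: BS norm_blinfun_compose)
    also have "\<dots> \<le> b ^ 2 ^ n * b ^ 2 ^ n" using Suc by (intro mult_mono) (auto simp: b0)
    finally show ?case using Suc by (simp add: BS adjointable_compose adj_compose power_add[symmetric] mult_2)
  qed
  have step: "(a n)\<^sup>2 \<le> A * a (Suc n)" for n
  proof -
    have "a (Suc n) = Re (\<phi> (inn E (blinfun_apply (B n) z) (blinfun_apply (B n) z)))"
      using adj_right[of "B n" z "blinfun_apply (B n) z"] B[of n] by (simp add: a_def BS)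
    moreover have "(a n)\<^sup>2 \<le> (cmod (\<phi> (inn E z (blinfun_apply (B n) z))))\<^sup>2"
      unfolding a_def by (intro abs_le_square_iff[THEN iffD1]) (simp add: abs_Re_le_cmod)
    ultimately show ?thesis using state_inn_cauchy_schwarz[OF \<phi>, of z "blinfun_apply (B n) z"] by (simp add: A_def)
  qed
  have up: "a n \<le> b ^ 2 ^ n * (norm z)\<^sup>2" for n
  proof -
    have "a n \<le> cmod (\<phi> (inn E z (blinfun_apply (B n) z)))" by (simp add: a_def complex_Re_le_cmod)
    also have "\<dots> \<le> norm z * norm (blinfun_apply (B n) z)" by (rule order_trans[OF state_norm[OF \<phi>] cauchy_schwarz])
    also have "\<dots> \<le> norm z * (b ^ 2 ^ n * norm z)"
      using B[of n] by (intro mult_left_mono order_trans[OF norm_blinfun mult_right_mono]) auto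
    finally show ?thesis by (simp add: power2_eq_square mult_ac)
  qed
  have a0p: "0 < a 0" using gt A0 b0 by (meson le_less_trans mult_nonneg_nonneg)
  have Ap: "0 < A" using step[of 0] a0p A0 by (cases "A = 0") auto
  have bp: "0 < b" using up[of 0] a0p b0 by (cases "b = 0") auto
  define r where "r = a 0 / (b * A)"
  have r1: "1 < r" using gt Ap bp by (simp add: r_def)
  have low: "A * (b * r) ^ 2 ^ n \<le> a n" for n
  proof (induction n)
    case 0
    then show ?case using Ap bp by (simp add: r_def)
  next
    case (Suc n)
    have "A * (A * (b * r) ^ 2 ^ Suc n) = (A * (b * r) ^ 2 ^ n)\<^sup>2"
      by (simp add: power2_eq_square power_add[symmetric] mult_2 mult_ac)
    also have "\<dots> \<le> (a n)\<^sup>2" using Suc Ap bp r1 by (intro power_mono) auto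
    also have "\<dots> \<le> A * a (Suc n)" by (rule step)
    finally show ?case using Ap by simp
  qed
  obtain n where n: "(norm z)\<^sup>2 / A < r ^ n" using real_arch_pow[OF r1] by blast
  have "r ^ n \<le> r ^ 2 ^ n" using r1 by (intro power_increasing) (auto intro: less_imp_le)
  then have "(norm z)\<^sup>2 < A * r ^ 2 ^ n" using n Ap by (simp add: field_simps) (meson less_le_trans mult_left_mono less_imp_le)
  moreover have "b ^ 2 ^ n * (A * r ^ 2 ^ n) \<le> b ^ 2 ^ n * (norm z)\<^sup>2"
    using order_trans[OF low up, of n] by (simp add: power_mult_distrib mult_ac)
  ultimately show False using bp by simp
qed

lemma state_contraction:
  fixes a x :: "'a::cstar_algebra"
  assumes "state \<phi>" "norm a \<le> K"
  shows "Re (\<phi> (star (a * x) * (a * x))) \<le> K\<^sup>2 * Re (\<phi> (star x * x))"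
proof -
  have "Re (\<phi> (star (a * x) * (a * x))) \<le> (norm a)\<^sup>2 * Re (\<phi> (star x * x))"
    using self.state_adjointable_le[OF _ assms(1), of "multiplier_op (emb a)" x] multiplier_op[of "emb a"]
    by (simp add: multiplier_op_emb norm_multiplier.rep_eq[symmetric] norm_emb)
  also have "\<dots> \<le> K\<^sup>2 * Re (\<phi> (star x * x))"
    using assms by (intro mult_right_mono power_mono) (auto simp: state_def)
  finally show ?thesis .
qed

section \<open>Continuous square roots\<close>

lemma closed_range_emb: "closed (range (emb :: 'b::cstar_algebra \<Rightarrow> _))"
  unfolding closed_sequential_limits
proof (intro allI impI, elim conjE)
  fix X and T :: "'b multiplier" assume X: "\<forall>n. X n \<in> range emb" and lim: "X \<longlonglongrightarrow> T"
  then have "\<forall>n. \<exists>x. X n = emb x" by blast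
  from choice[OF this] obtain e where e: "X = (\<lambda>n. emb (e n))" by blast
  have d: "dist (emb x) (emb y) = dist x y" for x y :: 'b
    by (simp add: dist_norm clinear_diff[OF clinear_emb, symmetric] norm_emb)
  have "Cauchy e" using LIMSEQ_imp_Cauchy[OF lim] by (simp add: e Cauchy_def d)
  then obtain l where "e \<longlonglongrightarrow> l" using Cauchy_convergent convergent_def by blast
  then have "X \<longlonglongrightarrow> emb l" by (simp add: e tendsto_iff d)
  then show "T \<in> range emb" using LIMSEQ_unique[OF lim] by blast
qed

lemma bounded_linear_emb: "bounded_linear emb"
  by (rule bounded_linear_intro[where K = 1])
    (simp_all add: emb_add clinear_scaleR[OF clinear_emb] norm_emb)

lemma continuous_on_isometric_image:
  assumes "continuous_on A f"
    and "\<And>x y. x \<in> A \<Longrightarrow> y \<in> A \<Longrightarrow> dist (g x) (g y) = dist (f x) (f y)"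
  shows "continuous_on A g"
  unfolding continuous_on_def tendsto_iff
proof (intro ballI allI impI)
  fix x e assume x: "x \<in> A" and e: "(0::real) < e"
  have "\<forall>\<^sub>F y in at x within A. y \<in> A" by (simp add: eventually_at_topological) (metis UNIV_I open_UNIV)
  moreover have "\<forall>\<^sub>F y in at x within A. dist (f y) (f x) < e"
    using assms(1) x e unfolding continuous_on_def tendsto_iff by blast
  ultimately show "\<forall>\<^sub>F y in at x within A. dist (g y) (g x) < e"
    by eventually_elim (simp add: assms(2) x)
qed

text \<open>The root is \<open>1 - c\<close> with \<open>2 c - c\<^sup>2 = 1 - p\<close>, formed among the multipliers. It is continuous since the
  iteration converges uniformly, and it lies in \<open>B\<close> although \<open>1 - p\<close> need not.\<close>

theorem continuous_square_root:
  obtains s :: "'b::cstar_algebra \<Rightarrow> 'b" where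
    "continuous_on {p. positive p \<and> norm p \<le> 1} s"
    "\<And>p. positive p \<Longrightarrow> norm p \<le> 1 \<Longrightarrow> star (s p) = s p \<and> s p * s p = p"
proof -
  define R :: "'b \<Rightarrow> 'b multiplier" where "R p = 1 - one_minus_sqrt (1 - emb p)" for p
  have inj: "emb x = emb y \<Longrightarrow> x = y" for x y :: 'b
    using norm_emb[of "x - y"] by (simp add: clinear_diff[OF clinear_emb])
  have le1: "norm (1 - emb p) \<le> 1" if p: "positive p" "norm p \<le> 1" for p :: 'b
  proof -
    have "sa_square (emb p)" using p(1) by (auto simp: positive_def emb_mult emb_star sa_square_star_mult)
    then have "norm ((norm p / 2) *\<^sub>R 1 - emb p) \<le> norm p / 2"
      using sa_square_shift[of "emb p"] by (simp add: norm_emb)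
    moreover have "norm ((1 - norm p / 2) *\<^sub>R (1::'b multiplier)) \<le> 1 - norm p / 2"
      using p(2) norm_one_le[where 'a="'b multiplier"] by (simp add: mult_left_le)
    moreover have "1 - emb p = (1 - norm p / 2) *\<^sub>R 1 + ((norm p / 2) *\<^sub>R 1 - emb p)"
      by (simp add: algebra_simps)
    ultimately show ?thesis
      using norm_triangle_ineq[of "(1 - norm p / 2) *\<^sub>R (1::'b multiplier)" "(norm p / 2) *\<^sub>R 1 - emb p"]
      by (simp only:)
  qed
  have ran: "R p \<in> range emb" if p: "positive p" "norm p \<le> 1" for p :: 'b
  proof -
    \<comment> \<open>the iterates lie in \<open>B + \<complex>\<close>, with scalar part tending to \<open>0\<close>\<close>
    have "\<exists>e. 1 - sqrt_iter n (1 - emb p) = (1 - scalar_iter n) *\<^sub>R 1 + emb e" for n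
    proof (induction n)
      case 0
      then show ?case by (intro exI[of _ 0]) (simp add: clinear_zero[OF clinear_emb])
    next
      case (Suc n)
      then obtain e where "1 - sqrt_iter n (1 - emb p) = (1 - scalar_iter n) *\<^sub>R 1 + emb e" by blast
      then have e: "sqrt_iter n (1 - emb p) = scalar_iter n *\<^sub>R 1 - emb e"
        by (simp add: algebra_simps)
      let ?s = "scalar_iter n"
      let ?e = "(1/2) *\<^sub>R (p + (2 * ?s) *\<^sub>R e - e * e)"
      have ee: "emb ?e = (1/2) *\<^sub>R (emb p + (2 * ?s) *\<^sub>R emb e - emb e * emb e)"
        by (simp add: clinear_add[OF clinear_emb] clinear_diff[OF clinear_emb] clinear_scaleR[OF clinear_emb] emb_mult)
      have sq: "(?s *\<^sub>R 1 - emb e) * (?s *\<^sub>R 1 - emb e) = (?s * ?s) *\<^sub>R 1 - (2 * ?s) *\<^sub>R emb e + emb e * emb e"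
        by (simp add: algebra_simps scaleR_2[symmetric])
      have "1 - sqrt_iter (Suc n) (1 - emb p) =
          (1/2) *\<^sub>R (2 *\<^sub>R 1 - (1 - emb p + ((?s * ?s) *\<^sub>R 1 - (2 * ?s) *\<^sub>R emb e + emb e * emb e)))"
        unfolding sqrt_iter.simps e sq by (simp add: scaleR_diff_right)
      also have "2 *\<^sub>R 1 - (1 - emb p + ((?s * ?s) *\<^sub>R 1 - (2 * ?s) *\<^sub>R emb e + emb e * emb e)) =
          (1 - ?s * ?s) *\<^sub>R 1 + (emb p + (2 * ?s) *\<^sub>R emb e - emb e * emb e)"
        by (simp add: scaleR_2 scaleR_diff_left)
      also have "(1/2) *\<^sub>R \<dots> = (1 - scalar_iter (Suc n)) *\<^sub>R 1 + emb ?e"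
      proof -
        have "1 - scalar_iter (Suc n) = (1/2) * (1 - ?s * ?s)" by (simp add: field_simps)
        then show ?thesis unfolding ee by (simp only: scaleR_add_right scaleR_scaleR)
      qed
      finally have "1 - sqrt_iter (Suc n) (1 - emb p) = (1 - scalar_iter (Suc n)) *\<^sub>R 1 + emb ?e" .
      then show ?case by blast
    qed
    then obtain e where e: "\<And>n. 1 - sqrt_iter n (1 - emb p) = (1 - scalar_iter n) *\<^sub>R 1 + emb (e n)"
      using choice[of "\<lambda>n e. 1 - sqrt_iter n (1 - emb p) = (1 - scalar_iter n) *\<^sub>R 1 + emb e"] by blast
    have "(\<lambda>n. (1 - sqrt_iter n (1 - emb p)) - (1 - scalar_iter n) *\<^sub>R 1) \<longlonglongrightarrow> R p - (1 - 1) *\<^sub>R 1"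
      unfolding R_def by (intro tendsto_intros sqrt_iter_tendsto le1 p scalar_iter_lim)
    then have "(\<lambda>n. emb (e n)) \<longlonglongrightarrow> R p" by (simp add: e)
    then show ?thesis by (rule closed_sequentially[OF closed_range_emb, rotated]) auto
  qed
  define s where "s p = inv emb (R p)" for p :: 'b
  have es: "emb (s p) = R p" if "positive p" "norm p \<le> 1" for p
    unfolding s_def using ran[OF that] by (rule f_inv_into_f)
  show thesis
  proof
    fix p :: 'b assume p: "positive p" "norm p \<le> 1"
    define c where "c = one_minus_sqrt (1 - emb p)"
    have sp: "star p = p" using p(1) by (auto simp: positive_def star_mult star_star)
    have "star c = c" unfolding c_def
      by (rule star_one_minus_sqrt[OF le1[OF p]]) (simp add: star_diff emb_star[symmetric] sp)
    moreover have cc: "2 *\<^sub>R c - c * c = 1 - emb p" unfolding c_def by (rule one_minus_sqrt_eq[OF le1[OF p]])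
    have "(1 - c) * (1 - c) = 1 - (2 *\<^sub>R c - c * c)" by (simp add: algebra_simps scaleR_2)
    then have "(1 - c) * (1 - c) = emb p" unfolding cc by simp
    ultimately have "star (R p) = R p" "R p * R p = emb p"
      by (simp_all add: R_def c_def[symmetric] star_diff)
    then show "star (s p) = s p \<and> s p * s p = p"
      by (intro conjI inj) (simp_all add: emb_star emb_mult es[OF p])
  next
    have "continuous_on {p. positive p \<and> norm p \<le> 1} R"
      unfolding R_def
    proof (rule continuous_on_diff[OF continuous_on_const continuous_on_compose2[OF continuous_on_one_minus_sqrt
            continuous_on_diff[OF continuous_on_const]]])
      show "continuous_on {p::'b. positive p \<and> norm p \<le> 1} emb"
        by (rule bounded_linear.continuous_on[OF bounded_linear_emb continuous_on_id])
      show "(\<lambda>p::'b. 1 - emb p) ` {p. positive p \<and> norm p \<le> 1} \<subseteq> cball 0 1"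
      proof
        fix T assume "T \<in> (\<lambda>p::'b. 1 - emb p) ` {p. positive p \<and> norm p \<le> 1}"
        then obtain p :: 'b where p: "T = 1 - emb p" "positive p" "norm p \<le> 1" by (elim imageE CollectE conjE)
        show "T \<in> cball 0 1" unfolding p(1) mem_cball_0 by (rule le1[OF p(2,3)])
      qed
    qed
    moreover have iso: "dist (s p) (s q) = dist (R p) (R q)"
      if "positive p" "norm p \<le> 1" "positive q" "norm q \<le> 1" for p q
    proof -
      have "dist (s p) (s q) = norm (emb (s p - s q))" by (simp only: norm_emb dist_norm)
      also have "\<dots> = dist (R p) (R q)"
        by (simp only: clinear_diff[OF clinear_emb] es[OF that(1,2)] es[OF that(3,4)] dist_norm)
      finally show ?thesis .
    qed
    ultimately show "continuous_on {p. positive p \<and> norm p \<le> 1} s"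
      by (rule continuous_on_isometric_image) simp_all
  qed
qed

section \<open>Cut-off functions and partitions of unity\<close>

lemma Hausdorff_space_t2: "Hausdorff_space (euclidean :: 'g::t2_space topology)"
  unfolding Hausdorff_space_def by (auto simp: disjnt_def) (metis hausdorff)

lemma Cc_I: "continuous_on UNIV f \<Longrightarrow> compact K \<Longrightarrow> (\<And>x. x \<notin> K \<Longrightarrow> f x = 0) \<Longrightarrow> f \<in> Cc"
  by (auto simp: Cc_def)

lemma Cc_E:
  assumes "f \<in> Cc"
  obtains K where "continuous_on UNIV f" "compact K" "\<And>x. x \<notin> K \<Longrightarrow> f x = 0"
  using assms by (auto simp: Cc_def)

lemma Cc_continuous: "f \<in> Cc \<Longrightarrow> continuous_on UNIV f"
  by (auto simp: Cc_def)

lemma Cc_dominated: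
  assumes "continuous_on UNIV h" "f \<in> Cc" "\<And>x. f x = 0 \<Longrightarrow> h x = 0"
  shows "h \<in> Cc"
proof -
  obtain K where "compact K" "\<And>x. x \<notin> K \<Longrightarrow> f x = 0" using assms(2) by (rule Cc_E) blast
  then show ?thesis by (intro Cc_I[OF assms(1), of K]) (auto intro: assms(3))
qed

lemma Cc_in_c0_set: "f \<in> Cc \<Longrightarrow> f \<in> c0_set"
  by (auto simp: Cc_def c0_set_def)

lemma Cc_add: "f \<in> Cc \<Longrightarrow> h \<in> Cc \<Longrightarrow> (\<lambda>x. f x + h x) \<in> Cc"
proof (elim Cc_E)
  fix K L assume "continuous_on UNIV f" "compact K" "\<And>x. x \<notin> K \<Longrightarrow> f x = 0"
    "continuous_on UNIV h" "compact L" "\<And>x. x \<notin> L \<Longrightarrow> h x = 0"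
  then show ?thesis by (intro Cc_I[of _ "K \<union> L"] continuous_intros) auto
qed

lemma Cc_zero: "(\<lambda>x. 0) \<in> Cc"
  by (rule Cc_I[of _ "{}"]) auto

lemma Cc_sum: "finite I \<Longrightarrow> (\<And>i. i \<in> I \<Longrightarrow> f i \<in> Cc) \<Longrightarrow> (\<lambda>x. \<Sum>i\<in>I. f i x) \<in> Cc"
  by (induction I rule: finite_induct) (auto intro: Cc_zero Cc_add)

lemma Cc_bounded_linear:
  assumes "bounded_linear T" "f \<in> Cc"
  shows "(\<lambda>x. T (f x)) \<in> Cc"
proof (rule Cc_dominated[OF _ assms(2)])
  show "continuous_on UNIV (\<lambda>x. T (f x))"
    by (rule bounded_linear.continuous_on[OF assms(1) Cc_continuous[OF assms(2)]])
qed (simp add: linear_simps[OF assms(1)])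

lemma Cc_scaleR: "\<phi> \<in> Cc \<Longrightarrow> continuous_on UNIV f \<Longrightarrow> (\<lambda>x. \<phi> x *\<^sub>R f x) \<in> Cc"
  by (rule Cc_dominated[of _ \<phi>]) (auto intro!: continuous_intros simp: Cc_continuous)

lemma continuous_on_c0 [continuous_intros]: "continuous_on S (apply_c0 f)"
  using apply_c0[of f] by (auto simp: c0_set_def intro: continuous_on_subset)

lemma Cc_scaleR_c0: "\<phi> \<in> Cc \<Longrightarrow> (\<lambda>x. \<phi> x *\<^sub>R apply_c0 f x) \<in> Cc"
  by (rule Cc_scaleR) (auto intro: continuous_intros)

lemma apply_Abs_Cc [simp]: "f \<in> Cc \<Longrightarrow> apply_c0 (Abs_c0 f) = f"
  by (simp add: Abs_c0_inverse Cc_in_c0_set)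

lemma apply_c0_minus: "apply_c0 (f - h) x = apply_c0 f x - apply_c0 h x"
  by (simp only: minus_c0_def plus_c0.rep_eq uminus_c0.rep_eq) simp

lemma apply_c0_sum: "apply_c0 (sum f I) x = (\<Sum>i\<in>I. apply_c0 (f i) x)"
  by (induction I rule: infinite_finite_induct) (simp_all add: zero_c0.rep_eq plus_c0.rep_eq)

lemma bounded_linear_apply_c0: "bounded_linear (\<lambda>f. apply_c0 f x)"
  by (rule bounded_linear_intro[where K = 1])
    (simp_all add: plus_c0.rep_eq scaleR_c0.rep_eq norm_c0_ge)

lemma c0_dist_le: "(\<And>x. norm (apply_c0 f x - apply_c0 h x) \<le> e) \<Longrightarrow> dist f h \<le> e"
  unfolding dist_norm by (rule norm_c0_le) (simp add: apply_c0_minus)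

text \<open>The parameter only names the type of the space.\<close>

locale lc_space =
  fixes dom :: "'g::t2_space itself"
  assumes lc: "locally_compact_space (euclidean :: 'g topology)"
begin

lemma compact_neighbourhood:
  fixes K :: "'g set"
  assumes "compact K"
  obtains V L where "open V" "compact L" "K \<subseteq> V" "V \<subseteq> L"
proof -
  have "compactin euclidean K" using assms by simp
  then have "\<exists>U L. openin euclidean U \<and> compactin euclidean L \<and> closedin euclidean L \<and> K \<subseteq> U \<and> U \<subseteq> L"
    by (rule iffD1[OF locally_compact_space_compact_closed_compact[OF disjI1[OF Hausdorff_space_t2]] lc,
          rule_format])
  then show thesis using that by auto
qed

lemma completely_regular: "completely_regular_space (euclidean :: 'g topology)"
  by (rule locally_compact_regular_imp_completely_regular_space[OF lc]) (simp add: Hausdorff_space_t2)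

lemma Urysohn_Cc:
  fixes K U :: "'g set"
  assumes "compact K" "open U" "K \<subseteq> U"
  obtains \<eta> :: "'g \<Rightarrow> real" where "\<eta> \<in> Cc" "\<And>x. 0 \<le> \<eta> x" "\<And>x. \<eta> x \<le> 1"
    "\<And>x. x \<in> K \<Longrightarrow> \<eta> x = 1" "\<And>x. x \<notin> U \<Longrightarrow> \<eta> x = 0"
proof -
  obtain V L where VL: "open V" "compact L" "K \<subseteq> V" "V \<subseteq> L" using compact_neighbourhood[OF assms(1)] .
  have "closedin euclidean (- (U \<inter> V))" "compactin euclidean K" "disjnt K (- (U \<inter> V))"
    using assms VL by (auto simp: disjnt_def closed_Compl open_Int)
  from Urysohn_completely_regular_compact_closed[OF zero_le_one completely_regular this(2,1,3)]
  obtain f :: "'g \<Rightarrow> real" where f: "continuous_map euclidean (top_of_set {0..1}) f"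
    "f ` (- (U \<inter> V)) \<subseteq> {0}" "f ` K \<subseteq> {1}" .
  have c: "continuous_on UNIV f" and r: "f x \<in> {0..1}" for x
    using f(1) by (auto simp: continuous_map_in_subtopology)
  show thesis
  proof
    show "f \<in> Cc" using c VL(2)
    proof (rule Cc_I)
      show "f x = 0" if "x \<notin> L" for x using f(2) VL(4) that by auto
    qed
    show "0 \<le> f x" "f x \<le> 1" for x using r[of x] by auto
    show "f x = 1" if "x \<in> K" for x using f(3) that by auto
    show "f x = 0" if "x \<notin> U" for x using f(2) that by auto
  qed
qed

lemma partition_of_unity:
  fixes K :: "'g set" and N :: "'g \<Rightarrow> 'g set"
  assumes "compact K" and N: "\<And>r. r \<in> K \<Longrightarrow> open (N r) \<and> r \<in> N r"
  obtains I and \<phi> :: "'g \<Rightarrow> 'g \<Rightarrow> real" where "finite I" "I \<subseteq> K" "\<And>i. i \<in> I \<Longrightarrow> \<phi> i \<in> Cc"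
    "\<And>i x. i \<in> I \<Longrightarrow> 0 \<le> \<phi> i x" "\<And>i x. i \<in> I \<Longrightarrow> x \<notin> N i \<Longrightarrow> \<phi> i x = 0"
    "\<And>x. (\<Sum>i\<in>I. \<phi> i x) \<le> 1" "\<And>x. x \<in> K \<Longrightarrow> (\<Sum>i\<in>I. \<phi> i x) = 1"
proof -
  have "\<forall>r\<in>K. \<exists>\<eta>::'g \<Rightarrow> real. \<eta> \<in> Cc \<and> (\<forall>x. 0 \<le> \<eta> x) \<and> \<eta> r = 1 \<and> (\<forall>x. x \<notin> N r \<longrightarrow> \<eta> x = 0)"
  proof
    fix r assume "r \<in> K"
    then have "open (N r)" "{r} \<subseteq> N r" using N by auto
    then obtain \<eta> :: "'g \<Rightarrow> real" where
      "\<eta> \<in> Cc" "\<And>x. 0 \<le> \<eta> x" "\<And>x. x \<in> {r} \<Longrightarrow> \<eta> x = 1" "\<And>x. x \<notin> N r \<Longrightarrow> \<eta> x = 0"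
      by (rule Urysohn_Cc[OF compact_sing]) (rule that)
    then show "\<exists>\<eta>::'g \<Rightarrow> real. \<eta> \<in> Cc \<and> (\<forall>x. 0 \<le> \<eta> x) \<and> \<eta> r = 1 \<and> (\<forall>x. x \<notin> N r \<longrightarrow> \<eta> x = 0)"
      by auto
  qed
  from bchoice[OF this] obtain \<eta> :: "'g \<Rightarrow> 'g \<Rightarrow> real" where
    \<eta>: "\<And>r. r \<in> K \<Longrightarrow> \<eta> r \<in> Cc" "\<And>r x. r \<in> K \<Longrightarrow> 0 \<le> \<eta> r x" "\<And>r. r \<in> K \<Longrightarrow> \<eta> r r = 1"
      "\<And>r x. r \<in> K \<Longrightarrow> x \<notin> N r \<Longrightarrow> \<eta> r x = 0" by blast
  have "K \<subseteq> (\<Union>r\<in>K. {x. \<eta> r x > 1/2})" using \<eta>(3) by force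
  moreover have "open {x. \<eta> r x > 1/2}" if "r \<in> K" for r
    using Cc_continuous[OF \<eta>(1)[OF that]] by (intro open_Collect_less continuous_intros) auto
  ultimately obtain I where I: "I \<subseteq> K" "finite I" "K \<subseteq> (\<Union>r\<in>I. {x. \<eta> r x > 1/2})"
    using compactE_image[OF assms(1), of K "\<lambda>r. {x. \<eta> r x > 1/2}"] by blast
  define S where "S x = (\<Sum>i\<in>I. \<eta> i x)" for x
  have cS: "continuous_on UNIV S" unfolding S_def
    using \<eta>(1) I(1) by (intro continuous_on_sum Cc_continuous) auto
  have S0: "0 \<le> S x" for x unfolding S_def using \<eta>(2) I by (intro sum_nonneg) auto
  have S1: "S x \<ge> 1/2" if "x \<in> K" for x
  proof -
    obtain i where i: "i \<in> I" "\<eta> i x > 1/2" using I(3) \<open>x \<in> K\<close> by auto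
    have "\<eta> i x \<le> S x" unfolding S_def
      by (rule member_le_sum[OF i(1) _ I(2)]) (use \<eta>(2) I in auto)
    then show ?thesis using i by simp
  qed
  define \<phi> where "\<phi> i x = inverse (max (S x) (1/2)) *\<^sub>R \<eta> i x" for i x
  have sum: "(\<Sum>i\<in>I. \<phi> i x) = inverse (max (S x) (1/2)) * S x" for x
    by (simp add: \<phi>_def S_def sum_distrib_left)
  show thesis
  proof
    show "\<phi> i \<in> Cc" if "i \<in> I" for i
    proof (rule Cc_dominated[OF _ \<eta>(1)])
      show "continuous_on UNIV (\<phi> i)" unfolding \<phi>_def
        using Cc_continuous[OF \<eta>(1), of i] I(1) that
        by (intro continuous_intros cS) (auto simp: max_def)
    qed (use I that in \<open>auto simp: \<phi>_def\<close>)
    show "0 \<le> \<phi> i x" if "i \<in> I" for i x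
      unfolding \<phi>_def using \<eta>(2)[of i x] I(1) that by (auto intro!: mult_nonneg_nonneg)
    show "\<phi> i x = 0" if "i \<in> I" "x \<notin> N i" for i x using \<eta>(4) that I by (auto simp: \<phi>_def)
    show "(\<Sum>i\<in>I. \<phi> i x) \<le> 1" for x unfolding sum using S0[of x] by (auto simp: max_def field_simps)
    show "(\<Sum>i\<in>I. \<phi> i x) = 1" if "x \<in> K" for x unfolding sum using S1[OF that] by (auto simp: max_def)
  qed (use I in auto)
qed

text \<open>A partition of unity subordinate to sets on which \<open>F x s\<close> varies by at most \<open>\<epsilon>\<close>, uniformly in \<open>s\<close>. The
  parameter \<open>s\<close> serves Fubini's theorem.\<close>

lemma partition_approximation:
  fixes F :: "'g \<Rightarrow> 's \<Rightarrow> 'v::real_normed_vector"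
  assumes "compact K" "open W" "K \<subseteq> W" "\<And>x s. x \<notin> K \<Longrightarrow> F x s = 0" "\<epsilon> > 0"
    and uc: "\<And>x. x \<in> K \<Longrightarrow> \<exists>N. open N \<and> x \<in> N \<and> (\<forall>y\<in>N. \<forall>s. norm (F y s - F x s) \<le> \<epsilon>)"
  obtains I and \<phi> :: "'g \<Rightarrow> 'g \<Rightarrow> real" where "finite I" "I \<subseteq> K" "\<And>i. i \<in> I \<Longrightarrow> \<phi> i \<in> Cc"
    "\<And>i x. i \<in> I \<Longrightarrow> x \<notin> W \<Longrightarrow> \<phi> i x = 0" "\<And>i x. i \<in> I \<Longrightarrow> 0 \<le> \<phi> i x"
    "\<And>x s. norm (F x s - (\<Sum>i\<in>I. \<phi> i x *\<^sub>R F i s)) \<le> \<epsilon>"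
proof -
  obtain N where N: "\<And>x. x \<in> K \<Longrightarrow> open (N x) \<and> x \<in> N x \<and> (\<forall>y\<in>N x. \<forall>s. norm (F y s - F x s) \<le> \<epsilon>)"
  proof -
    have "\<forall>x\<in>K. \<exists>N. open N \<and> x \<in> N \<and> (\<forall>y\<in>N. \<forall>s. norm (F y s - F x s) \<le> \<epsilon>)" using uc by blast
    from bchoice[OF this] show ?thesis using that by blast
  qed
  obtain I and \<phi> :: "'g \<Rightarrow> 'g \<Rightarrow> real" where \<phi>: "finite I" "I \<subseteq> K" "\<And>i. i \<in> I \<Longrightarrow> \<phi> i \<in> Cc"
    "\<And>i x. i \<in> I \<Longrightarrow> 0 \<le> \<phi> i x" "\<And>i x. i \<in> I \<Longrightarrow> x \<notin> N i \<inter> W \<Longrightarrow> \<phi> i x = 0"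
    "\<And>x. (\<Sum>i\<in>I. \<phi> i x) \<le> 1" "\<And>x. x \<in> K \<Longrightarrow> (\<Sum>i\<in>I. \<phi> i x) = 1"
  proof -
    have "open (N r \<inter> W) \<and> r \<in> N r \<inter> W" if "r \<in> K" for r
      using N[OF that] assms(2,3) that by (auto intro: open_Int)
    from partition_of_unity[OF assms(1) this] show ?thesis using that by blast
  qed
  show thesis
  proof
    fix x s
    have eq: "F x s = (\<Sum>i\<in>I. \<phi> i x *\<^sub>R F x s)"
    proof (cases "x \<in> K")
      case True
      then show ?thesis by (simp add: scaleR_sum_left[symmetric] \<phi>(7))
    next
      case False
      then show ?thesis by (simp add: assms(4))
    qed
    have "norm (F x s - (\<Sum>i\<in>I. \<phi> i x *\<^sub>R F i s)) = norm (\<Sum>i\<in>I. \<phi> i x *\<^sub>R (F x s - F i s))"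
      by (subst eq) (simp add: sum_subtractf scaleR_diff_right)
    also have "\<dots> \<le> (\<Sum>i\<in>I. \<phi> i x * \<epsilon>)"
    proof (rule sum_norm_le)
      fix i assume i: "i \<in> I"
      show "norm (\<phi> i x *\<^sub>R (F x s - F i s)) \<le> \<phi> i x * \<epsilon>"
      proof (cases "x \<in> N i")
        case True
        then show ?thesis using N[of i] \<phi>(2,4) i by (auto intro!: mult_left_mono)
      next
        case False
        then show ?thesis using \<phi>(5)[OF i, of x] by simp
      qed
    qed
    also have "\<dots> = (\<Sum>i\<in>I. \<phi> i x) * \<epsilon>" by (simp add: sum_distrib_right)
    also have "\<dots> \<le> \<epsilon>" using mult_right_mono[OF \<phi>(6)[of x], of \<epsilon>] assms(5) by simp
    finally show "norm (F x s - (\<Sum>i\<in>I. \<phi> i x *\<^sub>R F i s)) \<le> \<epsilon>" .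
  qed (use \<phi> in auto)
qed

lemma Cc_approximation:
  fixes f :: "'g \<Rightarrow> 'v::real_normed_vector"
  assumes "continuous_on UNIV f" "compact K" "open W" "K \<subseteq> W" "\<And>x. x \<notin> K \<Longrightarrow> f x = 0" "\<epsilon> > 0"
  obtains I and \<phi> :: "'g \<Rightarrow> 'g \<Rightarrow> real" where "finite I" "I \<subseteq> K" "\<And>i. i \<in> I \<Longrightarrow> \<phi> i \<in> Cc"
    "\<And>i x. i \<in> I \<Longrightarrow> x \<notin> W \<Longrightarrow> \<phi> i x = 0" "\<And>i x. i \<in> I \<Longrightarrow> 0 \<le> \<phi> i x"
    "\<And>x. norm (f x - (\<Sum>i\<in>I. \<phi> i x *\<^sub>R f i)) \<le> \<epsilon>"
proof -
  have uc: "\<exists>N. open N \<and> x \<in> N \<and> (\<forall>y\<in>N. \<forall>s::unit. norm (f y - f x) \<le> \<epsilon>)" for x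
  proof (intro exI conjI)
    show "open {y. dist (f y) (f x) < \<epsilon>}" using assms(1) by (intro open_Collect_less continuous_intros)
  qed (use assms(6) in \<open>auto simp: dist_norm\<close>)
  show thesis
  proof (rule partition_approximation[OF assms(2-4) _ assms(6) uc])
    fix I :: "'g set" and \<phi> :: "'g \<Rightarrow> 'g \<Rightarrow> real"
    assume "finite I" "I \<subseteq> K" "\<And>i. i \<in> I \<Longrightarrow> \<phi> i \<in> Cc"
      "\<And>i x. i \<in> I \<Longrightarrow> x \<notin> W \<Longrightarrow> \<phi> i x = 0" "\<And>i x. i \<in> I \<Longrightarrow> 0 \<le> \<phi> i x"
      "\<And>x s::unit. norm (f x - (\<Sum>i\<in>I. \<phi> i x *\<^sub>R f i)) \<le> \<epsilon>"
    then show thesis by (rule that)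
  qed (rule assms(5))
qed

lemma c0_cutoff:
  fixes f :: "('g, 'v::real_normed_vector) c0"
  assumes "\<epsilon> > 0"
  obtains \<eta> :: "'g \<Rightarrow> real" where "\<eta> \<in> Cc" "\<And>x. 0 \<le> \<eta> x" "\<And>x. \<eta> x \<le> 1"
    "\<And>x. norm (apply_c0 f x - \<eta> x *\<^sub>R apply_c0 f x) \<le> \<epsilon>"
proof -
  obtain K where K: "compact K" "\<And>x. x \<notin> K \<Longrightarrow> norm (apply_c0 f x) < \<epsilon>"
    using c0_setD[OF apply_c0[of f] assms] by blast
  obtain \<eta> :: "'g \<Rightarrow> real" where \<eta>: "\<eta> \<in> Cc" "\<And>x. 0 \<le> \<eta> x" "\<And>x. \<eta> x \<le> 1" "\<And>x. x \<in> K \<Longrightarrow> \<eta> x = 1"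
    using Urysohn_Cc[OF K(1) open_UNIV] by auto
  have "norm (apply_c0 f x - \<eta> x *\<^sub>R apply_c0 f x) \<le> \<epsilon>" for x
  proof (cases "x \<in> K")
    case True
    then show ?thesis using \<eta>(4) assms by simp
  next
    case False
    have "norm (apply_c0 f x - \<eta> x *\<^sub>R apply_c0 f x) = norm ((1 - \<eta> x) *\<^sub>R apply_c0 f x)"
      by (simp add: scaleR_diff_left)
    also have "\<dots> \<le> 1 * norm (apply_c0 f x)"
      unfolding norm_scaleR using \<eta>(2,3)[of x] by (intro mult_right_mono) auto
    finally show ?thesis using K(2)[OF False] by simp
  qed
  then show thesis using that \<eta> by blast
qed

lemma c0_approx_by_Cc:
  fixes f :: "('g, 'v::real_normed_vector) c0"
  assumes "\<epsilon> > 0"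
  obtains h where "apply_c0 h \<in> Cc" "dist h f \<le> \<epsilon>"
proof -
  obtain \<eta> :: "'g \<Rightarrow> real" where \<eta>: "\<eta> \<in> Cc" "\<And>x. norm (apply_c0 f x - \<eta> x *\<^sub>R apply_c0 f x) \<le> \<epsilon>"
    by (rule c0_cutoff[OF assms, of f]) (rule that)
  have m: "(\<lambda>x. \<eta> x *\<^sub>R apply_c0 f x) \<in> Cc" by (rule Cc_scaleR_c0[OF \<eta>(1)])
  show thesis
    by (rule that[of "Abs_c0 (\<lambda>x. \<eta> x *\<^sub>R apply_c0 f x)"])
      (use m \<eta>(2) in \<open>auto intro!: c0_dist_le simp: norm_minus_commute\<close>)
qed

lemma closure_Cc: "closure {f :: ('g, 'v::real_normed_vector) c0. apply_c0 f \<in> Cc} = UNIV"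
proof (rule equalityI[OF subset_UNIV subsetI])
  fix f :: "('g, 'v) c0"
  show "f \<in> closure {f. apply_c0 f \<in> Cc}"
    unfolding closure_approachable
  proof (intro allI impI)
    fix e :: real assume "e > 0"
    then have "e / 2 > 0" by simp
    from c0_approx_by_Cc[OF this, of f] obtain h where "apply_c0 h \<in> Cc" "dist h f \<le> e / 2" by blast
    then show "\<exists>h\<in>{f. apply_c0 f \<in> Cc}. dist h f < e" using \<open>e > 0\<close> by force
  qed
qed

text \<open>Cut \<open>f\<close> off to compact support, then approximate it by \<open>\<Sum> \<phi>\<^sub>i f(i)\<close>, whose coefficients are values of
  \<open>f\<close>.\<close>

lemma span_tensors_dense:
  fixes f :: "('g, 'v::real_normed_vector) c0"
  assumes "subspace V" "\<And>x. apply_c0 f x \<in> V"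
    and S: "\<And>\<phi> v. \<phi> \<in> Cc \<Longrightarrow> v \<in> V \<Longrightarrow> Abs_c0 (\<lambda>x. \<phi> x *\<^sub>R v) \<in> S"
  shows "f \<in> closure (span S)"
  unfolding closure_approachable
proof (intro allI impI)
  fix e :: real assume "e > 0"
  then have e: "e / 3 > 0" by simp
  obtain \<eta> :: "'g \<Rightarrow> real" where \<eta>: "\<eta> \<in> Cc" "\<And>x. norm (apply_c0 f x - \<eta> x *\<^sub>R apply_c0 f x) \<le> e / 3"
    by (rule c0_cutoff[OF e, of f]) (rule that)
  let ?h = "\<lambda>x. \<eta> x *\<^sub>R apply_c0 f x"
  have h: "?h \<in> Cc" by (rule Cc_scaleR_c0[OF \<eta>(1)])
  obtain K where K: "continuous_on UNIV ?h" "compact K" "\<And>x. x \<notin> K \<Longrightarrow> ?h x = 0" using h by (rule Cc_E) blast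
  obtain I and \<phi> :: "'g \<Rightarrow> 'g \<Rightarrow> real" where \<phi>: "finite I" "\<And>i. i \<in> I \<Longrightarrow> \<phi> i \<in> Cc"
    "\<And>x. norm (?h x - (\<Sum>i\<in>I. \<phi> i x *\<^sub>R ?h i)) \<le> e / 3"
    by (rule Cc_approximation[OF K(1,2) open_UNIV subset_UNIV _ e]) (erule K(3), rule that)
  define k where "k = (\<Sum>i\<in>I. Abs_c0 (\<lambda>x. \<phi> i x *\<^sub>R ?h i))"
  have m: "(\<lambda>x. \<phi> i x *\<^sub>R ?h i) \<in> Cc" if "i \<in> I" for i
    by (rule Cc_scaleR[OF \<phi>(2)[OF that]]) simp
  have "k \<in> span S" unfolding k_def
    by (intro span_sum span_base S \<phi>(2) subspace_scale[OF assms(1)] assms(2))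
  moreover have "dist k f < e"
  proof -
    have "dist k f \<le> 2 * (e / 3)"
    proof (rule c0_dist_le)
      fix x
      have kx: "apply_c0 k x = (\<Sum>i\<in>I. \<phi> i x *\<^sub>R ?h i)"
        unfolding k_def apply_c0_sum by (rule sum.cong) (use m in auto)
      have "norm (apply_c0 k x - apply_c0 f x) \<le> norm (apply_c0 k x - ?h x) + norm (?h x - apply_c0 f x)"
        using norm_triangle_ineq[of "apply_c0 k x - ?h x" "?h x - apply_c0 f x"] by simp
      also have "\<dots> \<le> e / 3 + e / 3"
        unfolding kx
        by (rule add_mono) (subst norm_minus_commute, rule \<phi>(3) \<eta>(2))+
      finally show "norm (apply_c0 k x - apply_c0 f x) \<le> 2 * (e / 3)" by simp
    qed
    then show ?thesis using \<open>e > 0\<close> by simp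
  qed
  ultimately show "\<exists>y\<in>span S. dist y f < e" by blast
qed

end

section \<open>Strongly continuous families\<close>

definition strongly_continuous :: "('g::topological_space \<Rightarrow> 'a::banach \<Rightarrow>\<^sub>L 'b::real_normed_vector) \<Rightarrow> bool" where
  "strongly_continuous Z \<longleftrightarrow> (\<forall>x. continuous_on UNIV (\<lambda>g. blinfun_apply (Z g) x))"

text \<open>Baire's theorem for the closed sets on which the family is bounded by \<open>n\<close>.\<close>

theorem uniform_boundedness:
  fixes Z :: "'g \<Rightarrow> 'a::banach \<Rightarrow>\<^sub>L 'b::real_normed_vector"
  assumes "\<And>x. \<exists>C. \<forall>g\<in>K. norm (blinfun_apply (Z g) x) \<le> C"
  obtains C where "0 < C" "\<And>g. g \<in> K \<Longrightarrow> norm (Z g) \<le> C"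
proof -
  define A where "A n = {x. \<forall>g\<in>K. norm (blinfun_apply (Z g) x) \<le> real n}" for n
  have clA: "closed (A n)" for n
  proof -
    have "A n = (\<Inter>g\<in>K. {x. norm (blinfun_apply (Z g) x) \<le> real n})" by (auto simp: A_def)
    then show ?thesis by (auto intro!: closed_INT closed_Collect_le continuous_intros)
  qed
  have "\<Union>(range A) = UNIV"
  proof (rule equalityI[OF subset_UNIV subsetI])
    fix x obtain C where C: "\<forall>g\<in>K. norm (blinfun_apply (Z g) x) \<le> C" using assms by blast
    obtain n :: nat where "C \<le> real n" using real_arch_simple by blast
    then have "x \<in> A n" using C by (auto simp: A_def intro: order_trans)
    then show "x \<in> \<Union>(range A)" by blast
  qed
  moreover have "Met_TC.mtopology interior_of \<Union>(range A) = {}"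
    if "\<And>n. interior (A n) = {}"
    by (rule Met_TC.metric_Baire_category_alt) (use that clA in \<open>auto simp: complete_UNIV\<close>)
  ultimately obtain n x0 where "x0 \<in> interior (A n)" by fastforce
  then obtain r where r: "r > 0" "cball x0 r \<subseteq> A n" by (meson mem_interior_cball)
  show thesis
  proof
    show "0 < 2 * real n / r + 1" using r by (simp add: add_nonneg_pos)
    fix g assume g: "g \<in> K"
    have "norm (Z g) \<le> 2 * real n / r"
    proof (rule norm_blinfun_bound)
      fix y
      show "norm (blinfun_apply (Z g) y) \<le> 2 * real n / r * norm y"
      proof (cases "y = 0")
        case False
        define z where "z = (r / norm y) *\<^sub>R y"
        have "x0 + z \<in> A n" "x0 \<in> A n" using r False by (auto simp: z_def dist_norm intro!: subsetD[OF r(2)])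
        then have "norm (blinfun_apply (Z g) (x0 + z)) \<le> real n" "norm (blinfun_apply (Z g) x0) \<le> real n"
          using g by (auto simp: A_def)
        then have "norm (blinfun_apply (Z g) z) \<le> 2 * real n"
          using norm_triangle_ineq4[of "blinfun_apply (Z g) (x0 + z)" "blinfun_apply (Z g) x0"]
          by (simp add: blinfun.add_right)
        then show ?thesis using r False by (simp add: z_def blinfun.scaleR_right field_simps)
      qed simp
    qed (use r in simp)
    then show "norm (Z g) \<le> 2 * real n / r + 1" by simp
  qed
qed

lemma strongly_continuous_bounded:
  fixes Z :: "'g::topological_space \<Rightarrow> 'a::banach \<Rightarrow>\<^sub>L 'b::real_normed_vector"
  assumes "strongly_continuous Z" "compact K"
  obtains C where "0 < C" "\<And>g. g \<in> K \<Longrightarrow> norm (Z g) \<le> C"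
proof (rule uniform_boundedness)
  fix x
  have "compact ((\<lambda>g. blinfun_apply (Z g) x) ` K)"
    using assms by (intro compact_continuous_image)
      (auto simp: strongly_continuous_def intro: continuous_on_subset[of UNIV])
  then have "bounded ((\<lambda>g. blinfun_apply (Z g) x) ` K)" by (rule compact_imp_bounded)
  then show "\<exists>C. \<forall>g\<in>K. norm (blinfun_apply (Z g) x) \<le> C" by (auto simp: bounded_iff)
qed (use that in blast)

context lc_space
begin

text \<open>By the uniform boundedness theorem the norms \<open>\<parallel>Z\<^sub>g\<parallel>\<close> are locally bounded, so a pointwise limit may be
  taken in both arguments.\<close>

lemma strongly_continuous_apply:
  fixes Z :: "'g \<Rightarrow> 'a::banach \<Rightarrow>\<^sub>L 'b::real_normed_vector"
  assumes "strongly_continuous Z" "continuous_on UNIV f"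
  shows "continuous_on UNIV (\<lambda>g. blinfun_apply (Z g) (f g))"
  unfolding continuous_on_def
proof (rule ballI)
  fix g0 :: 'g
  obtain V L where VL: "open V" "compact L" "{g0} \<subseteq> V" "V \<subseteq> L"
    using compact_neighbourhood[OF compact_sing] .
  obtain C where C: "0 < C" "\<And>g. g \<in> L \<Longrightarrow> norm (Z g) \<le> C"
    using strongly_continuous_bounded[OF assms(1) VL(2)] by blast
  have "((\<lambda>g. blinfun_apply (Z g) (f g) - blinfun_apply (Z g0) (f g0)) \<longlongrightarrow> 0) (at g0 within UNIV)"
  proof (rule Lim_null_comparison)
    have "\<forall>\<^sub>F g in at g0. g \<in> V" using VL by (intro eventually_at_topological[THEN iffD2]) auto
    then show "\<forall>\<^sub>F g in at g0. norm (blinfun_apply (Z g) (f g) - blinfun_apply (Z g0) (f g0)) \<le>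
        C * norm (f g - f g0) + norm (blinfun_apply (Z g) (f g0) - blinfun_apply (Z g0) (f g0))"
    proof eventually_elim
      case (elim g)
      have "norm (blinfun_apply (Z g) (f g - f g0)) \<le> C * norm (f g - f g0)"
        using C(2)[of g] VL elim by (intro order_trans[OF norm_blinfun mult_right_mono]) auto
      then show ?case
        using norm_triangle_ineq[of "blinfun_apply (Z g) (f g - f g0)"
            "blinfun_apply (Z g) (f g0) - blinfun_apply (Z g0) (f g0)"]
        by (simp add: blinfun.diff_right)
    qed
    have 1: "(f \<longlongrightarrow> f g0) (at g0)" using assms(2) by (simp add: continuous_on_def)
    have 2: "((\<lambda>g. blinfun_apply (Z g) (f g0)) \<longlongrightarrow> blinfun_apply (Z g0) (f g0)) (at g0)"
      using assms(1) by (simp add: strongly_continuous_def continuous_on_def)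
    have "((\<lambda>g. C * norm (f g - f g0) + norm (blinfun_apply (Z g) (f g0) - blinfun_apply (Z g0) (f g0)))
        \<longlongrightarrow> C * norm (f g0 - f g0) + norm (blinfun_apply (Z g0) (f g0) - blinfun_apply (Z g0) (f g0))) (at g0)"
      by (intro tendsto_intros 1 2)
    then show "((\<lambda>g. C * norm (f g - f g0) + norm (blinfun_apply (Z g) (f g0) - blinfun_apply (Z g0) (f g0)))
        \<longlongrightarrow> 0) (at g0)" by simp
  qed
  then show "((\<lambda>g. blinfun_apply (Z g) (f g)) \<longlongrightarrow> blinfun_apply (Z g0) (f g0)) (at g0 within UNIV)"
    by (simp add: LIM_zero_iff)
qed

lemma strongly_continuous_compose:
  fixes Y :: "'g \<Rightarrow> 'b::banach \<Rightarrow>\<^sub>L 'c::real_normed_vector" and Z :: "'g \<Rightarrow> 'a::banach \<Rightarrow>\<^sub>L 'b"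
  assumes "strongly_continuous Y" "strongly_continuous Z"
  shows "strongly_continuous (\<lambda>g. Y g o\<^sub>L Z g)"
  unfolding strongly_continuous_def blinfun_apply_blinfun_compose
proof
  show "continuous_on UNIV (\<lambda>g. blinfun_apply (Y g) (blinfun_apply (Z g) x))" for x
    by (rule strongly_continuous_apply[OF assms(1)]) (use assms(2) in \<open>simp add: strongly_continuous_def\<close>)
qed

end

section \<open>The Hilbert module of functions vanishing at infinity\<close>

lemma positive_scaleR: "positive p \<Longrightarrow> 0 \<le> r \<Longrightarrow> positive (r *\<^sub>R p)"
  unfolding positive_def
proof (elim exE)
  fix b assume "p = star b * b" "0 \<le> r"
  then show "\<exists>c. r *\<^sub>R p = star c * c"
    by (intro exI[of _ "sqrt r *\<^sub>R b"]) (simp add: star_scaleR)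
qed

text \<open>A continuous choice of square roots, after normalising \<open>\<parallel>p\<parallel>\<close> to \<open>1\<close>. The root vanishes at infinity
  because \<open>\<parallel>h(g)\<parallel>\<^sup>2 = \<parallel>p(g)\<parallel>\<close>.\<close>

lemma positive_c0:
  fixes p :: "('g::topological_space, 'b::cstar_algebra) c0"
  assumes "\<And>g. positive (apply_c0 p g)"
  shows "positive p"
proof (cases "p = 0")
  case True
  then show ?thesis by (auto simp: positive_def intro!: exI[of _ 0])
next
  case False
  then have R: "norm p > 0" by simp
  obtain s :: "'b \<Rightarrow> 'b" where s: "continuous_on {p. positive p \<and> norm p \<le> 1} s"
    "\<And>p. positive p \<Longrightarrow> norm p \<le> 1 \<Longrightarrow> star (s p) = s p \<and> s p * s p = p"
    by (rule continuous_square_root) (rule that)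
  define q where "q g = (1 / norm p) *\<^sub>R apply_c0 p g" for g
  have q: "positive (q g)" "norm (q g) \<le> 1" for g
    using R norm_c0_ge[of p g] by (auto simp: q_def intro!: positive_scaleR assms)
  define h where "h g = sqrt (norm p) *\<^sub>R s (q g)" for g
  have hh: "star (h g) * h g = apply_c0 p g" for g
  proof -
    have "star (h g) * h g = norm p *\<^sub>R (s (q g) * s (q g))"
      using s(2)[OF q] R by (simp add: h_def star_scaleR)
    also have "\<dots> = norm p *\<^sub>R q g" using s(2)[OF q] by simp
    finally show ?thesis using R by (simp add: q_def)
  qed
  have "continuous_on UNIV (\<lambda>g. s (q g))"
  proof (rule continuous_on_compose2[OF s(1)])
    show "continuous_on UNIV q" unfolding q_def by (intro continuous_intros)
  qed (use q in auto)
  then have ch: "continuous_on UNIV h" unfolding h_def by (intro continuous_intros)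
  have hc: "h \<in> c0_set"
  proof (rule c0_setI[OF ch])
    fix \<epsilon> :: real assume "\<epsilon> > 0"
    then have "\<epsilon>\<^sup>2 > 0" by simp
    then obtain K where K: "compact K" "\<And>g. g \<notin> K \<Longrightarrow> norm (apply_c0 p g) < \<epsilon>\<^sup>2"
      using c0_setD[OF apply_c0[of p]] by blast
    have "norm (h g) < \<epsilon>" if "g \<notin> K" for g
    proof -
      have "(norm (h g))\<^sup>2 < \<epsilon>\<^sup>2" using K(2)[OF that] by (simp add: hh[symmetric] cstar_identity)
      then show ?thesis using \<open>\<epsilon> > 0\<close> by (meson less_imp_le power_less_imp_less_base)
    qed
    then show "\<exists>K. compact K \<and> (\<forall>g. g \<notin> K \<longrightarrow> norm (h g) < \<epsilon>)" using K(1) by blast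
  qed
  have "p = star (Abs_c0 h) * Abs_c0 h"
    by (rule c0_eqI) (simp add: times_c0.rep_eq star_c0.rep_eq Abs_c0_inverse[OF hc] hh)
  then show ?thesis by (auto simp: positive_def)
qed

lemma c0_pair:
  fixes f :: "('g::topological_space, 'a::real_normed_vector) c0" and h :: "('g, 'b::real_normed_vector) c0"
  shows "(\<lambda>g. (apply_c0 f g, apply_c0 h g)) \<in> c0_set"
proof (rule c0_setI)
  show "continuous_on UNIV (\<lambda>g. (apply_c0 f g, apply_c0 h g))" by (intro continuous_intros)
  fix \<epsilon> :: real assume "\<epsilon> > 0"
  then have e: "\<epsilon> / 2 > 0" by simp
  obtain K where K: "compact K" "\<And>x. x \<notin> K \<Longrightarrow> norm (apply_c0 f x) < \<epsilon> / 2"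
    using c0_setD[OF apply_c0[of f] e] by blast
  obtain L where L: "compact L" "\<And>x. x \<notin> L \<Longrightarrow> norm (apply_c0 h x) < \<epsilon> / 2"
    using c0_setD[OF apply_c0[of h] e] by blast
  have "norm (apply_c0 f x, apply_c0 h x) < \<epsilon>" if "x \<notin> K \<union> L" for x
    using K(2)[of x] L(2)[of x] that norm_Pair_le[of "apply_c0 f x" "apply_c0 h x"] by simp
  then show "\<exists>K. compact K \<and> (\<forall>x. x \<notin> K \<longrightarrow> norm (apply_c0 f x, apply_c0 h x) < \<epsilon>)"
    using compact_Un[OF K(1) L(1)] by blast
qed

lemma rmult_c0_in: "(\<lambda>g. apply_c0 c g *\<^sub>C apply_c0 f g) \<in> c0_set"
  for c :: "('g::topological_space, complex) c0" and f :: "('g, 'v::cbanach) c0"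
proof (rule c0_set_dominated[OF _ apply_c0[of f]])
  show "norm (apply_c0 c g *\<^sub>C apply_c0 f g) \<le> norm c * norm (apply_c0 f g)" for g
    by (simp add: norm_scaleC mult_right_mono norm_c0_ge)
  have "bounded_bilinear (\<lambda>(c::complex) (x::'v). c *\<^sub>C x)"
    by standard (auto simp: scaleC_add_left scaleC_add_right scaleR_scaleC scaleC_scaleC
        scaleC_complex_def norm_scaleC mult.commute intro!: exI[of _ 1])
  then show "continuous_on UNIV (\<lambda>g. apply_c0 c g *\<^sub>C apply_c0 f g)"
    by (rule bounded_bilinear.continuous_on) (intro continuous_intros)+
qed

definition c0_scale :: "('g::topological_space, complex) c0 \<Rightarrow> ('g, 'v::cbanach) c0 \<Rightarrow> ('g, 'v) c0" where
  "c0_scale c f = Abs_c0 (\<lambda>g. apply_c0 c g *\<^sub>C apply_c0 f g)"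

lemma apply_c0_scale [simp]: "apply_c0 (c0_scale c f) g = apply_c0 c g *\<^sub>C apply_c0 f g"
  by (simp add: c0_scale_def Abs_c0_inverse[OF rmult_c0_in])

lemma bounded_linear_c0_scale: "bounded_linear (c0_scale c)"
proof (rule bounded_linear_intro[where K = "norm c"])
  show "c0_scale c (x + y) = c0_scale c x + c0_scale c y" for x y :: "('a, 'b) c0"
    by (rule c0_eqI) (simp add: plus_c0.rep_eq scaleC_add_right)
  show "c0_scale c (r *\<^sub>R x) = r *\<^sub>R c0_scale c x" for r and x :: "('a, 'b) c0"
    by (rule c0_eqI) (simp only: apply_c0_scale scaleR_c0.rep_eq, simp add: scaleR_scaleC scaleC_scaleC mult.commute)
  show "norm (c0_scale c x) \<le> norm x * norm c" for x :: "('a, 'b) c0"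
    by (rule norm_c0_le) (simp add: norm_scaleC mult.commute mult_mono norm_c0_ge)
qed

lemma apply_c0_tensor: "apply_c0 (c0_tensor x c) g = apply_c0 c g *\<^sub>C x"
  by (simp add: c0_tensor.rep_eq)

lemma clinear_c0_tensor: "clinear (c0_tensor x)" "clinear (\<lambda>x. c0_tensor x c)"
  unfolding clinear_def
  by (auto intro!: c0_eqI simp: apply_c0_tensor plus_c0.rep_eq scaleC_c0.rep_eq scaleC_add_left
      scaleC_add_right scaleC_scaleC scaleC_complex_def mult.commute)

definition cut :: "('g::topological_space \<Rightarrow> real) \<Rightarrow> ('g, complex) c0" where
  "cut \<phi> = Abs_c0 (\<lambda>g. complex_of_real (\<phi> g))"

lemma Cc_of_real: "\<phi> \<in> Cc \<Longrightarrow> (\<lambda>g. complex_of_real (\<phi> g)) \<in> Cc"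
  by (rule Cc_bounded_linear[OF bounded_linear_of_real])

lemma apply_cut [simp]: "\<phi> \<in> Cc \<Longrightarrow> apply_c0 (cut \<phi>) g = complex_of_real (\<phi> g)"
  by (simp add: cut_def Cc_of_real)

lemma cut_Cc: "\<phi> \<in> Cc \<Longrightarrow> apply_c0 (cut \<phi>) \<in> Cc"
  by (simp add: cut_def Cc_of_real)

lemma scale_cut [simp]: "\<phi> \<in> Cc \<Longrightarrow> apply_c0 (cut \<phi>) g *\<^sub>C x = \<phi> g *\<^sub>R (x::'v::cbanach)"
  by (simp add: scaleR_scaleC)

lemma c0_tensor_cut: "\<phi> \<in> Cc \<Longrightarrow> c0_tensor v (cut \<phi>) = Abs_c0 (\<lambda>g. \<phi> g *\<^sub>R v)"
proof (rule c0_eqI)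
  fix g assume \<phi>: "\<phi> \<in> Cc"
  have "(\<lambda>g. \<phi> g *\<^sub>R v) \<in> Cc" by (rule Cc_scaleR[OF \<phi>]) simp
  then show "apply_c0 (c0_tensor v (cut \<phi>)) g = apply_c0 (Abs_c0 (\<lambda>g. \<phi> g *\<^sub>R v)) g"
    by (simp add: apply_c0_tensor \<phi> del: apply_cut)
qed

lemma Cc_c0_scale: "apply_c0 c \<in> Cc \<Longrightarrow> apply_c0 (c0_scale c f) \<in> Cc"
  by (rule Cc_dominated[where f = "apply_c0 c", OF continuous_on_c0]) simp_all

context lc_space
begin

lemma closure_span_c0_tensor:
  "closure (span {c0_tensor x c |x (c::('g, complex) c0). True}) = (UNIV :: ('g, 'v::cbanach) c0 set)"
proof (rule equalityI[OF subset_UNIV subsetI])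
  fix f :: "('g, 'v) c0"
  show "f \<in> closure (span {c0_tensor x c |x c. True})"
    by (rule span_tensors_dense[OF subspace_UNIV]) (auto simp: c0_tensor_cut[symmetric])
qed

lemma blinfun_eq_on_tensors:
  fixes R S :: "('g, 'v::cbanach) c0 \<Rightarrow>\<^sub>L 'w::real_normed_vector"
  assumes "\<And>x c. blinfun_apply R (c0_tensor x c) = blinfun_apply S (c0_tensor x c)"
  shows "R = S"
proof (rule blinfun_eqI)
  fix f :: "('g, 'v) c0"
  have "span {c0_tensor x c |x (c::('g, complex) c0). True} \<subseteq> {f. blinfun_apply R f = blinfun_apply S f}"
    by (rule span_minimal) (auto simp: assms subspace_def blinfun.add_right blinfun.scaleR_right)
  moreover have "closed {f. blinfun_apply R f = blinfun_apply S f}"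
    by (intro closed_Collect_eq continuous_intros)
  ultimately have "closure (span {c0_tensor x c |x (c::('g, complex) c0). True}) \<subseteq>
      {f. blinfun_apply R f = blinfun_apply S f}"
    by (rule closure_minimal)
  then show "blinfun_apply R f = blinfun_apply S f" unfolding closure_span_c0_tensor by blast
qed

lemma rmult_c0_tensor:
  "blinfun_apply (rmult (c0_tensor :: 'v::cbanach \<Rightarrow> ('g, complex) c0 \<Rightarrow> ('g, 'v) c0) c) f = c0_scale c f"
proof -
  let ?R = "Blinfun (c0_scale c) :: ('g, 'v) c0 \<Rightarrow>\<^sub>L ('g, 'v) c0"
  have R: "blinfun_apply ?R f = c0_scale c f" for f
    by (simp add: bounded_linear_Blinfun_apply[OF bounded_linear_c0_scale])
  have t: "c0_scale c (c0_tensor x d) = c0_tensor x (d * c)" for x :: 'v and d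
    by (rule c0_eqI) (simp add: apply_c0_tensor scaleC_scaleC times_c0.rep_eq mult.commute)
  have "rmult c0_tensor c = ?R"
    unfolding rmult_def
  proof (rule the_equality)
    show "\<forall>x d. blinfun_apply ?R (c0_tensor x d) = c0_tensor x (d * c)" by (simp add: R t)
    fix S :: "('g, 'v) c0 \<Rightarrow>\<^sub>L ('g, 'v) c0"
    assume "\<forall>x d. blinfun_apply S (c0_tensor x d) = c0_tensor x (d * c)"
    then show "S = ?R" by (intro blinfun_eq_on_tensors) (simp add: R t)
  qed
  then show ?thesis by (simp add: R)
qed

end

definition pointwise :: "('g::topological_space \<Rightarrow> 'e::real_normed_vector uop) \<Rightarrow> ('g, 'e) c0 uop" where
  "pointwise T = {(f, h). \<forall>g. (apply_c0 f g, apply_c0 h g) \<in> T g}"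

lemma c0_multiplication_pointwise: "c0_multiplication Z = pointwise (\<lambda>g. graph (blinfun_apply (Z g)))"
  by (auto simp: c0_multiplication_def pointwise_def graph_def)

lemma closed_pointwise:
  fixes T :: "'g::topological_space \<Rightarrow> 'e::real_normed_vector uop"
  assumes "\<And>g. closed (T g)"
  shows "closed (pointwise T)"
proof -
  have "pointwise T = (\<Inter>g. (\<lambda>p. (apply_c0 (fst p) g, apply_c0 (snd p) g)) -` T g)"
    by (auto simp: pointwise_def)
  moreover have "continuous_on UNIV (\<lambda>p::('g, 'e) c0 \<times> ('g, 'e) c0. (apply_c0 (fst p) g, apply_c0 (snd p) g))" for g
    by (intro continuous_on_Pair bounded_linear.continuous_on[OF bounded_linear_apply_c0]
        continuous_on_fst continuous_on_snd continuous_on_id)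
  ultimately show ?thesis
    using assms by (auto intro!: closed_INT closed_vimage)
qed

lemma closed_graph_blinfun: "closed (graph (blinfun_apply (Z :: 'a::real_normed_vector \<Rightarrow>\<^sub>L 'a)))"
proof -
  have "graph (blinfun_apply Z) = {p. snd p = blinfun_apply Z (fst p)}" by (auto simp: graph_def)
  then show ?thesis by (auto intro!: closed_Collect_eq continuous_intros)
qed

lemma closed_c0_multiplication: "closed (c0_multiplication Z)"
  unfolding c0_multiplication_pointwise by (rule closed_pointwise) (rule closed_graph_blinfun)

context lc_space
begin

text \<open>A pair \<open>(f, h)\<close> with values in the graph of \<open>D\<close> is a function with values in a closed subspace of
  \<open>E \<times> E\<close>, hence a limit of sums of tensors with elements of that subspace.\<close>

lemma amplify_c0:
  fixes D :: "'e::cbanach uop"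
  assumes "subspace D" "closed D" and sc: "\<And>c x y. (x, y) \<in> D \<Longrightarrow> (c *\<^sub>C x, c *\<^sub>C y) \<in> D"
  shows "amplify (c0_tensor :: 'e \<Rightarrow> ('g, complex) c0 \<Rightarrow> ('g, 'e) c0) D = pointwise (\<lambda>_. D)"
    (is "amplify ?\<theta> D = ?P")
proof
  let ?S = "{(?\<theta> x c, ?\<theta> y c) |x y c. (x, y) \<in> D}"
  have "subspace ?P"
    unfolding subspace_def pointwise_def
    using subspace_0[OF assms(1)] subspace_add[OF assms(1)] subspace_scale[OF assms(1)]
    by (force simp: zero_c0.rep_eq plus_c0.rep_eq scaleR_c0.rep_eq zero_prod_def)
  then have "span ?S \<subseteq> ?P"
    by (intro span_minimal) (auto simp: pointwise_def apply_c0_tensor intro: sc)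
  then show "amplify ?\<theta> D \<subseteq> ?P"
    unfolding amplify_def by (rule closure_minimal) (rule closed_pointwise[OF assms(2)])
  show "?P \<subseteq> amplify ?\<theta> D"
  proof clarify
    fix f h :: "('g, 'e) c0" assume fh: "(f, h) \<in> ?P"
    define k where "k = Abs_c0 (\<lambda>g. (apply_c0 f g, apply_c0 h g))"
    have ak: "apply_c0 k g = (apply_c0 f g, apply_c0 h g)" for g
      by (simp add: k_def Abs_c0_inverse[OF c0_pair])
    let ?p = "\<lambda>k :: ('g, 'e \<times> 'e) c0. (Abs_c0 (\<lambda>g. fst (apply_c0 k g)), Abs_c0 (\<lambda>g. snd (apply_c0 k g)))"
    have 1: "apply_c0 (Abs_c0 (\<lambda>g. fst (apply_c0 k g))) g = fst (apply_c0 k g)"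
      "apply_c0 (Abs_c0 (\<lambda>g. snd (apply_c0 k g))) g = snd (apply_c0 k g)" for g and k :: "('g, 'e \<times> 'e) c0"
      by (simp_all add: Abs_c0_inverse c0_set_bounded_linear[OF bounded_linear_fst apply_c0]
          c0_set_bounded_linear[OF bounded_linear_snd apply_c0])
    have bl: "bounded_linear ?p"
    proof (rule bounded_linear_Pair)
      show "bounded_linear (\<lambda>k :: ('g, 'e \<times> 'e) c0. Abs_c0 (\<lambda>g. fst (apply_c0 k g)))"
      proof (rule bounded_linear_intro[where K = 1])
        fix x :: "('g, 'e \<times> 'e) c0"
        show "norm (Abs_c0 (\<lambda>g. fst (apply_c0 x g))) \<le> norm x * 1"
          using norm_fst_le[of "fst (apply_c0 x g)" "snd (apply_c0 x g)" for g] norm_c0_ge[of x]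
          by (intro norm_c0_le) (simp add: 1, meson order_trans)
      qed (rule c0_eqI, simp only: 1, simp only: 1 plus_c0.rep_eq scaleR_c0.rep_eq,
          simp only: fst_add snd_add fst_scaleR snd_scaleR)+
      show "bounded_linear (\<lambda>k :: ('g, 'e \<times> 'e) c0. Abs_c0 (\<lambda>g. snd (apply_c0 k g)))"
      proof (rule bounded_linear_intro[where K = 1])
        fix x :: "('g, 'e \<times> 'e) c0"
        show "norm (Abs_c0 (\<lambda>g. snd (apply_c0 x g))) \<le> norm x * 1"
          using norm_snd_le[of "snd (apply_c0 x g)" "fst (apply_c0 x g)" for g] norm_c0_ge[of x]
          by (intro norm_c0_le) (simp add: 1, meson order_trans)
      qed (rule c0_eqI, simp only: 1, simp only: 1 plus_c0.rep_eq scaleR_c0.rep_eq,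
          simp only: fst_add snd_add fst_scaleR snd_scaleR)+
    qed
    let ?V = "{Abs_c0 (\<lambda>g. \<phi> g *\<^sub>R v) |\<phi> v. \<phi> \<in> Cc \<and> v \<in> D} :: ('g, 'e \<times> 'e) c0 set"
    have "?p ` ?V \<subseteq> ?S"
    proof clarify
      fix \<phi> :: "'g \<Rightarrow> real" and x y assume \<phi>: "\<phi> \<in> Cc" and xy: "(x, y) \<in> D"
      have m: "(\<lambda>g. \<phi> g *\<^sub>R (x, y)) \<in> Cc" by (rule Cc_scaleR[OF \<phi>]) simp
      have "?p (Abs_c0 (\<lambda>g. \<phi> g *\<^sub>R (x, y))) = (?\<theta> x (cut \<phi>), ?\<theta> y (cut \<phi>))"
        using m by (simp add: c0_tensor_cut[OF \<phi>])
      then show "\<exists>x' y' c. ?p (Abs_c0 (\<lambda>g. \<phi> g *\<^sub>R (x, y))) = (?\<theta> x' c, ?\<theta> y' c) \<and> (x', y') \<in> D"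
        using xy by blast
    qed
    have "k \<in> closure (span ?V)"
    proof (rule span_tensors_dense[OF assms(1)])
      show "apply_c0 k x \<in> D" for x using fh by (simp add: ak pointwise_def)
    qed blast
    then have "?p k \<in> ?p ` closure (span ?V)" by blast
    also have "\<dots> \<subseteq> closure (?p ` span ?V)"
      using closure_bounded_linear_image_subset[OF bl] by blast
    also have "?p ` span ?V = span (?p ` ?V)"
      by (rule linear_span_image[symmetric]) (rule bounded_linear.linear[OF bl])
    also have "closure (span (?p ` ?V)) \<subseteq> closure (span ?S)"
      using \<open>?p ` ?V \<subseteq> ?S\<close> by (intro closure_mono span_mono)
    finally have "?p k \<in> amplify ?\<theta> D" by (simp add: amplify_def)
    moreover have "?p k = (f, h)" by (simp add: ak apply_c0_inverse)
    ultimately show "(f, h) \<in> amplify ?\<theta> D" by simp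
  qed
qed

end

section \<open>Multiplication operators on \<open>C\<^sub>0(G, E)\<close>\<close>

context hmod
begin

lemma bounded_bilinear_rmul: "bounded_bilinear (rmul E)"
proof
  note l = clinear_add[OF rmul_clinear(2)] clinear_scaleR[OF rmul_clinear(2)]
    and r = clinear_add[OF rmul_clinear(1)] clinear_scaleR[OF rmul_clinear(1)]
  show "rmul E (a + a') b = rmul E a b + rmul E a' b" for a a' b by (rule l)
  show "rmul E a (b + b') = rmul E a b + rmul E a b'" for a b b' by (rule r)
  show "rmul E (c *\<^sub>R a) b = c *\<^sub>R rmul E a b" for c a b by (rule l)
  show "rmul E a (c *\<^sub>R b) = c *\<^sub>R rmul E a b" for c a b by (rule r)
  show "\<exists>K. \<forall>a b. norm (rmul E a b) \<le> norm a * norm b * K"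
    by (intro exI[of _ 1]) (simp add: norm_rmul)
qed

lemma c0_module_apply:
  fixes f h :: "('g::topological_space, 'e) c0" and b :: "('g, 'b) c0"
  shows apply_rmul_c0: "apply_c0 (rmul (c0_module E) f b) g = rmul E (apply_c0 f g) (apply_c0 b g)"
    and apply_inn_c0: "apply_c0 (inn (c0_module E) f h) g = inn E (apply_c0 f g) (apply_c0 h g)"
proof -
  have "(\<lambda>g. rmul E (apply_c0 f g) (apply_c0 b g)) \<in> c0_set"
  proof (rule c0_set_dominated[OF _ apply_c0[of f]])
    show "continuous_on UNIV (\<lambda>g. rmul E (apply_c0 f g) (apply_c0 b g))"
      by (rule bounded_bilinear.continuous_on[OF bounded_bilinear_rmul]) (intro continuous_intros)+
    show "norm (rmul E (apply_c0 f g) (apply_c0 b g)) \<le> norm b * norm (apply_c0 f g)" for g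
      using norm_rmul[of "apply_c0 f g" "apply_c0 b g"] mult_left_mono[OF norm_c0_ge[of b g] norm_ge_zero[of "apply_c0 f g"]]
      by (simp add: mult.commute)
  qed
  then show "apply_c0 (rmul (c0_module E) f b) g = rmul E (apply_c0 f g) (apply_c0 b g)"
    by (simp add: c0_module_def Abs_c0_inverse)
  have "(\<lambda>g. inn E (apply_c0 f g) (apply_c0 h g)) \<in> c0_set"
  proof (rule c0_set_dominated[OF _ apply_c0[of f]])
    show "continuous_on UNIV (\<lambda>g. inn E (apply_c0 f g) (apply_c0 h g))"
      by (rule bounded_bilinear.continuous_on[OF bounded_bilinear_inn]) (intro continuous_intros)+
    show "norm (inn E (apply_c0 f g) (apply_c0 h g)) \<le> norm h * norm (apply_c0 f g)" for g
      using cauchy_schwarz[of "apply_c0 f g" "apply_c0 h g"] mult_left_mono[OF norm_c0_ge[of h g] norm_ge_zero[of "apply_c0 f g"]]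
      by (simp add: mult.commute)
  qed
  then show "apply_c0 (inn (c0_module E) f h) g = inn E (apply_c0 f g) (apply_c0 h g)"
    by (simp add: c0_module_def Abs_c0_inverse)
qed

lemma hilbert_c0_module:
  "hilbert_module (c0_module E :: (('g::topological_space, 'e) c0, ('g, 'b) c0) hmodule)"
  unfolding hilbert_module_def
proof (intro conjI allI)
  note simps = apply_rmul_c0 apply_inn_c0 plus_c0.rep_eq scaleC_c0.rep_eq times_c0.rep_eq star_c0.rep_eq
  let ?F = "c0_module E :: (('g, 'e) c0, ('g, 'b) c0) hmodule"
  fix x y :: "('g, 'e) c0" and a b :: "('g, 'b) c0"
  show "clinear (rmul ?F x)" unfolding clinear_def
    by (auto intro!: c0_eqI simp: simps clinear_add[OF rmul_clinear(1)] clinear_scaleC[OF rmul_clinear(1)])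
  show "clinear (\<lambda>x. rmul ?F x b)" unfolding clinear_def
    by (auto intro!: c0_eqI simp: simps clinear_add[OF rmul_clinear(2)] clinear_scaleC[OF rmul_clinear(2)])
  show "rmul ?F (rmul ?F x a) b = rmul ?F x (a * b)"
    by (rule c0_eqI) (simp add: simps rmul_rmul)
  show "clinear (inn ?F x)" unfolding clinear_def
    by (auto intro!: c0_eqI simp: simps inn_add_right inn_scaleC_right)
  show "inn ?F x (rmul ?F y b) = inn ?F x y * b"
    by (rule c0_eqI) (simp add: simps inn_rmul_right)
  show "star (inn ?F x y) = inn ?F y x"
    by (rule c0_eqI) (simp add: simps star_inn)
  show "positive (inn ?F x x)"
    by (rule positive_c0) (simp add: simps positive_inn)
  have "norm (inn ?F x x) = norm x * norm x"
  proof (rule antisym)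
    show "norm (inn ?F x x) \<le> norm x * norm x"
      by (rule norm_c0_le) (simp add: simps norm_inn_self mult_mono norm_c0_ge)
    have "norm x \<le> sqrt (norm (inn ?F x x))"
    proof (rule norm_c0_le)
      fix g
      have "(norm (apply_c0 x g))\<^sup>2 \<le> norm (inn ?F x x)"
        using norm_c0_ge[of "inn ?F x x" g] by (simp add: simps norm_inn_self power2_eq_square)
      then show "norm (apply_c0 x g) \<le> sqrt (norm (inn ?F x x))" by (rule real_le_rsqrt)
    qed
    then show "norm x * norm x \<le> norm (inn ?F x x)"
      using mult_mono[of "norm x" "sqrt (norm (inn ?F x x))" "norm x" "sqrt (norm (inn ?F x x))"] by simp
  qed
  then show "norm x = sqrt (norm (inn ?F x x))" by simp
qed

text \<open>\<open>1 + Z\<^sup>* Z\<close> is bounded below by \<open>1\<close>, and is surjective by continuation along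
  \<open>1 + t Z\<^sup>* Z\<close> in finitely many contraction steps.\<close>

lemma one_plus_square_below:
  assumes "adjointable E Z" "0 \<le> t"
  shows "norm x \<le> norm (x + t *\<^sub>R blinfun_apply (adj E Z) (blinfun_apply Z x))"
proof (cases "x = 0")
  case False
  let ?y = "x + t *\<^sub>R blinfun_apply (adj E Z) (blinfun_apply Z x)"
  obtain \<phi> where \<phi>: "state \<phi>" "\<phi> (inn E x x) = complex_of_real ((norm x)\<^sup>2)"
    using norming_state_inn[OF False] by blast
  have "inn E x ?y = inn E x x + t *\<^sub>R inn E (blinfun_apply Z x) (blinfun_apply Z x)"
    by (simp add: inn_add_right inn_scaleR_right adj_right[OF assms(1)])
  then have "Re (\<phi> (inn E x ?y)) = (norm x)\<^sup>2 + t * Re (\<phi> (inn E (blinfun_apply Z x) (blinfun_apply Z x)))"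
    using \<phi>(2) by (simp add: clinear_add[OF state_clinear[OF \<phi>(1)]] clinear_scaleR[OF state_clinear[OF \<phi>(1)]])
  then have "(norm x)\<^sup>2 \<le> Re (\<phi> (inn E x ?y))"
    using assms(2) state_nonneg[OF \<phi>(1) positive_inn[of "blinfun_apply Z x"]] by simp
  also have "\<dots> \<le> norm (inn E x ?y)"
    using state_norm[OF \<phi>(1), of "inn E x ?y"] complex_Re_le_cmod[of "\<phi> (inn E x ?y)"] by linarith
  also have "\<dots> \<le> norm x * norm ?y" by (rule cauchy_schwarz)
  finally show ?thesis using False by (simp add: power2_eq_square)
qed simp

lemma one_plus_square_surj:
  assumes Z: "adjointable E Z"
  obtains r where "\<And>y. r y + blinfun_apply (adj E Z) (blinfun_apply Z (r y)) = y"
proof -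
  define K where "K = adj E Z o\<^sub>L Z"
  define k where "k = norm K"
  obtain n :: nat where n: "2 * k < real n" using reals_Archimedean2 by blast
  then have n0: "real n > 0" using norm_ge_zero[of K] unfolding k_def by linarith
  \<comment> \<open>the step length of the continuation; a step is solved by a contraction with constant \<open>1/2\<close>\<close>
  define \<delta> where "\<delta> = 1 / real n"
  have \<delta>: "0 \<le> \<delta>" "\<delta> * k \<le> 1 / 2" using n n0 by (auto simp: \<delta>_def field_simps)
  have below: "norm x \<le> norm (x + t *\<^sub>R blinfun_apply K x)" if "0 \<le> t" for t x
    using one_plus_square_below[OF Z that, of x] by (simp add: K_def)
  have "\<forall>y. \<exists>x. x + (real m * \<delta>) *\<^sub>R blinfun_apply K x = y" for m
  proof (induction m)
    case (Suc m)
    from choice[OF this] obtain r where r: "\<And>y. r y + (real m * \<delta>) *\<^sub>R blinfun_apply K (r y) = y" by blast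
    have lip: "dist (r y) (r y') \<le> dist y y'" for y y'
    proof -
      have "(r y - r y') + (real m * \<delta>) *\<^sub>R blinfun_apply K (r y - r y') = y - y'"
        using r[of y] r[of y'] by (simp add: blinfun.diff_right scaleR_diff_right) (metis add_diff_add)
      then show ?thesis using below[of "real m * \<delta>" "r y - r y'"] \<delta>(1) by (simp add: dist_norm)
    qed
    show ?case
    proof
      fix y
      let ?f = "\<lambda>x. r (y - \<delta> *\<^sub>R blinfun_apply K x)"
      have "dist (?f x) (?f x') \<le> 1/2 * dist x x'" for x x'
      proof -
        have "dist (?f x) (?f x') \<le> dist (y - \<delta> *\<^sub>R blinfun_apply K x) (y - \<delta> *\<^sub>R blinfun_apply K x')"
          by (rule lip)
        also have "\<dots> = norm (\<delta> *\<^sub>R blinfun_apply K (x' - x))"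
          by (simp add: dist_norm blinfun.diff_right scaleR_diff_right)
        also have "\<dots> \<le> \<delta> * (k * norm (x' - x))"
          using \<delta>(1) norm_blinfun[of K "x' - x"] by (simp add: k_def mult_left_mono)
        also have "\<dots> \<le> 1/2 * norm (x' - x)"
          using mult_right_mono[OF \<delta>(2), of "norm (x' - x)"] by (simp add: mult.assoc)
        finally show ?thesis by (simp add: dist_norm norm_minus_commute)
      qed
      then have "\<exists>!x. ?f x = x" by (intro banach_fix_type[of "1/2"]) auto
      then obtain x where x: "?f x = x" by blast
      have "x + (real m * \<delta>) *\<^sub>R blinfun_apply K x = y - \<delta> *\<^sub>R blinfun_apply K x"
        using r[of "y - \<delta> *\<^sub>R blinfun_apply K x"] unfolding x .
      then have "x + (real (Suc m) * \<delta>) *\<^sub>R blinfun_apply K x = y"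
        by (simp add: algebra_simps scaleR_add_left)
      then show "\<exists>x. x + (real (Suc m) * \<delta>) *\<^sub>R blinfun_apply K x = y" by blast
    qed
  qed simp
  from this[of n] have "\<forall>y. \<exists>x. x + blinfun_apply K x = y" using n0 by (simp add: \<delta>_def)
  from choice[OF this] obtain r where "\<And>y. r y + blinfun_apply K (r y) = y" by blast
  then show thesis using that[of r] by (simp add: K_def)
qed

end

locale c0_setting = hmod E + lc_space dom
  for E :: "('e::cbanach, 'b::cstar_algebra) hmodule" and dom :: "'g::t2_space itself"
begin

abbreviation "\<theta> \<equiv> (c0_tensor :: 'e \<Rightarrow> ('g, complex) c0 \<Rightarrow> ('g, 'e) c0)"
abbreviation "F \<equiv> (c0_module E :: (('g, 'e) c0, ('g, 'b) c0) hmodule)"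

sublocale F: hmod F
  by standard (rule hilbert_c0_module)

lemma ext_tensor_c0: "ext_tensor (c0_tensor :: 'b \<Rightarrow> ('g, complex) c0 \<Rightarrow> ('g, 'b) c0) E \<theta> F"
  unfolding ext_tensor_def
proof (intro conjI allI)
  show "rmul F (\<theta> x c) (c0_tensor b d) = \<theta> (rmul E x b) (c * d)" for x c b d
    by (rule c0_eqI) (simp add: apply_rmul_c0 apply_c0_tensor times_c0.rep_eq scaleC_scaleC
        clinear_scaleC[OF rmul_clinear(1)] clinear_scaleC[OF rmul_clinear(2)] mult.commute)
  show "inn F (\<theta> x c) (\<theta> y d) = c0_tensor (inn E x y) (star c * d)" for x c y d
    by (rule c0_eqI) (simp add: apply_inn_c0 apply_c0_tensor times_c0.rep_eq star_c0.rep_eq star_complex_def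
        scaleC_scaleC inn_scaleC_left inn_scaleC_right mult.commute)
qed (rule hilbert_c0_module clinear_c0_tensor closure_span_c0_tensor)+

lemma strongly_continuous_star:
  assumes "star_strongly_continuous E (Z :: 'g \<Rightarrow> 'e \<Rightarrow>\<^sub>L 'e)"
  shows "strongly_continuous Z" "strongly_continuous (\<lambda>g. adj E (Z g))" "adjointable E (Z g)"
  using assms by (auto simp: star_strongly_continuous_def strongly_continuous_def)

lemma star_strongly_continuousI:
  fixes Z :: "'g \<Rightarrow> 'e \<Rightarrow>\<^sub>L 'e"
  assumes "strongly_continuous Z" "strongly_continuous (\<lambda>g. adj E (Z g))" "\<And>g. adjointable E (Z g)"
  shows "star_strongly_continuous E Z"
  using assms by (auto simp: star_strongly_continuous_def strongly_continuous_def)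

lemma ssc_adj: "star_strongly_continuous E (Z :: 'g \<Rightarrow> _) \<Longrightarrow> star_strongly_continuous E (\<lambda>g. adj E (Z g))"
  using strongly_continuous_star[of Z]
  by (intro star_strongly_continuousI) (simp_all add: adj_adj adjointable_adj)

lemma ssc_compose:
  fixes Y Z :: "'g \<Rightarrow> 'e \<Rightarrow>\<^sub>L 'e"
  assumes "star_strongly_continuous E Y" "star_strongly_continuous E Z"
  shows "star_strongly_continuous E (\<lambda>g. Y g o\<^sub>L Z g)"
  using strongly_continuous_star[OF assms(1)] strongly_continuous_star[OF assms(2)]
  by (intro star_strongly_continuousI) (simp_all add: strongly_continuous_compose adj_compose adjointable_compose)

lemma ssc_add:
  fixes Y Z :: "'g \<Rightarrow> 'e \<Rightarrow>\<^sub>L 'e"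
  assumes "star_strongly_continuous E Y" "star_strongly_continuous E Z"
  shows "star_strongly_continuous E (\<lambda>g. Y g + Z g)"
  using assms unfolding star_strongly_continuous_def
  by (simp add: adj_add adjointable_add blinfun.add_left continuous_on_add)

lemma ssc_minus:
  fixes Z :: "'g \<Rightarrow> 'e \<Rightarrow>\<^sub>L 'e"
  assumes "star_strongly_continuous E Z"
  shows "star_strongly_continuous E (\<lambda>g. - Z g)"
  using assms unfolding star_strongly_continuous_def
  by (simp add: adj_minus adjointable_minus blinfun.minus_left continuous_on_minus)

lemma ssc_const: "adjointable E T \<Longrightarrow> star_strongly_continuous E (\<lambda>_::'g. T)"
  by (simp add: star_strongly_continuous_def)

lemma Cc_apply:
  fixes Z :: "'g \<Rightarrow> 'e \<Rightarrow>\<^sub>L 'e"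
  assumes "strongly_continuous Z" "f \<in> Cc"
  shows "(\<lambda>g. blinfun_apply (Z g) (f g)) \<in> Cc"
  by (rule Cc_dominated[OF strongly_continuous_apply[OF assms(1) Cc_continuous[OF assms(2)]] assms(2)])
    (simp add: blinfun.zero_right)

lemma c0_multiplication_Cc:
  fixes Z :: "'g \<Rightarrow> 'e \<Rightarrow>\<^sub>L 'e"
  assumes "strongly_continuous Z" "apply_c0 f \<in> Cc"
  shows "(f, Abs_c0 (\<lambda>g. blinfun_apply (Z g) (apply_c0 f g))) \<in> c0_multiplication Z"
  using Cc_apply[OF assms] by (simp add: c0_multiplication_def)

lemma Domain_c0_multiplication_dense:
  fixes Z :: "'g \<Rightarrow> 'e \<Rightarrow>\<^sub>L 'e"
  assumes "strongly_continuous Z"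
  shows "closure (Domain (c0_multiplication Z)) = UNIV"
proof -
  have "{f. apply_c0 f \<in> Cc} \<subseteq> Domain (c0_multiplication Z)"
    using c0_multiplication_Cc[OF assms] by blast
  then show ?thesis using closure_mono closure_Cc by blast
qed

text \<open>For the inclusion from left to right, test with the tensors \<open>e \<otimes> \<eta>\<close>, where \<open>\<eta>(g) = 1\<close>.\<close>

lemma op_adj_c0_multiplication:
  fixes Z :: "'g \<Rightarrow> 'e \<Rightarrow>\<^sub>L 'e"
  assumes "star_strongly_continuous E Z"
  shows "op_adj F (c0_multiplication Z) = c0_multiplication (\<lambda>g. adj E (Z g))"
proof (intro equalityI subrelI)
  note Z = strongly_continuous_star[OF assms]
  fix x y assume xy: "(x, y) \<in> op_adj F (c0_multiplication Z)"
  have "apply_c0 y g = blinfun_apply (adj E (Z g)) (apply_c0 x g)" for g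
  proof (rule inn_ext)
    fix e
    obtain \<eta> :: "'g \<Rightarrow> real" where \<eta>: "\<eta> \<in> Cc" "\<And>x. x \<in> {g} \<Longrightarrow> \<eta> x = 1"
      by (rule Urysohn_Cc[OF compact_sing open_UNIV subset_UNIV, of g]) (rule that)
    let ?u = "\<theta> e (cut \<eta>)"
    have u: "apply_c0 ?u \<in> Cc"
      using Cc_scaleR[OF \<eta>(1), of "\<lambda>_. e"] by (simp add: c0_tensor_cut \<eta>(1))
    have "inn F (Abs_c0 (\<lambda>g. blinfun_apply (Z g) (apply_c0 ?u g))) x = inn F ?u y"
      using xy c0_multiplication_Cc[OF Z(1) u] by (auto simp: op_adj_def)
    then have "apply_c0 (inn F (Abs_c0 (\<lambda>g. blinfun_apply (Z g) (apply_c0 ?u g))) x) g = apply_c0 (inn F ?u y) g"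
      by simp
    then have "inn E (blinfun_apply (Z g) e) (apply_c0 x g) = inn E e (apply_c0 y g)"
      using Cc_apply[OF Z(1) u] \<eta> by (simp add: apply_inn_c0 apply_c0_tensor)
    then show "inn E e (apply_c0 y g) = inn E e (blinfun_apply (adj E (Z g)) (apply_c0 x g))"
      by (simp add: adj_right[OF Z(3)])
  qed
  then show "(x, y) \<in> c0_multiplication (\<lambda>g. adj E (Z g))" by (simp add: c0_multiplication_def)
next
  fix x y assume "(x, y) \<in> c0_multiplication (\<lambda>g. adj E (Z g))"
  then show "(x, y) \<in> op_adj F (c0_multiplication Z)"
    by (auto simp: op_adj_def c0_multiplication_def apply_inn_c0 adj_right[OF strongly_continuous_star(3)[OF assms]]
        intro!: c0_eqI)
qed

lemma linear_op_c0_multiplication: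
  fixes Z :: "'g \<Rightarrow> 'e \<Rightarrow>\<^sub>L 'e"
  assumes "\<And>g. adjointable E (Z g)"
  shows "linear_op F (c0_multiplication Z)"
  unfolding linear_op_def
proof (intro conjI)
  show "single_valued (c0_multiplication Z)"
    by (auto simp: single_valued_def c0_multiplication_def intro: c0_eqI)
  show "subspace (c0_multiplication Z)"
    by (auto simp: subspace_def c0_multiplication_def zero_prod_def zero_c0.rep_eq plus_c0.rep_eq scaleR_c0.rep_eq
        blinfun.add_right blinfun.scaleR_right blinfun.zero_right)
  show "\<forall>(x, y)\<in>c0_multiplication Z. (\<forall>c. (c *\<^sub>C x, c *\<^sub>C y) \<in> c0_multiplication Z) \<and>
      (\<forall>b. (rmul F x b, rmul F y b) \<in> c0_multiplication Z)"
    by (auto simp: c0_multiplication_def scaleC_c0.rep_eq apply_rmul_c0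
        clinear_scaleC[OF adjointable_clinear[OF assms]] adjointable_rmul[OF assms])
qed

text \<open>Solve \<open>f(g) + Z\<^sub>g\<^sup>* Z\<^sub>g f(g) = h(g)\<close> pointwise, for compactly supported \<open>h\<close>. As \<open>1 + Z\<^sub>g\<^sup>* Z\<^sub>g\<close> is bounded
  below by \<open>1\<close> uniformly in \<open>g\<close>, the solution is continuous.\<close>

lemma regular_c0_multiplication:
  fixes Z :: "'g \<Rightarrow> 'e \<Rightarrow>\<^sub>L 'e"
  assumes "star_strongly_continuous E Z"
  shows "regular_op F (c0_multiplication Z)"
proof -
  note Z = strongly_continuous_star[OF assms]
  let ?T = "c0_multiplication Z"
  have adjT: "op_adj F ?T = c0_multiplication (\<lambda>g. adj E (Z g))" by (rule op_adj_c0_multiplication[OF assms])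
  have "{h. apply_c0 h \<in> Cc} \<subseteq> {x + z |x z. (x, z) \<in> ?T O op_adj F ?T}"
  proof clarify
    fix h :: "('g, 'e) c0" assume h: "apply_c0 h \<in> Cc"
    let ?K = "\<lambda>g x. blinfun_apply (adj E (Z g)) (blinfun_apply (Z g) x)"
    have "\<forall>g. \<exists>x. x + ?K g x = apply_c0 h g"
    proof
      fix g
      obtain r where "\<And>y. r y + ?K g (r y) = y" by (rule one_plus_square_surj[OF Z(3), of g]) (rule that)
      then show "\<exists>x. x + ?K g x = apply_c0 h g" by blast
    qed
    from choice[OF this] obtain f where f: "\<And>g. f g + ?K g (f g) = apply_c0 h g" by blast
    have below: "norm x \<le> norm (x + ?K g x)" for g x
      using one_plus_square_below[OF Z(3), of 1 x] by simp
    have cK: "continuous_on UNIV (\<lambda>g. ?K g x)" for x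
      using strongly_continuous_compose[OF Z(2,1)] by (simp add: strongly_continuous_def)
    have "continuous_on UNIV f"
      unfolding continuous_on_def
    proof
      fix g0
      let ?d = "\<lambda>g. apply_c0 h g - (f g0 + ?K g (f g0))"
      have "((\<lambda>g. f g - f g0) \<longlongrightarrow> 0) (at g0)"
      proof (rule Lim_null_comparison)
        show "\<forall>\<^sub>F g in at g0. norm (f g - f g0) \<le> norm (?d g)"
        proof (rule always_eventually, rule allI)
          fix g
          have "(f g - f g0) + ?K g (f g - f g0) = ?d g"
            by (simp add: blinfun.diff_right f[symmetric])
          then show "norm (f g - f g0) \<le> norm (?d g)" using below[of "f g - f g0" g] by (simp only:)
        qed
        have "continuous_on UNIV (\<lambda>g. norm (?d g))" by (intro continuous_intros cK)
        then have "((\<lambda>g. norm (?d g)) \<longlongrightarrow> norm (?d g0)) (at g0)" by (simp add: continuous_on_def)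
        then show "((\<lambda>g. norm (?d g)) \<longlongrightarrow> 0) (at g0)" by (simp add: f)
      qed
      then show "(f \<longlongrightarrow> f g0) (at g0 within UNIV)" by (simp add: LIM_zero_iff)
    qed
    moreover have "f g = 0" if "apply_c0 h g = 0" for g
      using below[of "f g" g] f[of g] that by simp
    ultimately have fc: "f \<in> Cc" using Cc_dominated[OF _ h, of f] by blast
    define f1 where "f1 = Abs_c0 f"
    define f2 where "f2 = Abs_c0 (\<lambda>g. blinfun_apply (Z g) (f g))"
    define f3 where "f3 = Abs_c0 (\<lambda>g. ?K g (f g))"
    have a: "apply_c0 f1 = f" "apply_c0 f2 = (\<lambda>g. blinfun_apply (Z g) (f g))" "apply_c0 f3 = (\<lambda>g. ?K g (f g))"
      using fc Cc_apply[OF Z(1) fc] Cc_apply[OF Z(2) Cc_apply[OF Z(1) fc]] by (simp_all add: f1_def f2_def f3_def)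
    have "(f1, f2) \<in> ?T" "(f2, f3) \<in> op_adj F ?T"
      unfolding adjT by (simp_all add: c0_multiplication_def a)
    moreover have "h = f1 + f3" by (rule c0_eqI) (simp add: plus_c0.rep_eq a f)
    ultimately show "\<exists>x z. h = x + z \<and> (x, z) \<in> ?T O op_adj F ?T" by blast
  qed
  then have "closure {x + z |x z. (x, z) \<in> ?T O op_adj F ?T} = UNIV"
    using closure_mono closure_Cc by blast
  then show ?thesis
    unfolding regular_op_def adjT
    using linear_op_c0_multiplication[of Z, OF Z(3)] closed_c0_multiplication Domain_c0_multiplication_dense[OF Z(1)]
      Domain_c0_multiplication_dense[OF Z(2)] by blast
qed

lemma matched_c0_multiplication:
  fixes Z :: "'g \<Rightarrow> 'e \<Rightarrow>\<^sub>L 'e"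
  assumes "star_strongly_continuous E Z"
  shows "matched \<theta> F (c0_multiplication Z)"
  unfolding matched_def
proof
  show "regular_op F (c0_multiplication Z)" by (rule regular_c0_multiplication[OF assms])
  have "{c. apply_c0 c \<in> Cc} \<subseteq> {c. range (blinfun_apply (rmult \<theta> c)) \<subseteq> Domain (c0_multiplication Z)}"
  proof clarify
    fix c :: "('g, complex) c0" and f :: "('g, 'e) c0" assume "apply_c0 c \<in> Cc"
    then have "apply_c0 (c0_scale c f) \<in> Cc" by (rule Cc_c0_scale)
    then show "blinfun_apply (rmult \<theta> c) f \<in> Domain (c0_multiplication Z)"
      using c0_multiplication_Cc[OF strongly_continuous_star(1)[OF assms]] unfolding rmult_c0_tensor by blast
  qed
  then show "closure {c. range (blinfun_apply (rmult \<theta> c)) \<subseteq> Domain (c0_multiplication Z)} = UNIV"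
    using closure_mono closure_Cc by blast
qed

lemma c0_multiplication_id: "c0_multiplication (\<lambda>_::'g. id_blinfun :: 'e \<Rightarrow>\<^sub>L 'e) = Id"
  by (auto simp: c0_multiplication_def intro: c0_eqI)

lemma matched_Id: "matched \<theta> F Id"
  unfolding c0_multiplication_id[symmetric] by (rule matched_c0_multiplication[OF ssc_const]) simp

lemma op_adj_Id: "op_adj F Id = Id"
  using op_adj_c0_multiplication[OF ssc_const[OF adjointable_id]] by (simp add: c0_multiplication_id)

lemma converse_c0_multiplication:
  fixes Z Y :: "'g \<Rightarrow> 'e \<Rightarrow>\<^sub>L 'e"
  assumes "\<And>g. inverse_of (Z g) (Y g)"
  shows "(c0_multiplication Z)\<inverse> = c0_multiplication Y"
proof -
  have "blinfun_apply (Y g) (blinfun_apply (Z g) x) = x" "blinfun_apply (Z g) (blinfun_apply (Y g) x) = x" for g x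
    using assms[of g] unfolding inverse_of_def
    by (metis blinfun_apply_blinfun_compose blinfun_apply_id_blinfun id_apply)+
  then show ?thesis by (auto simp: c0_multiplication_def)
qed

text \<open>The unbounded \<open>W\<close> is bounded on the support of a cut-off \<open>\<eta>\<close>, so after cutting off a small change of
  \<open>f\<close> changes \<open>W f\<close> by little.\<close>

lemma closure_eq_c0_multiplication:
  fixes W :: "'g \<Rightarrow> 'e \<Rightarrow>\<^sub>L 'e"
  assumes W: "strongly_continuous W" and sub: "R \<subseteq> c0_multiplication W"
    and dense: "closure S = UNIV"
    and core: "\<And>f \<phi>. f \<in> S \<Longrightarrow> \<phi> \<in> Cc \<Longrightarrow> c0_scale (cut \<phi>) f \<in> Domain R"
  shows "closure R = c0_multiplication W"
proof
  show "closure R \<subseteq> c0_multiplication W" by (rule closure_minimal[OF sub closed_c0_multiplication])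
  show "c0_multiplication W \<subseteq> closure R"
  proof (rule subrelI)
    fix f h assume fh: "(f, h) \<in> c0_multiplication W"
    then have hW: "apply_c0 h g = blinfun_apply (W g) (apply_c0 f g)" for g by (simp add: c0_multiplication_def)
    show "(f, h) \<in> closure R"
      unfolding closure_approachable
    proof (intro allI impI)
      fix e :: real assume "e > 0"
      \<comment> \<open>the approximations of \<open>f\<close> and of \<open>h\<close> are each within \<open>2 d\<close>\<close>
      define d where "d = e / 5"
      have d: "d > 0" "4 * d < e" using \<open>e > 0\<close> by (auto simp: d_def)
      define k where "k = Abs_c0 (\<lambda>g. (apply_c0 f g, apply_c0 h g))"
      have ak: "apply_c0 k g = (apply_c0 f g, apply_c0 h g)" for g
        by (simp add: k_def Abs_c0_inverse[OF c0_pair])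
      obtain \<eta> :: "'g \<Rightarrow> real" where \<eta>: "\<eta> \<in> Cc" "\<And>g. 0 \<le> \<eta> g" "\<And>g. \<eta> g \<le> 1"
        "\<And>g. norm (apply_c0 k g - \<eta> g *\<^sub>R apply_c0 k g) \<le> d"
        by (rule c0_cutoff[OF d(1), of k]) (rule that)
      have \<eta>f: "norm (apply_c0 f g - \<eta> g *\<^sub>R apply_c0 f g) \<le> d" for g
        using norm_fst_le[of "apply_c0 f g - \<eta> g *\<^sub>R apply_c0 f g" "apply_c0 h g - \<eta> g *\<^sub>R apply_c0 h g"] \<eta>(4)[of g]
        by (simp add: ak)
      have \<eta>h: "norm (apply_c0 h g - \<eta> g *\<^sub>R apply_c0 h g) \<le> d" for g
        using norm_snd_le[of "apply_c0 h g - \<eta> g *\<^sub>R apply_c0 h g" "apply_c0 f g - \<eta> g *\<^sub>R apply_c0 f g"] \<eta>(4)[of g]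
        by (simp add: ak)
      obtain L where L: "compact L" "\<And>g. g \<notin> L \<Longrightarrow> \<eta> g = 0" using \<eta>(1) by (auto simp: Cc_def)
      obtain C where C: "0 < C" "\<And>g. g \<in> L \<Longrightarrow> norm (W g) \<le> C"
        by (rule strongly_continuous_bounded[OF W L(1)]) (rule that)
      have "d / (C + 1) > 0" using C(1) d(1) by simp
      then obtain f' where f': "f' \<in> S" "dist f' f < d / (C + 1)"
        using dense closure_approachable[of f S] by auto
      have df: "norm (apply_c0 f' g - apply_c0 f g) < d / (C + 1)" for g
        using norm_c0_ge[of "f' - f" g] f'(2) by (simp add: dist_norm apply_c0_minus)
      have small: "C * (d / (C + 1)) \<le> d" "d / (C + 1) \<le> d" using C(1) d(1) by (auto simp: field_simps)
      obtain y where y: "(c0_scale (cut \<eta>) f', y) \<in> R" using core[OF f'(1) \<eta>(1)] by blast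
      then have yW: "apply_c0 y g = \<eta> g *\<^sub>R blinfun_apply (W g) (apply_c0 f' g)" for g
        using sub \<eta>(1) by (force simp: c0_multiplication_def blinfun.scaleR_right simp del: apply_cut)
      have 1: "dist (c0_scale (cut \<eta>) f') f \<le> 2 * d"
      proof (rule c0_dist_le)
        fix g
        have "norm (\<eta> g *\<^sub>R (apply_c0 f' g - apply_c0 f g)) \<le> 1 * (d / (C + 1))"
          unfolding norm_scaleR using \<eta>(2,3)[of g] df[of g] by (intro mult_mono) auto
        moreover
        have "apply_c0 (c0_scale (cut \<eta>) f') g - apply_c0 f g =
            \<eta> g *\<^sub>R (apply_c0 f' g - apply_c0 f g) - (apply_c0 f g - \<eta> g *\<^sub>R apply_c0 f g)"
          using \<eta>(1) by (simp add: scaleR_diff_right del: apply_cut)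
        from arg_cong[OF this, of norm] have "norm (apply_c0 (c0_scale (cut \<eta>) f') g - apply_c0 f g) \<le>
            norm (\<eta> g *\<^sub>R (apply_c0 f' g - apply_c0 f g)) + norm (apply_c0 f g - \<eta> g *\<^sub>R apply_c0 f g)"
          using norm_triangle_ineq4 by (simp only:)
        ultimately show "norm (apply_c0 (c0_scale (cut \<eta>) f') g - apply_c0 f g) \<le> 2 * d"
          using \<eta>f[of g] small(2) by linarith
      qed
      have 2: "dist y h \<le> 2 * d"
      proof (rule c0_dist_le)
        fix g
        have "norm (\<eta> g *\<^sub>R blinfun_apply (W g) (apply_c0 f' g - apply_c0 f g)) \<le> d"
        proof (cases "g \<in> L")
          case True
          have "norm (blinfun_apply (W g) (apply_c0 f' g - apply_c0 f g)) \<le> C * (d / (C + 1))"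
            using C(1) C(2)[OF True] df[of g] by (intro order_trans[OF norm_blinfun mult_mono]) auto
          then have "norm (\<eta> g *\<^sub>R blinfun_apply (W g) (apply_c0 f' g - apply_c0 f g)) \<le> 1 * (C * (d / (C + 1)))"
            unfolding norm_scaleR using \<eta>(2,3)[of g] C(1) by (intro mult_mono) auto
          then show ?thesis using small(1) by linarith
        next
          case False
          then show ?thesis using L(2) d(1) by simp
        qed
        moreover have "apply_c0 y g - apply_c0 h g =
            \<eta> g *\<^sub>R blinfun_apply (W g) (apply_c0 f' g - apply_c0 f g) - (apply_c0 h g - \<eta> g *\<^sub>R apply_c0 h g)"
          by (simp add: yW blinfun.diff_right scaleR_diff_right hW)
        from arg_cong[OF this, of norm] have "norm (apply_c0 y g - apply_c0 h g) \<le>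
            norm (\<eta> g *\<^sub>R blinfun_apply (W g) (apply_c0 f' g - apply_c0 f g)) +
            norm (apply_c0 h g - \<eta> g *\<^sub>R apply_c0 h g)"
          using norm_triangle_ineq4 by (simp only:)
        ultimately show "norm (apply_c0 y g - apply_c0 h g) \<le> 2 * d"
          using \<eta>h[of g] by linarith
      qed
      have "dist (c0_scale (cut \<eta>) f', y) (f, h) \<le> dist (c0_scale (cut \<eta>) f') f + dist y h"
        using norm_Pair_le[of "c0_scale (cut \<eta>) f' - f" "y - h"] by (simp add: dist_norm)
      then show "\<exists>p\<in>R. dist p (f, h) < e" using 1 2 d(2) y by force
    qed
  qed
qed

lemma mprod_c0_multiplication:
  fixes Y Z :: "'g \<Rightarrow> 'e \<Rightarrow>\<^sub>L 'e"
  assumes "star_strongly_continuous E Y" "star_strongly_continuous E Z"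
  shows "mprod (c0_multiplication Y) (c0_multiplication Z) = c0_multiplication (\<lambda>g. Y g o\<^sub>L Z g)"
  unfolding mprod_def
proof (rule closure_eq_c0_multiplication[where S = UNIV])
  note Y = strongly_continuous_star(1)[OF assms(1)] and Z = strongly_continuous_star(1)[OF assms(2)]
  show "strongly_continuous (\<lambda>g. Y g o\<^sub>L Z g)" by (rule strongly_continuous_compose[OF Y Z])
  show "c0_multiplication Z O c0_multiplication Y \<subseteq> c0_multiplication (\<lambda>g. Y g o\<^sub>L Z g)"
    by (auto simp: c0_multiplication_def)
  fix f :: "('g, 'e) c0" and \<phi> :: "'g \<Rightarrow> real" assume "\<phi> \<in> Cc"
  then have f: "apply_c0 (c0_scale (cut \<phi>) f) \<in> Cc" by (intro Cc_c0_scale cut_Cc)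
  let ?h = "Abs_c0 (\<lambda>g. blinfun_apply (Z g) (apply_c0 (c0_scale (cut \<phi>) f) g))"
  have "apply_c0 ?h \<in> Cc" using Cc_apply[OF Z f] by simp
  then show "c0_scale (cut \<phi>) f \<in> Domain (c0_multiplication Z O c0_multiplication Y)"
    using c0_multiplication_Cc[OF Z f] c0_multiplication_Cc[OF Y, of ?h] by blast
qed simp

text \<open>What passes from relations on \<open>E\<close> to operators on \<open>C\<^sub>0(G, E)\<close>: a product such as \<open>\<mu> (D \<otimes> 1) \<mu>\<^sup>*\<close> contains
  those pairs of functions with values in the graphs that have compact support, but perhaps not all.\<close>

definition localised :: "('g \<Rightarrow> 'e uop) \<Rightarrow> ('g, 'e) c0 uop \<Rightarrow> bool" where
  "localised Tg T \<longleftrightarrow> T \<subseteq> pointwise Tg \<and>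
     (\<forall>f h. apply_c0 f \<in> Cc \<longrightarrow> apply_c0 h \<in> Cc \<longrightarrow> (f, h) \<in> pointwise Tg \<longrightarrow> (f, h) \<in> T)"

text \<open>\<open>Y\<^sub>g\<close> intertwines \<open>S\<^sub>g\<close> and \<open>T\<^sub>g\<close> up to a *-strongly continuous family of bounded
  operators: \<open>T\<^sub>g Y\<^sub>g = Y\<^sub>g S\<^sub>g + W\<^sub>g\<close> on the domain of \<open>S\<^sub>g\<close>.\<close>

definition intertwines :: "('g \<Rightarrow> 'e uop) \<Rightarrow> ('g \<Rightarrow> 'e \<Rightarrow>\<^sub>L 'e) \<Rightarrow> ('g \<Rightarrow> 'e uop) \<Rightarrow> bool" where
  "intertwines T Y S \<longleftrightarrow> star_strongly_continuous E Y \<and>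
     (\<exists>W. star_strongly_continuous E W \<and>
       (\<forall>g. \<forall>(x, s)\<in>S g. (blinfun_apply (Y g) x, blinfun_apply (Y g) s + blinfun_apply (W g) x) \<in> T g))"

text \<open>The closure of \<open>T a - a S\<close> is the multiplication operator by the family \<open>W\<^sub>g\<close> that extends
  \<open>T\<^sub>g Y\<^sub>g - Y\<^sub>g S\<^sub>g\<close>: multiplying elements of \<open>dom S\<close> by scalar functions of compact support gives enough
  elements of its domain.\<close>

lemma comm_matchedI:
  fixes Y :: "'g \<Rightarrow> 'e \<Rightarrow>\<^sub>L 'e"
  assumes T: "localised Tg T" and S: "localised Sg S" and Y: "intertwines Tg Y Sg"
    and sv: "\<And>g. single_valued (Tg g)"
    and sc: "\<And>g x y r. (x, y) \<in> Sg g \<Longrightarrow> (r *\<^sub>C x, r *\<^sub>C y) \<in> Sg g"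
    and dense: "closure (Domain S) = UNIV"
  shows "comm_matched \<theta> F T (c0_multiplication Y) S"
proof -
  obtain W where W: "star_strongly_continuous E W" and Yss: "star_strongly_continuous E Y"
    and YW: "\<And>g x s. (x, s) \<in> Sg g \<Longrightarrow> (blinfun_apply (Y g) x, blinfun_apply (Y g) s + blinfun_apply (W g) x) \<in> Tg g"
    using Y unfolding intertwines_def by blast
  note Ysc = strongly_continuous_star(1)[OF Yss] and Wsc = strongly_continuous_star(1)[OF W]
  let ?a = "c0_multiplication Y"
  have core: "c0_scale c f \<in> Domain (twisted_comm T ?a S)" if f: "f \<in> Domain S" and c: "apply_c0 c \<in> Cc" for c f
  proof -
    obtain s where s: "(f, s) \<in> S" using f by blast
    let ?f = "c0_scale c f" and ?s = "c0_scale c s"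
    let ?Y = "\<lambda>f. Abs_c0 (\<lambda>g. blinfun_apply (Y g) (apply_c0 f g))"
    let ?y = "Abs_c0 (\<lambda>g. blinfun_apply (Y g) (apply_c0 ?s g) + blinfun_apply (W g) (apply_c0 ?f g))"
    have fc: "apply_c0 ?f \<in> Cc" and sc': "apply_c0 ?s \<in> Cc" by (rule Cc_c0_scale[OF c])+
    have m: "(\<lambda>g. blinfun_apply (Y g) (apply_c0 ?s g)) \<in> Cc" "(\<lambda>g. blinfun_apply (Y g) (apply_c0 ?f g)) \<in> Cc"
      "(\<lambda>g. blinfun_apply (Y g) (apply_c0 ?s g) + blinfun_apply (W g) (apply_c0 ?f g)) \<in> Cc"
      by (intro Cc_add Cc_apply Ysc Wsc fc sc')+
    have "(f, s) \<in> pointwise Sg" using s S by (auto simp: localised_def)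
    then have fs: "(?f, ?s) \<in> pointwise Sg" by (auto simp: pointwise_def intro: sc)
    then have 1: "(?f, ?s) \<in> S" using S fc sc' by (auto simp: localised_def)
    note ay = apply_Abs_Cc[OF m(2)] apply_Abs_Cc[OF m(3)]
    have "(?Y ?f, ?y) \<in> pointwise Tg"
      unfolding pointwise_def mem_Collect_eq case_prod_conv ay
    proof
      fix g
      have "(apply_c0 ?f g, apply_c0 ?s g) \<in> Sg g" using fs unfolding pointwise_def by blast
      then show "(blinfun_apply (Y g) (apply_c0 ?f g),
          blinfun_apply (Y g) (apply_c0 ?s g) + blinfun_apply (W g) (apply_c0 ?f g)) \<in> Tg g" by (rule YW)
    qed
    moreover have "apply_c0 (?Y ?f) \<in> Cc" "apply_c0 ?y \<in> Cc" unfolding ay by (rule m(2), rule m(3))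
    ultimately have 2: "(?Y ?f, ?y) \<in> T" using T unfolding localised_def by blast
    have 3: "(?f, ?Y ?f) \<in> ?a" "(?s, ?Y ?s) \<in> ?a" by (rule c0_multiplication_Cc[OF Ysc]; fact)+
    show ?thesis unfolding twisted_comm_def using 1 2 3 by blast
  qed
  have "closure (twisted_comm T ?a S) = c0_multiplication W"
  proof (rule closure_eq_c0_multiplication[OF Wsc _ dense])
    show "twisted_comm T ?a S \<subseteq> c0_multiplication W"
    proof (rule subrelI)
      fix f k assume "(f, k) \<in> twisted_comm T ?a S"
      then obtain f1 y s z where f1: "(f, f1) \<in> ?a" and y: "(f1, y) \<in> T" and s: "(f, s) \<in> S"
        and z: "(s, z) \<in> ?a" and k: "k = y - z"
        unfolding twisted_comm_def by blast
      have "apply_c0 k g = blinfun_apply (W g) (apply_c0 f g)" for g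
      proof -
      have "(apply_c0 f g, apply_c0 s g) \<in> Sg g" using s S unfolding localised_def pointwise_def by blast
      then have "(apply_c0 f1 g, apply_c0 z g + blinfun_apply (W g) (apply_c0 f g)) \<in> Tg g"
        using YW[of "apply_c0 f g" "apply_c0 s g" g] f1 z by (simp add: c0_multiplication_def)
      moreover have "(apply_c0 f1 g, apply_c0 y g) \<in> Tg g" using y T by (auto simp: localised_def pointwise_def)
      ultimately have "apply_c0 y g = apply_c0 z g + blinfun_apply (W g) (apply_c0 f g)"
        using single_valuedD[OF sv[of g]] by blast
      then show ?thesis by (simp add: apply_c0_minus k)
      qed
      then show "(f, k) \<in> c0_multiplication W" by (simp add: c0_multiplication_def)
    qed
    show "c0_scale (cut \<phi>) f \<in> Domain (twisted_comm T ?a S)" if "f \<in> Domain S" "\<phi> \<in> Cc" for f \<phi>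
      by (rule core[OF that(1) cut_Cc[OF that(2)]])
  qed
  moreover have "{c. apply_c0 c \<in> Cc} \<subseteq> {c. blinfun_apply (rmult \<theta> c) ` Domain S \<subseteq> Domain (twisted_comm T ?a S)}"
  proof (rule subsetI, rule CollectI, rule image_subsetI)
    fix c :: "('g, complex) c0" and f assume "c \<in> {c. apply_c0 c \<in> Cc}" "f \<in> Domain S"
    then show "blinfun_apply (rmult \<theta> c) f \<in> Domain (twisted_comm T ?a S)"
      unfolding rmult_c0_tensor by (intro core) simp_all
  qed
  from closure_mono[OF this]
  have "closure {c. blinfun_apply (rmult \<theta> c) ` Domain S \<subseteq> Domain (twisted_comm T ?a S)} = UNIV"
    unfolding closure_Cc by (rule top_le)
  ultimately show ?thesis
    unfolding comm_matched_def using matched_c0_multiplication[OF W] by simp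
qed

lemma intertwines_compose:
  assumes "intertwines T Y S" "intertwines S Z R"
  shows "intertwines T (\<lambda>g. Y g o\<^sub>L Z g) R"
proof -
  obtain V where V: "star_strongly_continuous E V" "star_strongly_continuous E Y"
    "\<And>g x s. (x, s) \<in> S g \<Longrightarrow> (blinfun_apply (Y g) x, blinfun_apply (Y g) s + blinfun_apply (V g) x) \<in> T g"
    using assms(1) unfolding intertwines_def by blast
  obtain W where W: "star_strongly_continuous E W" "star_strongly_continuous E Z"
    "\<And>g x s. (x, s) \<in> R g \<Longrightarrow> (blinfun_apply (Z g) x, blinfun_apply (Z g) s + blinfun_apply (W g) x) \<in> S g"
    using assms(2) unfolding intertwines_def by blast
  show ?thesis
    unfolding intertwines_def
  proof (intro conjI exI[of _ "\<lambda>g. (Y g o\<^sub>L W g) + (V g o\<^sub>L Z g)"] allI ballI, goal_cases)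
    case (3 g p)
    then show ?case using V(3)[OF W(3), of "fst p" "snd p" g]
      by (cases p) (simp add: blinfun.add_right blinfun.add_left add.assoc)
  qed (intro ssc_compose ssc_add V W)+
qed

text \<open>By self-adjointness, \<open>S\<^sub>g Y\<^sub>g\<^sup>* - Y\<^sub>g\<^sup>* T\<^sub>g\<close> extends to \<open>- W\<^sub>g\<^sup>*\<close>.\<close>

lemma intertwines_adj:
  assumes Y: "intertwines T Y S" and S: "\<And>g. op_adj E (S g) = S g" and T: "\<And>g. op_adj E (T g) = T g"
  shows "intertwines S (\<lambda>g. adj E (Y g)) T"
proof -
  obtain W where W: "star_strongly_continuous E W" and Yss: "star_strongly_continuous E Y" and
    YW: "\<And>g x s. (x, s) \<in> S g \<Longrightarrow> (blinfun_apply (Y g) x, blinfun_apply (Y g) s + blinfun_apply (W g) x) \<in> T g"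
    using Y unfolding intertwines_def by blast
  note Ya = strongly_continuous_star(3)[OF Yss] and Wa = strongly_continuous_star(3)[OF W]
  show ?thesis
    unfolding intertwines_def
  proof (intro conjI exI[of _ "\<lambda>g. - adj E (W g)"] allI ballI, goal_cases)
    case (3 g p)
    obtain y t where p: "p = (y, t)" by (cases p)
    have yt: "(y, t) \<in> op_adj E (T g)" using 3 p T by simp
    have "inn E s (blinfun_apply (adj E (Y g)) y) =
        inn E x (blinfun_apply (adj E (Y g)) t + blinfun_apply (- adj E (W g)) y)" if "(x, s) \<in> S g" for x s
    proof -
      have "inn E (blinfun_apply (Y g) s + blinfun_apply (W g) x) y = inn E (blinfun_apply (Y g) x) t"
        using yt YW[OF that] by (auto simp: op_adj_def)
      then show ?thesis
        by (simp add: inn_add_left inn_add_right blinfun.minus_left inn_minus_right adj_right[OF Ya] adj_right[OF Wa]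
            eq_diff_eq inn_diff_right)
    qed
    then have "(blinfun_apply (adj E (Y g)) y, blinfun_apply (adj E (Y g)) t + blinfun_apply (- adj E (W g)) y)
        \<in> op_adj E (S g)"
      by (auto simp: op_adj_def)
    then show ?case by (simp add: S p)
  qed (intro ssc_adj ssc_minus Yss W)+
qed

end

section \<open>Conformal equivariance and intertwiners\<close>

lemma rel_graph_iff: "(x, y) \<in> graph f \<longleftrightarrow> y = f x"
  by (auto simp: graph_def)

lemma subspace_closure:
  fixes S :: "'v::real_normed_vector set"
  assumes "subspace S"
  shows "subspace (closure S)"
  unfolding subspace_def
proof (intro conjI ballI allI)
  show "0 \<in> closure S" using subspace_0[OF assms] closure_subset by blast
  fix x assume x: "x \<in> closure S"
  then obtain u where u: "\<And>n. u n \<in> S" "u \<longlonglongrightarrow> x" unfolding closure_sequential by blast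
  show "c *\<^sub>R x \<in> closure S" for c
    unfolding closure_sequential
    by (intro exI[of _ "\<lambda>n. c *\<^sub>R u n"] conjI allI subspace_scale[OF assms] tendsto_intros u)
  fix y assume "y \<in> closure S"
  then obtain v where v: "\<And>n. v n \<in> S" "v \<longlonglongrightarrow> y" unfolding closure_sequential by blast
  show "x + y \<in> closure S"
    unfolding closure_sequential
    by (intro exI[of _ "\<lambda>n. u n + v n"] conjI allI subspace_add[OF assms] tendsto_intros u v)
qed

lemma op_adjI: "(\<And>u v. (u, v) \<in> T \<Longrightarrow> inn E v x = inn E u y) \<Longrightarrow> (x, y) \<in> op_adj E T"
  unfolding op_adj_def by blast

lemma op_adjD: "(x, y) \<in> op_adj E T \<Longrightarrow> (u, v) \<in> T \<Longrightarrow> inn E v x = inn E u y"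
  unfolding op_adj_def by blast

context c0_setting
begin

text \<open>In terms of graphs: the domain condition turns the inclusion of the twisted commutator in a
  bounded operator into an identity on all of \<open>dom S\<^sub>g\<close>.\<close>

lemma intertwinesI:
  fixes Y Z :: "'g \<Rightarrow> 'e \<Rightarrow>\<^sub>L 'e"
  assumes "star_strongly_continuous E Y" "star_strongly_continuous E Z"
    and ext: "\<And>g. twisted_comm (T g) (graph (blinfun_apply (Y g))) (S g) \<subseteq> graph (blinfun_apply (Z g))"
    and dom: "\<And>g x s. (x, s) \<in> S g \<Longrightarrow> blinfun_apply (Y g) x \<in> Domain (T g)"
  shows "intertwines T Y S"
  unfolding intertwines_def
proof (intro conjI exI[of _ Z] allI ballI assms(1,2), clarify)
  fix g x s assume xs: "(x, s) \<in> S g"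
  obtain y where y: "(blinfun_apply (Y g) x, y) \<in> T g" using dom[OF xs] by blast
  have "(x, y - blinfun_apply (Y g) s) \<in> twisted_comm (T g) (graph (blinfun_apply (Y g))) (S g)"
  proof -
    have "(x, y) \<in> graph (blinfun_apply (Y g)) O T g" by (rule relcompI[OF _ y]) (simp add: rel_graph_iff)
    moreover have "(x, blinfun_apply (Y g) s) \<in> S g O graph (blinfun_apply (Y g))"
      by (rule relcompI[OF xs]) (simp add: rel_graph_iff)
    ultimately show ?thesis unfolding twisted_comm_def by blast
  qed
  then have "y - blinfun_apply (Y g) s = blinfun_apply (Z g) x" using ext[of g] by (auto simp: rel_graph_iff)
  then have "y = blinfun_apply (Y g) s + blinfun_apply (Z g) x" by (simp add: algebra_simps)
  then show "(blinfun_apply (Y g) x, blinfun_apply (Y g) s + blinfun_apply (Z g) x) \<in> T g" using y by simp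
qed

end

locale conformal = c0_setting E dom
  for E :: "('e::cbanach, 'b::cstar_algebra) hmodule" and dom :: "'g::{topological_group_add, t2_space} itself" +
  fixes \<alpha> :: "'g \<Rightarrow> 'a::cstar_algebra \<Rightarrow> 'a" and \<beta> :: "'g \<Rightarrow> 'b \<Rightarrow> 'b"
    and \<gamma> :: "('e \<Rightarrow>\<^sub>L 'e) option" and \<pi> :: "'a \<Rightarrow> 'e \<Rightarrow>\<^sub>L 'e" and D :: "'e uop"
    and U :: "'g \<Rightarrow> 'e \<Rightarrow> 'e" and \<mu> :: "'g \<Rightarrow> 'e \<Rightarrow>\<^sub>L 'e"
  assumes action: "cstar_action \<alpha>" and trivial: "\<And>g b. \<beta> g b = b"
    and conf: "conformally_equivariant \<alpha> \<beta> E \<gamma> \<pi> D U \<mu>"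
begin

lemma kasparov: "kasparov_module E \<gamma> \<pi> D" and equivariant: "equivariant_correspondence \<alpha> \<beta> E \<gamma> \<pi> U"
  and ssc_\<mu>: "star_strongly_continuous E \<mu>" and ssc_\<mu>_inv: "star_strongly_continuous E (\<lambda>g. op_inv (\<mu> g))"
  and even_\<mu>: "even_map \<gamma> (blinfun_apply (\<mu> g))" and invertible_\<mu>: "\<exists>S. adjointable E S \<and> inverse_of (\<mu> g) S"
  and A_in_AQ: "range \<pi> \<subseteq> closure (span {\<pi> a o\<^sub>L q |a q. q \<in> conformal_set E D U \<mu>})"
  using conf by (auto simp: conformally_equivariant_def)

lemma regular_D: "regular_op E D" and sa_D: "op_adj E D = D" and odd_D: "odd_op \<gamma> D"
  and corr: "correspondence E \<gamma> \<pi>" and A_Lip: "range \<pi> \<subseteq> closure (Lip0 E D)"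
  and compact_resolvent: "resolvent_sq D o\<^sub>L \<pi> a \<in> compact_ops E"
  using kasparov by (auto simp: kasparov_module_def self_adjoint_op_def)

lemma linear_D: "linear_op E D" and closed_D: "closed D" and dense_D: "closure (Domain D) = UNIV"
  using regular_D by (auto simp: regular_op_def)

lemma sv_D: "single_valued D" and subspace_D: "subspace D" and scale_D: "(x, y) \<in> D \<Longrightarrow> (c *\<^sub>C x, c *\<^sub>C y) \<in> D"
  using linear_D by (auto simp: linear_op_def)

lemma U_add: "U (g + h) x = U g (U h x)" and U_clinear: "clinear (U g)" and U_even: "even_map \<gamma> (U g)"
  and U_inn: "inn E (U g x) (U g y) = inn E x y" and U_\<pi>: "U g (blinfun_apply (\<pi> a) x) = blinfun_apply (\<pi> (\<alpha> g a)) (U g x)"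
  and U_continuous: "continuous_on UNIV (\<lambda>(g, x). U g x)"
  using equivariant trivial by (auto simp: equivariant_correspondence_def)

lemma U_norm: "norm (U g x) = norm x"
proof -
  have "norm (U g x) * norm (U g x) = norm x * norm x" by (simp add: norm_inn_self[symmetric] U_inn)
  then show ?thesis by (metis abs_norm_cancel real_sqrt_mult_self real_sqrt_mult)
qed

lemma U_zero: "U 0 x = x"
proof -
  have "U 0 (U 0 x - x) = 0" using U_add[of 0 0 x] by (simp add: clinear_diff[OF U_clinear])
  then have "norm (U 0 x - x) = 0" using U_norm[of 0 "U 0 x - x"] by simp
  then show ?thesis by simp
qed

lemma U_minus [simp]: "U g (U (- g) x) = x" "U (- g) (U g x) = x"
  using U_add[of g "- g" x] U_add[of "- g" g x] by (simp_all add: U_zero)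

lemma bounded_linear_U: "bounded_linear (U g)"
  by (rule bounded_linear_intro[where K = 1])
    (simp_all add: clinear_add[OF U_clinear] clinear_scaleR[OF U_clinear] U_norm)

definition Ub :: "'g \<Rightarrow> 'e \<Rightarrow>\<^sub>L 'e" where "Ub g = Blinfun (U g)"

lemma Ub_apply [simp]: "blinfun_apply (Ub g) x = U g x"
  by (simp add: Ub_def bounded_linear_Blinfun_apply[OF bounded_linear_U])

lemma Ub_inn: "inn E (blinfun_apply (Ub g) x) y = inn E x (blinfun_apply (Ub (- g)) y)"
  using U_inn[of g x "U (- g) y"] by simp

lemma adjointable_Ub: "adjointable E (Ub g)" and adj_Ub: "adj E (Ub g) = Ub (- g)"
  by (rule adjointableI adj_eqI, rule Ub_inn)+

lemma continuous_U: "continuous_on UNIV (\<lambda>g. U g x)"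
  using continuous_on_compose2[OF U_continuous, of UNIV "\<lambda>g. (g, x)"] by (simp add: continuous_intros)

lemma ssc_Ub: "star_strongly_continuous E Ub"
proof -
  have "continuous_on UNIV (\<lambda>g::'g. U (- g) x)" for x
    by (rule continuous_on_compose2[OF continuous_U]) (auto intro: continuous_intros)
  then show ?thesis
    by (auto simp: star_strongly_continuous_def adjointable_Ub adj_Ub continuous_U)
qed

lemma ssc_Ub_minus: "star_strongly_continuous E (\<lambda>g. Ub (- g))"
  using ssc_adj[OF ssc_Ub] by (simp add: adj_Ub)

abbreviation "\<mu>i g \<equiv> op_inv (\<mu> g)"
abbreviation "\<nu> g \<equiv> adj E (\<mu>i g)"

lemma inverse_\<mu>: "inverse_of (\<mu> g) (\<mu>i g)"
  unfolding op_inv_def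
proof (rule theI')
  obtain S where S: "inverse_of (\<mu> g) S" using invertible_\<mu>[of g] by blast
  have "S' = S" if "inverse_of (\<mu> g) S'" for S'
  proof (rule blinfun_eqI)
    fix x
    have "blinfun_apply S' x = blinfun_apply S' (blinfun_apply (\<mu> g o\<^sub>L S) x)" using S by (simp add: inverse_of_def)
    also have "\<dots> = blinfun_apply (S' o\<^sub>L \<mu> g) (blinfun_apply S x)" by simp
    also have "\<dots> = blinfun_apply S x" using that by (simp only: inverse_of_def) simp
    finally show "blinfun_apply S' x = blinfun_apply S x" .
  qed
  then show "\<exists>!S. inverse_of (\<mu> g) S" using S by blast
qed

lemma \<mu>_\<mu>i [simp]: "blinfun_apply (\<mu> g) (blinfun_apply (\<mu>i g) x) = x"
    "blinfun_apply (\<mu>i g) (blinfun_apply (\<mu> g) x) = x"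
  using inverse_\<mu>[of g] unfolding inverse_of_def
  by (metis blinfun_apply_blinfun_compose blinfun_apply_id_blinfun id_apply)+

lemma adjointable_\<mu>: "adjointable E (\<mu> g)" and adjointable_\<mu>i: "adjointable E (\<mu>i g)"
  using ssc_\<mu> ssc_\<mu>_inv by (auto simp: star_strongly_continuous_def)

lemma \<mu>_adj_\<nu> [simp]: "blinfun_apply (adj E (\<mu> g)) (blinfun_apply (\<nu> g) x) = x"
    "blinfun_apply (\<nu> g) (blinfun_apply (adj E (\<mu> g)) x) = x"
  by (rule inn_ext, simp add: adj_right[OF adjointable_\<mu>, symmetric] adj_right[OF adjointable_\<mu>i, symmetric])+

text \<open>The three families of self-adjoint operators over \<open>G\<close>: \<open>D\<close>, \<open>\<mu>\<^sub>g D \<mu>\<^sub>g\<^sup>*\<close> and \<open>U\<^sub>g D U\<^sub>g\<^sup>*\<close>.\<close>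

abbreviation "Dc \<equiv> (\<lambda>_::'g. D)"
abbreviation "Mg g \<equiv> graph (blinfun_apply (adj E (\<mu> g))) O D O graph (blinfun_apply (\<mu> g))"
abbreviation "Vg g \<equiv> map_prod (U g) (U g) ` D"

lemma Mg_iff: "(x, s) \<in> Mg g \<longleftrightarrow> (blinfun_apply (adj E (\<mu> g)) x, blinfun_apply (\<mu>i g) s) \<in> D"
  by (auto simp: rel_graph_iff relcomp.simps)

lemma Vg_iff: "(x, s) \<in> Vg g \<longleftrightarrow> (U (- g) x, U (- g) s) \<in> D"
proof
  assume "(x, s) \<in> Vg g"
  then obtain u v where "(u, v) \<in> D" "x = U g u" "s = U g v" by blast
  then show "(U (- g) x, U (- g) s) \<in> D" by simp
next
  assume "(U (- g) x, U (- g) s) \<in> D"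
  then have "map_prod (U g) (U g) (U (- g) x, U (- g) s) \<in> Vg g" by (rule imageI)
  then show "(x, s) \<in> Vg g" by simp
qed

lemma sv_Mg: "single_valued (Mg g)"
  unfolding single_valued_def Mg_iff using single_valuedD[OF sv_D] by (metis \<mu>_\<mu>i(1))

lemma scale_Mg: "(x, y) \<in> Mg g \<Longrightarrow> (c *\<^sub>C x, c *\<^sub>C y) \<in> Mg g"
  unfolding Mg_iff
  by (simp add: clinear_scaleC[OF adjointable_clinear[OF adjointable_adj[OF adjointable_\<mu>]]]
      clinear_scaleC[OF adjointable_clinear[OF adjointable_\<mu>i]] scale_D)

text \<open>Test an element of the adjoint on the pairs \<open>(\<mu>\<^sub>g\<^sup>-\<^sup>1\<^sup>* u, \<mu>\<^sub>g v)\<close> with \<open>(u, v)\<close> in \<open>D\<close>.\<close>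

lemma sa_Mg: "op_adj E (Mg g) = Mg g"
proof (intro equalityI subrelI)
  fix x y assume xy: "(x, y) \<in> op_adj E (Mg g)"
  have "(blinfun_apply (adj E (\<mu> g)) x, blinfun_apply (\<mu>i g) y) \<in> op_adj E D"
  proof (rule op_adjI)
    fix u v assume uv: "(u, v) \<in> D"
    have "(blinfun_apply (\<nu> g) u, blinfun_apply (\<mu> g) v) \<in> Mg g" by (simp only: Mg_iff \<mu>_\<mu>i \<mu>_adj_\<nu> uv)
    from op_adjD[OF xy this]
    show "inn E v (blinfun_apply (adj E (\<mu> g)) x) = inn E u (blinfun_apply (\<mu>i g) y)"
      by (simp add: adj_right[OF adjointable_\<mu>] adj_left[OF adjointable_\<mu>i])
  qed
  then show "(x, y) \<in> Mg g" by (simp only: sa_D Mg_iff)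
next
  fix x y assume "(x, y) \<in> Mg g"
  then have xy: "(blinfun_apply (adj E (\<mu> g)) x, blinfun_apply (\<mu>i g) y) \<in> op_adj E D" by (simp only: sa_D Mg_iff)
  show "(x, y) \<in> op_adj E (Mg g)"
  proof (rule op_adjI)
    fix u v assume "(u, v) \<in> Mg g"
    then have "(blinfun_apply (adj E (\<mu> g)) u, blinfun_apply (\<mu>i g) v) \<in> D" by (simp only: Mg_iff)
    from op_adjD[OF xy this] show "inn E v x = inn E u y"
      by (simp add: adj_left[OF adjointable_\<mu>, symmetric] adj_right[OF adjointable_\<mu>, symmetric])
  qed
qed

lemma sa_Vg: "op_adj E (Vg g) = Vg g"
proof (intro equalityI subrelI)
  have sw: "inn E (U g x) y = inn E x (U (- g) y)" for x y using Ub_inn[of g x y] by simp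
  show "(x, y) \<in> Vg g" if xy: "(x, y) \<in> op_adj E (Vg g)" for x y
  proof -
    have "(U (- g) x, U (- g) y) \<in> op_adj E D"
    proof (rule op_adjI)
      fix u v assume uv: "(u, v) \<in> D"
      have "(U g u, U g v) \<in> Vg g" using uv by (simp only: Vg_iff U_minus)
      from op_adjD[OF xy this] show "inn E v (U (- g) x) = inn E u (U (- g) y)" by (simp add: sw)
    qed
    then show ?thesis by (simp only: sa_D Vg_iff)
  qed
  show "(x, y) \<in> op_adj E (Vg g)" if "(x, y) \<in> Vg g" for x y
  proof (rule op_adjI)
    have xy: "(U (- g) x, U (- g) y) \<in> op_adj E D" using that by (simp only: sa_D Vg_iff)
    fix u v assume "(u, v) \<in> Vg g"
    then have "(U (- g) u, U (- g) v) \<in> D" by (simp only: Vg_iff)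
    from op_adjD[OF xy this] show "inn E v x = inn E u y" by (simp add: sw[symmetric] U_inn)
  qed
qed

lemma intertwines_Lip0: "l \<in> Lip0 E D \<Longrightarrow> intertwines Dc (\<lambda>_. l) Dc"
  unfolding Lip0_def mem_Collect_eq
proof (elim conjE exE)
  fix Z assume "adjointable E l" "adjointable E Z" "twisted_comm D (graph (blinfun_apply l)) D \<subseteq> graph (blinfun_apply Z)"
    "blinfun_apply l ` Domain D \<subseteq> Domain D"
  then show ?thesis by (intro intertwinesI[where Z = "\<lambda>_. Z"] ssc_const) blast+
qed

text \<open>The domain condition for the third claim: \<open>x\<close> is in the domain of \<open>\<mu>\<^sub>g D \<mu>\<^sub>g\<^sup>*\<close> iff \<open>\<mu>\<^sub>g\<^sup>* x\<close> is in
  \<open>dom D\<close>, and \<open>q x = (q \<mu>\<^sub>g\<^sup>-\<^sup>1\<^sup>*) (\<mu>\<^sub>g\<^sup>* x)\<close>.\<close>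

lemma intertwines_conformal:
  assumes q: "q \<in> conformal_set E D U \<mu>"
  shows "adjointable E q" "intertwines Dc (\<lambda>_. q) Dc" "intertwines Vg (\<lambda>_. q) Mg"
    "intertwines Dc (\<lambda>g. q o\<^sub>L \<mu> g) Dc" "intertwines Dc (\<lambda>g. q o\<^sub>L \<nu> g) Dc"
proof -
  have Lip: "q \<in> Lip0 E D"
    and dom: "\<And>g b. b \<in> {q o\<^sub>L \<mu> g, q o\<^sub>L \<nu> g} \<Longrightarrow> blinfun_apply b ` Domain D \<subseteq> Domain D \<inter> U g ` Domain D"
    and 2: "extends_star_strongly E (\<lambda>g. twisted_comm (Vg g) (graph (blinfun_apply q)) (Mg g))"
    and 3: "extends_star_strongly E (\<lambda>g. twisted_comm D (graph (blinfun_apply (q o\<^sub>L \<mu> g))) D)"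
    and 4: "extends_star_strongly E (\<lambda>g. twisted_comm D (graph (blinfun_apply (q o\<^sub>L \<nu> g))) D)"
    using q unfolding conformal_set_def Let_def by blast+
  show aq: "adjointable E q" using Lip by (simp add: Lip0_def)
  note sscq = ssc_const[OF aq]
  show "intertwines Dc (\<lambda>_. q) Dc" by (rule intertwines_Lip0[OF Lip])
  obtain Z where Z: "star_strongly_continuous E Z"
    "\<And>g. twisted_comm (Vg g) (graph (blinfun_apply q)) (Mg g) \<subseteq> graph (blinfun_apply (Z g))"
    using 2 unfolding extends_star_strongly_def by blast
  show "intertwines Vg (\<lambda>_. q) Mg"
  proof (rule intertwinesI[OF sscq Z])
    fix g x s assume "(x, s) \<in> Mg g"
    then have "blinfun_apply (adj E (\<mu> g)) x \<in> Domain D" unfolding Mg_iff by blast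
    then have "blinfun_apply (q o\<^sub>L \<nu> g) (blinfun_apply (adj E (\<mu> g)) x) \<in> U g ` Domain D"
      using dom[of "q o\<^sub>L \<nu> g" g] by blast
    then show "blinfun_apply q x \<in> Domain (Vg g)" by (auto simp: Domain.simps) force
  qed
  obtain Z where Z: "star_strongly_continuous E Z"
    "\<And>g. twisted_comm D (graph (blinfun_apply (q o\<^sub>L \<mu> g))) D \<subseteq> graph (blinfun_apply (Z g))"
    using 3 unfolding extends_star_strongly_def by blast
  show "intertwines Dc (\<lambda>g. q o\<^sub>L \<mu> g) Dc"
    by (rule intertwinesI[OF ssc_compose[OF sscq ssc_\<mu>] Z]) (use dom[of "q o\<^sub>L \<mu> g" g for g] in blast)
  obtain Z where Z: "star_strongly_continuous E Z"
    "\<And>g. twisted_comm D (graph (blinfun_apply (q o\<^sub>L \<nu> g))) D \<subseteq> graph (blinfun_apply (Z g))"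
    using 4 unfolding extends_star_strongly_def by blast
  show "intertwines Dc (\<lambda>g. q o\<^sub>L \<nu> g) Dc"
    by (rule intertwinesI[OF ssc_compose[OF sscq ssc_adj[OF ssc_\<mu>_inv]] Z]) (use dom[of "q o\<^sub>L \<nu> g" g for g] in blast)
qed

lemma intertwines_U: "intertwines Dc (\<lambda>g. Ub (- g)) Vg"
  unfolding intertwines_def
proof (intro conjI exI[of _ "\<lambda>_. 0"] ssc_Ub_minus ssc_const allI ballI)
  fix g p assume "p \<in> Vg g"
  then show "case p of (x, s) \<Rightarrow> (blinfun_apply (Ub (- g)) x, blinfun_apply (Ub (- g)) s + blinfun_apply 0 x) \<in> D"
    by (cases p) (simp only: Vg_iff case_prod_conv Ub_apply, simp)
qed simp

section \<open>Elements of the three sets of matched operators\<close>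

abbreviation "D1 \<equiv> amplify \<theta> D"
abbreviation "\<mu>m \<equiv> c0_multiplication \<mu>"
abbreviation "M1 \<equiv> op_adj F \<mu>m O D1 O \<mu>m"

lemma D1_pointwise: "D1 = pointwise Dc"
  by (rule amplify_c0[OF subspace_D closed_D scale_D])

lemma op_adj_\<mu>m: "op_adj F \<mu>m = c0_multiplication (\<lambda>g. adj E (\<mu> g))"
  by (rule op_adj_c0_multiplication[OF ssc_\<mu>])

lemma converse_\<mu>m: "\<mu>m\<inverse> = c0_multiplication \<mu>i"
  by (rule converse_c0_multiplication) (rule inverse_\<mu>)

lemma op_adj_converse_\<mu>m: "op_adj F (\<mu>m\<inverse>) = c0_multiplication \<nu>"
  unfolding converse_\<mu>m by (rule op_adj_c0_multiplication[OF ssc_\<mu>_inv])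

lemma localised_D1: "localised Dc D1"
  by (simp add: localised_def D1_pointwise)

text \<open>The tensors \<open>x \<otimes> c\<close> with \<open>x\<close> in \<open>dom D\<close> span a dense subspace.\<close>

lemma Domain_D1_dense: "closure (Domain D1) = UNIV"
proof (rule equalityI[OF subset_UNIV])
  have sub: "subspace (Domain D1)"
  proof -
    have "subspace D1" unfolding D1_pointwise subspace_def pointwise_def
      using subspace_0[OF subspace_D] subspace_add[OF subspace_D] subspace_scale[OF subspace_D]
      by (force simp: zero_c0.rep_eq plus_c0.rep_eq scaleR_c0.rep_eq zero_prod_def)
    then have "subspace (fst ` D1)" by (rule linear_subspace_image[OF linear_fst])
    then show ?thesis by (simp add: Domain_fst)
  qed
  have "\<theta> x c \<in> closure (Domain D1)" for x c
  proof -
    have bl: "bounded_linear (\<lambda>x. \<theta> x c)"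
    proof (rule bounded_linear_intro[where K = "norm c"])
      show "norm (\<theta> x c) \<le> norm x * norm c" for x
        by (rule norm_c0_le) (simp add: apply_c0_tensor norm_scaleC mult.commute mult_left_mono norm_c0_ge)
    qed (simp_all add: clinear_add[OF clinear_c0_tensor(2)] clinear_scaleR[OF clinear_c0_tensor(2)])
    have "(\<lambda>x. \<theta> x c) ` Domain D \<subseteq> Domain D1"
    proof clarify
      fix x y assume "(x, y) \<in> D"
      then have "(\<theta> x c, \<theta> y c) \<in> D1" unfolding D1_pointwise pointwise_def by (simp add: apply_c0_tensor scale_D)
      then show "\<theta> x c \<in> Domain D1" by blast
    qed
    then have "(\<lambda>x. \<theta> x c) ` closure (Domain D) \<subseteq> closure (Domain D1)"
      using closure_bounded_linear_image_subset[OF bl] closure_mono by blast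
    then show ?thesis unfolding dense_D by blast
  qed
  then have "span {\<theta> x c |x c. True} \<subseteq> closure (Domain D1)"
    by (intro span_minimal subspace_closure[OF sub]) blast
  then have "closure (span {\<theta> x c |x c. True}) \<subseteq> closure (Domain D1)" by (rule closure_minimal) simp
  then show "UNIV \<subseteq> closure (Domain D1)" unfolding closure_span_c0_tensor .
qed

lemma compact_pair_in_M1:
  assumes "apply_c0 f \<in> Cc" "apply_c0 h \<in> Cc" "(f, h) \<in> pointwise Mg"
  shows "(f, h) \<in> M1"
proof -
  let ?f = "Abs_c0 (\<lambda>g. blinfun_apply (adj E (\<mu> g)) (apply_c0 f g))"
  let ?h = "Abs_c0 (\<lambda>g. blinfun_apply (\<mu>i g) (apply_c0 h g))"
  have m: "(\<lambda>g. blinfun_apply (adj E (\<mu> g)) (apply_c0 f g)) \<in> Cc" "(\<lambda>g. blinfun_apply (\<mu>i g) (apply_c0 h g)) \<in> Cc"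
    by (intro Cc_apply strongly_continuous_star(2)[OF ssc_\<mu>] strongly_continuous_star(1)[OF ssc_\<mu>_inv] assms)+
  have "(f, ?f) \<in> op_adj F \<mu>m" unfolding op_adj_\<mu>m unfolding c0_multiplication_def using m(1) by simp
  moreover have "(?h, h) \<in> \<mu>m" unfolding c0_multiplication_def using m(2) by simp
  moreover have "(?f, ?h) \<in> D1"
    unfolding D1_pointwise using assms(3) unfolding pointwise_def Mg_iff by (simp add: m)
  ultimately show ?thesis by blast
qed

lemma localised_M1: "localised Mg M1"
  unfolding localised_def
proof (intro conjI allI impI compact_pair_in_M1)
  show "M1 \<subseteq> pointwise Mg"
  proof (rule subrelI)
    fix f h assume "(f, h) \<in> M1"
    then obtain f' h' where "(f, f') \<in> op_adj F \<mu>m" "(f', h') \<in> D1" "(h', h) \<in> \<mu>m" by blast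
    then show "(f, h) \<in> pointwise Mg"
      unfolding op_adj_\<mu>m D1_pointwise unfolding c0_multiplication_def pointwise_def Mg_iff by simp
  qed
qed

text \<open>For \<open>f\<close> of compact support, approximate \<open>\<mu>\<^sup>* f\<close> by \<open>d\<close> in the domain of \<open>D \<otimes> 1\<close>; then
  \<open>\<mu>\<^sup>-\<^sup>1\<^sup>* (\<eta> d)\<close> approximates \<open>f\<close> for a cut-off \<open>\<eta>\<close>, which makes it compactly supported and keeps
  the possibly unbounded \<open>\<mu>\<^sup>-\<^sup>1\<^sup>*\<close> under control.\<close>

lemma Domain_M1_dense: "closure (Domain M1) = UNIV"
proof -
  have "f \<in> closure (Domain M1)" if f: "apply_c0 f \<in> Cc" for f
    unfolding closure_approachable
  proof (intro allI impI)
    fix e :: real assume e: "e > 0"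
    obtain L where L: "compact L" "\<And>g. g \<notin> L \<Longrightarrow> apply_c0 f g = 0" using f by (auto simp: Cc_def)
    obtain \<eta> :: "'g \<Rightarrow> real" where \<eta>: "\<eta> \<in> Cc" "\<And>x. 0 \<le> \<eta> x" "\<And>x. \<eta> x \<le> 1" "\<And>x. x \<in> L \<Longrightarrow> \<eta> x = 1"
      by (rule Urysohn_Cc[OF L(1) open_UNIV subset_UNIV]) (rule that)
    obtain K where K: "compact K" "\<And>g. g \<notin> K \<Longrightarrow> \<eta> g = 0" using \<eta>(1) by (auto simp: Cc_def)
    have sc\<nu>: "strongly_continuous \<nu>" by (rule strongly_continuous_star(2)[OF ssc_\<mu>_inv])
    obtain C where C: "0 < C" "\<And>g. g \<in> K \<Longrightarrow> norm (\<nu> g) \<le> C"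
      by (rule strongly_continuous_bounded[OF sc\<nu> K(1)]) (rule that)
    let ?f = "Abs_c0 (\<lambda>g. blinfun_apply (adj E (\<mu> g)) (apply_c0 f g))"
    have mf: "(\<lambda>g. blinfun_apply (adj E (\<mu> g)) (apply_c0 f g)) \<in> Cc"
      by (rule Cc_apply[OF strongly_continuous_star(2)[OF ssc_\<mu>] f])
    have "e / (2 * C) > 0" using e C by simp
    then obtain d where d: "d \<in> Domain D1" "dist d ?f < e / (2 * C)"
    proof -
      have "?f \<in> closure (Domain D1)" unfolding Domain_D1_dense by simp
      then show ?thesis using that \<open>e / (2 * C) > 0\<close> unfolding closure_approachable by blast
    qed
    obtain d' where d': "(d, d') \<in> D1" using d(1) by blast
    have dd: "norm (apply_c0 d g - blinfun_apply (adj E (\<mu> g)) (apply_c0 f g)) \<le> e / (2 * C)" for g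
      using norm_c0_ge[of "d - ?f" g] d(2) mf by (simp add: dist_norm apply_c0_minus)
    let ?k = "\<lambda>g. blinfun_apply (\<nu> g) (\<eta> g *\<^sub>R apply_c0 d g)"
    let ?k' = "\<lambda>g. blinfun_apply (\<mu> g) (\<eta> g *\<^sub>R apply_c0 d' g)"
    have kc: "?k \<in> Cc" "?k' \<in> Cc"
      by (intro Cc_apply sc\<nu> strongly_continuous_star(1)[OF ssc_\<mu>] Cc_scaleR_c0 \<eta>(1))+
    have "(Abs_c0 ?k, Abs_c0 ?k') \<in> pointwise Mg"
      unfolding pointwise_def mem_Collect_eq case_prod_conv apply_Abs_Cc[OF kc(1)] apply_Abs_Cc[OF kc(2)] Mg_iff \<mu>_\<mu>i \<mu>_adj_\<nu>
    proof
      fix g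
      have "(apply_c0 d g, apply_c0 d' g) \<in> D" using d' unfolding D1_pointwise pointwise_def by simp
      then show "(\<eta> g *\<^sub>R apply_c0 d g, \<eta> g *\<^sub>R apply_c0 d' g) \<in> D" by (simp add: scaleR_scaleC scale_D)
    qed
    then have "(Abs_c0 ?k, Abs_c0 ?k') \<in> M1" by (intro compact_pair_in_M1) (simp_all only: apply_Abs_Cc[OF kc(1)] apply_Abs_Cc[OF kc(2)] kc)
    then have "Abs_c0 ?k \<in> Domain M1" by blast
    moreover have "dist (Abs_c0 ?k) f \<le> e / 2"
    proof (rule c0_dist_le)
      fix g
      have "\<eta> g *\<^sub>R apply_c0 f g = apply_c0 f g" using \<eta>(4)[of g] L(2)[of g] by (cases "g \<in> L") simp_all
      then have "?k g - apply_c0 f g = \<eta> g *\<^sub>R blinfun_apply (\<nu> g) (apply_c0 d g - blinfun_apply (adj E (\<mu> g)) (apply_c0 f g))"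
        by (simp add: blinfun.diff_right blinfun.scaleR_right scaleR_diff_right)
      also have "norm \<dots> \<le> e / 2"
      proof (cases "g \<in> K")
        case True
        have "norm (blinfun_apply (\<nu> g) (apply_c0 d g - blinfun_apply (adj E (\<mu> g)) (apply_c0 f g))) \<le> C * (e / (2 * C))"
          using C(1) C(2)[OF True] dd[of g] by (intro order_trans[OF norm_blinfun mult_mono]) auto
        then have "norm (\<eta> g *\<^sub>R blinfun_apply (\<nu> g) (apply_c0 d g - blinfun_apply (adj E (\<mu> g)) (apply_c0 f g))) \<le> 1 * (C * (e / (2 * C)))"
          unfolding norm_scaleR using \<eta>(2,3)[of g] by (intro mult_mono) auto
        then show ?thesis using C(1) by simp
      next
        case False
        then show ?thesis using K(2) e by simp
      qed
      finally show "norm (apply_c0 (Abs_c0 ?k) g - apply_c0 f g) \<le> e / 2" by (simp only: apply_Abs_Cc[OF kc(1)])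
    qed
    ultimately show "\<exists>y\<in>Domain M1. dist y f < e" using e by force
  qed
  then have "{f. apply_c0 f \<in> Cc} \<subseteq> closure (Domain M1)" by blast
  then have "closure {f :: ('g, 'e) c0. apply_c0 f \<in> Cc} \<subseteq> closure (Domain M1)" by (rule closure_minimal) simp
  then show ?thesis unfolding closure_Cc by (rule top_le)
qed

lemma comm_matched_DD: "intertwines Dc Y Dc \<Longrightarrow> comm_matched \<theta> F D1 (c0_multiplication Y) D1"
  by (rule comm_matchedI[OF localised_D1 localised_D1 _ sv_D scale_D Domain_D1_dense])

lemma comm_matched_MM: "intertwines Mg Y Mg \<Longrightarrow> comm_matched \<theta> F M1 (c0_multiplication Y) M1"
  by (rule comm_matchedI[OF localised_M1 localised_M1 _ sv_Mg scale_Mg Domain_M1_dense])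

lemma comm_matched_DM: "intertwines Dc Y Mg \<Longrightarrow> comm_matched \<theta> F D1 (c0_multiplication Y) M1"
  by (rule comm_matchedI[OF localised_D1 localised_M1 _ sv_D scale_Mg Domain_M1_dense])

lemma intertwines_ssc: "intertwines T Y S \<Longrightarrow> star_strongly_continuous E Y"
  by (simp add: intertwines_def)

lemma mprod_Id: "mprod Id (c0_multiplication Y) = c0_multiplication Y" "mprod (c0_multiplication Y) Id = c0_multiplication Y"
  unfolding mprod_def by (simp_all add: closure_closed[OF closed_c0_multiplication])

lemma Lip0_in_left_set:
  assumes "l \<in> Lip0 E D"
  shows "c0_multiplication (\<lambda>_. l) \<in> side_set \<theta> F D Id"
proof -
  have i: "intertwines Dc (\<lambda>_. l) Dc" by (rule intertwines_Lip0[OF assms])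
  show ?thesis
    unfolding side_set_def Let_def op_adj_Id Id_O_R R_O_Id converse_Id mem_Collect_eq mprod_Id
    using matched_c0_multiplication[OF intertwines_ssc[OF i]] comm_matched_DD[OF i] by blast
qed

text \<open>\<open>U\<^sub>g\<^sup>*\<close> intertwines \<open>U\<^sub>g D U\<^sub>g\<^sup>*\<close> with \<open>D\<close> exactly, and \<open>q\<close> intertwines \<open>\<mu>\<^sub>g D \<mu>\<^sub>g\<^sup>*\<close> with
  \<open>U\<^sub>g D U\<^sub>g\<^sup>*\<close>.\<close>

lemma middle_set_element:
  assumes q: "q \<in> conformal_set E D U \<mu>"
  shows "c0_multiplication (\<lambda>g. Ub (- g) o\<^sub>L q) \<in> middle_set \<theta> F D Id \<mu>m"
proof -
  have i: "intertwines Dc (\<lambda>g. Ub (- g) o\<^sub>L q) Mg"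
    by (rule intertwines_compose[OF intertwines_U intertwines_conformal(3)[OF q]])
  show ?thesis
    unfolding middle_set_def Let_def op_adj_Id Id_O_R R_O_Id mem_Collect_eq
    using matched_c0_multiplication[OF intertwines_ssc[OF i]] comm_matched_DM[OF i] by blast
qed

primrec square_power :: "('e \<Rightarrow>\<^sub>L 'e) \<Rightarrow> nat \<Rightarrow> 'e \<Rightarrow>\<^sub>L 'e" where
  "square_power q 0 = id_blinfun"
| "square_power q (Suc n) = square_power q n o\<^sub>L (adj E q o\<^sub>L q)"

lemma square_power_Suc': "square_power q (Suc n) = (adj E q o\<^sub>L q) o\<^sub>L square_power q n"
proof (induction n)
  case 0
  then show ?case by (simp add: blinfun_eqI)
next
  case (Suc n)
  have "square_power q (Suc (Suc n)) = square_power q (Suc n) o\<^sub>L (adj E q o\<^sub>L q)" by simp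
  also have "\<dots> = ((adj E q o\<^sub>L q) o\<^sub>L square_power q n) o\<^sub>L (adj E q o\<^sub>L q)" by (simp only: Suc.IH)
  also have "\<dots> = (adj E q o\<^sub>L q) o\<^sub>L square_power q (Suc n)" by (simp add: blinfun_eqI)
  finally show ?case .
qed

text \<open>Passing from \<open>\<mu>\<^sub>g D \<mu>\<^sub>g\<^sup>*\<close> to \<open>U\<^sub>g D U\<^sub>g\<^sup>*\<close> by \<open>q\<close> and back by \<open>q\<^sup>*\<close> shows that \<open>q\<^sup>* q\<close> intertwines
  \<open>\<mu>\<^sub>g D \<mu>\<^sub>g\<^sup>*\<close> with itself.\<close>

lemma right_set_element:
  assumes q: "q \<in> conformal_set E D U \<mu>"
  shows "c0_multiplication (\<lambda>_. square_power q (Suc n)) \<in> side_set \<theta> F D \<mu>m"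
proof -
  note aq = intertwines_conformal(1)[OF q] and qD = intertwines_conformal(2)[OF q] and qVM = intertwines_conformal(3)[OF q]
    and q\<mu> = intertwines_conformal(4)[OF q] and q\<nu> = intertwines_conformal(5)[OF q]
  define r where "r = square_power q (Suc n)"
  have sD: "intertwines Dc (\<lambda>_. square_power q n) Dc" and sM: "intertwines Mg (\<lambda>_. square_power q n) Mg" for n
  proof (induction n)
    case 0
    have "intertwines S (\<lambda>_. id_blinfun) S" for S :: "'g \<Rightarrow> 'e uop"
      unfolding intertwines_def by (intro conjI exI[of _ "\<lambda>_. 0"] ssc_const) auto
    then show "intertwines Dc (\<lambda>_. square_power q 0) Dc" "intertwines Mg (\<lambda>_. square_power q 0) Mg" by simp_all
  next
    case (Suc n)
    show "intertwines Dc (\<lambda>_. square_power q (Suc n)) Dc"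
      unfolding square_power.simps
      by (intro intertwines_compose[OF Suc(1)] intertwines_compose[OF intertwines_adj[OF qD sa_D sa_D] qD])
    show "intertwines Mg (\<lambda>_. square_power q (Suc n)) Mg"
      unfolding square_power.simps
      by (intro intertwines_compose[OF Suc(2)] intertwines_compose[OF intertwines_adj[OF qVM sa_Mg sa_Vg] qVM])
  qed
  have rD: "intertwines Dc (\<lambda>_. r) Dc" and rM: "intertwines Mg (\<lambda>_. r) Mg" unfolding r_def by (rule sD sM)+
  \<comment> \<open>\<open>r = q\<^sup>* y = z q\<close>: the outer \<open>q\<^sup>*\<close> or \<open>q\<close> absorbs the factor \<open>\<mu>\<^sub>g\<close> in each of the four products below\<close>
  define y where "y = q o\<^sub>L square_power q n"
  have yD: "intertwines Dc (\<lambda>_. y) Dc" unfolding y_def by (rule intertwines_compose[OF qD sD])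
  have ry: "r = adj E q o\<^sub>L y" unfolding r_def square_power_Suc' y_def by (simp add: blinfun_eqI)
  define z where "z = square_power q n o\<^sub>L adj E q"
  have zD: "intertwines Dc (\<lambda>_. z) Dc" unfolding z_def by (rule intertwines_compose[OF sD intertwines_adj[OF qD sa_D sa_D]])
  have rz: "r = z o\<^sub>L q" unfolding r_def z_def by (simp add: blinfun_eqI)
  have 1: "intertwines Dc (\<lambda>g. adj E (\<mu> g) o\<^sub>L r) Dc"
  proof -
    have "adj E (q o\<^sub>L \<mu> g) o\<^sub>L y = adj E (\<mu> g) o\<^sub>L r" for g
      unfolding ry by (simp add: adj_compose aq adjointable_\<mu> blinfun_eqI)
    then show ?thesis using intertwines_compose[OF intertwines_adj[OF q\<mu> sa_D sa_D] yD] by simp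
  qed
  have 2: "intertwines Dc (\<lambda>g. \<mu>i g o\<^sub>L r) Dc"
  proof -
    have "adj E (q o\<^sub>L \<nu> g) o\<^sub>L y = \<mu>i g o\<^sub>L r" for g
      unfolding ry by (simp add: adj_compose aq adjointable_\<mu>i adjointable_adj adj_adj blinfun_eqI)
    then show ?thesis using intertwines_compose[OF intertwines_adj[OF q\<nu> sa_D sa_D] yD] by simp
  qed
  have 3: "intertwines Dc (\<lambda>g. r o\<^sub>L \<mu> g) Dc"
  proof -
    have "z o\<^sub>L (q o\<^sub>L \<mu> g) = r o\<^sub>L \<mu> g" for g unfolding rz by (simp add: blinfun_eqI)
    then show ?thesis using intertwines_compose[OF zD q\<mu>] by simp
  qed
  have 4: "intertwines Dc (\<lambda>g. r o\<^sub>L \<nu> g) Dc"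
  proof -
    have "z o\<^sub>L (q o\<^sub>L \<nu> g) = r o\<^sub>L \<nu> g" for g unfolding rz by (simp add: blinfun_eqI)
    then show ?thesis using intertwines_compose[OF zD q\<nu>] by simp
  qed
  note ssr = intertwines_ssc[OF rD]
  have m: "mprod (op_adj F \<mu>m) (c0_multiplication (\<lambda>_. r)) = c0_multiplication (\<lambda>g. adj E (\<mu> g) o\<^sub>L r)"
    "mprod (\<mu>m\<inverse>) (c0_multiplication (\<lambda>_. r)) = c0_multiplication (\<lambda>g. \<mu>i g o\<^sub>L r)"
    "mprod (c0_multiplication (\<lambda>_. r)) \<mu>m = c0_multiplication (\<lambda>g. r o\<^sub>L \<mu> g)"
    "mprod (c0_multiplication (\<lambda>_. r)) (op_adj F (\<mu>m\<inverse>)) = c0_multiplication (\<lambda>g. r o\<^sub>L \<nu> g)"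
    unfolding op_adj_converse_\<mu>m unfolding op_adj_\<mu>m converse_\<mu>m
    by (rule mprod_c0_multiplication; intro ssr ssc_adj ssc_\<mu> ssc_\<mu>_inv)+
  show ?thesis
    unfolding r_def[symmetric] side_set_def Let_def mem_Collect_eq m
    by (intro conjI matched_c0_multiplication[OF ssr] comm_matched_DD comm_matched_MM rD rM 1 2 3 4)
qed

lemma mprod_elements:
  assumes "l \<in> Lip0 E D" "q \<in> conformal_set E D U \<mu>"
  shows "mprod (c0_multiplication (\<lambda>_. l)) (mprod (c0_multiplication (\<lambda>g. Ub (- g) o\<^sub>L q))
      (c0_multiplication (\<lambda>_. square_power q (Suc n)))) =
    c0_multiplication (\<lambda>g. l o\<^sub>L ((Ub (- g) o\<^sub>L q) o\<^sub>L square_power q (Suc n)))"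
  and "star_strongly_continuous E (\<lambda>g. l o\<^sub>L ((Ub (- g) o\<^sub>L q) o\<^sub>L square_power q (Suc n)))"
proof -
  have aq: "adjointable E q" by (rule intertwines_conformal(1)[OF assms(2)])
  have as: "adjointable E (square_power q n)" for n
    by (induction n) (simp_all add: adjointable_compose adjointable_adj aq)
  have l: "adjointable E l" using assms(1) by (simp add: Lip0_def)
  have 1: "star_strongly_continuous E (\<lambda>g. Ub (- g) o\<^sub>L q)" by (intro ssc_compose ssc_Ub_minus ssc_const aq)
  have 2: "star_strongly_continuous E (\<lambda>g. (Ub (- g) o\<^sub>L q) o\<^sub>L square_power q (Suc n))"
    by (rule ssc_compose[OF 1 ssc_const[OF as]])
  show "mprod (c0_multiplication (\<lambda>_. l)) (mprod (c0_multiplication (\<lambda>g. Ub (- g) o\<^sub>L q))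
      (c0_multiplication (\<lambda>_. square_power q (Suc n)))) =
    c0_multiplication (\<lambda>g. l o\<^sub>L ((Ub (- g) o\<^sub>L q) o\<^sub>L square_power q (Suc n)))"
    unfolding mprod_c0_multiplication[OF 1 ssc_const[OF as]] by (rule mprod_c0_multiplication[OF ssc_const[OF l] 2])
  show "star_strongly_continuous E (\<lambda>g. l o\<^sub>L ((Ub (- g) o\<^sub>L q) o\<^sub>L square_power q (Suc n)))"
    by (rule ssc_compose[OF ssc_const[OF l] 2])
qed

end

section \<open>Integrals of compactly supported continuous functions\<close>

text \<open>Norms of functions with values in a nonseparable space are treated pointwise: for a continuous
  \<open>f\<close> and a simple \<open>s\<close>, the function \<open>\<parallel>f - s\<parallel>\<close> is Borel because \<open>s\<close> has finitely many values.\<close>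

lemma measurable_norm_diff_simple:
  fixes f :: "'g::topological_space \<Rightarrow> 'v::real_normed_vector"
  assumes "sets M = sets borel" "continuous_on UNIV f" "simple_function M s"
  shows "(\<lambda>x. norm (f x - s x)) \<in> borel_measurable M"
proof -
  have sp: "space M = UNIV" using sets_eq_imp_space_eq[OF assms(1)] by simp
  have fin: "finite (range s)" using simple_functionD(1)[OF assms(3)] by (simp add: sp)
  have "norm (f x - s x) = (\<Sum>v\<in>range s. indicator (s -` {v}) x * norm (f x - v))" for x
  proof -
    have "(\<Sum>v\<in>range s. indicator (s -` {v}) x * norm (f x - v)) = (\<Sum>v\<in>{s x}. indicator (s -` {v}) x * norm (f x - v))"
      using fin by (intro sum.mono_neutral_right) (auto simp: indicator_def)
    then show ?thesis by simp
  qed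
  moreover have "(\<lambda>x. \<Sum>v\<in>range s. indicator (s -` {v}) x * norm (f x - v)) \<in> borel_measurable M"
  proof (rule borel_measurable_sum, rule borel_measurable_times)
    fix v
    show "indicator (s -` {v}) \<in> borel_measurable M"
      using simple_functionD(2)[OF assms(3), of "{v}"] by (intro borel_measurable_indicator) (simp add: sp)
    have "(\<lambda>x. norm (f x - v)) \<in> borel_measurable borel"
      using assms(2) by (intro borel_measurable_continuous_onI continuous_intros)
    then show "(\<lambda>x. norm (f x - v)) \<in> borel_measurable M"
      by (simp add: measurable_cong_sets[OF assms(1) refl])
  qed
  ultimately show ?thesis by simp
qed

text \<open>With functionals \<open>T\<close>, this reduces identities between vector-valued integrals to the scalar case.\<close>

lemma has_integral_of_bounded_linear:
  fixes f :: "'g::topological_space \<Rightarrow> 'v::real_normed_vector" and T :: "'v \<Rightarrow> 'w::real_normed_vector"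
  assumes M: "sets M = sets borel" "continuous_on UNIV f" and T: "bounded_linear T" and f: "has_integral_of M f v"
  shows "has_integral_of M (\<lambda>x. T (f x)) (T v)"
proof -
  obtain s where s: "\<And>i::nat. Bochner_Integration.simple_bochner_integrable M (s i)"
    "(\<lambda>i. \<integral>\<^sup>+ x. ennreal (norm (f x - s i x)) \<partial>M) \<longlonglongrightarrow> 0"
    "(\<lambda>i. Bochner_Integration.simple_bochner_integral M (s i)) \<longlonglongrightarrow> v"
    using f unfolding has_integral_of_def by blast
  obtain K where K: "K > 0" "\<And>x. norm (T x) \<le> norm x * K" using bounded_linear.pos_bounded[OF T] by blast
  have l: "linear T" by (rule bounded_linear.linear[OF T])
  have T0: "T 0 = 0" by (rule linear_0[OF l])
  show ?thesis
    unfolding has_integral_of_def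
  proof (intro exI[of _ "\<lambda>i x. T (s i x)"] conjI allI)
    show "Bochner_Integration.simple_bochner_integrable M (\<lambda>x. T (s i x))" for i
      by (rule Bochner_Integration.simple_bochner_integrable_compose2[where p = "\<lambda>x y. T x", OF T0 s(1) s(1)])
    show "(\<lambda>i. Bochner_Integration.simple_bochner_integral M (\<lambda>x. T (s i x))) \<longlonglongrightarrow> T v"
      using bounded_linear.tendsto[OF T s(3)]
      by (simp add: Bochner_Integration.simple_bochner_integral_linear[OF l s(1)])
    have le: "(\<integral>\<^sup>+ x. ennreal (norm (T (f x) - T (s i x))) \<partial>M) \<le> ennreal K * (\<integral>\<^sup>+ x. ennreal (norm (f x - s i x)) \<partial>M)" for i
    proof -
      have sf: "simple_function M (s i)" using s(1)[of i] by (auto elim: Bochner_Integration.simple_bochner_integrable.cases)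
      have "(\<integral>\<^sup>+ x. ennreal (norm (T (f x) - T (s i x))) \<partial>M) \<le> (\<integral>\<^sup>+ x. ennreal K * ennreal (norm (f x - s i x)) \<partial>M)"
      proof (rule nn_integral_mono)
        fix x
        have "norm (T (f x) - T (s i x)) \<le> K * norm (f x - s i x)"
          using K(2)[of "f x - s i x"] by (simp add: linear_diff[OF l] mult.commute)
        then show "ennreal (norm (T (f x) - T (s i x))) \<le> ennreal K * ennreal (norm (f x - s i x))"
          using K(1) by (simp add: ennreal_mult[symmetric] ennreal_leI)
      qed
      also have "\<dots> = ennreal K * (\<integral>\<^sup>+ x. ennreal (norm (f x - s i x)) \<partial>M)"
        using measurable_norm_diff_simple[OF M sf] by (intro nn_integral_cmult) simp
      finally show ?thesis .
    qed
    have lim: "(\<lambda>i. ennreal K * (\<integral>\<^sup>+ x. ennreal (norm (f x - s i x)) \<partial>M)) \<longlonglongrightarrow> ennreal K * 0"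
      by (intro ennreal_tendsto_cmult s(2)) simp
    show "(\<lambda>i. \<integral>\<^sup>+ x. ennreal (norm (T (f x) - T (s i x))) \<partial>M) \<longlonglongrightarrow> 0"
    proof (rule tendsto_sandwich[where f = "\<lambda>_. 0", OF _ _ tendsto_const])
      show "(\<lambda>i. ennreal K * (\<integral>\<^sup>+ x. ennreal (norm (f x - s i x)) \<partial>M)) \<longlonglongrightarrow> 0"
        using lim by simp
    qed (simp_all add: le)
  qed
qed

lemma has_integral_of_real:
  fixes f :: "'g::topological_space \<Rightarrow> real"
  assumes "sets M = sets borel" "continuous_on UNIV f" "has_integral_of M f v"
  shows "integrable M f" "integral\<^sup>L M f = v"
proof -
  have "f \<in> borel_measurable borel" by (rule borel_measurable_continuous_onI[OF assms(2)])
  then have "f \<in> borel_measurable M" by (simp add: measurable_cong_sets[OF assms(1) refl])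
  then have "has_bochner_integral M f v"
    using assms(3) unfolding has_integral_of_def by (auto intro: has_bochner_integral.intros)
  then show "integrable M f" "integral\<^sup>L M f = v"
    by (auto simp: has_bochner_integral_iff)
qed

text \<open>The first entry of the list within distance \<open>e\<close>: applied to an \<open>e\<close>-net of the compact range of \<open>f\<close>, it
  yields a simple function close to \<open>f\<close>.\<close>

primrec pick :: "real \<Rightarrow> 'v list \<Rightarrow> 'v::real_normed_vector \<Rightarrow> 'v" where
  "pick e [] y = 0"
| "pick e (v # vs) y = (if dist y v < e then v else pick e vs y)"

lemma pick_close: "\<exists>v\<in>set vs. dist y v < e \<Longrightarrow> dist y (pick e vs y) < e"
  by (induction vs) auto

lemma simple_function_pick:
  fixes f :: "'g::topological_space \<Rightarrow> 'v::real_normed_vector"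
  assumes "sets M = sets borel" "continuous_on UNIV f"
  shows "simple_function M (\<lambda>x. pick e vs (f x))"
proof (induction vs)
  case (Cons v vs)
  have "{x \<in> space M. dist (f x) v < e} \<in> sets M"
  proof -
    have "open {x. dist (f x) v < e}" using assms(2) by (intro open_Collect_less continuous_intros)
    then show ?thesis using sets_eq_imp_space_eq[OF assms(1)] by (simp add: assms(1))
  qed
  then show ?case unfolding pick.simps by (intro simple_function_If Cons simple_function_const)
qed simp

lemma Cc_has_integral_of:
  fixes f :: "'g::t2_space \<Rightarrow> 'v::banach"
  assumes M: "sets M = sets borel" "\<And>K. compact K \<Longrightarrow> emeasure M K < \<infinity>" and f: "f \<in> Cc"
  shows "\<exists>v. has_integral_of M f v"
proof -
  obtain K where K: "continuous_on UNIV f" "compact K" "\<And>x. x \<notin> K \<Longrightarrow> f x = 0" using f by (rule Cc_E) (rule that)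
  have sp: "space M = UNIV" using sets_eq_imp_space_eq[OF M(1)] by simp
  have Ks: "K \<in> sets M" unfolding M(1) using compact_imp_closed[OF K(2)] by (simp add: borel_closed)
  define m where "m = measure M K"
  have m: "emeasure M K = ennreal m" "0 \<le> m" using M(2)[OF K(2)] by (simp_all add: m_def emeasure_eq_ennreal_measure)
  have "\<exists>s. Bochner_Integration.simple_bochner_integrable M s \<and> (\<forall>x. norm (f x - s x) \<le> e * indicator K x)" if e: "e > 0" for e
  proof -
    have "compact (f ` K)" by (rule compact_continuous_image[OF continuous_on_subset[OF K(1) subset_UNIV] K(2)])
    then obtain k where k: "finite k" "f ` K \<subseteq> (\<Union>x\<in>k. ball x e)"
      using e compact_eq_totally_bounded[of "f ` K"] by auto
    obtain vs where vs: "set vs = k" using finite_list[OF k(1)] by blast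
    define s where "s x = (if x \<in> K then pick e vs (f x) else 0)" for x
    have "simple_function M s" unfolding s_def
      by (intro simple_function_If_set simple_function_pick M(1) K(1) simple_function_const) (use Ks sp in simp)
    moreover have "emeasure M {y \<in> space M. s y \<noteq> 0} \<noteq> \<infinity>"
    proof -
      have "emeasure M {y \<in> space M. s y \<noteq> 0} \<le> emeasure M K"
        by (rule emeasure_mono[OF _ Ks]) (auto simp: s_def)
      then show ?thesis using M(2)[OF K(2)] by (auto simp: top_unique)
    qed
    moreover have "norm (f x - s x) \<le> e * indicator K x" for x
    proof (cases "x \<in> K")
      case True
      then have "\<exists>v\<in>set vs. dist (f x) v < e" using k(2) by (force simp: vs dist_commute)
      then have "dist (f x) (pick e vs (f x)) < e" by (rule pick_close)
      then show ?thesis using True by (simp add: s_def dist_norm)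
    next
      case False
      then show ?thesis using K(3) by (simp add: s_def)
    qed
    ultimately show ?thesis by (blast intro: Bochner_Integration.simple_bochner_integrable.intros)
  qed
  then have "\<forall>n::nat. \<exists>s. Bochner_Integration.simple_bochner_integrable M s \<and> (\<forall>x. norm (f x - s x) \<le> inverse (real (Suc n)) * indicator K x)"
    by simp
  from choice[OF this] obtain s where s: "\<And>n. Bochner_Integration.simple_bochner_integrable M (s n)"
    "\<And>n x. norm (f x - s n x) \<le> inverse (real (Suc n)) * indicator K x" by blast
  have ind: "(\<integral>\<^sup>+ x. ennreal (c * indicator K x) \<partial>M) = ennreal (c * m)" if "c \<ge> 0" for c
  proof -
    have "(\<integral>\<^sup>+ x. ennreal (c * indicator K x) \<partial>M) = (\<integral>\<^sup>+ x. ennreal c * indicator K x \<partial>M)"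
      by (rule nn_integral_cong) (simp add: indicator_def)
    then show ?thesis using Ks m that by (simp add: nn_integral_cmult_indicator ennreal_mult)
  qed
  have "(\<lambda>i. \<integral>\<^sup>+ x. ennreal (norm (f x - s i x)) \<partial>M) \<longlonglongrightarrow> 0"
  proof (rule tendsto_sandwich[where f = "\<lambda>_. 0", OF _ _ tendsto_const])
    have "(\<integral>\<^sup>+ x. ennreal (norm (f x - s n x)) \<partial>M) \<le> ennreal (inverse (real (Suc n)) * m)" for n
      unfolding ind[symmetric, OF inverse_nonnegative_iff_nonnegative[THEN iffD2, OF of_nat_0_le_iff]]
      by (intro nn_integral_mono ennreal_leI s(2))
    then show "\<forall>\<^sub>F i in sequentially. (\<integral>\<^sup>+ x. ennreal (norm (f x - s i x)) \<partial>M) \<le> ennreal (inverse (real (Suc i)) * m)"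
      by simp
    have "(\<lambda>i. inverse (real (Suc i)) * m) \<longlonglongrightarrow> 0 * m" by (intro tendsto_intros LIMSEQ_inverse_real_of_nat)
    then show "(\<lambda>i. ennreal (inverse (real (Suc i)) * m)) \<longlonglongrightarrow> 0"
      using tendsto_ennrealI by fastforce
  qed simp
  moreover have "Cauchy (\<lambda>i. Bochner_Integration.simple_bochner_integral M (s i))"
  proof -
    have le: "norm (Bochner_Integration.simple_bochner_integral M (s i) - Bochner_Integration.simple_bochner_integral M (s j))
      \<le> (inverse (real (Suc i)) + inverse (real (Suc j))) * m" for i j
    proof -
      let ?d = "\<lambda>x. s i x - s j x" and ?c = "inverse (real (Suc i)) + inverse (real (Suc j))"
      have d: "Bochner_Integration.simple_bochner_integrable M ?d" "Bochner_Integration.simple_bochner_integrable M (\<lambda>x. norm (?d x))"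
        by (rule Bochner_Integration.simple_bochner_integrable_compose2[where p = "\<lambda>x y. x - y", OF _ s(1) s(1)], simp)
          (rule Bochner_Integration.simple_bochner_integrable_compose2[where p = "\<lambda>x y. norm (x - y)", OF _ s(1) s(1)], simp)
      have "norm (Bochner_Integration.simple_bochner_integral M (s i) - Bochner_Integration.simple_bochner_integral M (s j))
        = norm (Bochner_Integration.simple_bochner_integral M ?d)"
        by (simp add: Bochner_Integration.simple_bochner_integral_diff[OF s(1) s(1)])
      also have "\<dots> \<le> Bochner_Integration.simple_bochner_integral M (\<lambda>x. norm (?d x))"
        by (rule Bochner_Integration.simple_bochner_integral_norm_bound[OF d(1)])
      finally have "ennreal (norm (Bochner_Integration.simple_bochner_integral M (s i) - Bochner_Integration.simple_bochner_integral M (s j)))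
        \<le> ennreal (Bochner_Integration.simple_bochner_integral M (\<lambda>x. norm (?d x)))" by (rule ennreal_leI)
      also have "\<dots> = (\<integral>\<^sup>+ x. ennreal (norm (?d x)) \<partial>M)"
        by (rule Bochner_Integration.simple_bochner_integral_eq_nn_integral[OF d(2)]) simp
      also have "\<dots> \<le> (\<integral>\<^sup>+ x. ennreal (?c * indicator K x) \<partial>M)"
      proof (intro nn_integral_mono ennreal_leI)
        fix x
        have "norm (?d x) \<le> norm (f x - s i x) + norm (f x - s j x)"
          using norm_triangle_ineq4[of "f x - s j x" "f x - s i x"] by simp
        then show "norm (?d x) \<le> ?c * indicator K x" using s(2)[of x i] s(2)[of x j] by (simp add: distrib_right)
      qed
      also have "\<dots> = ennreal (?c * m)" by (rule ind) simp
      finally show ?thesis using m(2) by (simp add: ennreal_le_iff)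
    qed
    show ?thesis
    proof (rule CauchyI)
      fix e :: real assume e: "e > 0"
      have "(\<lambda>i. inverse (real (Suc i)) * m) \<longlonglongrightarrow> 0 * m" by (intro tendsto_intros LIMSEQ_inverse_real_of_nat)
      then have "\<forall>\<^sub>F i in sequentially. inverse (real (Suc i)) * m < e / 2"
        using e by (intro order_tendstoD(2)) auto
      then obtain N where N: "\<And>i. i \<ge> N \<Longrightarrow> inverse (real (Suc i)) * m < e / 2"
        unfolding eventually_sequentially by blast
      show "\<exists>N. \<forall>i\<ge>N. \<forall>j\<ge>N. norm (Bochner_Integration.simple_bochner_integral M (s i) - Bochner_Integration.simple_bochner_integral M (s j)) < e"
      proof (intro exI allI impI)
        fix i j assume "i \<ge> N" "j \<ge> N"
        from N[OF this(1)] N[OF this(2)] le[of i j]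
        show "norm (Bochner_Integration.simple_bochner_integral M (s i) - Bochner_Integration.simple_bochner_integral M (s j)) < e"
          unfolding distrib_right by linarith
      qed
    qed
  qed
  then obtain v where "(\<lambda>i. Bochner_Integration.simple_bochner_integral M (s i)) \<longlonglongrightarrow> v"
    using Cauchy_convergent convergent_def by blast
  ultimately show ?thesis unfolding has_integral_of_def using s(1) by blast
qed

locale haar = lc_space dom for dom :: "'g::{topological_group_add, t2_space} itself" +
  fixes M :: "'g measure"
  assumes haar: "left_haar_measure M"
begin

lemma sets_M: "sets M = sets borel" and finite_compact: "compact K \<Longrightarrow> emeasure M K < \<infinity>"
  and left_invariant: "S \<in> sets borel \<Longrightarrow> emeasure M ((\<lambda>s. g + s) ` S) = emeasure M S"
  using haar by (auto simp: left_haar_measure_def)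

lemma space_M [simp]: "space M = UNIV"
  using sets_eq_imp_space_eq[OF sets_M] by simp

definition integ :: "('g \<Rightarrow> 'v::real_normed_vector) \<Rightarrow> 'v" where
  "integ f = (THE v. has_integral_of M f v)"

lemma functional_of_integral:
  assumes "continuous_on UNIV f" "has_integral_of M f v" "bounded_linear (r :: 'v::real_normed_vector \<Rightarrow> real)"
  shows "r v = (\<integral>g. r (f g) \<partial>M)"
  using has_integral_of_real(2)[OF sets_M bounded_linear.continuous_on[OF assms(3,1)]
      has_integral_of_bounded_linear[OF sets_M assms(1,3,2)]] by simp

lemma has_integral_of_unique:
  assumes "continuous_on UNIV f" "has_integral_of M f v" "has_integral_of M f w"
  shows "v = w"
  by (rule eq_by_functionals) (simp add: functional_of_integral[OF assms(1,2)] functional_of_integral[OF assms(1,3)])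

lemma integ_eqI: "continuous_on UNIV f \<Longrightarrow> has_integral_of M f v \<Longrightarrow> integ f = v"
  unfolding integ_def using has_integral_of_unique by blast

lemma has_integral_integ: "f \<in> Cc \<Longrightarrow> has_integral_of M f (integ f :: 'v::banach)"
  using Cc_has_integral_of[OF sets_M finite_compact, of f] integ_eqI[OF Cc_continuous] by metis

lemma integ_functional:
  fixes f :: "'g \<Rightarrow> 'v::banach"
  shows "f \<in> Cc \<Longrightarrow> bounded_linear (r :: 'v \<Rightarrow> real) \<Longrightarrow> r (integ f) = (\<integral>g. r (f g) \<partial>M)"
  by (rule functional_of_integral[OF Cc_continuous has_integral_integ])

lemma integ_real: "f \<in> Cc \<Longrightarrow> integ f = (\<integral>g. f g \<partial>M)" for f :: "'g \<Rightarrow> real"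
  using integ_functional[of f "\<lambda>x. x"] bounded_linear_ident by simp

lemma Cc_integrable: "f \<in> Cc \<Longrightarrow> integrable M f" for f :: "'g \<Rightarrow> real"
  by (rule has_integral_of_real(1)[OF sets_M Cc_continuous has_integral_integ])

lemma integ_bounded_linear:
  fixes f :: "'g \<Rightarrow> 'v::banach" and T :: "'v \<Rightarrow> 'w::banach"
  assumes "bounded_linear T" "f \<in> Cc"
  shows "T (integ f) = integ (\<lambda>g. T (f g))"
  using integ_eqI[OF Cc_continuous[OF Cc_bounded_linear[OF assms]]
      has_integral_of_bounded_linear[OF sets_M Cc_continuous[OF assms(2)] assms(1) has_integral_integ[OF assms(2)]]]
  by simp

lemma integ_add:
  fixes f h :: "'g \<Rightarrow> 'v::banach"
  assumes "f \<in> Cc" "h \<in> Cc"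
  shows "integ (\<lambda>g. f g + h g) = integ f + integ h"
proof (rule eq_by_functionals)
  fix r :: "'v \<Rightarrow> real" assume r: "bounded_linear r"
  have "r (integ (\<lambda>g. f g + h g)) = (\<integral>g. r (f g) + r (h g) \<partial>M)"
    by (simp add: integ_functional[OF Cc_add[OF assms] r] linear_simps[OF r])
  also have "\<dots> = r (integ f) + r (integ h)"
    by (subst Bochner_Integration.integral_add)
      (simp_all add: integ_functional[OF _ r] assms Cc_integrable Cc_bounded_linear[OF r])
  finally show "r (integ (\<lambda>g. f g + h g)) = r (integ f + integ h)" by (simp add: linear_simps[OF r])
qed

lemma integ_zero [simp]: "integ (\<lambda>g. 0 :: 'v::banach) = 0"
  using integ_add[of "\<lambda>_. 0::'v" "\<lambda>_. 0"] Cc_zero by simp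

lemma Cc_norm: "f \<in> Cc \<Longrightarrow> (\<lambda>g. norm (f g)) \<in> Cc"
  by (rule Cc_dominated[of _ f]) (auto intro!: continuous_intros simp: Cc_continuous)

lemma norm_integ:
  fixes f :: "'g \<Rightarrow> 'v::banach"
  assumes "f \<in> Cc"
  shows "norm (integ f) \<le> (\<integral>g. norm (f g) \<partial>M)"
proof -
  obtain r :: "'v \<Rightarrow> real" where r: "linear r" "\<And>x. r x \<le> norm x" "r (integ f) = norm (integ f)"
    using Hahn_Banach_norming[of "integ f"] by blast
  have bl: "bounded_linear r" by (rule dominated_bounded_linear[OF r(1,2)])
  have "norm (integ f) = (\<integral>g. r (f g) \<partial>M)" using integ_functional[OF assms bl] r(3) by simp
  also have "\<dots> \<le> (\<integral>g. norm (f g) \<partial>M)"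
    by (intro integral_mono Cc_integrable Cc_bounded_linear[OF bl] Cc_norm assms r(2))
  finally show ?thesis .
qed

lemma norm_integ_bound:
  fixes f :: "'g \<Rightarrow> 'v::banach"
  assumes "continuous_on UNIV f" "compact K" "\<And>g. g \<notin> K \<Longrightarrow> f g = 0" "\<And>g. norm (f g) \<le> C"
  shows "norm (integ f) \<le> C * measure M K"
proof -
  have f: "f \<in> Cc" by (rule Cc_I[OF assms(1-3)])
  have K: "K \<in> sets M" unfolding sets_M using compact_imp_closed[OF assms(2)] by (simp add: borel_closed)
  have i: "integrable M (\<lambda>g. C * indicator K g)"
    using K finite_compact[OF assms(2)] by (intro integrable_mult_right) (simp add: integrable_indicator_iff)
  have "norm (integ f) \<le> (\<integral>g. norm (f g) \<partial>M)" by (rule norm_integ[OF f])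
  also have "\<dots> \<le> (\<integral>g. C * indicator K g \<partial>M)"
    by (intro integral_mono Cc_integrable Cc_norm f i) (use assms(3,4) in \<open>auto simp: indicator_def\<close>)
  also have "\<dots> = C * measure M K" using K by simp
  finally show ?thesis .
qed

lemma integ_diff:
  fixes f h :: "'g \<Rightarrow> 'v::banach"
  assumes "f \<in> Cc" "h \<in> Cc"
  shows "integ (\<lambda>g. f g - h g) = integ f - integ h" and "(\<lambda>g. f g - h g) \<in> Cc"
proof -
  have m: "(\<lambda>g. - h g) \<in> Cc" by (rule Cc_bounded_linear[OF bounded_linear_minus[OF bounded_linear_ident] assms(2)])
  have "integ (\<lambda>g. - h g) = - integ h"
    using integ_bounded_linear[OF bounded_linear_minus[OF bounded_linear_ident] assms(2)] by simp
  then show "integ (\<lambda>g. f g - h g) = integ f - integ h" "(\<lambda>g. f g - h g) \<in> Cc"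
    using integ_add[OF assms(1) m] Cc_add[OF assms(1) m] by simp_all
qed

lemma integ_sum:
  fixes f :: "'i \<Rightarrow> 'g \<Rightarrow> 'v::banach"
  shows "finite I \<Longrightarrow> (\<And>i. i \<in> I \<Longrightarrow> f i \<in> Cc) \<Longrightarrow> integ (\<lambda>g. \<Sum>i\<in>I. f i g) = (\<Sum>i\<in>I. integ (f i))"
  by (induction I rule: finite_induct) (simp_all add: integ_add Cc_sum)

lemma continuous_translations:
  "continuous_on UNIV (\<lambda>s::'g. g + s)" "continuous_on UNIV (\<lambda>s::'g. s + g)" "continuous_on UNIV (\<lambda>s::'g. - s)"
  by (intro continuous_intros)+

lemma Cc_homeomorphic:
  fixes f :: "'g \<Rightarrow> 'v::real_normed_vector"
  assumes "f \<in> Cc" "continuous_on UNIV t" "continuous_on UNIV t'" "\<And>s. t' (t s) = s"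
  shows "(\<lambda>s. f (t s)) \<in> Cc"
proof -
  obtain K where K: "continuous_on UNIV f" "compact K" "\<And>x. x \<notin> K \<Longrightarrow> f x = 0" using assms(1) by (rule Cc_E) (rule that)
  show ?thesis
  proof (rule Cc_I)
    show "continuous_on UNIV (\<lambda>s. f (t s))" by (rule continuous_on_compose2[OF K(1) assms(2)]) simp
    show "compact (t' ` K)" by (rule compact_continuous_image[OF continuous_on_subset[OF assms(3) subset_UNIV] K(2)])
    show "f (t s) = 0" if "s \<notin> t' ` K" for s
    proof (rule K(3))
      show "t s \<notin> K" using that assms(4)[of s] by force
    qed
  qed
qed

lemma Cc_translate:
  fixes f :: "'g \<Rightarrow> 'v::real_normed_vector"
  assumes "f \<in> Cc"
  shows "(\<lambda>s. f (g + s)) \<in> Cc" "(\<lambda>s. f (s + g)) \<in> Cc" "(\<lambda>s. f (- s)) \<in> Cc"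
proof -
  show "(\<lambda>s. f (g + s)) \<in> Cc"
    by (rule Cc_homeomorphic[OF assms continuous_translations(1) continuous_translations(1)[of "- g"]])
      (simp add: add.assoc[symmetric])
  show "(\<lambda>s. f (s + g)) \<in> Cc"
    by (rule Cc_homeomorphic[OF assms continuous_translations(2) continuous_translations(2)[of "- g"]])
      (simp add: add.assoc)
  show "(\<lambda>s. f (- s)) \<in> Cc"
    by (rule Cc_homeomorphic[OF assms continuous_translations(3) continuous_translations(3)]) simp
qed

lemma measurable_translations:
  "(\<lambda>s. g + s) \<in> measurable M M" "(\<lambda>s. s + g) \<in> measurable M M"
  unfolding measurable_cong_sets[OF sets_M sets_M]
  by (rule borel_measurable_continuous_onI[OF continuous_translations(1)])
    (rule borel_measurable_continuous_onI[OF continuous_translations(2)])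

lemma Cc_measurable: "f \<in> Cc \<Longrightarrow> f \<in> borel_measurable M" for f :: "'g \<Rightarrow> real"
  using borel_measurable_continuous_onI[OF Cc_continuous, of f] by (simp add: measurable_cong_sets[OF sets_M refl])

lemma integral_left_translate:
  fixes f :: "'g \<Rightarrow> real"
  assumes "f \<in> Cc"
  shows "(\<integral>s. f (g + s) \<partial>M) = (\<integral>s. f s \<partial>M)"
proof -
  have "distr M M (\<lambda>s. g + s) = M"
  proof (rule measure_eqI)
    fix S assume "S \<in> sets (distr M M (\<lambda>s. g + s))"
    then have S: "S \<in> sets M" by simp
    have "emeasure (distr M M (\<lambda>s. g + s)) S = emeasure M ((\<lambda>s. g + s) -` S \<inter> space M)"
      by (rule emeasure_distr[OF measurable_translations(1) S])
    also have "(\<lambda>s. g + s) -` S \<inter> space M = (\<lambda>s. - g + s) ` S"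
      by (auto simp: image_iff add.assoc[symmetric] intro!: bexI[of _ "g + _"])
    finally show "emeasure (distr M M (\<lambda>s. g + s)) S = emeasure M S"
      using left_invariant[of S "- g"] S by (simp add: sets_M)
  qed simp
  then show ?thesis
    using integral_distr[OF measurable_translations(1)[of g] Cc_measurable[OF assms]] by simp
qed

lemma integ_left_translate:
  fixes f :: "'g \<Rightarrow> 'v::banach"
  assumes "f \<in> Cc"
  shows "integ (\<lambda>s. f (g + s)) = integ f"
proof (rule eq_by_functionals)
  fix r :: "'v \<Rightarrow> real" assume r: "bounded_linear r"
  show "r (integ (\<lambda>s. f (g + s))) = r (integ f)"
    using integral_left_translate[OF Cc_bounded_linear[OF r assms], of g]
    by (simp add: integ_functional[OF _ r] assms Cc_translate)
qed

text \<open>By inner regularity of the open set \<open>G\<close>, some compact set has positive measure.\<close>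

lemma exists_mass:
  obtains \<phi> :: "'g \<Rightarrow> real" where "\<phi> \<in> Cc" "\<And>x. 0 \<le> \<phi> x" "(\<integral>s. \<phi> s \<partial>M) > 0"
proof -
  have "emeasure M UNIV \<noteq> 0" "emeasure M UNIV = (SUP K\<in>{K. compact K \<and> K \<subseteq> UNIV}. emeasure M K)"
    using haar open_UNIV unfolding left_haar_measure_def by blast+
  then have "\<exists>K. compact K \<and> emeasure M K \<noteq> 0" by (metis (mono_tags, lifting) SUP_bot_conv(2) bot_ennreal mem_Collect_eq)
  then obtain K where K: "compact K" "emeasure M K \<noteq> 0" by blast
  obtain \<phi> :: "'g \<Rightarrow> real" where \<phi>: "\<phi> \<in> Cc" "\<And>x. 0 \<le> \<phi> x" "\<And>x. x \<in> K \<Longrightarrow> \<phi> x = 1"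
    by (rule Urysohn_Cc[OF K(1) open_UNIV subset_UNIV]) (rule that)
  have Ks: "K \<in> sets M" unfolding sets_M using compact_imp_closed[OF K(1)] by (simp add: borel_closed)
  have "measure M K = (\<integral>s. indicator K s \<partial>M)" using Ks by simp
  also have "\<dots> \<le> (\<integral>s. \<phi> s \<partial>M)"
  proof (rule integral_mono)
    show "integrable M (indicator K :: 'g \<Rightarrow> real)"
      using Ks finite_compact[OF K(1)] by (simp add: integrable_indicator_iff)
    show "integrable M \<phi>" by (rule Cc_integrable[OF \<phi>(1)])
    show "indicator K s \<le> \<phi> s" for s using \<phi>(2,3) by (auto simp: indicator_def)
  qed
  finally have "measure M K \<le> (\<integral>s. \<phi> s \<partial>M)" .
  moreover have "measure M K > 0"
    using K(2) finite_compact[OF K(1)] by (simp add: emeasure_eq_ennreal_measure zero_less_measure_iff)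
  ultimately show thesis using that \<phi> by simp
qed

lemma continuous_integ_parameter:
  fixes H :: "'p::topological_space \<Rightarrow> 'g \<Rightarrow> 'v::banach"
  assumes H: "continuous_on UNIV (\<lambda>(p, s). H p s)"
    and supp: "\<And>p0. \<exists>N K. open N \<and> p0 \<in> N \<and> compact K \<and> (\<forall>p\<in>N. \<forall>s. s \<notin> K \<longrightarrow> H p s = 0)"
  shows "continuous_on UNIV (\<lambda>p. integ (H p))"
  unfolding continuous_on_def tendsto_iff
proof (intro ballI allI impI)
  fix p0 :: 'p and e :: real assume e: "e > 0"
  obtain N K where NK: "open N" "p0 \<in> N" "compact K" "\<And>p s. p \<in> N \<Longrightarrow> s \<notin> K \<Longrightarrow> H p s = 0" using supp[of p0] by blast
  define m where "m = measure M K + 1"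
  have m: "m > 0" by (simp add: m_def add_nonneg_pos)
  define d where "d = e / (2 * m)"
  have d: "d > 0" using e m by (simp add: d_def)
  obtain X0 where X0: "p0 \<in> X0" "open X0" "\<forall>p\<in>X0 \<inter> UNIV. \<forall>s\<in>K. dist ((\<lambda>(p, s). H p s) (p, s)) ((\<lambda>(p, s). H p s) (p0, s)) \<le> d"
    by (rule continuous_on_prod_compactE[OF continuous_on_subset[OF H subset_UNIV] NK(3) UNIV_I d]) (rule that)
  have cH: "continuous_on UNIV (H p)" for p
    using continuous_on_compose2[OF H, of UNIV "\<lambda>s. (p, s)"] by (simp add: continuous_intros)
  have Cc: "H p \<in> Cc" if "p \<in> N" for p using NK(4)[OF that] by (intro Cc_I[OF cH NK(3)])
  have "dist (integ (H p)) (integ (H p0)) < e" if p: "p \<in> N \<inter> X0" for p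
  proof -
    have "dist (integ (H p)) (integ (H p0)) = norm (integ (\<lambda>s. H p s - H p0 s))"
      using p by (simp add: dist_norm integ_diff Cc NK(2))
    also have "\<dots> \<le> d * measure M K"
    proof (rule norm_integ_bound[OF _ NK(3)])
      show "continuous_on UNIV (\<lambda>s. H p s - H p0 s)" by (intro continuous_intros cH)
      show "H p s - H p0 s = 0" if "s \<notin> K" for s using NK(2,4) p that by simp
      show "norm (H p s - H p0 s) \<le> d" for s
        using X0(3) p NK(2,4) d by (cases "s \<in> K") (auto simp: dist_norm)
    qed
    also have "\<dots> < e"
    proof -
      have "d * measure M K \<le> d * m" using d by (simp add: m_def)
      also have "\<dots> = e / 2" using m by (simp add: d_def)
      finally show ?thesis using e by linarith
    qed
    finally show ?thesis .
  qed
  then show "\<forall>\<^sub>F p in at p0 within UNIV. dist (integ (H p)) (integ (H p0)) < e"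
    unfolding eventually_at_topological using NK(1,2) X0(1,2) by (intro exI[of _ "N \<inter> X0"]) auto
qed

text \<open>Fubini's theorem, by approximating the integrand with finite sums of products.\<close>

lemma Fubini_real:
  fixes H :: "'g \<Rightarrow> 'g \<Rightarrow> real"
  assumes H: "continuous_on UNIV (\<lambda>(r, s). H r s)" and K: "compact K" "\<And>r s. r \<notin> K \<Longrightarrow> H r s = 0"
    and L: "compact L" "\<And>r s. s \<notin> L \<Longrightarrow> H r s = 0"
  shows "integ (\<lambda>r. integ (\<lambda>s. H r s)) = integ (\<lambda>s. integ (\<lambda>r. H r s))"
proof -
  obtain W K' where W: "open W" "compact K'" "K \<subseteq> W" "W \<subseteq> K'" using compact_neighbourhood[OF K(1)] .
  have c1: "continuous_on UNIV (H r)" for r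
    using continuous_on_compose2[OF H, of UNIV "\<lambda>s. (r, s)"] by (simp add: continuous_intros)
  have c2: "continuous_on UNIV (\<lambda>r. H r s)" for s
    using continuous_on_compose2[OF H, of UNIV "\<lambda>r. (r, s)"] by (simp add: continuous_intros)
  have Cc1: "H r \<in> Cc" for r by (rule Cc_I[OF c1 L])
  have Cc2: "(\<lambda>r. H r s) \<in> Cc" for s by (rule Cc_I[OF c2 K])
  have i1: "continuous_on UNIV (\<lambda>r. integ (\<lambda>s. H r s))"
    by (rule continuous_integ_parameter[OF H]) (use L in \<open>blast intro: open_UNIV\<close>)
  have H': "continuous_on UNIV (\<lambda>(s, r). H r s)"
    using continuous_on_compose2[OF H, of UNIV "\<lambda>(s, r). (r, s)"] by (simp add: split_beta' continuous_intros)
  have i2: "continuous_on UNIV (\<lambda>s. integ (\<lambda>r. H r s))"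
    by (rule continuous_integ_parameter[OF H']) (use K in \<open>blast intro: open_UNIV\<close>)
  have i1K: "integ (\<lambda>s. H r s) = 0" if "r \<notin> K" for r using K(2)[OF that] by simp
  have i2L: "integ (\<lambda>r. H r s) = 0" if "s \<notin> L" for s using L(2)[OF that] by simp
  have ii1: "(\<lambda>r. integ (\<lambda>s. H r s)) \<in> Cc" by (rule Cc_I[OF i1 K(1) i1K])
  have ii2: "(\<lambda>s. integ (\<lambda>r. H r s)) \<in> Cc" by (rule Cc_I[OF i2 L(1) i2L])
  define m where "m = measure M K' * measure M L"
  have "norm (integ (\<lambda>r. integ (\<lambda>s. H r s)) - integ (\<lambda>s. integ (\<lambda>r. H r s))) \<le> 2 * m * e" if e: "e > 0" for e
  proof -
    have uc: "\<exists>N. open N \<and> r \<in> N \<and> (\<forall>r'\<in>N. \<forall>s. norm (H r' s - H r s) \<le> e)" for r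
    proof -
      obtain X0 where X0: "r \<in> X0" "open X0" "\<forall>p\<in>X0 \<inter> UNIV. \<forall>s\<in>L. dist ((\<lambda>(p, s). H p s) (p, s)) ((\<lambda>(p, s). H p s) (r, s)) \<le> e"
        by (rule continuous_on_prod_compactE[OF continuous_on_subset[OF H subset_UNIV] L(1) UNIV_I e]) (rule that)
      have "norm (H r' s - H r s) \<le> e" if "r' \<in> X0" for r' s
        using X0(3) that L(2) e by (cases "s \<in> L") (auto simp: dist_norm)
      then show ?thesis using X0 by blast
    qed
    obtain I and \<phi> :: "'g \<Rightarrow> 'g \<Rightarrow> real" where \<phi>: "finite I" "\<And>i. i \<in> I \<Longrightarrow> \<phi> i \<in> Cc"
      "\<And>i x. i \<in> I \<Longrightarrow> x \<notin> W \<Longrightarrow> \<phi> i x = 0" "\<And>x s. norm (H x s - (\<Sum>i\<in>I. \<phi> i x *\<^sub>R H i s)) \<le> e"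
      by (rule partition_approximation[OF K(1) W(1,3) K(2) e uc]) (assumption, rule that)
    let ?A = "\<lambda>r s. \<Sum>i\<in>I. \<phi> i r *\<^sub>R H i s"
    have A1: "integ (\<lambda>s. ?A r s) = (\<Sum>i\<in>I. \<phi> i r * integ (H i))" for r
      using \<phi>(1) by (subst integ_sum)
        (auto intro!: Cc_bounded_linear[OF bounded_linear_mult_right] Cc1 sum.cong
          simp: integ_bounded_linear[OF bounded_linear_mult_right Cc1, symmetric])
    have A2: "integ (\<lambda>r. ?A r s) = (\<Sum>i\<in>I. integ (\<phi> i) * H i s)" for s
      using \<phi>(1,2) by (subst integ_sum)
        (auto intro!: Cc_bounded_linear[OF bounded_linear_mult_left] sum.cong
          simp: integ_bounded_linear[OF bounded_linear_mult_left \<phi>(2), symmetric])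
    have AC1: "(\<lambda>s. ?A r s) \<in> Cc" for r
      using \<phi>(1) by (intro Cc_sum) (auto intro!: Cc_bounded_linear[OF bounded_linear_mult_right] Cc1)
    have AC2: "(\<lambda>r. ?A r s) \<in> Cc" for s
      using \<phi>(1,2) by (intro Cc_sum) (auto intro!: Cc_bounded_linear[OF bounded_linear_mult_left])
    have AA1: "(\<lambda>r. \<Sum>i\<in>I. \<phi> i r * integ (H i)) \<in> Cc"
      using \<phi>(1,2) by (intro Cc_sum) (auto intro!: Cc_bounded_linear[OF bounded_linear_mult_left])
    have AA2: "(\<lambda>s. \<Sum>i\<in>I. integ (\<phi> i) * H i s) \<in> Cc"
      using \<phi>(1) by (intro Cc_sum) (auto intro!: Cc_bounded_linear[OF bounded_linear_mult_right] Cc1)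
    have both: "integ (\<lambda>r. \<Sum>i\<in>I. \<phi> i r * integ (H i)) = integ (\<lambda>s. \<Sum>i\<in>I. integ (\<phi> i) * H i s)"
    proof -
      have "integ (\<lambda>r. \<Sum>i\<in>I. \<phi> i r * integ (H i)) = (\<Sum>i\<in>I. integ (\<phi> i) * integ (H i))"
        using \<phi>(1,2) by (subst integ_sum)
          (auto intro!: Cc_bounded_linear[OF bounded_linear_mult_left] sum.cong
            simp: integ_bounded_linear[OF bounded_linear_mult_left \<phi>(2), symmetric])
      moreover have "integ (\<lambda>s. \<Sum>i\<in>I. integ (\<phi> i) * H i s) = (\<Sum>i\<in>I. integ (\<phi> i) * integ (H i))"
        using \<phi>(1) by (subst integ_sum)
          (auto intro!: Cc_bounded_linear[OF bounded_linear_mult_right] Cc1 sum.cong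
            simp: integ_bounded_linear[OF bounded_linear_mult_right Cc1, symmetric])
      ultimately show ?thesis by simp
    qed
    have b1: "norm (integ (\<lambda>s. H r s) - (\<Sum>i\<in>I. \<phi> i r * integ (H i))) \<le> e * measure M L" for r
      unfolding A1[symmetric] integ_diff(1)[OF Cc1 AC1, symmetric]
      by (rule norm_integ_bound[OF Cc_continuous[OF integ_diff(2)[OF Cc1 AC1]] L(1) _ \<phi>(4)]) (simp add: L(2))
    have b2: "norm (integ (\<lambda>r. H r s) - (\<Sum>i\<in>I. integ (\<phi> i) * H i s)) \<le> e * measure M K'" for s
      unfolding A2[symmetric] integ_diff(1)[OF Cc2 AC2, symmetric]
    proof (rule norm_integ_bound[OF Cc_continuous[OF integ_diff(2)[OF Cc2 AC2]] W(2) _ \<phi>(4)])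
      fix r assume "r \<notin> K'"
      then have "r \<notin> K" "r \<notin> W" using W by auto
      then show "H r s - ?A r s = 0" using K(2) \<phi>(3) by simp
    qed
    have "norm (integ (\<lambda>r. integ (\<lambda>s. H r s)) - integ (\<lambda>r. \<Sum>i\<in>I. \<phi> i r * integ (H i))) \<le> (e * measure M L) * measure M K'"
      unfolding integ_diff(1)[OF ii1 AA1, symmetric]
    proof (rule norm_integ_bound[OF Cc_continuous[OF integ_diff(2)[OF ii1 AA1]] W(2) _ b1])
      fix r assume "r \<notin> K'"
      then have "r \<notin> K" "r \<notin> W" using W by auto
      then show "integ (H r) - (\<Sum>i\<in>I. \<phi> i r * integ (H i)) = 0" using i1K \<phi>(3) by simp
    qed
    moreover have "norm (integ (\<lambda>s. integ (\<lambda>r. H r s)) - integ (\<lambda>s. \<Sum>i\<in>I. integ (\<phi> i) * H i s)) \<le> (e * measure M K') * measure M L"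
      unfolding integ_diff(1)[OF ii2 AA2, symmetric]
      by (rule norm_integ_bound[OF Cc_continuous[OF integ_diff(2)[OF ii2 AA2]] L(1) _ b2]) (simp add: i2L L(2))
    ultimately show ?thesis
      unfolding both m_def
      using norm_triangle_ineq4[of "integ (\<lambda>r. integ (\<lambda>s. H r s)) - integ (\<lambda>s. \<Sum>i\<in>I. integ (\<phi> i) * H i s)"
          "integ (\<lambda>s. integ (\<lambda>r. H r s)) - integ (\<lambda>s. \<Sum>i\<in>I. integ (\<phi> i) * H i s)"]
      by (simp add: mult_ac)
  qed
  note le = this
  have m0: "m \<ge> 0" by (simp add: m_def)
  have "norm (integ (\<lambda>r. integ (\<lambda>s. H r s)) - integ (\<lambda>s. integ (\<lambda>r. H r s))) \<le> 0"
  proof (rule field_le_epsilon)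
    fix e :: real assume e: "e > 0"
    have "e / (2 * m + 1) > 0" using e m0 by (simp add: add_nonneg_pos)
    from le[OF this] have "norm (integ (\<lambda>r. integ (\<lambda>s. H r s)) - integ (\<lambda>s. integ (\<lambda>r. H r s))) \<le> 2 * m * (e / (2 * m + 1))" .
    also have "\<dots> \<le> (2 * m + 1) * (e / (2 * m + 1))" using \<open>e / (2 * m + 1) > 0\<close> by (intro mult_right_mono) auto
    also have "\<dots> = e" using m0 by (simp add: add_nonneg_eq_0_iff)
    finally show "norm (integ (\<lambda>r. integ (\<lambda>s. H r s)) - integ (\<lambda>s. integ (\<lambda>r. H r s))) \<le> 0 + e" by simp
  qed
  then show ?thesis by simp
qed

theorem Fubini:
  fixes H :: "'g \<Rightarrow> 'g \<Rightarrow> 'v::banach"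
  assumes H: "continuous_on UNIV (\<lambda>(r, s). H r s)" and K: "compact K" "\<And>r s. r \<notin> K \<Longrightarrow> H r s = 0"
    and L: "compact L" "\<And>r s. s \<notin> L \<Longrightarrow> H r s = 0"
  shows "integ (\<lambda>r. integ (\<lambda>s. H r s)) = integ (\<lambda>s. integ (\<lambda>r. H r s))"
    and "(\<lambda>r. integ (\<lambda>s. H r s)) \<in> Cc" and "(\<lambda>s. integ (\<lambda>r. H r s)) \<in> Cc"
    and "H r \<in> Cc" and "(\<lambda>r. H r s) \<in> Cc"
proof -
  have c1: "continuous_on UNIV (H r)" for r
    using continuous_on_compose2[OF H, of UNIV "\<lambda>s. (r, s)"] by (simp add: continuous_intros)
  have c2: "continuous_on UNIV (\<lambda>r. H r s)" for s
    using continuous_on_compose2[OF H, of UNIV "\<lambda>r. (r, s)"] by (simp add: continuous_intros)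
  show Cc1: "H r \<in> Cc" for r by (rule Cc_I[OF c1 L])
  show Cc2: "(\<lambda>r. H r s) \<in> Cc" for s by (rule Cc_I[OF c2 K])
  have i1: "continuous_on UNIV (\<lambda>r. integ (\<lambda>s. H r s))"
    by (rule continuous_integ_parameter[OF H]) (use L in \<open>blast intro: open_UNIV\<close>)
  have H': "continuous_on UNIV (\<lambda>(s, r). H r s)"
    using continuous_on_compose2[OF H, of UNIV "\<lambda>(s, r). (r, s)"] by (simp add: split_beta' continuous_intros)
  have i2: "continuous_on UNIV (\<lambda>s. integ (\<lambda>r. H r s))"
    by (rule continuous_integ_parameter[OF H']) (use K in \<open>blast intro: open_UNIV\<close>)
  show ii1: "(\<lambda>r. integ (\<lambda>s. H r s)) \<in> Cc" by (rule Cc_I[OF i1 K(1)]) (simp add: K(2))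
  show ii2: "(\<lambda>s. integ (\<lambda>r. H r s)) \<in> Cc" by (rule Cc_I[OF i2 L(1)]) (simp add: L(2))
  show "integ (\<lambda>r. integ (\<lambda>s. H r s)) = integ (\<lambda>s. integ (\<lambda>r. H r s))"
  proof (rule eq_by_functionals)
    fix f :: "'v \<Rightarrow> real" assume f: "bounded_linear f"
    have "continuous_on UNIV (\<lambda>(r, s). f (H r s))"
      using bounded_linear.continuous_on[OF f H] by (simp add: split_beta')
    then have "integ (\<lambda>r. integ (\<lambda>s. f (H r s))) = integ (\<lambda>s. integ (\<lambda>r. f (H r s)))"
      by (rule Fubini_real[OF _ K(1) _ L(1)]) (simp_all add: K(2) L(2) linear_simps[OF f])
    then show "f (integ (\<lambda>r. integ (\<lambda>s. H r s))) = f (integ (\<lambda>s. integ (\<lambda>r. H r s)))"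
      by (simp add: integ_bounded_linear[OF f] Cc1 Cc2 ii1 ii2)
  qed
qed

end

section \<open>The modular function\<close>

lemma continuous_on_pair_compose:
  assumes "continuous_on UNIV (\<lambda>(x, y). H x y)" "continuous_on S f" "continuous_on S h"
  shows "continuous_on S (\<lambda>p. H (f p) (h p))"
  using continuous_on_compose2[OF assms(1) continuous_on_Pair[OF assms(2,3)]] by simp

locale modular = haar dom M for dom :: "'g::{topological_group_add, t2_space} itself" and M +
  fixes \<Delta> :: "'g \<Rightarrow> real"
  assumes modular: "modular_function M \<Delta>"
begin

lemma \<Delta>_pos: "\<Delta> g > 0" and right_translate: "S \<in> sets borel \<Longrightarrow> emeasure M ((\<lambda>s. s + g) ` S) = ennreal (\<Delta> g) * emeasure M S"
  using modular by (auto simp: modular_function_def)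

lemma integral_right_translate:
  fixes f :: "'g \<Rightarrow> real"
  assumes "f \<in> Cc"
  shows "(\<integral>s. f (s + - g) \<partial>M) = \<Delta> g * (\<integral>s. f s \<partial>M)"
proof -
  have "distr M M (\<lambda>s. s + - g) = density M (\<lambda>_. ennreal (\<Delta> g))"
  proof (rule measure_eqI)
    fix S assume "S \<in> sets (distr M M (\<lambda>s. s + - g))"
    then have S: "S \<in> sets M" by simp
    have "emeasure (distr M M (\<lambda>s. s + - g)) S = emeasure M ((\<lambda>s. s + - g) -` S \<inter> space M)"
      by (rule emeasure_distr[OF measurable_translations(2) S])
    also have "(\<lambda>s. s + - g) -` S \<inter> space M = (\<lambda>s. s + g) ` S"
    proof (intro equalityI subsetI)
      fix s assume "s \<in> (\<lambda>s. s + - g) -` S \<inter> space M"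
      then show "s \<in> (\<lambda>s. s + g) ` S" by (intro image_eqI[of _ _ "s + - g"]) (auto simp: add.assoc)
    qed (auto simp: add.assoc)
    also have "emeasure M ((\<lambda>s. s + g) ` S) = ennreal (\<Delta> g) * emeasure M S"
      using right_translate S by (simp add: sets_M)
    finally show "emeasure (distr M M (\<lambda>s. s + - g)) S = emeasure (density M (\<lambda>_. ennreal (\<Delta> g))) S"
      using S by (simp add: emeasure_density_const)
  qed simp
  then have "(\<integral>s. f s \<partial>distr M M (\<lambda>s. s + - g)) = (\<integral>s. f s \<partial>density M (\<lambda>_. ennreal (\<Delta> g)))" by simp
  then show ?thesis
    using integral_distr[OF measurable_translations(2)[of "- g"] Cc_measurable[OF assms]]
      integral_density[OF Cc_measurable[OF assms], of "\<lambda>_. \<Delta> g"] \<Delta>_pos[of g]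
    by (simp add: less_imp_le)
qed

text \<open>Evaluate the right translate by \<open>g + h\<close> of a function of nonzero integral in two ways.\<close>

lemma \<Delta>_add: "\<Delta> (g + h) = \<Delta> g * \<Delta> h"
proof -
  obtain \<phi> :: "'g \<Rightarrow> real" where \<phi>: "\<phi> \<in> Cc" "(\<integral>s. \<phi> s \<partial>M) > 0" by (rule exists_mass) (rule that)
  have "\<Delta> (g + h) * (\<integral>s. \<phi> s \<partial>M) = (\<integral>s. \<phi> ((s + - h) + - g) \<partial>M)"
    using integral_right_translate[OF \<phi>(1), of "g + h"] by (simp only: minus_add add.assoc)
  also have "\<dots> = \<Delta> h * (\<integral>s. \<phi> (s + - g) \<partial>M)"
    by (rule integral_right_translate[OF Cc_translate(2)[OF \<phi>(1)]])
  also have "\<dots> = \<Delta> h * (\<Delta> g * (\<integral>s. \<phi> s \<partial>M))" by (simp only: integral_right_translate[OF \<phi>(1)])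
  finally show ?thesis using \<phi>(2) by simp
qed

lemma \<Delta>_zero: "\<Delta> 0 = 1"
  using \<Delta>_add[of 0 0] \<Delta>_pos[of 0] by simp

lemma \<Delta>_minus: "\<Delta> g * \<Delta> (- g) = 1"
  using \<Delta>_add[of g "- g"] by (simp add: \<Delta>_zero)

lemma continuous_\<Delta>: "continuous_on UNIV \<Delta>"
proof -
  obtain \<phi> :: "'g \<Rightarrow> real" where \<phi>: "\<phi> \<in> Cc" "(\<integral>s. \<phi> s \<partial>M) > 0" by (rule exists_mass) (rule that)
  obtain L where L: "continuous_on UNIV \<phi>" "compact L" "\<And>x. x \<notin> L \<Longrightarrow> \<phi> x = 0" using \<phi>(1) by (rule Cc_E) (rule that)
  have "continuous_on UNIV (\<lambda>g. integ (\<lambda>s. \<phi> (s + - g)))"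
  proof (rule continuous_integ_parameter)
    have "continuous_on UNIV (\<lambda>p::'g \<times> 'g. \<phi> (snd p + - fst p))"
      by (rule continuous_on_compose2[OF L(1)]) (intro continuous_intros, simp)
    then show "continuous_on UNIV (\<lambda>(g, s). \<phi> (s + - g))" by (simp add: split_beta')
    fix g0 :: 'g
    obtain V K where VK: "open V" "compact K" "{g0} \<subseteq> V" "V \<subseteq> K" using compact_neighbourhood[OF compact_sing] .
    let ?K = "(\<lambda>p. fst p + snd p) ` (L \<times> K)"
    have "compact ?K" by (intro compact_continuous_image compact_Times L(2) VK(2) continuous_intros)
    moreover have "\<phi> (s + - g) = 0" if "g \<in> V" "s \<notin> ?K" for g s
    proof (rule L(3))
      show "s + - g \<notin> L"
      proof
        assume "s + - g \<in> L"
        then have "(s + - g, g) \<in> L \<times> K" using that VK by auto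
        then have "s \<in> ?K" by (rule image_eqI[rotated]) (simp add: add.assoc)
        then show False using that by simp
      qed
    qed
    ultimately show "\<exists>N K. open N \<and> g0 \<in> N \<and> compact K \<and> (\<forall>g\<in>N. \<forall>s. s \<notin> K \<longrightarrow> \<phi> (s + - g) = 0)"
      using VK by blast
  qed
  moreover have "integ (\<lambda>s. \<phi> (s + - g)) = \<Delta> g * (\<integral>s. \<phi> s \<partial>M)" for g
    by (simp only: integ_real[OF Cc_translate(2)[OF \<phi>(1)]] integral_right_translate[OF \<phi>(1)])
  ultimately have "continuous_on UNIV (\<lambda>g. (\<Delta> g * (\<integral>s. \<phi> s \<partial>M)) / (\<integral>s. \<phi> s \<partial>M))"
    using \<phi>(2) by (intro continuous_on_divide continuous_on_const) auto
  then show ?thesis using \<phi>(2) by simp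
qed

lemma Cc_reflect:
  fixes f :: "'g \<Rightarrow> 'v::real_normed_vector"
  assumes "f \<in> Cc"
  shows "(\<lambda>s. \<Delta> (- s) *\<^sub>R f (- s)) \<in> Cc"
proof (rule Cc_dominated[OF _ Cc_translate(3)[OF assms]])
  have "continuous_on UNIV (\<lambda>s. \<Delta> (- s))"
    by (rule continuous_on_compose2[OF continuous_\<Delta>]) (intro continuous_intros, simp)
  then show "continuous_on UNIV (\<lambda>s. \<Delta> (- s) *\<^sub>R f (- s))"
    by (rule continuous_on_scaleR[OF _ Cc_continuous[OF Cc_translate(3)[OF assms]]])
qed simp

text \<open>Let \<open>I\<close> be the integral and \<open>J h = \<integral> h(-s) \<Delta>(-s) ds\<close>. Two translations and Fubini give
  \<open>I \<phi> J h = I \<phi> I h\<close>.\<close>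

lemma inversion_real:
  fixes h :: "'g \<Rightarrow> real"
  assumes h: "h \<in> Cc"
  shows "integ (\<lambda>s. \<Delta> (- s) *\<^sub>R h (- s)) = integ h"
proof -
  obtain \<phi> :: "'g \<Rightarrow> real" where \<phi>: "\<phi> \<in> Cc" "(\<integral>s. \<phi> s \<partial>M) > 0" by (rule exists_mass) (rule that)
  obtain K where K: "continuous_on UNIV \<phi>" "compact K" "\<And>x. x \<notin> K \<Longrightarrow> \<phi> x = 0" using \<phi>(1) by (rule Cc_E) (rule that)
  obtain L where L: "continuous_on UNIV h" "compact L" "\<And>x. x \<notin> L \<Longrightarrow> h x = 0" using h by (rule Cc_E) (rule that)
  define J where "J = integ (\<lambda>s. \<Delta> (- s) *\<^sub>R h (- s))"
  have Jc: "(\<lambda>s. \<Delta> (- s) *\<^sub>R h (- s)) \<in> Cc" by (rule Cc_reflect[OF h])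
  \<comment> \<open>a right translation by \<open>s\<close> multiplies the integral by \<open>\<Delta> s\<close>, which cancels\<close>
  have J: "J = integ (\<lambda>t. h (s + - t) * \<Delta> (- t))" for s
  proof -
    have "integ (\<lambda>t. \<Delta> (- (t + - s)) *\<^sub>R h (- (t + - s))) = \<Delta> s * J"
      using integral_right_translate[OF Jc, of s] by (simp only: J_def integ_real[OF Jc] integ_real[OF Cc_translate(2)[OF Jc]])
    moreover have "\<Delta> (- (t + - s)) *\<^sub>R h (- (t + - s)) = \<Delta> s * (h (s + - t) * \<Delta> (- t))" for t
      by (simp only: minus_add minus_minus \<Delta>_add real_scaleR_def mult_ac)
    ultimately have "integ (\<lambda>t. \<Delta> s * (h (s + - t) * \<Delta> (- t))) = \<Delta> s * J" by (simp only:)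
    moreover have "(\<lambda>t. h (s + - t) * \<Delta> (- t)) \<in> Cc"
    proof -
      have "(\<lambda>t. inverse (\<Delta> s) *\<^sub>R (\<Delta> (- (t + - s)) *\<^sub>R h (- (t + - s)))) \<in> Cc"
        by (rule Cc_bounded_linear[OF bounded_linear_scaleR_right Cc_translate(2)[OF Jc]])
      moreover have "inverse (\<Delta> s) *\<^sub>R (\<Delta> (- (t + - s)) *\<^sub>R h (- (t + - s))) = h (s + - t) * \<Delta> (- t)" for t
      proof -
        have "inverse (\<Delta> s) *\<^sub>R (\<Delta> (- (t + - s)) *\<^sub>R h (- (t + - s))) = (inverse (\<Delta> s) * \<Delta> s) * (h (s + - t) * \<Delta> (- t))"
          by (simp only: minus_add minus_minus \<Delta>_add real_scaleR_def mult_ac)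
        then show ?thesis using \<Delta>_pos[of s] by simp
      qed
      ultimately show ?thesis by (simp only:)
    qed
    from integ_bounded_linear[OF bounded_linear_mult_right this, of "\<Delta> s"]
    have "\<Delta> s * integ (\<lambda>t. h (s + - t) * \<Delta> (- t)) = integ (\<lambda>t. \<Delta> s * (h (s + - t) * \<Delta> (- t)))" .
    ultimately show ?thesis using \<Delta>_pos[of s] by simp
  qed
  let ?P = "(\<lambda>p. - fst p + snd p) ` (L \<times> K)"
  have P: "compact ?P" by (intro compact_continuous_image compact_Times L(2) K(2) continuous_intros)
  \<comment> \<open>integrated over \<open>t\<close> first, \<open>?H\<close> gives \<open>I \<phi> J h\<close>; over \<open>s\<close> first, \<open>I \<phi> I h\<close>\<close>
  let ?H = "\<lambda>s t. \<phi> s * (h (s + - t) * \<Delta> (- t))"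
  have PI: "t \<in> ?P" if "s + - t \<in> L" "s \<in> K" for s t
  proof -
    have "- (s + - t) + s = t" by (simp add: minus_add)
    then show ?thesis using that by (intro image_eqI[of _ _ "(s + - t, s)"]) auto
  qed
  have c\<phi>: "continuous_on UNIV (\<lambda>p::'g \<times> 'g. \<phi> (fst p))" and ch: "continuous_on UNIV (\<lambda>p::'g \<times> 'g. h (fst p + - snd p))"
    and c\<Delta>: "continuous_on UNIV (\<lambda>p::'g \<times> 'g. \<Delta> (- snd p))"
    by (rule continuous_on_compose2[OF K(1)], intro continuous_intros, simp)
      (rule continuous_on_compose2[OF L(1)], intro continuous_intros, simp,
       rule continuous_on_compose2[OF continuous_\<Delta>], intro continuous_intros, simp)
  have H: "continuous_on UNIV (\<lambda>(s, t). ?H s t)"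
    using continuous_on_mult[OF c\<phi> continuous_on_mult[OF ch c\<Delta>]] by (simp add: split_beta')
  have HK: "?H s t = 0" if "s \<notin> K" for s t using K(3)[OF that] by simp
  have HP: "?H s t = 0" if "t \<notin> ?P" for s t using PI[of s t] K(3)[of s] L(3)[of "s + - t"] that by fastforce
  note F = Fubini[of ?H, OF H K(2) HK P HP]
  have F1: "integ (\<lambda>s. integ (\<lambda>t. ?H s t)) = integ (\<lambda>t. integ (\<lambda>s. ?H s t))" by (rule F(1))
  have "integ (\<lambda>s. integ (\<lambda>t. ?H s t)) = integ (\<lambda>s. \<phi> s * J)"
  proof -
    have "integ (\<lambda>t. ?H s t) = \<phi> s * J" for s
    proof (cases "\<phi> s = 0")
      case False
      have "(\<lambda>t. inverse (\<phi> s) * ?H s t) \<in> Cc"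
        by (rule Cc_bounded_linear[OF bounded_linear_mult_right F(4)])
      then have "(\<lambda>t. h (s + - t) * \<Delta> (- t)) \<in> Cc" using False by (simp add: field_simps)
      then show ?thesis using J[of s] integ_bounded_linear[OF bounded_linear_mult_right] by metis
    qed simp
    then show ?thesis by simp
  qed
  also have "\<dots> = integ \<phi> * J" using integ_bounded_linear[OF bounded_linear_mult_left \<phi>(1)] by metis
  finally have 1: "integ (\<lambda>s. integ (\<lambda>t. ?H s t)) = integ \<phi> * J" .
  let ?H2 = "\<lambda>s t. \<phi> (s + t) * h s"
  have inner: "integ (\<lambda>s. ?H s t) = integ (\<lambda>s. ?H2 s t)" for t
  proof -
    have m: "(\<lambda>s. ?H2 s t) \<in> Cc"
      by (rule Cc_dominated[OF _ h]) (auto intro!: continuous_intros continuous_on_compose2[OF K(1)] L(1))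
    have eq: "?H s t = \<Delta> (- t) * ?H2 (s + - t) t" for s by (simp add: add.assoc)
    have "integ (\<lambda>s. ?H s t) = \<Delta> (- t) * integ (\<lambda>s. ?H2 (s + - t) t)"
      unfolding eq by (rule integ_bounded_linear[OF bounded_linear_mult_right Cc_translate(2)[OF m], symmetric])
    also have "integ (\<lambda>s. ?H2 (s + - t) t) = \<Delta> t * integ (\<lambda>s. ?H2 s t)"
      using integral_right_translate[OF m, of t] by (simp only: integ_real[OF m] integ_real[OF Cc_translate(2)[OF m]])
    finally show ?thesis using \<Delta>_minus[of t] by (simp add: mult.assoc[symmetric] mult.commute[of "\<Delta> (- t)"])
  qed
  have c\<phi>': "continuous_on UNIV (\<lambda>p::'g \<times> 'g. \<phi> (fst p + snd p))" and ch': "continuous_on UNIV (\<lambda>p::'g \<times> 'g. h (fst p))"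
    by (rule continuous_on_compose2[OF K(1)], intro continuous_intros, simp)
      (rule continuous_on_compose2[OF L(1)], intro continuous_intros, simp)
  have H2: "continuous_on UNIV (\<lambda>(s, t). ?H2 s t)"
    using continuous_on_mult[OF c\<phi>' ch'] by (simp add: split_beta')
  have H2L: "?H2 s t = 0" if "s \<notin> L" for s t using L(3)[OF that] by simp
  have H2P: "?H2 s t = 0" if "t \<notin> ?P" for s t
  proof (cases "s \<in> L \<and> s + t \<in> K")
    case True
    have "- s + (s + t) = t" by (simp add: add.assoc[symmetric])
    then have "t \<in> ?P" using True by (intro image_eqI[of _ _ "(s, s + t)"]) auto
    then show ?thesis using that by simp
  qed (use L(3) K(3) in auto)
  have "integ (\<lambda>s. integ (\<lambda>t. ?H s t)) = integ (\<lambda>t. integ (\<lambda>s. ?H2 s t))" using F1 by (simp only: inner)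
  also have "\<dots> = integ (\<lambda>s. integ (\<lambda>t. ?H2 s t))" by (rule Fubini(1)[of ?H2, OF H2 L(2) H2L P H2P, symmetric])
  also have "\<dots> = integ (\<lambda>s. integ \<phi> * h s)"
  proof -
    have "integ (\<lambda>t. ?H2 s t) = integ \<phi> * h s" for s
      using integ_bounded_linear[OF bounded_linear_mult_left Cc_translate(1)[OF \<phi>(1)], of s "h s"]
      by (simp add: integ_left_translate[OF \<phi>(1)])
    then show ?thesis by simp
  qed
  also have "\<dots> = integ \<phi> * integ h" by (rule integ_bounded_linear[OF bounded_linear_mult_right h, symmetric])
  finally have "integ \<phi> * J = integ \<phi> * integ h" by (rule trans[OF 1[symmetric]])
  then show ?thesis using \<phi>(2) by (simp add: J_def integ_real[OF \<phi>(1)])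
qed

theorem inversion:
  fixes f :: "'g \<Rightarrow> 'v::banach"
  assumes "f \<in> Cc"
  shows "integ (\<lambda>s. \<Delta> (- s) *\<^sub>R f (- s)) = integ f"
proof (rule eq_by_functionals)
  fix r :: "'v \<Rightarrow> real" assume r: "bounded_linear r"
  have "r (integ (\<lambda>s. \<Delta> (- s) *\<^sub>R f (- s))) = integ (\<lambda>s. \<Delta> (- s) *\<^sub>R r (f (- s)))"
    by (simp add: integ_bounded_linear[OF r Cc_reflect[OF assms]] linear_simps[OF r])
  also have "\<dots> = integ (\<lambda>s. r (f s))" by (rule inversion_real[OF Cc_bounded_linear[OF r assms]])
  finally show "r (integ (\<lambda>s. \<Delta> (- s) *\<^sub>R f (- s))) = r (integ f)" by (simp add: integ_bounded_linear[OF r assms])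
qed

end

section \<open>Strong integrals of operators\<close>

text \<open>Local boundedness again, from the uniform boundedness theorem.\<close>

lemma (in lc_space) strongly_continuous_joint:
  fixes Z :: "'g \<Rightarrow> 'a::banach \<Rightarrow>\<^sub>L 'b::real_normed_vector"
  assumes "strongly_continuous Z"
  shows "continuous_on UNIV (\<lambda>(g, x). blinfun_apply (Z g) x)"
proof -
  have "((\<lambda>(g, x). blinfun_apply (Z g) x) \<longlongrightarrow> blinfun_apply (Z g0) x0) (at (g0, x0))" for g0 :: 'g and x0 :: 'a
  proof -
  obtain V L where VL: "open V" "compact L" "{g0} \<subseteq> V" "V \<subseteq> L"
    using compact_neighbourhood[OF compact_sing] .
  obtain C where C: "0 < C" "\<And>g. g \<in> L \<Longrightarrow> norm (Z g) \<le> C"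
    using strongly_continuous_bounded[OF assms(1) VL(2)] by blast
  let ?Z = "\<lambda>p::'g \<times> 'a. blinfun_apply (Z (fst p)) (snd p)"
  have "((\<lambda>p. ?Z p - ?Z (g0, x0)) \<longlongrightarrow> 0) (at (g0, x0))"
  proof (rule Lim_null_comparison)
    have "open (V \<times> (UNIV :: 'a set))" "(g0, x0) \<in> V \<times> UNIV" using VL by (auto intro: open_Times)
    then have "\<forall>\<^sub>F p in at (g0, x0). p \<in> V \<times> UNIV" by (intro eventually_at_topological[THEN iffD2]) blast
    then show "\<forall>\<^sub>F p in at (g0, x0). norm (?Z p - ?Z (g0, x0)) \<le>
        C * norm (snd p - x0) + norm (blinfun_apply (Z (fst p)) x0 - blinfun_apply (Z g0) x0)"
    proof eventually_elim
      case (elim p)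
      have "norm (blinfun_apply (Z (fst p)) (snd p - x0)) \<le> C * norm (snd p - x0)"
        using C(2)[of "fst p"] VL elim by (intro order_trans[OF norm_blinfun mult_right_mono]) auto
      then show ?case
        using norm_triangle_ineq[of "blinfun_apply (Z (fst p)) (snd p - x0)"
            "blinfun_apply (Z (fst p)) x0 - blinfun_apply (Z g0) x0"]
        by (simp add: blinfun.diff_right)
    qed
    have c: "continuous_on UNIV (\<lambda>p::'g \<times> 'a. C * norm (snd p - x0) + norm (blinfun_apply (Z (fst p)) x0 - blinfun_apply (Z g0) x0))"
    proof (rule continuous_on_add[OF _ continuous_on_norm[OF continuous_on_diff[OF _ continuous_on_const]]])
      show "continuous_on UNIV (\<lambda>p::'g \<times> 'a. C * norm (snd p - x0))" by (intro continuous_intros)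
      show "continuous_on UNIV (\<lambda>p::'g \<times> 'a. blinfun_apply (Z (fst p)) x0)"
        by (rule continuous_on_compose2[of UNIV "\<lambda>g. blinfun_apply (Z g) x0" UNIV fst])
          (use assms in \<open>auto simp: strongly_continuous_def intro: continuous_intros\<close>)
    qed
    then have "((\<lambda>p::'g \<times> 'a. C * norm (snd p - x0) + norm (blinfun_apply (Z (fst p)) x0 - blinfun_apply (Z g0) x0)) \<longlongrightarrow>
      C * norm (snd (g0, x0) - x0) + norm (blinfun_apply (Z (fst (g0, x0))) x0 - blinfun_apply (Z g0) x0)) (at (g0, x0))"
      unfolding continuous_on_def by (rule bspec[OF _ UNIV_I])
    then show "((\<lambda>p::'g \<times> 'a. C * norm (snd p - x0) + norm (blinfun_apply (Z (fst p)) x0 - blinfun_apply (Z g0) x0)) \<longlongrightarrow> 0) (at (g0, x0))"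
      by simp
  qed
  then have "(?Z \<longlongrightarrow> ?Z (g0, x0)) (at (g0, x0))" by (simp add: LIM_zero_iff)
  then show ?thesis by (simp add: split_beta')
  qed
  then show ?thesis unfolding continuous_on_def by auto
qed

definition compact_family :: "('g::topological_space \<Rightarrow> 'a::banach \<Rightarrow>\<^sub>L 'b::real_normed_vector) \<Rightarrow> bool" where
  "compact_family Z \<longleftrightarrow> strongly_continuous Z \<and> (\<exists>K. compact K \<and> (\<forall>g. g \<notin> K \<longrightarrow> Z g = 0))"

lemma compact_family_Cc: "compact_family Z \<Longrightarrow> (\<lambda>g. blinfun_apply (Z g) x) \<in> Cc"
  unfolding compact_family_def strongly_continuous_def
proof (elim conjE exE)
  fix K assume "\<forall>x. continuous_on UNIV (\<lambda>g. blinfun_apply (Z g) x)" "compact K" "\<forall>g. g \<notin> K \<longrightarrow> Z g = 0"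
  then show ?thesis by (intro Cc_I[of _ K]) auto
qed

lemma compact_family_bounded:
  assumes "compact_family Z"
  obtains C where "0 < C" "\<And>g. norm (Z g) \<le> C"
proof -
  obtain K where K: "strongly_continuous Z" "compact K" "\<And>g. g \<notin> K \<Longrightarrow> Z g = 0"
    using assms unfolding compact_family_def by blast
  obtain C where C: "0 < C" "\<And>g. g \<in> K \<Longrightarrow> norm (Z g) \<le> C" by (rule strongly_continuous_bounded[OF K(1,2)]) (rule that)
  show thesis
  proof (rule that[OF C(1)])
    show "norm (Z g) \<le> C" for g using C K(3) by (cases "g \<in> K") auto
  qed
qed

lemma Cc_compact_family: "f \<in> Cc \<Longrightarrow> compact_family f" for f :: "'g::topological_space \<Rightarrow> 'a::banach \<Rightarrow>\<^sub>L 'b::real_normed_vector"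
  by (auto simp: compact_family_def Cc_def strongly_continuous_def intro!: continuous_intros)

lemma (in lc_space) compact_family_compose:
  fixes Y :: "'g \<Rightarrow> 'b::banach \<Rightarrow>\<^sub>L 'c::real_normed_vector" and Z :: "'g \<Rightarrow> 'a::banach \<Rightarrow>\<^sub>L 'b"
  shows "compact_family Y \<Longrightarrow> strongly_continuous Z \<Longrightarrow> compact_family (\<lambda>g. Y g o\<^sub>L Z g)"
    and "strongly_continuous Y \<Longrightarrow> compact_family Z \<Longrightarrow> compact_family (\<lambda>g. Y g o\<^sub>L Z g)"
proof -
  show "compact_family (\<lambda>g. Y g o\<^sub>L Z g)" if "compact_family Y" "strongly_continuous Z"
    using that unfolding compact_family_def
    by (auto intro!: strongly_continuous_compose blinfun_eqI)
  show "compact_family (\<lambda>g. Y g o\<^sub>L Z g)" if "strongly_continuous Y" "compact_family Z"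
    using that unfolding compact_family_def
    by (auto intro!: strongly_continuous_compose blinfun_eqI simp: blinfun.zero_right)
qed

lemma strongly_continuous_const: "strongly_continuous (\<lambda>_. T)"
  by (simp add: strongly_continuous_def)

context haar
begin

text \<open>The integral in the strong operator topology; the integrands are in general not norm continuous.\<close>

definition opint :: "('g \<Rightarrow> 'a::banach \<Rightarrow>\<^sub>L 'b::banach) \<Rightarrow> 'a \<Rightarrow>\<^sub>L 'b" where
  "opint Z = Blinfun (\<lambda>x. integ (\<lambda>g. blinfun_apply (Z g) x))"

lemma opint_bounded_linear:
  fixes Z :: "'g \<Rightarrow> 'a::banach \<Rightarrow>\<^sub>L 'b::banach"
  assumes "compact_family Z"
  shows "bounded_linear (\<lambda>x. integ (\<lambda>g. blinfun_apply (Z g) x))"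
proof -
  note Cc = compact_family_Cc[OF assms]
  obtain K where K: "strongly_continuous Z" "compact K" "\<And>g. g \<notin> K \<Longrightarrow> Z g = 0"
    using assms unfolding compact_family_def by blast
  obtain C where C: "0 < C" "\<And>g. norm (Z g) \<le> C" by (rule compact_family_bounded[OF assms]) (rule that)
  show ?thesis
  proof (rule bounded_linear_intro[where K = "C * measure M K"])
    show "integ (\<lambda>g. blinfun_apply (Z g) (x + y)) = integ (\<lambda>g. blinfun_apply (Z g) x) + integ (\<lambda>g. blinfun_apply (Z g) y)" for x y
      by (simp add: blinfun.add_right integ_add Cc)
    show "integ (\<lambda>g. blinfun_apply (Z g) (r *\<^sub>R x)) = r *\<^sub>R integ (\<lambda>g. blinfun_apply (Z g) x)" for r x
      by (simp add: blinfun.scaleR_right integ_bounded_linear[OF bounded_linear_scaleR_right Cc])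
    fix x
    have "norm (integ (\<lambda>g. blinfun_apply (Z g) x)) \<le> (C * norm x) * measure M K"
    proof (rule norm_integ_bound[OF Cc_continuous[OF Cc] K(2)])
      show "norm (blinfun_apply (Z g) x) \<le> C * norm x" for g
        using C by (intro order_trans[OF norm_blinfun mult_right_mono]) auto
    qed (simp add: K(3))
    then show "norm (integ (\<lambda>g. blinfun_apply (Z g) x)) \<le> norm x * (C * measure M K)" by (simp add: mult_ac)
  qed
qed

lemma opint_apply: "compact_family Z \<Longrightarrow> blinfun_apply (opint Z) x = integ (\<lambda>g. blinfun_apply (Z g) x)"
  by (simp add: opint_def bounded_linear_Blinfun_apply[OF opint_bounded_linear])

lemma norm_opint:
  fixes Z :: "'g \<Rightarrow> 'a::banach \<Rightarrow>\<^sub>L 'b::banach"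
  assumes "compact_family Z" "compact K" "\<And>g. g \<notin> K \<Longrightarrow> Z g = 0" "\<And>g. norm (Z g) \<le> C" "0 \<le> C"
  shows "norm (opint Z) \<le> C * measure M K"
proof (rule norm_blinfun_bound)
  fix x
  have "norm (integ (\<lambda>g. blinfun_apply (Z g) x)) \<le> (C * norm x) * measure M K"
  proof (rule norm_integ_bound[OF Cc_continuous[OF compact_family_Cc[OF assms(1)]] assms(2)])
    show "norm (blinfun_apply (Z g) x) \<le> C * norm x" for g
      using assms(4) by (intro order_trans[OF norm_blinfun mult_right_mono]) auto
  qed (simp add: assms(3))
  then show "norm (blinfun_apply (opint Z) x) \<le> C * measure M K * norm x"
    by (simp add: opint_apply[OF assms(1)] mult_ac)
qed (use assms(5) in simp)

lemma opint_left: "compact_family Z \<Longrightarrow> opint (\<lambda>g. T o\<^sub>L Z g) = T o\<^sub>L opint Z"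
  for Z :: "'g \<Rightarrow> 'a::banach \<Rightarrow>\<^sub>L 'b::banach" and T :: "'b \<Rightarrow>\<^sub>L 'c::banach"
  using compact_family_compose(2)[OF strongly_continuous_const, of Z T]
  by (intro blinfun_eqI) (simp add: opint_apply integ_bounded_linear[OF blinfun.bounded_linear_right compact_family_Cc])

lemma opint_right: "compact_family Z \<Longrightarrow> opint (\<lambda>g. Z g o\<^sub>L T) = opint Z o\<^sub>L T"
  for Z :: "'g \<Rightarrow> 'b::banach \<Rightarrow>\<^sub>L 'c::banach" and T :: "'a::banach \<Rightarrow>\<^sub>L 'b"
  using compact_family_compose(1)[OF _ strongly_continuous_const, of Z T]
  by (intro blinfun_eqI) (simp add: opint_apply)

lemma compact_family_add:
  assumes "compact_family Y" "compact_family (Z :: 'g \<Rightarrow> 'a::banach \<Rightarrow>\<^sub>L 'b::real_normed_vector)"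
  shows "compact_family (\<lambda>g. Y g + Z g)"
proof -
  obtain K where K: "strongly_continuous Y" "compact K" "\<And>g. g \<notin> K \<Longrightarrow> Y g = 0" using assms(1) unfolding compact_family_def by blast
  obtain L where L: "strongly_continuous Z" "compact L" "\<And>g. g \<notin> L \<Longrightarrow> Z g = 0" using assms(2) unfolding compact_family_def by blast
  show ?thesis
    unfolding compact_family_def
  proof (intro conjI exI[of _ "K \<union> L"] compact_Un K L)
    show "strongly_continuous (\<lambda>g. Y g + Z g)"
      using K(1) L(1) unfolding strongly_continuous_def blinfun.add_left by (intro allI continuous_on_add) auto
  qed (use K L in auto)
qed

lemma compact_family_scaleR:
  "compact_family Z \<Longrightarrow> continuous_on UNIV \<phi> \<Longrightarrow> compact_family (\<lambda>g. \<phi> g *\<^sub>R Z g)"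
  for Z :: "'g \<Rightarrow> 'a::banach \<Rightarrow>\<^sub>L 'b::real_normed_vector"
  unfolding compact_family_def strongly_continuous_def blinfun.scaleR_left
  by (intro conjI allI continuous_on_scaleR) auto

lemma Cc_scaleR_compact_family:
  "\<phi> \<in> Cc \<Longrightarrow> strongly_continuous Z \<Longrightarrow> compact_family (\<lambda>g. \<phi> g *\<^sub>R Z g)"
  for Z :: "'g \<Rightarrow> 'a::banach \<Rightarrow>\<^sub>L 'b::real_normed_vector"
  unfolding compact_family_def Cc_def strongly_continuous_def blinfun.scaleR_left
  by (intro conjI allI continuous_on_scaleR) auto

lemma opint_add:
  "compact_family Y \<Longrightarrow> compact_family Z \<Longrightarrow> opint (\<lambda>g. Y g + Z g) = opint Y + opint Z"
  for Z :: "'g \<Rightarrow> 'a::banach \<Rightarrow>\<^sub>L 'b::banach"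
  by (intro blinfun_eqI) (simp add: opint_apply compact_family_add blinfun.add_left integ_add compact_family_Cc)

lemma opint_scaleR:
  "compact_family Z \<Longrightarrow> opint (\<lambda>g. r *\<^sub>R Z g) = r *\<^sub>R opint Z"
  for Z :: "'g \<Rightarrow> 'a::banach \<Rightarrow>\<^sub>L 'b::banach"
  by (intro blinfun_eqI) (simp add: opint_apply compact_family_scaleR blinfun.scaleR_left
      integ_bounded_linear[OF bounded_linear_scaleR_right compact_family_Cc])

lemma opint_diff:
  assumes "compact_family Y" "compact_family (Z :: 'g \<Rightarrow> 'a::banach \<Rightarrow>\<^sub>L 'b::banach)"
  shows "opint (\<lambda>g. Y g - Z g) = opint Y - opint Z" and "compact_family (\<lambda>g. Y g - Z g)"
  using opint_add[OF assms(1) compact_family_scaleR[OF assms(2), of "\<lambda>_. -1"]] opint_scaleR[OF assms(2), of "-1"]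
    compact_family_add[OF assms(1) compact_family_scaleR[OF assms(2), of "\<lambda>_. -1"]]
  by simp_all

lemma opint_Cc: "f \<in> Cc \<Longrightarrow> opint f = integ f" for f :: "'g \<Rightarrow> 'a::banach \<Rightarrow>\<^sub>L 'b::banach"
  by (intro blinfun_eqI)
    (simp add: opint_apply Cc_compact_family integ_bounded_linear[OF blinfun.bounded_linear_left])

text \<open>Approximate \<open>f\<close> uniformly by finite sums \<open>\<Sum> \<phi>\<^sub>i f(i)\<close> with supports in a fixed compact set.\<close>

lemma integ_in_closed_subspace:
  fixes f :: "'g \<Rightarrow> 'v::banach"
  assumes f: "f \<in> Cc" and S: "closed S" "subspace S" "\<And>g. f g \<in> S"
  shows "integ f \<in> S"
proof -
  obtain K where K: "continuous_on UNIV f" "compact K" "\<And>x. x \<notin> K \<Longrightarrow> f x = 0" using f by (rule Cc_E) (rule that)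
  obtain W K' where W: "open W" "compact K'" "K \<subseteq> W" "W \<subseteq> K'" using compact_neighbourhood[OF K(2)] .
  have "integ f \<in> closure S"
    unfolding closure_approachable
  proof (intro allI impI)
    fix e :: real assume e: "e > 0"
    define m where "m = measure M K' + 1"
    have m: "m > 0" by (simp add: m_def add_nonneg_pos)
    have em: "e / (2 * m) > 0" using e m by simp
    obtain I and \<phi> :: "'g \<Rightarrow> 'g \<Rightarrow> real" where \<phi>: "finite I" "\<And>i. i \<in> I \<Longrightarrow> \<phi> i \<in> Cc"
      "\<And>i x. i \<in> I \<Longrightarrow> x \<notin> W \<Longrightarrow> \<phi> i x = 0" "\<And>x. norm (f x - (\<Sum>i\<in>I. \<phi> i x *\<^sub>R f i)) \<le> e / (2 * m)"
      by (rule Cc_approximation[OF K(1,2) W(1,3) _ em]) (erule K(3), rule that)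
    have c: "(\<lambda>x. \<phi> i x *\<^sub>R f i) \<in> Cc" if "i \<in> I" for i by (rule Cc_scaleR[OF \<phi>(2)[OF that]]) simp
    have cs: "(\<lambda>x. \<Sum>i\<in>I. \<phi> i x *\<^sub>R f i) \<in> Cc" by (rule Cc_sum[OF \<phi>(1) c])
    have "integ (\<lambda>x. \<Sum>i\<in>I. \<phi> i x *\<^sub>R f i) = (\<Sum>i\<in>I. integ (\<phi> i) *\<^sub>R f i)"
      using \<phi>(1) c by (subst integ_sum) (auto intro!: sum.cong simp: integ_bounded_linear[OF bounded_linear_scaleR_left \<phi>(2), symmetric])
    also have "\<dots> \<in> S" by (intro subspace_sum subspace_scale S)
    finally have "integ (\<lambda>x. \<Sum>i\<in>I. \<phi> i x *\<^sub>R f i) \<in> S" .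
    moreover have "dist (integ (\<lambda>x. \<Sum>i\<in>I. \<phi> i x *\<^sub>R f i)) (integ f) \<le> e / (2 * m) * measure M K'"
      unfolding dist_norm norm_minus_commute[of _ "integ f"] integ_diff(1)[OF f cs, symmetric]
    proof (rule norm_integ_bound[OF Cc_continuous[OF integ_diff(2)[OF f cs]] W(2) _ \<phi>(4)])
      fix x assume "x \<notin> K'"
      then have "x \<notin> K" "x \<notin> W" using W by auto
      then show "f x - (\<Sum>i\<in>I. \<phi> i x *\<^sub>R f i) = 0" using K(3) \<phi>(3) by simp
    qed
    moreover have "e / (2 * m) * measure M K' < e"
    proof -
      have "e / (2 * m) * measure M K' \<le> e / (2 * m) * m" using em by (intro mult_left_mono) (auto simp: m_def)
      also have "\<dots> = e / 2" using m by simp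
      finally show ?thesis using e by linarith
    qed
    ultimately show "\<exists>y\<in>S. dist y (integ f) < e" by (meson le_less_trans)
  qed
  then show ?thesis using S(1) by simp
qed

end

lemma (in hmod) bounded_linear_inn_left: "bounded_linear (\<lambda>x. inn E x y)"
  by (rule bounded_bilinear.bounded_linear_left[OF bounded_bilinear_inn])

section \<open>The integrated representation\<close>

lemma dense_eq1:
  fixes F H :: "'a::topological_space \<Rightarrow> 'b::t2_space"
  assumes "closure S = UNIV" "continuous_on UNIV F" "continuous_on UNIV H" "\<And>a. a \<in> S \<Longrightarrow> F a = H a"
  shows "F a = H a"
proof -
  have "closure S \<subseteq> {a. F a = H a}"
    using assms(4) by (intro closure_minimal closed_Collect_eq assms(2,3)) auto
  then show ?thesis using assms(1) by blast
qed

lemma dense_eq2: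
  fixes F H :: "'a::topological_space \<times> 'a \<Rightarrow> 'b::t2_space"
  assumes "closure S = UNIV" "continuous_on UNIV F" "continuous_on UNIV H" "\<And>a b. a \<in> S \<Longrightarrow> b \<in> S \<Longrightarrow> F (a, b) = H (a, b)"
  shows "F (a, b) = H (a, b)"
  by (rule dense_eq1[of "S \<times> S"]) (use assms in \<open>auto simp: closure_Times\<close>)

text \<open>Left multiplication by \<open>f a\<close> is a *-representation on the Hilbert module \<open>B\<close>, hence contractive.\<close>

lemma star_hom_contractive:
  fixes a :: "'a::cstar_algebra" and f :: "'a \<Rightarrow> 'b::cstar_algebra"
  assumes "clinear f" "\<And>a b. f (a * b) = f a * f b" "\<And>a. f (star a) = star (f a)"
  shows "norm (f a) \<le> norm a"
proof -
  have "star_rep self_module (\<lambda>a. multiplier_op (emb (f a)))"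
    unfolding star_rep_def
  proof (intro conjI allI)
    show "clinear (\<lambda>a. multiplier_op (emb (f a)))"
      unfolding clinear_def
      by (simp add: clinear_add[OF assms(1)] clinear_scaleC[OF assms(1)] clinear_add[OF clinear_emb] clinear_scaleC[OF clinear_emb]
          plus_multiplier.rep_eq scaleC_multiplier.rep_eq)
    show "multiplier_op (emb (f (a * b))) = multiplier_op (emb (f a)) o\<^sub>L multiplier_op (emb (f b))" for a b
      by (simp add: assms(2) emb_mult times_multiplier.rep_eq)
  qed (simp add: multiplier_op_emb star_mult assms(3) mult.assoc)
  from self.star_rep_contractive[OF this, of a] show ?thesis
    by (simp add: norm_multiplier.rep_eq[symmetric] norm_emb)
qed

context hmod
begin

definition rank_one :: "'e \<Rightarrow> 'e \<Rightarrow> 'e \<Rightarrow>\<^sub>L 'e" where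
  "rank_one x y = Blinfun (\<lambda>z. rmul E x (inn E y z))"

lemma norm_rank_one: "norm (rmul E x (inn E y z)) \<le> norm x * norm y * norm z"
proof -
  have "norm (rmul E x (inn E y z)) \<le> norm x * norm (inn E y z)" by (rule norm_rmul)
  also have "\<dots> \<le> norm x * (norm y * norm z)" by (intro mult_left_mono cauchy_schwarz norm_ge_zero)
  finally show ?thesis by (simp add: mult.assoc)
qed

lemma rank_one_apply: "blinfun_apply (rank_one x y) z = rmul E x (inn E y z)"
proof -
  have "bounded_linear (\<lambda>z. rmul E x (inn E y z))"
    by (rule bounded_linear_intro[where K = "norm x * norm y"])
      (use norm_rank_one[of x y] in \<open>simp_all add: inn_add_right inn_scaleR_right clinear_add[OF rmul_clinear(1)] clinear_scaleR[OF rmul_clinear(1)] mult_ac\<close>)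
  then show ?thesis by (simp add: rank_one_def bounded_linear_Blinfun_apply)
qed

lemma bounded_linear_rank_one: "bounded_linear (rank_one x)"
proof (rule bounded_linear_intro[where K = "norm x"])
  show "rank_one x (y + z) = rank_one x y + rank_one x z" for y z
    by (rule blinfun_eqI) (simp add: rank_one_apply blinfun.add_left inn_add_left clinear_add[OF rmul_clinear(1)])
  show "rank_one x (r *\<^sub>R y) = r *\<^sub>R rank_one x y" for r y
    by (rule blinfun_eqI) (simp add: rank_one_apply blinfun.scaleR_left inn_scaleR_left clinear_scaleR[OF rmul_clinear(1)])
  show "norm (rank_one x y) \<le> norm y * norm x" for y
    by (rule norm_blinfun_bound) (use norm_rank_one[of x y] in \<open>simp_all add: rank_one_apply mult_ac\<close>)
qed

lemma compact_ops_rank_one: "compact_ops E = closure (span {rank_one x y |x y. True})"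
proof -
  have "{T. \<exists>x y. \<forall>z. blinfun_apply T z = rmul E x (inn E y z)} = {rank_one x y |x y. True}"
  proof (intro equalityI subsetI)
    fix T assume "T \<in> {T. \<exists>x y. \<forall>z. blinfun_apply T z = rmul E x (inn E y z)}"
    then obtain x y where "\<And>z. blinfun_apply T z = rmul E x (inn E y z)" by blast
    then have "T = rank_one x y" by (intro blinfun_eqI) (simp add: rank_one_apply)
    then show "T \<in> {rank_one x y |x y. True}" by blast
  qed (use rank_one_apply in blast)
  then show ?thesis by (simp add: compact_ops_def)
qed

lemma compact_ops_subspace: "subspace (compact_ops E)" and compact_ops_closed: "closed (compact_ops E)"
  by (simp_all add: compact_ops_def subspace_closure)

lemma compact_ops_induct:
  assumes "T \<in> compact_ops E" "subspace V" "closed V" "\<And>x y. rank_one x y \<in> V"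
  shows "T \<in> V"
proof -
  have "closure (span {rank_one x y |x y. True}) \<subseteq> V"
    by (intro closure_minimal span_minimal assms(2,3)) (use assms(4) in auto)
  then show ?thesis using assms(1) compact_ops_rank_one by blast
qed

end

locale crossed = conformal E dom \<alpha> \<beta> \<gamma> \<pi> D U \<mu> + modular dom M \<Delta>
  for E :: "('e::cbanach, 'b::cstar_algebra) hmodule" and dom :: "'g::{topological_group_add, t2_space} itself"
    and \<alpha> :: "'g \<Rightarrow> 'a::cstar_algebra \<Rightarrow> 'a" and \<beta> :: "'g \<Rightarrow> 'b \<Rightarrow> 'b"
    and \<gamma> :: "('e \<Rightarrow>\<^sub>L 'e) option" and \<pi> :: "'a \<Rightarrow> 'e \<Rightarrow>\<^sub>L 'e" and D :: "'e uop"
    and U :: "'g \<Rightarrow> 'e \<Rightarrow> 'e" and \<mu> :: "'g \<Rightarrow> 'e \<Rightarrow>\<^sub>L 'e" and M :: "'g measure" and \<Delta> :: "'g \<Rightarrow> real" +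
  fixes \<iota> :: "('g \<Rightarrow> 'a) \<Rightarrow> 'p::cstar_algebra"
  assumes universal: "universal_crossed_product M \<Delta> \<alpha> \<iota>"
begin

lemma \<alpha>_clinear: "clinear (\<alpha> g)" and \<alpha>_mult: "\<alpha> g (a * b) = \<alpha> g a * \<alpha> g b" and \<alpha>_star: "\<alpha> g (star a) = star (\<alpha> g a)"
  and \<alpha>_continuous: "continuous_on UNIV (\<lambda>g. \<alpha> g a)"
  using action by (auto simp: cstar_action_def)

lemma \<alpha>_norm: "norm (\<alpha> g a) \<le> norm a"
  by (rule star_hom_contractive[OF \<alpha>_clinear \<alpha>_mult \<alpha>_star])

lemma bounded_linear_\<alpha>: "bounded_linear (\<alpha> g)"
  by (rule bounded_linear_intro[where K = 1])
    (simp_all add: clinear_add[OF \<alpha>_clinear] clinear_scaleR[OF \<alpha>_clinear] \<alpha>_norm)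

lemma \<alpha>_joint: "continuous_on UNIV (\<lambda>(g, a). \<alpha> g a)"
proof -
  have "strongly_continuous (\<lambda>g. Blinfun (\<alpha> g))"
    by (simp add: strongly_continuous_def bounded_linear_Blinfun_apply[OF bounded_linear_\<alpha>] \<alpha>_continuous)
  from strongly_continuous_joint[OF this] show ?thesis
    by (simp add: bounded_linear_Blinfun_apply[OF bounded_linear_\<alpha>])
qed

lemma rep_\<pi>: "star_rep E \<pi>" and grading: "is_grading E \<gamma>" and even_\<pi>: "even_map \<gamma> (blinfun_apply (\<pi> a))"
  using corr by (auto simp: correspondence_def)

lemma \<pi>_clinear: "clinear \<pi>" and \<pi>_mult: "\<pi> (a * b) = \<pi> a o\<^sub>L \<pi> b"
  and \<pi>_adj: "inn E (blinfun_apply (\<pi> a) x) y = inn E x (blinfun_apply (\<pi> (star a)) y)"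
  using rep_\<pi> by (auto simp: star_rep_def)

lemma bounded_linear_\<pi>: "bounded_linear \<pi>"
  by (rule bounded_linear_intro[where K = 1])
    (simp_all add: clinear_add[OF \<pi>_clinear] clinear_scaleR[OF \<pi>_clinear] star_rep_contractive[OF rep_\<pi>])

lemma bounded_linear_\<pi>_apply: "bounded_linear (\<lambda>a. blinfun_apply (\<pi> a) x)"
  using bounded_linear_compose[OF blinfun.bounded_linear_left bounded_linear_\<pi>] .

definition family :: "('g \<Rightarrow> 'a) \<Rightarrow> 'g \<Rightarrow> 'e \<Rightarrow>\<^sub>L 'e" where
  "family f g = \<pi> (f g) o\<^sub>L Ub g"

lemma compact_family: "f \<in> Cc \<Longrightarrow> compact_family (family f)"
  unfolding family_def
  by (rule compact_family_compose(1)[OF Cc_compact_family[OF Cc_bounded_linear[OF bounded_linear_\<pi>]] strongly_continuous_star(1)[OF ssc_Ub]])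

definition rep0 :: "('g \<Rightarrow> 'a) \<Rightarrow> 'e \<Rightarrow>\<^sub>L 'e" where
  "rep0 f = opint (family f)"

lemma rep0_apply: "f \<in> Cc \<Longrightarrow> blinfun_apply (rep0 f) x = integ (\<lambda>g. blinfun_apply (\<pi> (f g)) (U g x))"
  by (simp add: rep0_def opint_apply compact_family) (simp add: family_def)

lemma integrand_Cc: "f \<in> Cc \<Longrightarrow> (\<lambda>g. blinfun_apply (\<pi> (f g)) (U g x)) \<in> Cc"
  using compact_family_Cc[OF compact_family, of f x] by (simp add: family_def)

lemma rep0_add: "f \<in> Cc \<Longrightarrow> h \<in> Cc \<Longrightarrow> rep0 (\<lambda>g. f g + h g) = rep0 f + rep0 h"
  by (rule blinfun_eqI)
    (simp add: rep0_apply Cc_add blinfun.add_left clinear_add[OF \<pi>_clinear] integ_add integrand_Cc)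

lemma Cc_scaleC: "f \<in> Cc \<Longrightarrow> (\<lambda>g. c *\<^sub>C f g) \<in> Cc" for f :: "'g \<Rightarrow> 'v::cbanach"
  by (rule Cc_bounded_linear[OF bounded_linear_scaleC])

lemma rep0_scaleC: "f \<in> Cc \<Longrightarrow> rep0 (\<lambda>g. c *\<^sub>C f g) = c *\<^sub>C rep0 f"
  by (rule blinfun_eqI)
    (simp add: rep0_apply Cc_scaleC scaleC_blinfun.rep_eq clinear_scaleC[OF \<pi>_clinear]
      integ_bounded_linear[OF bounded_linear_scaleC integrand_Cc])

lemma norm_rep0:
  assumes f: "f \<in> Cc"
  shows "norm (rep0 f) \<le> (\<integral>g. norm (f g) \<partial>M)"
proof (rule norm_blinfun_bound)
  fix x
  have "norm (blinfun_apply (rep0 f) x) \<le> (\<integral>g. norm (blinfun_apply (\<pi> (f g)) (U g x)) \<partial>M)"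
    unfolding rep0_apply[OF f] by (rule norm_integ[OF integrand_Cc[OF f]])
  also have "\<dots> \<le> (\<integral>g. norm (f g) * norm x \<partial>M)"
  proof (rule integral_mono)
    show "integrable M (\<lambda>g. norm (blinfun_apply (\<pi> (f g)) (U g x)))"
      by (rule Cc_integrable[OF Cc_norm[OF integrand_Cc[OF f]]])
    show "integrable M (\<lambda>g. norm (f g) * norm x)"
      by (rule Cc_integrable[OF Cc_bounded_linear[OF bounded_linear_mult_left Cc_norm[OF f]]])
    fix g
    have "norm (blinfun_apply (\<pi> (f g)) (U g x)) \<le> norm (\<pi> (f g)) * norm (U g x)" by (rule norm_blinfun)
    also have "\<dots> \<le> norm (f g) * norm x" unfolding U_norm by (intro mult_right_mono star_rep_contractive[OF rep_\<pi>]) simp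
    finally show "norm (blinfun_apply (\<pi> (f g)) (U g x)) \<le> norm (f g) * norm x" .
  qed
  finally show "norm (blinfun_apply (rep0 f) x) \<le> (\<integral>g. norm (f g) \<partial>M) * norm x" by simp
qed simp

subsection \<open>Convolution and involution\<close>

lemma convolution_integ: "convolution M \<alpha> f h s = integ (\<lambda>r. f r * \<alpha> r (h (- r + s)))"
  by (simp add: convolution_def integ_def)

lemma convolution_support:
  fixes f h :: "'g \<Rightarrow> 'a"
  assumes f: "f \<in> Cc" and h: "h \<in> Cc"
  obtains K P where "compact K" "compact P" "\<And>r s. r \<notin> K \<Longrightarrow> f r * \<alpha> r (h (- r + s)) = 0"
    "\<And>r s. s \<notin> P \<Longrightarrow> f r * \<alpha> r (h (- r + s)) = 0" "continuous_on UNIV (\<lambda>(r, s). f r * \<alpha> r (h (- r + s)))"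
proof -
  obtain K where K: "continuous_on UNIV f" "compact K" "\<And>x. x \<notin> K \<Longrightarrow> f x = 0" using f by (rule Cc_E) (rule that)
  obtain L where L: "continuous_on UNIV h" "compact L" "\<And>x. x \<notin> L \<Longrightarrow> h x = 0" using h by (rule Cc_E) (rule that)
  let ?P = "(\<lambda>p. fst p + snd p) ` (K \<times> L)"
  show thesis
  proof (rule that[OF K(2)])
    show "compact ?P" by (intro compact_continuous_image compact_Times L(2) K(2) continuous_intros)
    show "f r * \<alpha> r (h (- r + s)) = 0" if "r \<notin> K" for r s using K(3)[OF that] by simp
    show "f r * \<alpha> r (h (- r + s)) = 0" if "s \<notin> ?P" for r s
    proof (cases "r \<in> K \<and> - r + s \<in> L")
      case True
      then have "(r, - r + s) \<in> K \<times> L" by simp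
      then have "s \<in> ?P" by (rule image_eqI[rotated]) (simp add: add.assoc[symmetric])
      then show ?thesis using that by simp
    qed (use K(3) L(3) clinear_zero[OF \<alpha>_clinear] in auto)
    have cf: "continuous_on UNIV (\<lambda>p::'g \<times> 'g. f (fst p))" by (rule continuous_on_compose2[OF K(1)]) (intro continuous_intros, simp)
    have ch: "continuous_on UNIV (\<lambda>p::'g \<times> 'g. h (- fst p + snd p))" by (rule continuous_on_compose2[OF L(1)]) (intro continuous_intros, simp)
    have "continuous_on UNIV (\<lambda>p::'g \<times> 'g. \<alpha> (fst p) (h (- fst p + snd p)))"
      by (rule continuous_on_pair_compose[OF \<alpha>_joint continuous_on_fst[OF continuous_on_id] ch])
    then show "continuous_on UNIV (\<lambda>(r, s). f r * \<alpha> r (h (- r + s)))"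
      using continuous_on_mult[OF cf] by (simp add: split_beta')
  qed
qed

lemma convolution_Cc: "f \<in> Cc \<Longrightarrow> h \<in> Cc \<Longrightarrow> convolution M \<alpha> f h \<in> Cc"
proof -
  assume f: "f \<in> Cc" and h: "h \<in> Cc"
  obtain K P where KP: "compact K" "compact P" "\<And>r s. r \<notin> K \<Longrightarrow> f r * \<alpha> r (h (- r + s)) = 0"
    "\<And>r s. s \<notin> P \<Longrightarrow> f r * \<alpha> r (h (- r + s)) = 0" "continuous_on UNIV (\<lambda>(r, s). f r * \<alpha> r (h (- r + s)))"
    by (rule convolution_support[OF f h]) (rule that)
  have "(\<lambda>s. integ (\<lambda>r. f r * \<alpha> r (h (- r + s)))) \<in> Cc"
    by (rule Fubini(3)[OF KP(5,1) _ KP(2)]) (erule KP(3), erule KP(4))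
  moreover have "convolution M \<alpha> f h = (\<lambda>s. integ (\<lambda>r. f r * \<alpha> r (h (- r + s))))" by (rule ext) (rule convolution_integ)
  ultimately show ?thesis by (simp only:)
qed

text \<open>Fubini's theorem, the translation \<open>s = r + t\<close>, and \<open>\<pi>(\<alpha>\<^sub>r a) U\<^sub>r = U\<^sub>r \<pi>(a)\<close>.\<close>

lemma rep0_convolution:
  assumes f: "f \<in> Cc" and h: "h \<in> Cc"
  shows "rep0 (convolution M \<alpha> f h) = rep0 f o\<^sub>L rep0 h"
proof (rule blinfun_eqI)
  fix x
  obtain K P where KP: "compact K" "compact P" "\<And>r s. r \<notin> K \<Longrightarrow> f r * \<alpha> r (h (- r + s)) = 0"
    "\<And>r s. s \<notin> P \<Longrightarrow> f r * \<alpha> r (h (- r + s)) = 0" "continuous_on UNIV (\<lambda>(r, s). f r * \<alpha> r (h (- r + s)))"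
    by (rule convolution_support[OF f h]) (rule that)
  let ?H = "\<lambda>r s. f r * \<alpha> r (h (- r + s))"
  let ?P = "\<lambda>r s. blinfun_apply (\<pi> (?H r s)) (U s x)"
  have HK: "?P r s = 0" if "r \<notin> K" for r s using KP(3)[OF that] by (simp add: clinear_zero[OF \<pi>_clinear])
  have HP: "?P r s = 0" if "s \<notin> P" for r s using KP(4)[OF that] by (simp add: clinear_zero[OF \<pi>_clinear])
  have cU: "continuous_on UNIV (\<lambda>p::'g \<times> 'g. U (snd p) x)" by (rule continuous_on_compose2[OF continuous_U]) (intro continuous_intros, simp)
  have "continuous_on UNIV (\<lambda>p::'g \<times> 'g. ?H (fst p) (snd p))" using KP(5) by (simp add: split_beta')
  from bounded_bilinear.continuous_on[OF bounded_bilinear_blinfun_apply bounded_linear.continuous_on[OF bounded_linear_\<pi> this] cU]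
  have cP: "continuous_on UNIV (\<lambda>(r, s). ?P r s)" by (simp add: split_beta')
  have HCc: "(\<lambda>r. ?H r s) \<in> Cc" for s
    by (rule Fubini(5)[OF KP(5,1) _ KP(2)]) (erule KP(3), erule KP(4))
  have F: "integ (\<lambda>r. integ (\<lambda>s. ?P r s)) = integ (\<lambda>s. integ (\<lambda>r. ?P r s))"
    by (rule Fubini(1)[OF cP KP(1) HK KP(2) HP])
  have "blinfun_apply (rep0 (convolution M \<alpha> f h)) x = integ (\<lambda>s. blinfun_apply (\<pi> (integ (\<lambda>r. ?H r s))) (U s x))"
    by (simp only: rep0_apply[OF convolution_Cc[OF f h]] convolution_integ)
  also have "\<dots> = integ (\<lambda>s. integ (\<lambda>r. ?P r s))"
    by (simp only: integ_bounded_linear[OF bounded_linear_\<pi>_apply HCc])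
  also have "\<dots> = integ (\<lambda>r. integ (\<lambda>s. ?P r s))" by (rule F[symmetric])
  also have "\<dots> = integ (\<lambda>r. blinfun_apply (\<pi> (f r)) (U r (blinfun_apply (rep0 h) x)))"
  proof -
    have "integ (\<lambda>s. ?P r s) = blinfun_apply (\<pi> (f r)) (U r (blinfun_apply (rep0 h) x))" for r
    proof -
      define T where "T = \<pi> (f r) o\<^sub>L Ub r"
      let ?G = "\<lambda>t. blinfun_apply T (blinfun_apply (\<pi> (h t)) (U t x))"
      have "?P r s = ?G (- r + s)" for s
      proof -
        have "U s x = U r (U (- r + s) x)" unfolding U_add[symmetric] by (simp add: add.assoc[symmetric])
        then show ?thesis by (simp add: T_def \<pi>_mult U_\<pi>)
      qed
      then have "integ (\<lambda>s. ?P r s) = integ (\<lambda>s. ?G (- r + s))" by (simp only:)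
      also have "\<dots> = integ ?G"
        by (rule integ_left_translate[OF Cc_bounded_linear[OF blinfun.bounded_linear_right integrand_Cc[OF h]]])
      also have "\<dots> = blinfun_apply T (blinfun_apply (rep0 h) x)"
        unfolding rep0_apply[OF h] by (rule integ_bounded_linear[OF blinfun.bounded_linear_right integrand_Cc[OF h], symmetric])
      finally show ?thesis by (simp add: T_def)
    qed
    then show ?thesis by (simp only:)
  qed
  also have "\<dots> = blinfun_apply (rep0 f o\<^sub>L rep0 h) x" by (simp add: rep0_apply[OF f])
  finally show "blinfun_apply (rep0 (convolution M \<alpha> f h)) x = blinfun_apply (rep0 f o\<^sub>L rep0 h) x" .
qed

lemma involution_Cc:
  assumes f: "f \<in> Cc"
  shows "involution \<Delta> \<alpha> f \<in> Cc"
proof -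
  have "(\<lambda>s. \<Delta> (- s) *\<^sub>R star (f (- s))) \<in> Cc" by (rule Cc_reflect[OF Cc_bounded_linear[OF bounded_linear_star f]])
  then have "(\<lambda>s. \<alpha> s (\<Delta> (- s) *\<^sub>R star (f (- s)))) \<in> Cc"
    by (intro Cc_dominated[OF continuous_on_pair_compose[OF \<alpha>_joint continuous_on_id Cc_continuous]])
      (assumption, assumption, simp only: clinear_zero[OF \<alpha>_clinear])
  then show ?thesis by (simp add: involution_def[abs_def] clinear_scaleR[OF \<alpha>_clinear])
qed

text \<open>The modular function in the involution is compensated by the inversion formula.\<close>

lemma rep0_involution:
  assumes f: "f \<in> Cc"
  shows "inn E (blinfun_apply (rep0 f) x) y = inn E x (blinfun_apply (rep0 (involution \<Delta> \<alpha> f)) y)"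
proof -
  let ?k = "\<lambda>g. inn E (blinfun_apply (\<pi> (f g)) (U g x)) y"
  have k: "?k \<in> Cc" by (rule Cc_bounded_linear[OF bounded_linear_inn_left integrand_Cc[OF f]])
  have "inn E (blinfun_apply (rep0 f) x) y = integ ?k"
    unfolding rep0_apply[OF f] by (rule integ_bounded_linear[OF bounded_linear_inn_left integrand_Cc[OF f]])
  also have "\<dots> = integ (\<lambda>s. \<Delta> (- s) *\<^sub>R ?k (- s))" by (rule inversion[OF k, symmetric])
  also have "\<dots> = integ (\<lambda>s. inn E x (blinfun_apply (\<pi> (involution \<Delta> \<alpha> f s)) (U s y)))"
  proof -
    have "\<Delta> (- s) *\<^sub>R ?k (- s) = inn E x (blinfun_apply (\<pi> (involution \<Delta> \<alpha> f s)) (U s y))" for s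
    proof -
      have "?k (- s) = inn E (U s (U (- s) x)) (U s (blinfun_apply (\<pi> (star (f (- s)))) y))"
        by (simp only: U_inn \<pi>_adj)
      then show ?thesis
        by (simp add: U_\<pi> involution_def clinear_scaleR[OF \<pi>_clinear] blinfun.scaleR_left inn_scaleR_right)
    qed
    then show ?thesis by (simp only:)
  qed
  also have "\<dots> = inn E x (blinfun_apply (rep0 (involution \<Delta> \<alpha> f)) y)"
    unfolding rep0_apply[OF involution_Cc[OF f]]
    by (rule integ_bounded_linear[OF bounded_linear_inn_right integrand_Cc[OF involution_Cc[OF f]], symmetric])
  finally show ?thesis .
qed

lemma adj_rep0: "f \<in> Cc \<Longrightarrow> adj E (rep0 f) = rep0 (involution \<Delta> \<alpha> f)" and adjointable_rep0: "f \<in> Cc \<Longrightarrow> adjointable E (rep0 f)"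
  by (rule adj_eqI, erule rep0_involution) (rule adjointableI, erule rep0_involution)

lemma cstar_seminorm_rep0: "cstar_seminorm M \<Delta> \<alpha> (\<lambda>f. norm (rep0 f))"
  unfolding cstar_seminorm_def
proof (intro ballI conjI allI)
  fix f h :: "'g \<Rightarrow> 'a" and c assume f: "f \<in> Cc" and h: "h \<in> Cc"
  show "norm (rep0 f) \<le> (\<integral>g. norm (f g) \<partial>M)" by (rule norm_rep0[OF f])
  show "norm (rep0 (\<lambda>g. c *\<^sub>C f g)) = cmod c * norm (rep0 f)" by (simp add: rep0_scaleC[OF f] norm_scaleC)
  show "norm (rep0 (convolution M \<alpha> (involution \<Delta> \<alpha> f) f)) = (norm (rep0 f))\<^sup>2"
    using norm_adj_compose[OF adjointable_rep0[OF f]] by (simp add: rep0_convolution[OF involution_Cc[OF f] f] adj_rep0[OF f])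
  show "norm (rep0 (\<lambda>g. f g + h g)) \<le> norm (rep0 f) + norm (rep0 h)" by (simp add: rep0_add[OF f h] norm_triangle_ineq)
  show "norm (rep0 (convolution M \<alpha> f h)) \<le> norm (rep0 f) * norm (rep0 h)"
    by (simp add: rep0_convolution[OF f h] norm_blinfun_compose)
qed simp_all

lemma \<iota>_add: "f \<in> Cc \<Longrightarrow> h \<in> Cc \<Longrightarrow> \<iota> (\<lambda>g. f g + h g) = \<iota> f + \<iota> h"
  and \<iota>_mult: "f \<in> Cc \<Longrightarrow> h \<in> Cc \<Longrightarrow> \<iota> (convolution M \<alpha> f h) = \<iota> f * \<iota> h"
  and \<iota>_scaleC: "f \<in> Cc \<Longrightarrow> \<iota> (\<lambda>g. c *\<^sub>C f g) = c *\<^sub>C \<iota> f"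
  and \<iota>_star: "f \<in> Cc \<Longrightarrow> \<iota> (involution \<Delta> \<alpha> f) = star (\<iota> f)"
  and \<iota>_dense: "closure (\<iota> ` Cc) = UNIV"
  and \<iota>_universal: "cstar_seminorm M \<Delta> \<alpha> p \<Longrightarrow> f \<in> Cc \<Longrightarrow> p f \<le> norm (\<iota> f)"
  using universal unfolding universal_crossed_product_def by blast+

lemma norm_rep0_diff:
  assumes f: "f \<in> Cc" and h: "h \<in> Cc"
  shows "norm (rep0 f - rep0 h) \<le> norm (\<iota> f - \<iota> h)"
proof -
  have m: "(\<lambda>g. (- 1) *\<^sub>C h g) \<in> Cc" by (rule Cc_scaleC[OF h])
  have "norm (rep0 (\<lambda>g. f g + (- 1) *\<^sub>C h g)) \<le> norm (\<iota> (\<lambda>g. f g + (- 1) *\<^sub>C h g))"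
    by (rule \<iota>_universal[OF cstar_seminorm_rep0 Cc_add[OF f m]])
  then show ?thesis
    by (simp only: rep0_add[OF f m] \<iota>_add[OF f m] rep0_scaleC[OF h] \<iota>_scaleC[OF h])
      (simp add: scaleC_minus_left)
qed

text \<open>By the universal property \<open>\<parallel>rep0 f\<parallel> \<le> \<parallel>\<iota> f\<parallel>\<close>, so \<open>\<iota> f \<mapsto> rep0 f\<close> is well defined and extends continuously from
  the dense image of \<open>\<iota>\<close>.\<close>

definition \<rho> :: "'p \<Rightarrow> 'e \<Rightarrow>\<^sub>L 'e" where
  "\<rho> = (SOME \<rho>. 1-lipschitz_on UNIV \<rho> \<and> (\<forall>f\<in>Cc. \<rho> (\<iota> f) = rep0 f))"

lemma lipschitz_\<rho>: "1-lipschitz_on UNIV \<rho>" and \<rho>_\<iota>: "f \<in> Cc \<Longrightarrow> \<rho> (\<iota> f) = rep0 f"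
proof -
  define R where "R p = rep0 (SOME f. f \<in> Cc \<and> \<iota> f = p)" for p
  have R: "R (\<iota> f) = rep0 f" if f: "f \<in> Cc" for f
  proof -
    let ?h = "SOME h. h \<in> Cc \<and> \<iota> h = \<iota> f"
    have h: "?h \<in> Cc \<and> \<iota> ?h = \<iota> f" by (rule someI[of _ f]) (simp add: f)
    then show ?thesis using norm_rep0_diff[of ?h f] f by (simp add: R_def)
  qed
  have "1-lipschitz_on (\<iota> ` Cc) R"
  proof (rule lipschitz_onI)
    fix p q assume "p \<in> \<iota> ` Cc" "q \<in> \<iota> ` Cc"
    then obtain f h where "f \<in> Cc" "h \<in> Cc" "p = \<iota> f" "q = \<iota> h" by blast
    then show "dist (R p) (R q) \<le> 1 * dist p q" using norm_rep0_diff[of f h] by (simp add: R dist_norm)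
  qed simp
  from lipschitz_extend_closure[OF this] obtain \<rho>' where "1-lipschitz_on UNIV \<rho>'" "\<And>p. p \<in> \<iota> ` Cc \<Longrightarrow> \<rho>' p = R p"
    unfolding \<iota>_dense by blast
  then have "\<exists>\<rho>. 1-lipschitz_on UNIV \<rho> \<and> (\<forall>f\<in>Cc. \<rho> (\<iota> f) = rep0 f)" using R by (intro exI[of _ \<rho>']) simp
  then have "1-lipschitz_on UNIV \<rho> \<and> (\<forall>f\<in>Cc. \<rho> (\<iota> f) = rep0 f)" unfolding \<rho>_def by (rule someI_ex)
  then show "1-lipschitz_on UNIV \<rho>" "f \<in> Cc \<Longrightarrow> \<rho> (\<iota> f) = rep0 f" by blast+
qed

lemma continuous_\<rho>: "continuous_on UNIV \<rho>"
  by (rule lipschitz_on_continuous_on[OF lipschitz_\<rho>])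

lemma continuous_\<rho>_compose: "continuous_on S f \<Longrightarrow> continuous_on S (\<lambda>x. \<rho> (f x))"
  by (rule continuous_on_compose2[OF continuous_\<rho>]) auto

lemma \<rho>_add: "\<rho> (p + q) = \<rho> p + \<rho> q"
proof -
  have "continuous_on UNIV (\<lambda>x::'p \<times> 'p. \<rho> (fst x + snd x))" "continuous_on UNIV (\<lambda>x::'p \<times> 'p. \<rho> (fst x) + \<rho> (snd x))"
    by (intro continuous_\<rho>_compose continuous_intros)+
  from dense_eq2[OF \<iota>_dense this, of p q] show ?thesis
    by (force simp: \<iota>_add[symmetric] \<rho>_\<iota> Cc_add rep0_add)
qed

lemma \<rho>_mult: "\<rho> (p * q) = \<rho> p o\<^sub>L \<rho> q"
proof -
  have "continuous_on UNIV (\<lambda>x::'p \<times> 'p. \<rho> (fst x * snd x))" "continuous_on UNIV (\<lambda>x::'p \<times> 'p. \<rho> (fst x) o\<^sub>L \<rho> (snd x))"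
    by (intro continuous_\<rho>_compose continuous_intros bounded_bilinear.continuous_on[OF bounded_bilinear_blinfun_compose])+
  from dense_eq2[OF \<iota>_dense this, of p q] show ?thesis
    by (force simp: \<iota>_mult[symmetric] \<rho>_\<iota> convolution_Cc rep0_convolution)
qed

lemma \<rho>_scaleC: "\<rho> (c *\<^sub>C p) = c *\<^sub>C \<rho> p"
proof (rule dense_eq1[OF \<iota>_dense, of "\<lambda>p. \<rho> (c *\<^sub>C p)" "\<lambda>p. c *\<^sub>C \<rho> p"])
  show "continuous_on UNIV (\<lambda>p. \<rho> (c *\<^sub>C p))"
    by (rule continuous_\<rho>_compose[OF bounded_linear.continuous_on[OF bounded_linear_scaleC continuous_on_id]])
  show "continuous_on UNIV (\<lambda>p. c *\<^sub>C \<rho> p)"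
    by (rule bounded_linear.continuous_on[OF bounded_linear_scaleC continuous_\<rho>])
qed (auto simp: \<iota>_scaleC[symmetric] \<rho>_\<iota> Cc_scaleC rep0_scaleC)

lemma continuous_\<rho>_apply: "continuous_on S f \<Longrightarrow> continuous_on S (\<lambda>p. blinfun_apply (\<rho> (f p)) x)"
  by (rule bounded_linear.continuous_on[OF blinfun.bounded_linear_left continuous_\<rho>_compose])

lemma \<rho>_star: "inn E (blinfun_apply (\<rho> p) x) y = inn E x (blinfun_apply (\<rho> (star p)) y)"
proof (rule dense_eq1[OF \<iota>_dense, of "\<lambda>p. inn E (blinfun_apply (\<rho> p) x) y" "\<lambda>p. inn E x (blinfun_apply (\<rho> (star p)) y)"])
  show "continuous_on UNIV (\<lambda>p. inn E (blinfun_apply (\<rho> p) x) y)"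
    by (rule bounded_linear.continuous_on[OF bounded_linear_inn_left continuous_\<rho>_apply[OF continuous_on_id]])
  show "continuous_on UNIV (\<lambda>p. inn E x (blinfun_apply (\<rho> (star p)) y))"
    by (rule bounded_linear.continuous_on[OF bounded_linear_inn_right
          continuous_\<rho>_apply[OF bounded_linear.continuous_on[OF bounded_linear_star continuous_on_id]]])
qed (auto simp: \<iota>_star[symmetric] \<rho>_\<iota> involution_Cc rep0_involution)

lemma star_rep_\<rho>: "star_rep E \<rho>"
  by (simp add: star_rep_def clinear_def \<rho>_add \<rho>_mult \<rho>_scaleC \<rho>_star)

lemma integrated_rep: "integrated_rep M \<iota> E \<pi> U \<rho>"
  by (simp add: integrated_rep_def star_rep_\<rho> \<rho>_\<iota> rep0_apply has_integral_integ integrand_Cc)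

lemma correspondence_\<rho>: "correspondence E \<gamma> \<rho>"
  unfolding correspondence_def
proof (intro conjI allI)
  fix p
  show "even_map \<gamma> (blinfun_apply (\<rho> p))"
    unfolding even_map_def
  proof (intro allI impI)
    fix \<Gamma> x assume \<Gamma>: "\<gamma> = Some \<Gamma>"
    have e: "blinfun_apply (\<pi> a) (U g (blinfun_apply \<Gamma> x)) = blinfun_apply \<Gamma> (blinfun_apply (\<pi> a) (U g x))" for a g
      using even_\<pi>[of a] U_even[of g] \<Gamma> by (simp add: even_map_def)
    show "blinfun_apply (\<rho> p) (blinfun_apply \<Gamma> x) = blinfun_apply \<Gamma> (blinfun_apply (\<rho> p) x)"
    proof (rule dense_eq1[OF \<iota>_dense, of "\<lambda>p. blinfun_apply (\<rho> p) (blinfun_apply \<Gamma> x)" "\<lambda>p. blinfun_apply \<Gamma> (blinfun_apply (\<rho> p) x)"])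
      show "continuous_on UNIV (\<lambda>p. blinfun_apply (\<rho> p) (blinfun_apply \<Gamma> x))" by (rule continuous_\<rho>_apply[OF continuous_on_id])
      show "continuous_on UNIV (\<lambda>p. blinfun_apply \<Gamma> (blinfun_apply (\<rho> p) x))"
        by (rule bounded_linear.continuous_on[OF blinfun.bounded_linear_right continuous_\<rho>_apply[OF continuous_on_id]])
      show "blinfun_apply (\<rho> p) (blinfun_apply \<Gamma> x) = blinfun_apply \<Gamma> (blinfun_apply (\<rho> p) x)" if "p \<in> \<iota> ` Cc" for p
      proof -
        from that obtain f where f: "f \<in> Cc" "p = \<iota> f" by blast
        show ?thesis by (simp add: f(2) \<rho>_\<iota>[OF f(1)] rep0_apply[OF f(1)] e integ_bounded_linear[OF blinfun.bounded_linear_right integrand_Cc[OF f(1)]])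
      qed
    qed
  qed
qed (rule hilbert grading star_rep_\<rho>)+

subsection \<open>Compactness\<close>

lemma rank_one_Ub: "rank_one x y o\<^sub>L Ub g = rank_one x (U (- g) y)"
proof (rule blinfun_eqI)
  fix z
  have "inn E y (U g z) = inn E (U (- g) y) z" using U_inn[of "- g" y "U g z"] by simp
  then show "blinfun_apply (rank_one x y o\<^sub>L Ub g) z = blinfun_apply (rank_one x (U (- g) y)) z" by (simp add: rank_one_apply)
qed

lemma compact_Ub:
  assumes "T \<in> compact_ops E"
  shows "T o\<^sub>L Ub g \<in> compact_ops E"
proof -
  have bl: "bounded_linear (\<lambda>T. T o\<^sub>L Ub g)" by (rule bounded_bilinear.bounded_linear_left[OF bounded_bilinear_blinfun_compose])
  have "T \<in> (\<lambda>T. T o\<^sub>L Ub g) -` compact_ops E"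
  proof (rule compact_ops_induct[OF assms])
    show "subspace ((\<lambda>T. T o\<^sub>L Ub g) -` compact_ops E)"
      by (rule linear_subspace_vimage[OF bounded_linear.linear[OF bl] compact_ops_subspace])
    show "closed ((\<lambda>T. T o\<^sub>L Ub g) -` compact_ops E)"
      by (rule continuous_closed_vimage[OF compact_ops_closed]) (rule bounded_linear.isCont[OF bl continuous_ident])
    show "rank_one x y \<in> (\<lambda>T. T o\<^sub>L Ub g) -` compact_ops E" for x y
      unfolding vimage_eq rank_one_Ub compact_ops_rank_one by (rule subsetD[OF closure_subset span_base]) blast
  qed
  then show ?thesis by simp
qed

lemma norm_compose_Ub: "norm (T o\<^sub>L Ub g) \<le> norm T"
proof (rule norm_blinfun_bound)
  show "norm (blinfun_apply (T o\<^sub>L Ub g) x) \<le> norm T * norm x" for x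
    using norm_blinfun[of T "U g x"] by (simp add: U_norm)
qed simp

text \<open>Norm continuity, although \<open>g \<mapsto> U\<^sub>g\<close> is only strongly continuous: for rank one operators it is
  strong continuity of \<open>g \<mapsto> U\<^sub>g\<^sup>*\<close>.\<close>

lemma continuous_compact_Ub:
  assumes "T \<in> compact_ops E"
  shows "continuous_on UNIV (\<lambda>g. T o\<^sub>L Ub g)"
proof -
  have "T \<in> {T :: 'e \<Rightarrow>\<^sub>L 'e. continuous_on UNIV (\<lambda>g. T o\<^sub>L Ub g)}"
  proof (rule compact_ops_induct[OF assms])
    show "subspace {T :: 'e \<Rightarrow>\<^sub>L 'e. continuous_on UNIV (\<lambda>g. T o\<^sub>L Ub g)}"
      by (simp add: subspace_def continuous_on_add continuous_on_scaleR
        bounded_bilinear.add_left[OF bounded_bilinear_blinfun_compose]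
        bounded_bilinear.scaleR_left[OF bounded_bilinear_blinfun_compose]
        bounded_bilinear.zero_left[OF bounded_bilinear_blinfun_compose])
    show "closed {T :: 'e \<Rightarrow>\<^sub>L 'e. continuous_on UNIV (\<lambda>g. T o\<^sub>L Ub g)}"
      unfolding closed_sequential_limits
    proof (intro allI impI, elim conjE)
      fix X and T :: "'e \<Rightarrow>\<^sub>L 'e" assume X: "\<forall>n. X n \<in> {T :: 'e \<Rightarrow>\<^sub>L 'e. continuous_on UNIV (\<lambda>g. T o\<^sub>L Ub g)}" and lim: "X \<longlonglongrightarrow> T"
      have "uniform_limit UNIV (\<lambda>n g. X n o\<^sub>L Ub g) (\<lambda>g. T o\<^sub>L Ub g) sequentially"
      proof (rule uniform_limitI)
        fix e :: real assume "e > 0"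
        from tendstoD[OF lim this] show "\<forall>\<^sub>F n in sequentially. \<forall>g\<in>UNIV. dist (X n o\<^sub>L Ub g) (T o\<^sub>L Ub g) < e"
        proof eventually_elim
          case (elim n)
          have "dist (X n o\<^sub>L Ub g) (T o\<^sub>L Ub g) \<le> dist (X n) T" for g
            unfolding dist_norm bounded_bilinear.diff_left[OF bounded_bilinear_blinfun_compose, symmetric] by (rule norm_compose_Ub)
          then show ?case using elim le_less_trans by blast
        qed
      qed
      then show "T \<in> {T :: 'e \<Rightarrow>\<^sub>L 'e. continuous_on UNIV (\<lambda>g. T o\<^sub>L Ub g)}"
        using X by (intro CollectI uniform_limit_theorem) auto
    qed
    show "rank_one x y \<in> {T :: 'e \<Rightarrow>\<^sub>L 'e. continuous_on UNIV (\<lambda>g. T o\<^sub>L Ub g)}" for x y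
    proof -
      have "continuous_on UNIV (\<lambda>g::'g. U (- g) y)"
        by (rule continuous_on_compose2[OF continuous_U]) (intro continuous_intros, simp)
      from bounded_linear.continuous_on[OF bounded_linear_rank_one this] show ?thesis by (simp add: rank_one_Ub)
    qed
  qed
  then show ?thesis by simp
qed

lemma continuous_compact_family_Ub:
  assumes c: "continuous_on UNIV Z" and K: "\<And>g. Z g \<in> compact_ops E"
  shows "continuous_on UNIV (\<lambda>g. Z g o\<^sub>L Ub g)"
  unfolding continuous_on_def
proof
  fix g0 :: 'g
  have "((\<lambda>g. norm (Z g - Z g0) + norm ((Z g0 o\<^sub>L Ub g) - (Z g0 o\<^sub>L Ub g0))) \<longlongrightarrow> norm (Z g0 - Z g0) + norm ((Z g0 o\<^sub>L Ub g0) - (Z g0 o\<^sub>L Ub g0))) (at g0)"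
    using c continuous_compact_Ub[OF K[of g0]] unfolding continuous_on_def
    by (intro tendsto_add tendsto_norm tendsto_diff tendsto_const) auto
  then have lim: "((\<lambda>g. norm (Z g - Z g0) + norm ((Z g0 o\<^sub>L Ub g) - (Z g0 o\<^sub>L Ub g0))) \<longlongrightarrow> 0) (at g0)" by simp
  have "((\<lambda>g. (Z g o\<^sub>L Ub g) - (Z g0 o\<^sub>L Ub g0)) \<longlongrightarrow> 0) (at g0)"
  proof (rule Lim_null_comparison[OF always_eventually[OF allI] lim])
    fix g
    have "(Z g o\<^sub>L Ub g) - (Z g0 o\<^sub>L Ub g0) = ((Z g - Z g0) o\<^sub>L Ub g) + ((Z g0 o\<^sub>L Ub g) - (Z g0 o\<^sub>L Ub g0))"
      by (simp add: bounded_bilinear.diff_left[OF bounded_bilinear_blinfun_compose])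
    then show "norm ((Z g o\<^sub>L Ub g) - (Z g0 o\<^sub>L Ub g0)) \<le> norm (Z g - Z g0) + norm ((Z g0 o\<^sub>L Ub g) - (Z g0 o\<^sub>L Ub g0))"
      by (simp only:) (rule norm_triangle_le[OF add_right_mono[OF norm_compose_Ub]])
  qed
  then show "((\<lambda>g. Z g o\<^sub>L Ub g) \<longlongrightarrow> Z g0 o\<^sub>L Ub g0) (at g0)" by (simp add: LIM_zero_iff)
qed

text \<open>On \<open>\<iota> f\<close> the operator is the norm integral of a continuous function with compact values.\<close>

lemma compact_resolvent_\<rho>: "resolvent_sq D o\<^sub>L \<rho> p \<in> compact_ops E"
proof -
  let ?R = "resolvent_sq D"
  have bl: "bounded_linear (\<lambda>T. ?R o\<^sub>L T)" by (rule bounded_bilinear.bounded_linear_right[OF bounded_bilinear_blinfun_compose])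
  have "\<iota> ` Cc \<subseteq> {p. ?R o\<^sub>L \<rho> p \<in> compact_ops E}"
  proof clarify
    fix f :: "'g \<Rightarrow> 'a" assume f: "f \<in> Cc"
    let ?Z = "\<lambda>g. (?R o\<^sub>L \<pi> (f g)) o\<^sub>L Ub g"
    have Z1: "(\<lambda>g. ?R o\<^sub>L \<pi> (f g)) \<in> Cc" by (rule Cc_bounded_linear[OF bl Cc_bounded_linear[OF bounded_linear_\<pi> f]])
    have Z: "?Z \<in> Cc"
      by (rule Cc_dominated[OF continuous_compact_family_Ub[OF Cc_continuous[OF Z1] compact_resolvent] Z1])
        (simp add: bounded_bilinear.zero_left[OF bounded_bilinear_blinfun_compose])
    have "?R o\<^sub>L rep0 f = opint (\<lambda>g. ?R o\<^sub>L family f g)" by (simp add: rep0_def opint_left[OF compact_family[OF f]])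
    also have "\<dots> = opint ?Z" by (intro arg_cong[of _ _ opint] ext blinfun_eqI, simp add: family_def)
    also have "\<dots> = integ ?Z" by (rule opint_Cc[OF Z])
    also have "\<dots> \<in> compact_ops E"
      by (rule integ_in_closed_subspace[OF Z compact_ops_closed compact_ops_subspace compact_Ub[OF compact_resolvent]])
    finally show "?R o\<^sub>L \<rho> (\<iota> f) \<in> compact_ops E" by (simp add: \<rho>_\<iota>[OF f])
  qed
  moreover have "closed {p. ?R o\<^sub>L \<rho> p \<in> compact_ops E}"
    using continuous_closed_vimage[OF compact_ops_closed, of "\<lambda>p. ?R o\<^sub>L \<rho> p"]
      bounded_linear.continuous_on[OF bl continuous_\<rho>]
    by (simp add: vimage_def continuous_on_eq_continuous_at)
  ultimately show ?thesis using closure_minimal \<iota>_dense by blast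
qed

end

section \<open>Approximating an operator by its odd powers\<close>

context hmod
begin

text \<open>For \<open>w = (1 - s T\<^sup>* T) y\<close>, \<open>\<langle>w, w\<rangle> = \<langle>y, y\<rangle> - 2 s \<langle>T y, T y\<rangle> + s\<^sup>2 \<langle>T\<^sup>* T y, T\<^sup>* T y\<rangle>\<close>, and the last term is at
  most \<open>s \<langle>T y, T y\<rangle>\<close> when \<open>s \<parallel>T\<parallel>\<^sup>2 \<le> 1\<close>.\<close>

lemma state_shrink:
  fixes y :: 'e
  assumes T: "adjointable E T" and \<phi>: "state \<phi>" and s: "0 \<le> s" "s * (norm T)\<^sup>2 \<le> 1"
  defines "w \<equiv> y - s *\<^sub>R blinfun_apply (adj E T) (blinfun_apply T y)"
  shows "Re (\<phi> (inn E w w)) \<le> Re (\<phi> (inn E y y)) - s * Re (\<phi> (inn E (blinfun_apply T y) (blinfun_apply T y)))"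
proof -
  note cl = state_clinear[OF \<phi>]
  let ?t = "blinfun_apply T y" and ?b = "blinfun_apply (adj E T) (blinfun_apply T y)"
  define e where "e = Re (\<phi> (inn E ?t ?t))"
  have 1: "inn E ?b y = inn E ?t ?t" "inn E y ?b = inn E ?t ?t"
    using adj_left[OF T, of ?t y] adj_right[OF T, of y ?t] by simp_all
  have "inn E w w = inn E y y - s *\<^sub>R inn E ?t ?t - (s *\<^sub>R inn E ?t ?t - (s * s) *\<^sub>R inn E ?b ?b)"
    by (simp add: w_def inn_diff_left inn_diff_right inn_scaleR_left inn_scaleR_right 1 scaleR_diff_right)
  then have "Re (\<phi> (inn E w w)) = Re (\<phi> (inn E y y)) - 2 * s * e + s * s * Re (\<phi> (inn E ?b ?b))"
    by (simp add: clinear_diff[OF cl] clinear_scaleR[OF cl] e_def)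
  moreover have "s * s * Re (\<phi> (inn E ?b ?b)) \<le> s * e"
  proof -
    have "Re (\<phi> (inn E ?b ?b)) \<le> (norm T)\<^sup>2 * e"
      using state_adjointable_le[OF adjointable_adj[OF T] \<phi>, of ?t] by (simp add: norm_adj[OF T] e_def)
    then have "s * s * Re (\<phi> (inn E ?b ?b)) \<le> s * s * ((norm T)\<^sup>2 * e)" using s by (intro mult_left_mono) auto
    also have "\<dots> = s * (s * (norm T)\<^sup>2) * e" by (simp add: mult_ac)
    also have "\<dots> \<le> s * 1 * e"
      using s state_nonneg[OF \<phi> positive_inn] by (intro mult_right_mono mult_left_mono) (auto simp: e_def)
    finally show ?thesis by simp
  qed
  ultimately show ?thesis by (simp add: e_def)
qed

text \<open>With \<open>b = q\<^sup>* q\<close> and \<open>c = 1 - s b\<close>, telescoping \<open>s b c\<^sup>2\<^sup>k \<le> c\<^sup>2\<^sup>k - c\<^sup>2\<^sup>k\<^sup>+\<^sup>2\<close> shows that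
  \<open>N s b c\<^sup>2\<^sup>N \<le> 1\<close>.\<close>

lemma norm_compose_power_le:
  assumes q: "adjointable E q" and s: "0 < s" "s * (norm q)\<^sup>2 \<le> 1" and N: "0 < N"
  defines "c \<equiv> id_blinfun - s *\<^sub>R (adj E q o\<^sub>L q)"
  shows "(norm (blinfun_apply q ((blinfun_apply c ^^ N) x)))\<^sup>2 \<le> (norm x)\<^sup>2 / (real N * s)"
proof (rule norm_le_by_states)
  fix \<phi> :: "'b \<Rightarrow> complex" assume \<phi>: "state \<phi>"
  define y where "y n = (blinfun_apply c ^^ n) x" for n
  define e where "e y = Re (\<phi> (inn E (blinfun_apply q y) (blinfun_apply q y)))" for y
  define f where "f y = Re (\<phi> (inn E y y))" for y
  have c: "blinfun_apply c v = v - s *\<^sub>R blinfun_apply (adj E q) (blinfun_apply q v)" for v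
    by (simp add: c_def blinfun.diff_left blinfun.scaleR_left)
  have fc: "f (blinfun_apply c v) \<le> f v - s * e v" for v
    unfolding f_def e_def c by (rule state_shrink[OF q \<phi>]) (use s in auto)
  have ec: "e (blinfun_apply c v) \<le> e v" for v
  proof -
    let ?z = "blinfun_apply q v" and ?T = "adj E q"
    have "blinfun_apply q (blinfun_apply c v) = ?z - s *\<^sub>R blinfun_apply (adj E ?T) (blinfun_apply ?T ?z)"
      by (simp add: c blinfun.diff_right blinfun.scaleR_right adj_adj[OF q])
    then have "e (blinfun_apply c v) \<le> e v - s * Re (\<phi> (inn E (blinfun_apply ?T ?z) (blinfun_apply ?T ?z)))"
      using state_shrink[OF adjointable_adj[OF q] \<phi>, of s ?z] s by (simp add: e_def norm_adj[OF q])
    moreover have "0 \<le> s * Re (\<phi> (inn E (blinfun_apply ?T ?z) (blinfun_apply ?T ?z)))"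
      using s state_nonneg[OF \<phi> positive_inn] by simp
    ultimately show ?thesis by linarith
  qed
  have main: "real n * s * e (y n) + f (y n) \<le> f x" for n
  proof (induction n)
    case (Suc n)
    have y: "y (Suc n) = blinfun_apply c (y n)" by (simp add: y_def)
    have "real (Suc n) * s * e (y (Suc n)) \<le> real (Suc n) * s * e (y n)"
      unfolding y using s by (intro mult_left_mono ec) auto
    also have "\<dots> = real n * s * e (y n) + s * e (y n)" by (simp add: algebra_simps)
    finally show ?case using Suc fc[of "y n"] unfolding y by linarith
  qed (simp add: y_def)
  have "0 \<le> f (y N)" using state_nonneg[OF \<phi> positive_inn] by (simp add: f_def)
  then have "real N * s * e (y N) \<le> (norm x)\<^sup>2"
    using main[of N] state_inn_le[OF \<phi>, of x] by (simp add: f_def)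
  then show "Re (\<phi> (inn E (blinfun_apply q ((blinfun_apply c ^^ N) x)) (blinfun_apply q ((blinfun_apply c ^^ N) x)))) \<le> (norm x)\<^sup>2 / (real N * s)"
    using s N by (simp add: e_def y_def field_simps)
qed (use s in simp)

end

context conformal
begin

text \<open>Expanding \<open>q c\<^sup>N\<close> with \<open>c = 1 - s q\<^sup>* q\<close> gives \<open>q\<close> plus a combination of the operators in question, while
  \<open>\<parallel>q c\<^sup>N\<parallel>\<^sup>2 \<le> 1 / (N s)\<close>.\<close>

lemma in_closure_square_powers:
  assumes q: "adjointable E q"
  shows "q \<in> closure (span {q o\<^sub>L square_power q (Suc n) |n. True})"
proof -
  let ?W = "span {q o\<^sub>L square_power q (Suc n) |n. True}"
  let ?b = "adj E q o\<^sub>L q"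
  \<comment> \<open>the summand \<open>1\<close> covers the case \<open>q = 0\<close>\<close>
  define s where "s = 1 / ((norm q)\<^sup>2 + 1)"
  have s: "0 < s" "s * (norm q)\<^sup>2 \<le> 1" by (auto simp: s_def add_nonneg_pos)
  define c where "c = id_blinfun - s *\<^sub>R ?b"
  define C where "C = rec_nat id_blinfun (\<lambda>_ X. X o\<^sub>L c)"
  have C0: "C 0 = id_blinfun" and CS: "C (Suc n) = C n o\<^sub>L c" for n by (simp_all add: C_def)
  have C_apply: "blinfun_apply (C n) x = (blinfun_apply c ^^ n) x" for n x
    by (induction n arbitrary: x) (simp_all add: C0 CS funpow_swap1)
  have Wb: "w o\<^sub>L ?b \<in> ?W" if "w \<in> ?W" for w
    using that
  proof (induction rule: span_induct_alt)
    case base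
    show ?case using span_zero by (simp add: bounded_bilinear.zero_left[OF bounded_bilinear_blinfun_compose])
  next
    case (step r x y)
    then obtain n where x: "x = q o\<^sub>L square_power q (Suc n)" by blast
    have "x o\<^sub>L ?b = q o\<^sub>L square_power q (Suc (Suc n))" unfolding x by (rule blinfun_eqI) simp
    then have "x o\<^sub>L ?b \<in> ?W" by (simp only:) (rule span_base, blast)
    then show ?case
      using step.IH by (simp only: bounded_bilinear.add_left[OF bounded_bilinear_blinfun_compose]
          bounded_bilinear.scaleR_left[OF bounded_bilinear_blinfun_compose]) (intro span_add span_scale)
  qed
  have W: "q - (q o\<^sub>L C n) \<in> ?W" for n
  proof (induction n)
    case 0
    have "q - (q o\<^sub>L C 0) = 0" by (rule blinfun_eqI) (simp add: C0 blinfun.diff_left)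
    then show ?case using span_zero by simp
  next
    case (Suc n)
    have qb: "q o\<^sub>L ?b \<in> ?W"
    proof (rule span_base)
      have "q o\<^sub>L ?b = q o\<^sub>L square_power q (Suc 0)" by (rule blinfun_eqI) simp
      then show "q o\<^sub>L ?b \<in> {q o\<^sub>L square_power q (Suc n) |n. True}" by blast
    qed
    have "q - (q o\<^sub>L C (Suc n)) = (q - (q o\<^sub>L C n)) + s *\<^sub>R ((q o\<^sub>L ?b) - ((q - (q o\<^sub>L C n)) o\<^sub>L ?b))"
      by (rule blinfun_eqI)
        (simp add: CS c_def blinfun.diff_left blinfun.add_left blinfun.scaleR_left blinfun.diff_right blinfun.scaleR_right)
    then show ?case by (rule ssubst) (rule span_add[OF Suc span_scale[OF span_diff[OF qb Wb[OF Suc]]]])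
  qed
  show ?thesis
    unfolding closure_approachable
  proof (intro allI impI)
    fix e :: real assume e: "e > 0"
    obtain N :: nat where N: "1 / (s * e\<^sup>2) < real N" using reals_Archimedean2 by blast
    have se: "0 < s * e\<^sup>2" using s e by simp
    then have "0 < real N" using N by (meson less_trans zero_less_divide_1_iff)
    then have N0: "0 < N" by simp
    define d where "d = sqrt (1 / (real N * s))"
    have d0: "0 \<le> d" using s N0 by (simp add: d_def)
    have "1 / (real N * s) < e\<^sup>2" using N se N0 s by (simp add: field_simps)
    then have de: "d < e" unfolding d_def using e by (intro real_less_lsqrt) auto
    have "norm (q o\<^sub>L C N) \<le> d"
    proof (rule norm_blinfun_bound[OF d0])
      fix x
      have "(norm (blinfun_apply (q o\<^sub>L C N) x))\<^sup>2 \<le> (norm x)\<^sup>2 / (real N * s)"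
        using norm_compose_power_le[OF q s N0, of x] by (simp add: C_apply c_def)
      also have "\<dots> = (d * norm x)\<^sup>2" using s N0 by (simp add: d_def power_mult_distrib)
      finally show "norm (blinfun_apply (q o\<^sub>L C N) x) \<le> d * norm x" by (rule power2_le_imp_le) (simp add: d0)
    qed
    then have "dist (q - (q o\<^sub>L C N)) q < e" using de by (simp add: dist_norm)
    then show "\<exists>w\<in>?W. dist w q < e" using W by blast
  qed
qed

end

section \<open>States of compact support\<close>

context haar
begin

definition average :: "('g \<Rightarrow> real) \<Rightarrow> ('g, 'v::banach) c0 \<Rightarrow> 'v" where
  "average \<phi> f = integ (\<lambda>g. \<phi> g *\<^sub>R apply_c0 f g)"

lemma norm_average:
  assumes \<phi>: "\<phi> \<in> Cc" "\<And>g. 0 \<le> \<phi> g" "integ \<phi> = 1"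
  shows "norm (average \<phi> f) \<le> norm (f :: ('g, 'v::banach) c0)"
proof -
  have c: "(\<lambda>g. \<phi> g *\<^sub>R apply_c0 f g) \<in> Cc" by (rule Cc_scaleR_c0[OF \<phi>(1)])
  have "norm (average \<phi> f) \<le> (\<integral>g. norm (\<phi> g *\<^sub>R apply_c0 f g) \<partial>M)" unfolding average_def by (rule norm_integ[OF c])
  also have "\<dots> \<le> (\<integral>g. \<phi> g * norm f \<partial>M)"
  proof (rule integral_mono[OF Cc_integrable[OF Cc_norm[OF c]] Cc_integrable[OF Cc_bounded_linear[OF bounded_linear_mult_left \<phi>(1)]]])
    show "norm (\<phi> g *\<^sub>R apply_c0 f g) \<le> \<phi> g * norm f" for g
      using \<phi>(2)[of g] by (simp add: mult_left_mono norm_c0_ge)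
  qed
  also have "\<dots> = norm f" using \<phi>(3) by (simp add: integ_real[OF \<phi>(1)])
  finally show ?thesis .
qed

lemma average_add: "\<phi> \<in> Cc \<Longrightarrow> average \<phi> (f + h) = average \<phi> f + average \<phi> (h :: ('g, 'v::banach) c0)"
  by (simp add: average_def plus_c0.rep_eq scaleR_add_right integ_add Cc_scaleR_c0)

lemma average_scaleR: "\<phi> \<in> Cc \<Longrightarrow> average \<phi> (r *\<^sub>R f) = r *\<^sub>R average \<phi> (f :: ('g, 'v::banach) c0)"
  using integ_bounded_linear[OF bounded_linear_scaleR_right[of r] Cc_scaleR_c0[of \<phi> f]]
  by (simp add: average_def scaleR_c0.rep_eq mult.commute)

lemma average_scaleC: "\<phi> \<in> Cc \<Longrightarrow> average \<phi> (c *\<^sub>C f) = c *\<^sub>C average \<phi> (f :: ('g, 'v::cbanach) c0)"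
  using integ_bounded_linear[OF bounded_linear_scaleC[of c] Cc_scaleR_c0[of \<phi> f]]
  by (simp add: average_def scaleC_c0.rep_eq scaleR_scaleC scaleC_scaleC mult.commute)

lemma bounded_linear_average:
  assumes \<phi>: "\<phi> \<in> Cc" "\<And>g. 0 \<le> \<phi> g" "integ \<phi> = 1"
  shows "bounded_linear (average \<phi> :: ('g, 'v::banach) c0 \<Rightarrow> 'v)"
  by (rule bounded_linear_intro[where K = 1])
    (simp_all add: average_add average_scaleR \<phi>(1) norm_average[OF \<phi>])

lemma cut_off:
  assumes "\<phi> \<in> Cc"
  obtains \<eta> :: "'g \<Rightarrow> real" where "\<eta> \<in> Cc" "\<And>g. 0 \<le> \<eta> g" "\<And>g. \<eta> g \<le> 1" "\<And>g. \<phi> g *\<^sub>R \<eta> g = \<phi> g"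
proof -
  obtain K where K: "compact K" "\<And>x. x \<notin> K \<Longrightarrow> \<phi> x = 0" using assms by (rule Cc_E) (rule that)
  obtain \<eta> :: "'g \<Rightarrow> real" where \<eta>: "\<eta> \<in> Cc" "\<And>x. 0 \<le> \<eta> x" "\<And>x. \<eta> x \<le> 1" "\<And>x. x \<in> K \<Longrightarrow> \<eta> x = 1"
    by (rule Urysohn_Cc[OF K(1) open_UNIV subset_UNIV]) (rule that)
  show thesis
  proof (rule that[OF \<eta>(1-3)])
    show "\<phi> g *\<^sub>R \<eta> g = \<phi> g" for g using K(2)[of g] \<eta>(4)[of g] by (cases "g \<in> K") auto
  qed
qed

end

context haar
begin

text \<open>A cut-off function equal to \<open>1\<close> on the support of \<open>\<phi>\<close> has norm one and average one; it shows both
  that the norm of the state is \<open>1\<close> and that its support is compact.\<close>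

lemma state_average:
  assumes \<phi>: "\<phi> \<in> Cc" "\<And>g. 0 \<le> \<phi> g" "integ \<phi> = 1"
  shows "compactly_supported_state (average \<phi> :: ('g, complex) c0 \<Rightarrow> complex)"
proof -
  let ?\<psi> = "average \<phi> :: ('g, complex) c0 \<Rightarrow> complex"
  obtain \<eta> :: "'g \<Rightarrow> real" where \<eta>: "\<eta> \<in> Cc" "\<And>g. 0 \<le> \<eta> g" "\<And>g. \<eta> g \<le> 1" "\<And>g. \<phi> g *\<^sub>R \<eta> g = \<phi> g"
    by (rule cut_off[OF \<phi>(1)]) (rule that)
  have of_real: "integ (\<lambda>g. complex_of_real (h g)) = complex_of_real (integ h)" if "h \<in> Cc" for h
    by (rule integ_bounded_linear[OF bounded_linear_of_real that, symmetric])
  have \<psi>\<eta>: "?\<psi> (cut \<eta>) = 1"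
  proof -
    have "\<phi> g *\<^sub>R apply_c0 (cut \<eta>) g = complex_of_real (\<phi> g)" for g
      using \<eta>(4)[of g] by (simp add: \<eta>(1) scaleR_conv_of_real of_real_mult[symmetric] del: of_real_mult)
    then show ?thesis by (simp add: average_def of_real[OF \<phi>(1)] \<phi>(3))
  qed
  have n\<eta>: "norm (cut \<eta>) \<le> 1" by (rule norm_c0_le) (simp add: \<eta>)
  have bl: "bounded_linear ?\<psi>" by (rule bounded_linear_average[OF \<phi>])
  have n\<eta>1: "norm (cut \<eta>) = 1" using norm_average[OF \<phi>, of "cut \<eta>"] n\<eta> \<psi>\<eta> by simp
  have "onorm ?\<psi> = 1"
  proof (rule antisym)
    show "onorm ?\<psi> \<le> 1" by (rule onorm_bound) (simp_all add: norm_average[OF \<phi>])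
    show "1 \<le> onorm ?\<psi>" using onorm[OF bl, of "cut \<eta>"] \<psi>\<eta> n\<eta>1 by simp
  qed
  moreover have "?\<psi> (star c * c) = complex_of_real (integ (\<lambda>g. \<phi> g *\<^sub>R (cmod (apply_c0 c g))\<^sup>2)) \<and>
      0 \<le> integ (\<lambda>g. \<phi> g *\<^sub>R (cmod (apply_c0 c g))\<^sup>2)" for c
  proof -
    have h: "(\<lambda>g. \<phi> g *\<^sub>R (cmod (apply_c0 c g))\<^sup>2) \<in> Cc"
      by (rule Cc_scaleR[OF \<phi>(1)]) (intro continuous_intros)
    have "\<phi> g *\<^sub>R apply_c0 (star c * c) g = complex_of_real (\<phi> g *\<^sub>R (cmod (apply_c0 c g))\<^sup>2)" for g
      by (simp add: times_c0.rep_eq star_c0.rep_eq star_complex_def scaleR_conv_of_real mult.commute[of "cnj _"] complex_norm_square[symmetric] del: of_real_power)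
    then show ?thesis using \<phi>(2) by (simp only: average_def of_real[OF h]) (simp add: integ_real[OF h[unfolded real_scaleR_def]])
  qed
  ultimately have "state ?\<psi>"
    unfolding state_def using bl by (simp add: clinear_def average_add average_scaleC \<phi>(1))
  moreover have "cut \<eta> \<noteq> 0" using n\<eta>1 by auto
  ultimately show ?thesis unfolding compactly_supported_state_def using \<psi>\<eta> n\<eta>1 by (intro conjI exI[of _ "cut \<eta>"]) simp_all
qed

text \<open>A dense ideal contains some \<open>u\<close> with \<open>|u| \<ge> 1/2\<close> on the support of \<open>\<eta>\<close>, and then
  \<open>\<eta> = (\<eta> u\<^sup>*/|u|\<^sup>2) u\<close>.\<close>

lemma cut_pedersen:
  assumes \<eta>: "\<eta> \<in> Cc"
  shows "cut \<eta> \<in> (pedersen_ideal :: ('g, complex) c0 set)"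
  unfolding pedersen_ideal_def
proof (intro InterI, clarify)
  fix I :: "('g, complex) c0 set" assume I: "two_sided_ideal I" "closure I = UNIV"
  obtain \<zeta> :: "'g \<Rightarrow> real" where \<zeta>: "\<zeta> \<in> Cc" "\<And>g. \<eta> g *\<^sub>R \<zeta> g = \<eta> g" by (rule cut_off[OF \<eta>]) (rule that)
  obtain u where u: "u \<in> I" "dist u (cut \<zeta>) < 1 / 2"
    using closure_approachable[of "cut \<zeta>" I] I(2) by (auto elim!: allE[of _ "1/2"])
  have big: "1 / 2 \<le> cmod (apply_c0 u g)" if "\<eta> g \<noteq> 0" for g
  proof -
    have "\<zeta> g = 1" using \<zeta>(2)[of g] that by simp
    then have "cmod (apply_c0 u g - 1) < 1 / 2"
      using norm_c0_ge[of "u - cut \<zeta>" g] u(2) by (simp add: dist_norm apply_c0_minus \<zeta>(1))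
    then show ?thesis using norm_triangle_sub[of 1 "apply_c0 u g"] by (simp add: norm_minus_commute)
  qed
  \<comment> \<open>the maximum keeps the denominator away from \<open>0\<close>; on the support of \<open>\<eta>\<close> it is \<open>|u|\<^sup>2\<close>\<close>
  let ?w = "\<lambda>g. \<eta> g *\<^sub>R (cnj (apply_c0 u g) / complex_of_real (max ((cmod (apply_c0 u g))\<^sup>2) (1/4)))"
  have "complex_of_real (max ((cmod (apply_c0 u g))\<^sup>2) (1/4)) \<noteq> 0" for g
  proof -
    have "1/4 \<le> max ((cmod (apply_c0 u g))\<^sup>2) (1/4)" by (rule max.cobounded2)
    then have "max ((cmod (apply_c0 u g))\<^sup>2) (1/4) \<noteq> 0" by linarith
    then show ?thesis by (simp only: of_real_eq_0_iff not_False_eq_True)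
  qed
  then have w: "?w \<in> Cc"
    by (intro Cc_scaleR[OF \<eta>] continuous_on_divide continuous_intros) blast
  have "cut \<eta> = Abs_c0 ?w * u"
  proof (rule c0_eqI)
    fix g
    show "apply_c0 (cut \<eta>) g = apply_c0 (Abs_c0 ?w * u) g"
    proof (cases "\<eta> g = 0")
      case False
      have "(1/2)\<^sup>2 \<le> (cmod (apply_c0 u g))\<^sup>2" by (rule power_mono[OF big[OF False]]) simp
      then have m: "max ((cmod (apply_c0 u g))\<^sup>2) (1/4) = (cmod (apply_c0 u g))\<^sup>2" by (simp add: power2_eq_square)
      have nz: "apply_c0 u g \<noteq> 0" using big[OF False] by auto
      have "cnj (apply_c0 u g) / complex_of_real ((cmod (apply_c0 u g))\<^sup>2) * apply_c0 u g = 1"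
        using nz by (simp add: complex_norm_square field_simps del: of_real_power)
      then have "\<eta> g *\<^sub>R (cnj (apply_c0 u g) / complex_of_real (max ((cmod (apply_c0 u g))\<^sup>2) (1/4))) * apply_c0 u g = complex_of_real (\<eta> g)"
        by (simp only: m mult_scaleR_left) (simp only: scaleR_conv_of_real mult_1_right)
      then show ?thesis by (simp only: times_c0.rep_eq apply_Abs_Cc[OF w] apply_cut[OF \<eta>])
    qed (simp add: \<eta> times_c0.rep_eq w)
  qed
  then show "cut \<eta> \<in> I" using I(1) u(1) by (simp add: two_sided_ideal_def)
qed

lemma positive_cut:
  assumes "\<eta> \<in> Cc" "\<And>g. 0 \<le> \<eta> g"
  shows "Defs.positive (cut \<eta> :: ('g, complex) c0)"
  unfolding Defs.positive_def
proof (intro exI c0_eqI)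
  have s: "(\<lambda>g. sqrt (\<eta> g)) \<in> Cc"
    by (rule Cc_dominated[OF continuous_on_real_sqrt[OF Cc_continuous[OF assms(1)]] assms(1)]) simp
  show "apply_c0 (cut \<eta>) g = apply_c0 (star (cut (\<lambda>g. sqrt (\<eta> g))) * cut (\<lambda>g. sqrt (\<eta> g))) g" for g
    using assms(2)[of g] by (simp add: assms(1) s times_c0.rep_eq star_c0.rep_eq star_complex_def of_real_mult[symmetric] del: of_real_mult)
qed

lemma slice_map_average:
  assumes \<phi>: "\<phi> \<in> Cc" "\<And>g. 0 \<le> \<phi> g" "integ \<phi> = 1"
  shows "blinfun_apply (slice_map (c0_tensor :: 'v::cstar_algebra \<Rightarrow> ('g, complex) c0 \<Rightarrow> _) (average \<phi>)) f = average \<phi> f"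
proof -
  let ?P = "Blinfun (average \<phi>) :: ('g, 'v) c0 \<Rightarrow>\<^sub>L 'v"
  have P: "blinfun_apply ?P f = average \<phi> f" for f
    by (rule bounded_linear_Blinfun_apply[OF bounded_linear_average[OF \<phi>], THEN fun_cong])
  have t: "blinfun_apply ?P (c0_tensor b c) = average \<phi> c *\<^sub>C b" for b :: 'v and c
  proof -
    have "bounded_linear (\<lambda>z. z *\<^sub>C b)"
      by (rule bounded_linear_intro[where K = "norm b"])
        (simp_all add: scaleC_add_left norm_scaleC scaleR_scaleC scaleC_scaleC scaleC_complex_def)
    from integ_bounded_linear[OF this Cc_scaleR_c0[OF \<phi>(1)]] show ?thesis
      unfolding P by (simp add: average_def apply_c0_tensor scaleR_scaleC scaleC_scaleC scaleC_complex_def)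
  qed
  have "slice_map (c0_tensor :: 'v \<Rightarrow> ('g, complex) c0 \<Rightarrow> _) (average \<phi>) = ?P"
    unfolding slice_map_def
  proof (rule the_equality)
    fix P' :: "('g, 'v) c0 \<Rightarrow>\<^sub>L 'v" assume "\<forall>b c. blinfun_apply P' (c0_tensor b c) = average \<phi> c *\<^sub>C b"
    then show "P' = ?P" by (intro blinfun_eq_on_tensors) (simp add: t)
  qed (simp add: t)
  then show ?thesis by (simp add: P)
qed

end

section \<open>Slices and the algebra that they generate\<close>

text \<open>A candidate \<open>S\<close> in the intersection that defines the generated C*-algebra.\<close>

locale generation = crossed E dom \<alpha> \<beta> \<gamma> \<pi> D U \<mu> M \<Delta> \<iota>
  for E :: "('e::cbanach, 'b::cstar_algebra) hmodule" and dom :: "'g::{topological_group_add, t2_space} itself"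
    and \<alpha> :: "'g \<Rightarrow> 'a::cstar_algebra \<Rightarrow> 'a" and \<beta> :: "'g \<Rightarrow> 'b \<Rightarrow> 'b"
    and \<gamma> :: "('e \<Rightarrow>\<^sub>L 'e) option" and \<pi> :: "'a \<Rightarrow> 'e \<Rightarrow>\<^sub>L 'e" and D :: "'e uop"
    and U :: "'g \<Rightarrow> 'e \<Rightarrow> 'e" and \<mu> :: "'g \<Rightarrow> 'e \<Rightarrow>\<^sub>L 'e" and M :: "'g measure" and \<Delta> :: "'g \<Rightarrow> real"
    and \<iota> :: "('g \<Rightarrow> 'a) \<Rightarrow> 'p::cstar_algebra" +
  fixes S :: "('e \<Rightarrow>\<^sub>L 'e) set"
  assumes slices: "\<And>l t r \<psi> R. l \<in> side_set \<theta> F D Id \<Longrightarrow> t \<in> middle_set \<theta> F D Id \<mu>m \<Longrightarrow> r \<in> side_set \<theta> F D \<mu>m \<Longrightarrow>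
      compactly_supported_state \<psi> \<Longrightarrow>
      is_slice (c0_tensor :: 'b \<Rightarrow> ('g, complex) c0 \<Rightarrow> ('g, 'b) c0) E \<theta> F \<psi> (mprod l (mprod t r)) R \<Longrightarrow> R \<in> S"
    and S: "closed S" "0 \<in> S" "\<And>a b. a \<in> S \<Longrightarrow> b \<in> S \<Longrightarrow> a + b \<in> S" "\<And>a c. a \<in> S \<Longrightarrow> c *\<^sub>C a \<in> S"
      "\<And>a. a \<in> S \<Longrightarrow> adj E a \<in> S"
begin

lemma subspace_S: "subspace S"
  by (rule subspaceI) (simp_all add: S scaleR_scaleC)

lemma Cc_family: "\<phi> \<in> Cc \<Longrightarrow> star_strongly_continuous E Z \<Longrightarrow> compact_family (\<lambda>g::'g. \<phi> g *\<^sub>R Z g)"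
  by (rule Cc_scaleR_compact_family[OF _ strongly_continuous_star(1)])

lemma adj_opint:
  assumes "\<phi> \<in> Cc" "star_strongly_continuous E (Z :: 'g \<Rightarrow> 'e \<Rightarrow>\<^sub>L 'e)"
  shows "inn E (blinfun_apply (opint (\<lambda>g. \<phi> g *\<^sub>R Z g)) x) y = inn E x (blinfun_apply (opint (\<lambda>g. \<phi> g *\<^sub>R adj E (Z g))) y)"
proof -
  note f1 = Cc_family[OF assms] and f2 = Cc_family[OF assms(1) ssc_adj[OF assms(2)]]
  have "inn E (blinfun_apply (opint (\<lambda>g. \<phi> g *\<^sub>R Z g)) x) y = integ (\<lambda>g. inn E (blinfun_apply (\<phi> g *\<^sub>R Z g) x) y)"
    unfolding opint_apply[OF f1] by (rule integ_bounded_linear[OF bounded_linear_inn_left compact_family_Cc[OF f1]])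
  also have "\<dots> = integ (\<lambda>g. inn E x (blinfun_apply (\<phi> g *\<^sub>R adj E (Z g)) y))"
    by (simp add: blinfun.scaleR_left inn_scaleR_left inn_scaleR_right adj_right[OF strongly_continuous_star(3)[OF assms(2)]])
  also have "\<dots> = inn E x (blinfun_apply (opint (\<lambda>g. \<phi> g *\<^sub>R adj E (Z g))) y)"
    unfolding opint_apply[OF f2] by (rule integ_bounded_linear[OF bounded_linear_inn_right compact_family_Cc[OF f2], symmetric])
  finally show ?thesis .
qed

text \<open>The slice of a multiplication operator is the integral of the family. The cut-off \<open>\<eta>\<close> in the definition
  of a slice drops out since \<open>\<phi> \<eta>\<^sup>2 = \<phi>\<close>.\<close>

lemma is_slice_opint:
  fixes Z :: "'g \<Rightarrow> 'e \<Rightarrow>\<^sub>L 'e"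
  assumes \<phi>: "\<phi> \<in> Cc" "\<And>g. 0 \<le> \<phi> g" "integ \<phi> = 1" and Z: "star_strongly_continuous E Z"
  shows "is_slice (c0_tensor :: 'b \<Rightarrow> ('g, complex) c0 \<Rightarrow> ('g, 'b) c0) E \<theta> F (average \<phi>) (c0_multiplication Z) (opint (\<lambda>g. \<phi> g *\<^sub>R Z g))"
proof -
  obtain \<eta> :: "'g \<Rightarrow> real" where \<eta>: "\<eta> \<in> Cc" "\<And>g. 0 \<le> \<eta> g" "\<And>g. \<eta> g \<le> 1" "\<And>g. \<phi> g *\<^sub>R \<eta> g = \<phi> g"
    by (rule cut_off[OF \<phi>(1)]) (rule that)
  have \<eta>c: "complex_of_real (\<phi> g) * complex_of_real (\<eta> g) = complex_of_real (\<phi> g)" for g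
    using \<eta>(4)[of g] by (metis of_real_mult real_scaleR_def)
  have av: "average \<phi> (cut \<eta> * c) = average \<phi> c" for c :: "('g, complex) c0"
    by (simp only: average_def times_c0.rep_eq apply_cut[OF \<eta>(1)] scaleR_conv_of_real mult.assoc[symmetric] \<eta>c)
  have comm: "c * cut \<eta> = cut \<eta> * c" for c :: "('g, complex) c0"
    by (rule c0_eqI) (simp add: times_c0.rep_eq mult.commute)
  have one: "average \<phi> (cut \<eta>) = (1 :: complex)"
  proof -
    have "average \<phi> (cut \<eta>) = integ (\<lambda>g. complex_of_real (\<phi> g))"
      by (simp only: average_def apply_cut[OF \<eta>(1)] scaleR_conv_of_real \<eta>c)
    also have "\<dots> = complex_of_real (integ \<phi>)" by (rule integ_bounded_linear[OF bounded_linear_of_real \<phi>(1), symmetric])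
    finally show ?thesis by (simp add: \<phi>(3))
  qed
  have "norm (cut \<eta>) = 1"
  proof (rule antisym)
    show "norm (cut \<eta>) \<le> 1" by (rule norm_c0_le) (simp add: \<eta>)
    show "1 \<le> norm (cut \<eta>)" using norm_average[OF \<phi>, of "cut \<eta>"] by (simp add: one)
  qed
  moreover have "\<exists>z. (\<theta> y (cut \<eta>), z) \<in> c0_multiplication Z \<and>
      inn E x (blinfun_apply (opint (\<lambda>g. \<phi> g *\<^sub>R Z g)) y) = blinfun_apply (slice_map c0_tensor (average \<phi>)) (inn F (\<theta> x (cut \<eta>)) z)" for x y
  proof (intro exI conjI)
    let ?z = "Abs_c0 (\<lambda>g. blinfun_apply (Z g) (apply_c0 (\<theta> y (cut \<eta>)) g))"
    have tCc: "apply_c0 (\<theta> y (cut \<eta>)) \<in> Cc"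
      using Cc_scaleR[OF \<eta>(1), of "\<lambda>_. y"] by (simp add: c0_tensor_cut \<eta>(1))
    show "(\<theta> y (cut \<eta>), ?z) \<in> c0_multiplication Z"
      by (rule c0_multiplication_Cc[OF strongly_continuous_star(1)[OF Z] tCc])
    have z: "apply_c0 ?z g = \<eta> g *\<^sub>R blinfun_apply (Z g) y" for g
      using Cc_apply[OF strongly_continuous_star(1)[OF Z] tCc] by (simp add: apply_c0_tensor \<eta>(1) blinfun.scaleR_right scaleR_scaleC[symmetric])
    have f: "compact_family (\<lambda>g. \<phi> g *\<^sub>R Z g)" by (rule Cc_family[OF \<phi>(1) Z])
    have "inn E x (blinfun_apply (opint (\<lambda>g. \<phi> g *\<^sub>R Z g)) y) = integ (\<lambda>g. \<phi> g *\<^sub>R inn E x (blinfun_apply (Z g) y))"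
      unfolding opint_apply[OF f] integ_bounded_linear[OF bounded_linear_inn_right compact_family_Cc[OF f]]
      by (simp add: blinfun.scaleR_left inn_scaleR_right)
    also have "\<dots> = average \<phi> (inn F (\<theta> x (cut \<eta>)) ?z)"
      unfolding average_def
    proof (rule arg_cong[of _ _ integ], rule ext)
      fix g
      have "\<phi> g * (\<eta> g * \<eta> g) = \<phi> g" using \<eta>(4)[of g] by auto
      then show "\<phi> g *\<^sub>R inn E x (blinfun_apply (Z g) y) = \<phi> g *\<^sub>R apply_c0 (inn F (\<theta> x (cut \<eta>)) ?z) g"
        by (simp only: apply_inn_c0 z) (simp only: apply_c0_tensor scale_cut[OF \<eta>(1)] inn_scaleR_left inn_scaleR_right scaleR_scaleR mult.assoc)
    qed
    finally show "inn E x (blinfun_apply (opint (\<lambda>g. \<phi> g *\<^sub>R Z g)) y) = blinfun_apply (slice_map c0_tensor (average \<phi>)) (inn F (\<theta> x (cut \<eta>)) ?z)"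
      by (simp only: slice_map_average[OF \<phi>])
  qed
  moreover have "adjointable E (opint (\<lambda>g. \<phi> g *\<^sub>R Z g))" by (rule adjointableI[OF adj_opint[OF \<phi>(1) Z]])
  ultimately show ?thesis
    unfolding is_slice_def using cut_pedersen[OF \<eta>(1)] positive_cut[OF \<eta>(1,2)] one av
    by (intro conjI bexI[of _ "cut \<eta>"]) (simp_all add: comm)
qed

lemma slice_in_S:
  assumes "l \<in> Lip0 E D" "q \<in> conformal_set E D U \<mu>" "\<phi> \<in> Cc" "\<And>g. 0 \<le> \<phi> g" "integ \<phi> = 1"
  shows "opint (\<lambda>g. \<phi> g *\<^sub>R (l o\<^sub>L ((Ub (- g) o\<^sub>L q) o\<^sub>L square_power q (Suc n)))) \<in> S"
proof (rule slices[OF Lip0_in_left_set[OF assms(1)] middle_set_element[OF assms(2)] right_set_element[OF assms(2)] state_average[OF assms(3-5)]])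
  show "is_slice c0_tensor E \<theta> F (average \<phi>)
      (mprod (c0_multiplication (\<lambda>_. l)) (mprod (c0_multiplication (\<lambda>g. Ub (- g) o\<^sub>L q)) (c0_multiplication (\<lambda>_. square_power q (Suc n)))))
      (opint (\<lambda>g. \<phi> g *\<^sub>R (l o\<^sub>L ((Ub (- g) o\<^sub>L q) o\<^sub>L square_power q (Suc n)))))"
    unfolding mprod_elements(1)[OF assms(1,2)] by (rule is_slice_opint[OF assms(3-5) mprod_elements(2)[OF assms(1,2)]])
qed

text \<open>Scaling covers positive densities of positive mass; a general \<open>\<phi>\<close> is the difference
  \<open>(\<phi>\<^sub>+ + \<phi>\<^sub>1) - (\<phi>\<^sub>- + \<phi>\<^sub>1)\<close>, where \<open>\<phi>\<^sub>1\<close> is positive with positive mass.\<close>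

lemma opint_in_S_of_normalised:
  assumes Z: "strongly_continuous Z"
    and S1: "\<And>\<phi>. \<phi> \<in> Cc \<Longrightarrow> (\<And>g. 0 \<le> \<phi> g) \<Longrightarrow> integ \<phi> = 1 \<Longrightarrow> opint (\<lambda>g. \<phi> g *\<^sub>R Z g) \<in> S"
    and \<phi>: "\<phi> \<in> Cc"
  shows "opint (\<lambda>g. \<phi> g *\<^sub>R Z g) \<in> S"
proof -
  have pos: "opint (\<lambda>g. \<phi> g *\<^sub>R Z g) \<in> S" if \<phi>: "\<phi> \<in> Cc" "\<And>g. 0 \<le> \<phi> g" "0 < integ \<phi>" for \<phi>
  proof -
    let ?m = "integ \<phi>"
    let ?n = "\<lambda>g. inverse ?m * \<phi> g"
    have n: "?n \<in> Cc" by (rule Cc_bounded_linear[OF bounded_linear_mult_right \<phi>(1)])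
    have "integ ?n = 1"
      using \<phi>(3) by (simp add: integ_bounded_linear[OF bounded_linear_mult_right \<phi>(1), symmetric])
    then have "opint (\<lambda>g. ?n g *\<^sub>R Z g) \<in> S" using \<phi> by (intro S1 n) auto
    then have "?m *\<^sub>R opint (\<lambda>g. ?n g *\<^sub>R Z g) \<in> S" by (rule subspace_scale[OF subspace_S])
    moreover have "?m *\<^sub>R (?n g *\<^sub>R Z g) = \<phi> g *\<^sub>R Z g" for g using \<phi>(3) by simp
    ultimately show ?thesis
      using opint_scaleR[OF Cc_scaleR_compact_family[OF n Z], of ?m] by (simp only:)
  qed
  obtain \<phi>1 :: "'g \<Rightarrow> real" where \<phi>1: "\<phi>1 \<in> Cc" "\<And>g. 0 \<le> \<phi>1 g" "(\<integral>s. \<phi>1 s \<partial>M) > 0" by (rule exists_mass) (rule that)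
  have part: "opint (\<lambda>g. (max (h g) 0 + \<phi>1 g) *\<^sub>R Z g) \<in> S \<and> (\<lambda>g. max (h g) 0 + \<phi>1 g) \<in> Cc" if h: "h \<in> Cc" for h
  proof -
    have m: "(\<lambda>g. max (h g) 0) \<in> Cc"
      by (rule Cc_dominated[OF continuous_on_max[OF Cc_continuous[OF h] continuous_on_const] h]) simp
    have "0 \<le> integ (\<lambda>g. max (h g) 0)" by (simp add: integ_real[OF m])
    then have "0 < integ (\<lambda>g. max (h g) 0 + \<phi>1 g)" using \<phi>1(3) by (simp add: integ_add[OF m \<phi>1(1)] integ_real[OF \<phi>1(1)])
    then show ?thesis using \<phi>1(2) by (intro conjI pos Cc_add[OF m \<phi>1(1)]) (auto intro: add_nonneg_nonneg)
  qed
  have neg: "(\<lambda>g. - \<phi> g) \<in> Cc" using Cc_bounded_linear[OF bounded_linear_minus[OF bounded_linear_ident] \<phi>] .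
  have "opint (\<lambda>g. (max (\<phi> g) 0 + \<phi>1 g) *\<^sub>R Z g) - opint (\<lambda>g. (max (- \<phi> g) 0 + \<phi>1 g) *\<^sub>R Z g) \<in> S"
    by (intro subspace_diff[OF subspace_S] conjunct1[OF part] \<phi> neg)
  moreover have "(max (\<phi> g) 0 + \<phi>1 g) *\<^sub>R Z g - (max (- \<phi> g) 0 + \<phi>1 g) *\<^sub>R Z g = \<phi> g *\<^sub>R Z g" for g
    by (simp add: scaleR_diff_left[symmetric] max_def)
  ultimately show ?thesis
    using opint_diff(1)[OF Cc_scaleR_compact_family[OF conjunct2[OF part[OF \<phi>]] Z] Cc_scaleR_compact_family[OF conjunct2[OF part[OF neg]] Z]]
    by (simp only:)
qed

lemma S_closure_span:
  assumes T: "bounded_linear T" and y: "y \<in> closure (span X)" and X: "\<And>x. x \<in> X \<Longrightarrow> T x \<in> S"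
  shows "T y \<in> S"
proof -
  have "closure (span X) \<subseteq> T -` S"
  proof (rule closure_minimal[OF span_minimal])
    show "subspace (T -` S)" by (rule linear_subspace_vimage[OF bounded_linear.linear[OF T] subspace_S])
    show "closed (T -` S)" by (rule continuous_closed_vimage[OF S(1)]) (rule bounded_linear.isCont[OF T continuous_ident])
  qed (use X in auto)
  then show ?thesis using y by blast
qed

definition smear :: "('g \<Rightarrow> real) \<Rightarrow> 'e \<Rightarrow>\<^sub>L 'e" where
  "smear \<phi> = opint (\<lambda>g. \<phi> g *\<^sub>R Ub (- g))"

lemma opint_smear:
  assumes \<phi>: "\<phi> \<in> Cc"
  shows "opint (\<lambda>g. \<phi> g *\<^sub>R (l o\<^sub>L (Ub (- g) o\<^sub>L r))) = l o\<^sub>L (smear \<phi> o\<^sub>L r)"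
proof -
  have f: "compact_family (\<lambda>g. \<phi> g *\<^sub>R Ub (- g))" by (rule Cc_family[OF \<phi> ssc_Ub_minus])
  have "(\<lambda>g. \<phi> g *\<^sub>R (l o\<^sub>L (Ub (- g) o\<^sub>L r))) = (\<lambda>g. l o\<^sub>L ((\<phi> g *\<^sub>R Ub (- g)) o\<^sub>L r))"
    by (intro ext blinfun_eqI) (simp add: blinfun.scaleR_left blinfun.scaleR_right)
  then show ?thesis
    by (simp only: opint_left[OF compact_family_compose(1)[OF f strongly_continuous_const]] opint_right[OF f] smear_def)
qed

lemmas compose_linear =
  bounded_bilinear.bounded_linear_left[OF bounded_bilinear_blinfun_compose]
  bounded_bilinear.bounded_linear_right[OF bounded_bilinear_blinfun_compose]

lemma Lip0_smear:
  assumes l: "l \<in> Lip0 E D" and q: "q \<in> conformal_set E D U \<mu>" and \<phi>: "\<phi> \<in> Cc"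
  shows "l o\<^sub>L (smear \<phi> o\<^sub>L q) \<in> S"
proof (rule S_closure_span[OF bounded_linear_compose[OF compose_linear(2) compose_linear(2)] in_closure_square_powers])
  show "adjointable E q" by (rule intertwines_conformal(1)[OF q])
  fix x assume "x \<in> {q o\<^sub>L square_power q (Suc n) |n. True}"
  then obtain n where x: "x = q o\<^sub>L square_power q (Suc n)" by blast
  let ?Z = "\<lambda>g. l o\<^sub>L ((Ub (- g) o\<^sub>L q) o\<^sub>L square_power q (Suc n))"
  have "opint (\<lambda>g. \<phi> g *\<^sub>R ?Z g) \<in> S"
    by (rule opint_in_S_of_normalised[OF strongly_continuous_star(1)[OF mprod_elements(2)[OF l q]] slice_in_S[OF l q] \<phi>])
  moreover have "?Z g = l o\<^sub>L (Ub (- g) o\<^sub>L x)" for g by (rule blinfun_eqI) (simp add: x)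
  ultimately show "l o\<^sub>L (smear \<phi> o\<^sub>L x) \<in> S" by (simp only: opint_smear[OF \<phi>])
qed

lemma \<pi>_smear:
  assumes q: "q \<in> conformal_set E D U \<mu>" and \<phi>: "\<phi> \<in> Cc"
  shows "\<pi> a o\<^sub>L (smear \<phi> o\<^sub>L q) \<in> S"
proof (rule S_closure_span[OF compose_linear(1)])
  show "\<pi> a \<in> closure (span (Lip0 E D))" using A_Lip closure_mono[OF span_superset, of "Lip0 E D"] by blast
qed (rule Lip0_smear[OF _ q \<phi>])

lemma opint_sum:
  fixes Z :: "'i \<Rightarrow> 'g \<Rightarrow> 'e \<Rightarrow>\<^sub>L 'e"
  assumes "finite I" "\<And>i. i \<in> I \<Longrightarrow> compact_family (Z i)"
  shows "opint (\<lambda>g. \<Sum>i\<in>I. Z i g) = (\<Sum>i\<in>I. opint (Z i)) \<and> compact_family (\<lambda>g. \<Sum>i\<in>I. Z i g)"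
  using assms
proof (induction I rule: finite_induct)
  case empty
  have "(\<lambda>g. 0 :: 'e \<Rightarrow>\<^sub>L 'e) \<in> Cc" by (rule Cc_zero)
  then show ?case using opint_Cc Cc_compact_family by fastforce
qed (simp add: opint_add compact_family_add)

text \<open>Uniform approximation of \<open>f\<close> by finite sums \<open>\<Sum> \<phi>\<^sub>i f\<^sub>i\<close> with supports in a fixed compact set.\<close>

lemma opint_\<pi>_in_S:
  assumes Y: "strongly_continuous Y" and S1: "\<And>\<phi> a. \<phi> \<in> Cc \<Longrightarrow> opint (\<lambda>g. \<phi> g *\<^sub>R (\<pi> a o\<^sub>L Y g)) \<in> S"
    and f: "f \<in> Cc"
  shows "opint (\<lambda>g. \<pi> (f g) o\<^sub>L Y g) \<in> S"
proof -
  have fam: "compact_family (\<lambda>g. \<pi> (h g) o\<^sub>L Y g)" if "h \<in> Cc" for h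
    by (rule compact_family_compose(1)[OF Cc_compact_family[OF Cc_bounded_linear[OF bounded_linear_\<pi> that]] Y])
  obtain K where K: "continuous_on UNIV f" "compact K" "\<And>x. x \<notin> K \<Longrightarrow> f x = 0" using f by (rule Cc_E) (rule that)
  obtain W K' where W: "open W" "compact K'" "K \<subseteq> W" "W \<subseteq> K'" using compact_neighbourhood[OF K(2)] .
  obtain C where C: "0 < C" "\<And>g. g \<in> K' \<Longrightarrow> norm (Y g) \<le> C" by (rule strongly_continuous_bounded[OF Y W(2)]) (rule that)
  have "opint (\<lambda>g. \<pi> (f g) o\<^sub>L Y g) \<in> closure S"
    unfolding closure_approachable
  proof (intro allI impI)
    fix e :: real assume e: "e > 0"
    define m where "m = measure M K' + 1"
    have m: "m > 0" by (simp add: m_def add_nonneg_pos)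
    \<comment> \<open>a uniform error \<open>d\<close> changes the integral by at most \<open>d C\<close> times the measure of \<open>K'\<close>\<close>
    define d where "d = e / (2 * m * C)"
    have d: "d > 0" using e m C by (simp add: d_def)
    obtain I and \<phi> :: "'g \<Rightarrow> 'g \<Rightarrow> real" where \<phi>: "finite I" "\<And>i. i \<in> I \<Longrightarrow> \<phi> i \<in> Cc"
      "\<And>i x. i \<in> I \<Longrightarrow> x \<notin> W \<Longrightarrow> \<phi> i x = 0" "\<And>x. norm (f x - (\<Sum>i\<in>I. \<phi> i x *\<^sub>R f i)) \<le> d"
      by (rule Cc_approximation[OF K(1,2) W(1,3) _ d]) (erule K(3), rule that)
    let ?h = "\<lambda>x. \<Sum>i\<in>I. \<phi> i x *\<^sub>R f i"
    have c: "(\<lambda>x. \<phi> i x *\<^sub>R f i) \<in> Cc" if "i \<in> I" for i by (rule Cc_scaleR[OF \<phi>(2)[OF that]]) simp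
    have h: "?h \<in> Cc" by (rule Cc_sum[OF \<phi>(1) c])
    have heq: "\<pi> (?h g) o\<^sub>L Y g = (\<Sum>i\<in>I. \<phi> i g *\<^sub>R (\<pi> (f i) o\<^sub>L Y g))" for g
      by (simp add: clinear_sum[OF \<pi>_clinear] clinear_scaleR[OF \<pi>_clinear]
          bounded_bilinear.sum_left[OF bounded_bilinear_blinfun_compose]
          bounded_bilinear.scaleR_left[OF bounded_bilinear_blinfun_compose])
    have ZF: "compact_family (\<lambda>g. \<phi> i g *\<^sub>R (\<pi> (f i) o\<^sub>L Y g))" if "i \<in> I" for i
      by (rule Cc_scaleR_compact_family[OF \<phi>(2)[OF that] strongly_continuous_compose[OF strongly_continuous_const Y]])
    have "opint (\<lambda>g. \<pi> (?h g) o\<^sub>L Y g) = (\<Sum>i\<in>I. opint (\<lambda>g. \<phi> i g *\<^sub>R (\<pi> (f i) o\<^sub>L Y g)))"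
      unfolding heq by (rule conjunct1[OF opint_sum[OF \<phi>(1) ZF]])
    then have hS: "opint (\<lambda>g. \<pi> (?h g) o\<^sub>L Y g) \<in> S"
      using S1 \<phi>(2) by (simp add: subspace_sum[OF subspace_S])
    have "norm (opint (\<lambda>g. (\<pi> (f g) o\<^sub>L Y g) - (\<pi> (?h g) o\<^sub>L Y g))) \<le> (d * C) * measure M K'"
    proof (rule norm_opint[OF opint_diff(2)[OF fam[OF f] fam[OF h]] W(2)])
      have outside: "f g = 0 \<and> ?h g = 0" if "g \<notin> K'" for g
      proof -
        have "g \<notin> K" "g \<notin> W" using that W by auto
        then show ?thesis using K(3) \<phi>(3) by (simp add: sum.neutral)
      qed
      have eq: "(\<pi> (f g) o\<^sub>L Y g) - (\<pi> (?h g) o\<^sub>L Y g) = \<pi> (f g - ?h g) o\<^sub>L Y g" for g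
        by (simp only: clinear_diff[OF \<pi>_clinear] bounded_bilinear.diff_left[OF bounded_bilinear_blinfun_compose])
      show 0: "(\<pi> (f g) o\<^sub>L Y g) - (\<pi> (?h g) o\<^sub>L Y g) = 0" if "g \<notin> K'" for g
        using outside[OF that] by (simp only: cancel_comm_monoid_add_class.diff_cancel)
      show "norm ((\<pi> (f g) o\<^sub>L Y g) - (\<pi> (?h g) o\<^sub>L Y g)) \<le> d * C" for g
      proof (cases "g \<in> K'")
        case True
        have "norm (\<pi> (f g - ?h g) o\<^sub>L Y g) \<le> norm (\<pi> (f g - ?h g)) * norm (Y g)" by (rule norm_blinfun_compose)
        also have "\<dots> \<le> d * C"
          using d by (intro mult_mono C(2)[OF True] order_trans[OF star_rep_contractive[OF rep_\<pi>] \<phi>(4)]) auto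
        finally show ?thesis by (simp only: eq)
      next
        case False
        then show ?thesis using d C(1) by (subst 0) auto
      qed
    qed (use d C in simp)
    also have "(d * C) * measure M K' < e"
    proof -
      have "(d * C) * measure M K' \<le> (d * C) * m" using d C by (intro mult_left_mono) (auto simp: m_def)
      also have "\<dots> = e / 2" using m C by (simp add: d_def field_simps)
      finally show ?thesis using e by linarith
    qed
    finally have "norm (opint (\<lambda>g. \<pi> (f g) o\<^sub>L Y g) - opint (\<lambda>g. \<pi> (?h g) o\<^sub>L Y g)) < e"
      by (simp only: opint_diff(1)[OF fam[OF f] fam[OF h]])
    then show "\<exists>y\<in>S. dist y (opint (\<lambda>g. \<pi> (f g) o\<^sub>L Y g)) < e"
      using hS by (intro bexI[of _ "opint (\<lambda>g. \<pi> (?h g) o\<^sub>L Y g)"]) (simp_all only: dist_norm norm_minus_commute)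
  qed
  then show ?thesis using S(1) by simp
qed

text \<open>Apply the preceding lemma to \<open>f(g) = \<phi>(g) \<alpha>\<^sub>g\<^sup>-\<^sup>1(b)\<close>, for which \<open>\<pi>(f(g)) U\<^sub>g\<^sup>* = \<phi>(g) U\<^sub>g\<^sup>* \<pi>(b)\<close>.\<close>

lemma smear_\<pi>_conformal:
  assumes q: "q \<in> conformal_set E D U \<mu>" and \<phi>: "\<phi> \<in> Cc"
  shows "smear \<phi> o\<^sub>L (\<pi> b o\<^sub>L q) \<in> S"
proof -
  have aq: "adjointable E q" by (rule intertwines_conformal(1)[OF q])
  have "continuous_on UNIV (\<lambda>g::'g. \<alpha> (- g) b)"
    by (rule continuous_on_compose2[OF \<alpha>_continuous]) (intro continuous_intros, simp)
  then have f: "(\<lambda>g. \<phi> g *\<^sub>R \<alpha> (- g) b) \<in> Cc" by (rule Cc_scaleR[OF \<phi>])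
  have "opint (\<lambda>g. \<pi> (\<phi> g *\<^sub>R \<alpha> (- g) b) o\<^sub>L (Ub (- g) o\<^sub>L q)) \<in> S"
  proof (rule opint_\<pi>_in_S[OF _ _ f])
    show "strongly_continuous (\<lambda>g. Ub (- g) o\<^sub>L q)"
      by (rule strongly_continuous_star(1)[OF ssc_compose[OF ssc_Ub_minus ssc_const[OF aq]]])
    show "opint (\<lambda>g. \<phi> g *\<^sub>R (\<pi> a o\<^sub>L (Ub (- g) o\<^sub>L q))) \<in> S" if "\<phi> \<in> Cc" for \<phi> a
      unfolding opint_smear[OF that] by (rule \<pi>_smear[OF q that])
  qed
  moreover have "\<pi> (\<phi> g *\<^sub>R \<alpha> (- g) b) o\<^sub>L (Ub (- g) o\<^sub>L q) = \<phi> g *\<^sub>R (id_blinfun o\<^sub>L (Ub (- g) o\<^sub>L (\<pi> b o\<^sub>L q)))" for g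
    by (rule blinfun_eqI) (simp add: clinear_scaleR[OF \<pi>_clinear] blinfun.scaleR_left U_\<pi>)
  ultimately have "id_blinfun o\<^sub>L (smear \<phi> o\<^sub>L (\<pi> b o\<^sub>L q)) \<in> S" by (simp only: opint_smear[OF \<phi>])
  moreover have "id_blinfun o\<^sub>L (smear \<phi> o\<^sub>L (\<pi> b o\<^sub>L q)) = smear \<phi> o\<^sub>L (\<pi> b o\<^sub>L q)" by (rule blinfun_eqI) simp
  ultimately show ?thesis by (simp only:)
qed

lemma smear_\<pi>: "\<phi> \<in> Cc \<Longrightarrow> smear \<phi> o\<^sub>L \<pi> b \<in> S"
proof (rule S_closure_span[OF compose_linear(2)])
  show "\<pi> b \<in> closure (span {\<pi> a o\<^sub>L q |a q. q \<in> conformal_set E D U \<mu>})" using A_in_AQ by blast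
qed (auto intro: smear_\<pi>_conformal)

text \<open>Take adjoints in the preceding lemma, with \<open>b = a\<^sup>*\<close>.\<close>

lemma opint_\<pi>_Ub:
  assumes \<phi>: "\<phi> \<in> Cc"
  shows "opint (\<lambda>g. \<phi> g *\<^sub>R (\<pi> a o\<^sub>L Ub g)) \<in> S"
proof -
  have adj\<pi>: "adjointable E (\<pi> b)" "adj E (\<pi> b) = \<pi> (star b)" for b
    by (rule adjointableI[OF \<pi>_adj], rule adj_eqI[OF \<pi>_adj])
  let ?Z = "\<lambda>g. Ub (- g) o\<^sub>L \<pi> (star a)"
  have Z: "star_strongly_continuous E ?Z" by (rule ssc_compose[OF ssc_Ub_minus ssc_const[OF adj\<pi>(1)]])
  have "opint (\<lambda>g. \<phi> g *\<^sub>R ?Z g) = smear \<phi> o\<^sub>L \<pi> (star a)"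
  proof -
    have "\<phi> g *\<^sub>R ?Z g = \<phi> g *\<^sub>R (id_blinfun o\<^sub>L (Ub (- g) o\<^sub>L \<pi> (star a)))" for g
      by (rule blinfun_eqI) (simp add: blinfun.scaleR_left)
    then have "opint (\<lambda>g. \<phi> g *\<^sub>R ?Z g) = id_blinfun o\<^sub>L (smear \<phi> o\<^sub>L \<pi> (star a))" by (simp only: opint_smear[OF \<phi>])
    also have "\<dots> = smear \<phi> o\<^sub>L \<pi> (star a)" by (rule blinfun_eqI) simp
    finally show ?thesis .
  qed
  then have "adj E (opint (\<lambda>g. \<phi> g *\<^sub>R ?Z g)) \<in> S" using smear_\<pi>[OF \<phi>] by (simp only: S(5))
  moreover have "adj E (opint (\<lambda>g. \<phi> g *\<^sub>R ?Z g)) = opint (\<lambda>g. \<phi> g *\<^sub>R adj E (?Z g))"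
    by (rule adj_eqI[OF adj_opint[OF \<phi> Z]])
  moreover have "adj E (?Z g) = \<pi> a o\<^sub>L Ub g" for g
    by (simp add: adj_compose[OF adjointable_Ub adj\<pi>(1)] adj_Ub adj\<pi>(2) star_star)
  ultimately show ?thesis by (simp only:)
qed

theorem range_\<rho>: "\<rho> p \<in> S"
proof -
  have "\<iota> ` Cc \<subseteq> {p. \<rho> p \<in> S}"
    using opint_\<pi>_in_S[OF strongly_continuous_star(1)[OF ssc_Ub] opint_\<pi>_Ub]
    by (auto simp: \<rho>_\<iota> rep0_def family_def[abs_def])
  moreover have "closed {p. \<rho> p \<in> S}"
    using continuous_closed_vimage[OF S(1), of \<rho>] continuous_\<rho> by (simp add: vimage_def continuous_on_eq_continuous_at)
  ultimately show ?thesis using closure_minimal \<iota>_dense by blast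
qed

end

section \<open>The tensor product \<open>B \<otimes> C\<^sub>0(G)\<close>\<close>

lemma tsum_Nil [simp]: "tsum \<tau> [] = 0" and tsum_Cons [simp]: "tsum \<tau> (x # xs) = \<tau> (fst x) (snd x) + tsum \<tau> xs"
  and tsum_append: "tsum \<tau> (xs @ ys) = tsum \<tau> xs + tsum \<tau> (ys :: ('b \<times> 'c) list)"
  by (simp_all add: tsum_def split_beta)

lemma tsum_tmult:
  assumes "\<And>b c b' c'. \<tau> b c * \<tau> b' c' = (\<tau> (b * b') (c * c') :: 't::cstar_algebra)"
  shows "tsum \<tau> (tmult xs ys) = tsum \<tau> xs * tsum \<tau> ys"
proof (induction xs)
  case (Cons x xs)
  have "tsum \<tau> (map (\<lambda>(b', c'). (fst x * b', snd x * c')) ys) = \<tau> (fst x) (snd x) * tsum \<tau> ys"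
    by (induction ys) (auto simp: assms distrib_left)
  moreover have "tmult (x # xs) ys = map (\<lambda>(b', c'). (fst x * b', snd x * c')) ys @ tmult xs ys"
    by (simp add: tmult_def split_beta')
  ultimately show ?case using Cons by (simp add: tsum_append distrib_right)
qed (simp add: tmult_def)

lemma tsum_star:
  assumes "\<And>b c. star (\<tau> b c) = (\<tau> (star b) (star c) :: 't::cstar_algebra)"
  shows "tsum \<tau> (map (map_prod star star) xs) = star (tsum \<tau> xs)"
  by (induction xs) (auto simp: assms star_add)

lemma c0_tensor_mult: "c0_tensor b c * c0_tensor b' c' = c0_tensor (b * b') (c * c')"
  by (rule c0_eqI) (simp add: times_c0.rep_eq apply_c0_tensor mult_scaleC_left mult_scaleC_right scaleC_scaleC mult.commute)

lemma c0_tensor_star: "star (c0_tensor b c) = c0_tensor (star b) (star c)"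
  by (rule c0_eqI) (simp add: star_c0.rep_eq apply_c0_tensor star_scaleC star_complex_def)

definition push :: "('v::real_normed_vector \<Rightarrow> 'w::real_normed_vector) \<Rightarrow> ('g::topological_space, 'v) c0 \<Rightarrow> ('g, 'w) c0" where
  "push T f = Abs_c0 (\<lambda>g. T (apply_c0 f g))"

lemma apply_push: "bounded_linear T \<Longrightarrow> apply_c0 (push T f) g = T (apply_c0 f g)"
  by (simp add: push_def Abs_c0_inverse[OF c0_set_bounded_linear[OF _ apply_c0]])

text \<open>The product state \<open>\<phi> \<otimes> \<psi>\<close>.\<close>

definition product_functional :: "('b::cstar_algebra \<Rightarrow> complex) \<Rightarrow> (('g::topological_space, complex) c0 \<Rightarrow> complex) \<Rightarrow> ('g, 'b) c0 \<Rightarrow> complex" where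
  "product_functional \<phi> \<psi> f = \<psi> (push \<phi> f)"

lemmas apply_push_state = apply_push[OF state_bounded_linear]

lemma product_functional_add:
  assumes "state \<phi>" "state \<psi>"
  shows "product_functional \<phi> \<psi> (f + h) = product_functional \<phi> \<psi> f + product_functional \<phi> \<psi> h"
proof -
  have "push \<phi> (f + h) = push \<phi> f + push \<phi> h"
    by (rule c0_eqI) (simp add: plus_c0.rep_eq apply_push_state[OF assms(1)] clinear_add[OF state_clinear[OF assms(1)]])
  then show ?thesis by (simp add: product_functional_def clinear_add[OF state_clinear[OF assms(2)]])
qed

lemma product_functional_tensor:
  assumes "state \<phi>" "state \<psi>"
  shows "product_functional \<phi> \<psi> (c0_tensor b c) = \<phi> b * \<psi> c"
proof -
  have "push \<phi> (c0_tensor b c) = \<phi> b *\<^sub>C c"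
    by (rule c0_eqI) (simp add: scaleC_c0.rep_eq apply_push_state[OF assms(1)] apply_c0_tensor clinear_scaleC[OF state_clinear[OF assms(1)]]
      scaleC_complex_def mult.commute)
  then show ?thesis by (simp add: product_functional_def clinear_scaleC[OF state_clinear[OF assms(2)]] scaleC_complex_def)
qed

lemma product_functional_tsum:
  assumes "state \<phi>" "state \<psi>"
  shows "product_functional \<phi> \<psi> (tsum c0_tensor xs) = tsum (\<lambda>b c. \<phi> b * \<psi> c) xs"
proof (induction xs)
  case Nil
  have "product_functional \<phi> \<psi> 0 = 0" using product_functional_add[OF assms, of 0 0] by simp
  then show ?case by simp
qed (simp add: product_functional_add[OF assms] product_functional_tensor[OF assms])

text \<open>Pointwise, \<open>K\<^sup>2 \<phi>(v(g)\<^sup>* v(g)) - \<phi>((t v)(g)\<^sup>* (t v)(g))\<close> is nonnegative. So this function is positive in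
  \<open>C\<^sub>0(G)\<close>, and \<open>\<psi>\<close> preserves positivity.\<close>

lemma product_functional_contraction:
  fixes t v :: "('g::topological_space, 'b::cstar_algebra) c0"
  assumes \<phi>: "state \<phi>" and \<psi>: "state \<psi>" and K: "norm t \<le> K"
  shows "Re (product_functional \<phi> \<psi> (star (t * v) * (t * v))) \<le> K\<^sup>2 * Re (product_functional \<phi> \<psi> (star v * v))"
proof -
  define p where "p = push \<phi> (star v * v)"
  define r where "r = push \<phi> (star (t * v) * (t * v))"
  have "Defs.positive (K\<^sup>2 *\<^sub>R p - r)"
  proof (rule positive_c0)
    fix g
    let ?a = "\<phi> (star (apply_c0 v g) * apply_c0 v g)" and ?b = "\<phi> (star (apply_c0 t g * apply_c0 v g) * (apply_c0 t g * apply_c0 v g))"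
    have "apply_c0 (K\<^sup>2 *\<^sub>R p - r) g = K\<^sup>2 *\<^sub>R ?a - ?b"
      by (simp add: p_def r_def apply_c0_minus scaleR_c0.rep_eq apply_push_state[OF \<phi>] times_c0.rep_eq star_c0.rep_eq)
    moreover have "?a \<in> \<real>" "?b \<in> \<real>" using \<phi> by (simp_all add: state_def)
    moreover have "Re ?b \<le> K\<^sup>2 * Re ?a"
      by (rule state_contraction[OF \<phi> order_trans[OF norm_c0_ge K]])
    ultimately have e: "apply_c0 (K\<^sup>2 *\<^sub>R p - r) g = complex_of_real (K\<^sup>2 * Re ?a - Re ?b)" and n: "0 \<le> K\<^sup>2 * Re ?a - Re ?b"
      by (auto simp: complex_eq_iff complex_is_Real_iff)
    show "Defs.positive (apply_c0 (K\<^sup>2 *\<^sub>R p - r) g)"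
      unfolding e Defs.positive_def using n
      by (intro exI[of _ "complex_of_real (sqrt (K\<^sup>2 * Re ?a - Re ?b))"])
        (simp only: star_complex_def complex_cnj_complex_of_real of_real_mult[symmetric] real_sqrt_mult_self abs_of_nonneg)
  qed
  then have "0 \<le> Re (\<psi> (K\<^sup>2 *\<^sub>R p - r))" by (rule state_nonneg[OF \<psi>])
  then show ?thesis
    by (simp add: clinear_diff[OF state_clinear[OF \<psi>]] clinear_scaleR[OF state_clinear[OF \<psi>]] product_functional_def p_def r_def)
qed

context lc_space
begin

lemma point_state: "state (\<lambda>c :: ('g, complex) c0. apply_c0 c g)"
proof -
  obtain \<eta> :: "'g \<Rightarrow> real" where \<eta>: "\<eta> \<in> Cc" "\<And>x. 0 \<le> \<eta> x" "\<And>x. \<eta> x \<le> 1" "\<And>x. x \<in> {g} \<Longrightarrow> \<eta> x = 1"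
    by (rule Urysohn_Cc[OF compact_sing open_UNIV subset_UNIV, of g]) (rule that)
  have bl: "bounded_linear (\<lambda>c :: ('g, complex) c0. apply_c0 c g)" by (rule bounded_linear_apply_c0)
  have "onorm (\<lambda>c :: ('g, complex) c0. apply_c0 c g) = 1"
  proof (rule antisym)
    show "onorm (\<lambda>c :: ('g, complex) c0. apply_c0 c g) \<le> 1" by (rule onorm_bound) (simp_all add: norm_c0_ge)
    have "norm (cut \<eta>) \<le> 1" by (rule norm_c0_le) (simp add: \<eta>)
    moreover have "1 \<le> onorm (\<lambda>c :: ('g, complex) c0. apply_c0 c g) * norm (cut \<eta>)"
      using onorm[OF bl, of "cut \<eta>"] by (simp add: \<eta>)
    ultimately show "1 \<le> onorm (\<lambda>c :: ('g, complex) c0. apply_c0 c g)"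
      using onorm_pos_le[OF bl] by (meson mult_left_le order_trans)
  qed
  then show ?thesis
    unfolding state_def using bl
    by (simp add: clinear_def plus_c0.rep_eq scaleC_c0.rep_eq times_c0.rep_eq star_c0.rep_eq star_complex_def
        complex_is_Real_iff mult.commute[of _ "apply_c0 _ _"] complex_mult_cnj)
qed

text \<open>For the converse direction of the norm formula, evaluate at a point \<open>g\<close>, which is a state of \<open>C\<^sub>0(G)\<close>, and choose
  \<open>\<phi>\<close> norming \<open>z z\<^sup>*\<close>, where \<open>z\<close> is the value of the tensor at \<open>g\<close>.\<close>

lemma min_tensor_c0: "min_tensor (c0_tensor :: 'b::cstar_algebra \<Rightarrow> ('g, complex) c0 \<Rightarrow> ('g, 'b) c0)"
  unfolding min_tensor_def
proof (intro conjI allI impI)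
  let ?\<tau> = "c0_tensor :: 'b \<Rightarrow> ('g, complex) c0 \<Rightarrow> ('g, 'b) c0"
  have square: "tsum ?\<tau> (tsquare ys) = star (tsum ?\<tau> ys) * tsum ?\<tau> ys" for ys
    by (simp add: tsquare_def tsum_tmult[where \<tau> = c0_tensor, OF c0_tensor_mult] tsum_star[where \<tau> = c0_tensor, OF c0_tensor_star])
  fix xs and K :: real assume K: "0 \<le> K"
  show "norm (tsum ?\<tau> xs) \<le> K \<longleftrightarrow> (\<forall>\<phi> \<psi> ys. state \<phi> \<longrightarrow> state \<psi> \<longrightarrow>
      Re (tsum (\<lambda>b c. \<phi> b * \<psi> c) (tsquare (tmult xs ys))) \<le> K\<^sup>2 * Re (tsum (\<lambda>b c. \<phi> b * \<psi> c) (tsquare ys)))"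
    (is "_ \<longleftrightarrow> ?R")
  proof
    assume n: "norm (tsum ?\<tau> xs) \<le> K"
    show ?R
    proof (intro allI impI)
      fix \<phi> :: "'b \<Rightarrow> complex" and \<psi> :: "('g, complex) c0 \<Rightarrow> complex" and ys assume s: "state \<phi>" "state \<psi>"
      show "Re (tsum (\<lambda>b c. \<phi> b * \<psi> c) (tsquare (tmult xs ys))) \<le> K\<^sup>2 * Re (tsum (\<lambda>b c. \<phi> b * \<psi> c) (tsquare ys))"
        using product_functional_contraction[OF s n, of "tsum ?\<tau> ys"]
        by (simp only: product_functional_tsum[OF s, symmetric] square tsum_tmult[where \<tau> = c0_tensor, OF c0_tensor_mult])
    qed
  next
    assume R: ?R
    show "norm (tsum ?\<tau> xs) \<le> K"
    proof (rule norm_c0_le)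
      fix g
      define z where "z = apply_c0 (tsum ?\<tau> xs) g"
      obtain \<eta> :: "'g \<Rightarrow> real" where \<eta>: "\<eta> \<in> Cc" "\<And>x. x \<in> {g} \<Longrightarrow> \<eta> x = 1"
        by (rule Urysohn_Cc[OF compact_sing open_UNIV subset_UNIV, of g]) (rule that)
      have ineq: "Re (\<phi> (star (z * v) * (z * v))) \<le> K\<^sup>2 * Re (\<phi> (star v * v))" if \<phi>: "state \<phi>" for \<phi> v
      proof -
        let ?\<psi> = "\<lambda>c :: ('g, complex) c0. apply_c0 c g"
        have P: "product_functional \<phi> ?\<psi> f = \<phi> (apply_c0 f g)" for f
          by (simp add: product_functional_def apply_push_state[OF \<phi>])
        have v: "apply_c0 (tsum ?\<tau> [(v, cut \<eta>)]) g = v" by (simp add: apply_c0_tensor \<eta>)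
        have "Re (tsum (\<lambda>b c. \<phi> b * ?\<psi> c) (tsquare (tmult xs [(v, cut \<eta>)]))) \<le>
            K\<^sup>2 * Re (tsum (\<lambda>b c. \<phi> b * ?\<psi> c) (tsquare [(v, cut \<eta>)]))"
          using R \<phi> point_state by blast
        then show ?thesis
          by (simp only: product_functional_tsum[OF \<phi> point_state, symmetric] square tsum_tmult[where \<tau> = c0_tensor, OF c0_tensor_mult]
              P times_c0.rep_eq star_c0.rep_eq v z_def)
      qed
      have "norm z * norm z \<le> K * norm z"
      proof (cases "z = 0")
        case False
        have n: "norm (z * star z) = norm z * norm z" using norm_sq_star[of "star z"] by (simp add: star_star norm_star)
        then have "z * star z \<noteq> 0" using False by auto
        then obtain \<phi> where \<phi>: "state \<phi>" "\<phi> (star (z * star z) * (z * star z)) = complex_of_real ((norm (z * star z))\<^sup>2)"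
          using norming_state by blast
        have "(norm z * norm z)\<^sup>2 \<le> K\<^sup>2 * Re (\<phi> (star (star z) * star z))" using ineq[OF \<phi>(1), of "star z"] \<phi>(2) n by simp
        also have "\<dots> \<le> K\<^sup>2 * (norm z)\<^sup>2"
        proof (rule mult_left_mono)
          have "Re (\<phi> (star (star z) * star z)) \<le> norm (star (star z) * star z)"
            by (rule order_trans[OF complex_Re_le_cmod state_norm[OF \<phi>(1)]])
          then show "Re (\<phi> (star (star z) * star z)) \<le> (norm z)\<^sup>2" by (simp only: cstar_identity norm_star)
        qed simp
        finally have "(norm z * norm z)\<^sup>2 \<le> (K * norm z)\<^sup>2" by (simp add: power_mult_distrib)
        then show ?thesis by (rule power2_le_imp_le) (simp add: K)
      qed simp
      then show "norm (apply_c0 (tsum ?\<tau> xs) g) \<le> K" using K by (cases "z = 0") (auto simp: z_def)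
    qed
  qed
qed (rule clinear_c0_tensor c0_tensor_mult c0_tensor_star closure_span_c0_tensor)+

end

section \<open>The cycle\<close>

context conformal
begin

lemma even_uops:
  assumes \<gamma>: "is_grading E \<gamma>"
  shows "even_uop \<theta> \<gamma> Id" "even_uop \<theta> \<gamma> \<mu>m"
proof -
  have "\<exists>\<Gamma>1 :: ('g, 'e) c0 \<Rightarrow>\<^sub>L ('g, 'e) c0. (\<forall>x c. blinfun_apply \<Gamma>1 (\<theta> x c) = \<theta> (blinfun_apply \<Gamma> x) c) \<and>
      (\<forall>f g. apply_c0 (blinfun_apply \<Gamma>1 f) g = blinfun_apply \<Gamma> (apply_c0 f g))" if \<Gamma>: "\<gamma> = Some \<Gamma>" for \<Gamma>
  proof -
    let ?G = "push (blinfun_apply \<Gamma>) :: ('g, 'e) c0 \<Rightarrow> ('g, 'e) c0"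
    have G: "apply_c0 (?G f) g = blinfun_apply \<Gamma> (apply_c0 f g)" for f g
      by (rule apply_push[OF blinfun.bounded_linear_right])
    have "bounded_linear ?G"
    proof (rule bounded_linear_intro[where K = "norm \<Gamma>"])
      show "?G (f + h) = ?G f + ?G h" for f h by (rule c0_eqI) (simp only: G plus_c0.rep_eq blinfun.add_right)
      show "?G (r *\<^sub>R f) = r *\<^sub>R ?G f" for r f by (rule c0_eqI) (simp only: G scaleR_c0.rep_eq blinfun.scaleR_right)
      show "norm (?G f) \<le> norm f * norm \<Gamma>" for f
      proof (rule norm_c0_le)
        fix g
        have "norm (blinfun_apply \<Gamma> (apply_c0 f g)) \<le> norm \<Gamma> * norm f"
          by (intro order_trans[OF norm_blinfun] mult_left_mono norm_c0_ge) simp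
        then show "norm (apply_c0 (?G f) g) \<le> norm f * norm \<Gamma>" by (simp only: G mult.commute)
      qed
    qed
    then have B: "blinfun_apply (Blinfun ?G) = ?G" by (rule bounded_linear_Blinfun_apply)
    have "clinear (blinfun_apply \<Gamma>)"
      using \<gamma> \<Gamma> by (intro adjointable_clinear adjointableI[of _ \<Gamma>]) (simp add: is_grading_def)
    then have "?G (\<theta> x c) = \<theta> (blinfun_apply \<Gamma> x) c" for x c
      by (intro c0_eqI) (simp only: G apply_c0_tensor clinear_scaleC)
    then show ?thesis using B G by (intro exI[of _ "Blinfun ?G"]) simp
  qed
  note ex = this
  show "even_uop \<theta> \<gamma> Id"
    unfolding even_uop_def using ex by blast
  show "even_uop \<theta> \<gamma> \<mu>m"
    unfolding even_uop_def
  proof (intro allI impI)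
    fix \<Gamma> assume \<Gamma>: "\<gamma> = Some \<Gamma>"
    obtain \<Gamma>1 :: "('g, 'e) c0 \<Rightarrow>\<^sub>L ('g, 'e) c0" where \<Gamma>1: "\<forall>x c. blinfun_apply \<Gamma>1 (\<theta> x c) = \<theta> (blinfun_apply \<Gamma> x) c"
      "\<And>f g. apply_c0 (blinfun_apply \<Gamma>1 f) g = blinfun_apply \<Gamma> (apply_c0 f g)" using ex[OF \<Gamma>] by blast
    have "(blinfun_apply \<Gamma>1 u, blinfun_apply \<Gamma>1 v) \<in> \<mu>m" if "(u, v) \<in> \<mu>m" for u v
      using that even_\<mu> \<Gamma> by (simp add: c0_multiplication_def even_map_def \<Gamma>1(2))
    then show "\<exists>\<Gamma>1 :: ('g, 'e) c0 \<Rightarrow>\<^sub>L ('g, 'e) c0. (\<forall>x c. blinfun_apply \<Gamma>1 (\<theta> x c) = \<theta> (blinfun_apply \<Gamma> x) c) \<and>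
        (\<forall>(u, v)\<in>\<mu>m. (blinfun_apply \<Gamma>1 u, blinfun_apply \<Gamma>1 v) \<in> \<mu>m)"
      using \<Gamma>1(1) by (intro exI[of _ \<Gamma>1]) auto
  qed
qed

end

context crossed
begin

lemma cycle:
  "conformally_generated_cycle (c0_tensor :: 'b \<Rightarrow> ('g, complex) c0 \<Rightarrow> ('g, 'b) c0) \<theta> F E \<gamma> \<rho> D Id \<mu>m"
  unfolding conformally_generated_cycle_def
proof (intro conjI allI)
  show "\<forall>\<mu>'\<in>{Id, \<mu>m}. matched \<theta> F \<mu>' \<and> matched \<theta> F (\<mu>'\<inverse>) \<and> even_uop \<theta> \<gamma> \<mu>'"
    using matched_Id matched_c0_multiplication[OF ssc_\<mu>] matched_c0_multiplication[OF ssc_\<mu>_inv] even_uops[OF grading]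
    by (simp add: converse_\<mu>m)
  let ?X = "{R. \<exists>l\<in>side_set \<theta> F D Id. \<exists>t\<in>middle_set \<theta> F D Id \<mu>m. \<exists>r\<in>side_set \<theta> F D \<mu>m. \<exists>\<psi>.
      compactly_supported_state \<psi> \<and> is_slice c0_tensor E \<theta> F \<psi> (mprod l (mprod t r)) R}"
  show "range \<rho> \<subseteq> cstar_generated E ?X"
    unfolding cstar_generated_def
  proof (intro Inter_greatest, elim CollectE conjE)
    fix S assume S: "?X \<subseteq> S" "closed S" "0 \<in> S" "\<forall>a\<in>S. \<forall>b\<in>S. a + b \<in> S \<and> a o\<^sub>L b \<in> S"
      "\<forall>a\<in>S. adj E a \<in> S \<and> (\<forall>c. c *\<^sub>C a \<in> S)"
    interpret generation E dom \<alpha> \<beta> \<gamma> \<pi> D U \<mu> M \<Delta> \<iota> S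
      by unfold_locales (use S in blast)+
    show "range \<rho> \<subseteq> S" using range_\<rho> by blast
  qed
  show "self_adjoint_op E D" by (simp add: self_adjoint_op_def sa_D)
qed (rule correspondence_\<rho> min_tensor_c0 ext_tensor_c0 regular_D odd_D compact_resolvent_\<rho>)+

end

theorem proposition5p11:
  fixes \<alpha> :: "'g::{topological_group_add, t2_space} \<Rightarrow> 'a::cstar_algebra \<Rightarrow> 'a"
    and \<beta> :: "'g \<Rightarrow> 'b::cstar_algebra \<Rightarrow> 'b"
    and E :: "('e::cbanach, 'b) hmodule"
    and \<gamma> :: "('e \<Rightarrow>\<^sub>L 'e) option"
    and \<pi> :: "'a \<Rightarrow> 'e \<Rightarrow>\<^sub>L 'e"
    and D :: "'e uop"
    and U :: "'g \<Rightarrow> 'e \<Rightarrow> 'e"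
    and \<mu> :: "'g \<Rightarrow> 'e \<Rightarrow>\<^sub>L 'e"
    and M :: "'g measure"
    and \<Delta> :: "'g \<Rightarrow> real"
    and \<iota> :: "('g \<Rightarrow> 'a) \<Rightarrow> 'p::cstar_algebra"
  assumes "locally_compact_space (euclidean :: 'g topology)"
    and "cstar_action \<alpha>"
    and "cstar_action \<beta>" and "\<forall>g b. \<beta> g b = b"
    and "conformally_equivariant \<alpha> \<beta> E \<gamma> \<pi> D U \<mu>"
    and "left_haar_measure M" and "modular_function M \<Delta>"
    and "universal_crossed_product M \<Delta> \<alpha> \<iota>"
  shows "\<exists>\<rho>. integrated_rep M \<iota> E \<pi> U \<rho> \<and>
    conformally_generated_cycle
      (c0_tensor :: 'b \<Rightarrow> ('g, complex) c0 \<Rightarrow> ('g, 'b) c0)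
      (c0_tensor :: 'e \<Rightarrow> ('g, complex) c0 \<Rightarrow> ('g, 'e) c0)
      (c0_module E) E \<gamma> \<rho> D Id (c0_multiplication \<mu>)"
proof -
  have "hilbert_module E"
    using assms(5) by (simp add: conformally_equivariant_def kasparov_module_def correspondence_def)
  then interpret crossed E "TYPE('g)" \<alpha> \<beta> \<gamma> \<pi> D U \<mu> M \<Delta> \<iota>
    by unfold_locales (use assms in simp_all)
  show ?thesis using integrated_rep cycle by blast
qed

end
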